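(* For $n=2,3$, every invariant $\mathrm{SU}(n)$-structure $(\omega,\Psi)$ solving the twisted Calabi-Yau equation $$d\Psi=\theta_\omega\wedge\Psi,\qquad dd^c\omega=0,\qquad d\theta_\omega=0$$ on a $2n$-dimensional compact solvmanifold $\Gamma\backslash G$ must be torsion-free, i.e. $d\omega=0$ and $d\Psi=0$.
   Context: A compact solvmanifold is a quotient $\Gamma\backslash G$ of a simply connected solvable Lie group $G$ by a co-compact discrete subgroup $\Gamma$; an $\mathrm{SU}(n)$-structure on it is invariant if it is induced by a left-invariant one on $G$. An $\mathrm{SU}(n)$-structure on a $2n$-manifold is an almost Hermitian structure $(g,J)$ with fundamental $2$-form $\omega=g(J\cdot,\cdot)$, together with a complex $(n,0)$-form $\Psi=\psi_++i\psi_-$ of unit norm (normalized so that $\omega^2=\psi_+^2=\psi_-^2$ if $n=2$, and $3\,\psi_+\wedge\psi_-=2\,\omega^3$ if $n=3$). For a $k$-form $\alpha$, $J\alpha=\alpha(J\cdot,\dots,J\cdot)$. The Lee form is $\theta_\omega=-J\delta_g\omega$, equivalently the unique $1$-form with $d\omega^{n-1}=\theta_\omega\wedge\omega^{n-1}$. $d^c\omega=Jd\omega$. *)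

theory Defs
  imports "HOL-Analysis.Analysis" "HOL-Algebra.Solvable_Groups" "HOL-Combinatorics.Permutations"
begin

section \<open>Smooth manifolds\<close>

text \<open>For open \<open>S\<close> and finite-dimensional \<open>'a\<close> this is the usual class of
  \<open>k\<close> times continuously differentiable maps.\<close>

primrec ck_on :: "nat \<Rightarrow> 'a::real_normed_vector set \<Rightarrow> ('a \<Rightarrow> 'b::real_normed_vector) \<Rightarrow> bool" where
  "ck_on 0 S f \<longleftrightarrow> continuous_on S f"
| "ck_on (Suc k) S f \<longleftrightarrow>
     (\<exists>f'. (\<forall>x\<in>S. (f has_derivative f' x) (at x)) \<and> (\<forall>v. ck_on k S (\<lambda>x. f' x v)))"

definition smooth_on :: "'a::real_normed_vector set \<Rightarrow> ('a \<Rightarrow> 'b::real_normed_vector) \<Rightarrow> bool" where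
  "smooth_on S f \<longleftrightarrow> (\<forall>k. ck_on k S f)"

type_synonym ('m, 'e) atlas = "('m set \<times> ('m \<Rightarrow> 'e)) set"

text \<open>Outside its domain \<open>U\<close> a chart \<open>(U, \<phi>)\<close> carries no information; its inverse is
  \<open>inv_into U \<phi>\<close>. Atlases need not be maximal.\<close>

definition smooth_atlas :: "('m::topological_space, 'e::euclidean_space) atlas \<Rightarrow> bool" where
  "smooth_atlas A \<longleftrightarrow>
     (\<Union>(U, \<phi>)\<in>A. U) = UNIV \<and>
     (\<forall>(U, \<phi>)\<in>A. open U \<and> open (\<phi> ` U) \<and> homeomorphism U (\<phi> ` U) \<phi> (inv_into U \<phi>)) \<and>
     (\<forall>(U, \<phi>)\<in>A. \<forall>(V, \<psi>)\<in>A. smooth_on (\<phi> ` (U \<inter> V)) (\<psi> \<circ> inv_into U \<phi>))"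

definition prod_atlas :: "('m, 'e) atlas \<Rightarrow> ('n, 'f) atlas \<Rightarrow> ('m \<times> 'n, 'e \<times> 'f) atlas" where
  "prod_atlas A B = {(U \<times> V, map_prod \<phi> \<psi>) | U \<phi> V \<psi>. (U, \<phi>) \<in> A \<and> (V, \<psi>) \<in> B}"

text \<open>Smoothness of \<open>F\<close> on an open set \<open>W\<close> of the source.\<close>

definition smooth_map_on ::
    "('m::topological_space, 'e::euclidean_space) atlas \<Rightarrow> ('n::topological_space, 'f::euclidean_space) atlas \<Rightarrow>
     'm set \<Rightarrow> ('m \<Rightarrow> 'n) \<Rightarrow> bool" where
  "smooth_map_on A B W F \<longleftrightarrow>
     continuous_on W F \<and>
     (\<forall>(U, \<phi>)\<in>A. \<forall>(V, \<psi>)\<in>B. smooth_on (\<phi> ` (U \<inter> W \<inter> F -` V)) (\<psi> \<circ> F \<circ> inv_into U \<phi>))"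

definition local_diffeo ::
    "('m::topological_space, 'e::euclidean_space) atlas \<Rightarrow> ('n::topological_space, 'f::euclidean_space) atlas \<Rightarrow>
     ('m \<Rightarrow> 'n) \<Rightarrow> bool" where
  "local_diffeo A B F \<longleftrightarrow>
     (\<forall>p. \<exists>W. p \<in> W \<and> open W \<and> open (F ` W) \<and> inj_on F W \<and>
          smooth_map_on A B W F \<and> smooth_map_on B A (F ` W) (inv_into W F))"

definition smooth_funs :: "('m, 'e::euclidean_space) atlas \<Rightarrow> ('m \<Rightarrow> real) set" where
  "smooth_funs A = {f. \<forall>(U, \<phi>)\<in>A. smooth_on (\<phi> ` U) (f \<circ> inv_into U \<phi>)}"


section \<open>Vector fields and tensors\<close>

text \<open>Vector fields are the derivations of the algebra of smooth functions. They are made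
  extensional (zero on non-smooth arguments), so that equality of vector fields is equality
  of operators.\<close>

type_synonym 'm vf = "('m \<Rightarrow> real) \<Rightarrow> 'm \<Rightarrow> real"

definition vfields :: "('m, 'e::euclidean_space) atlas \<Rightarrow> 'm vf set" where
  "vfields A = {X.
     (\<forall>f\<in>smooth_funs A. X f \<in> smooth_funs A) \<and>
     (\<forall>f. f \<notin> smooth_funs A \<longrightarrow> X f = (\<lambda>p. 0)) \<and>
     (\<forall>f\<in>smooth_funs A. \<forall>h\<in>smooth_funs A. \<forall>a b p. X (\<lambda>q. a * f q + b * h q) p = a * X f p + b * X h p) \<and>
     (\<forall>f\<in>smooth_funs A. \<forall>h\<in>smooth_funs A. \<forall>p. X (\<lambda>q. f q * h q) p = f p * X h p + h p * X f p)}"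

definition vf_add :: "'m vf \<Rightarrow> 'm vf \<Rightarrow> 'm vf" where
  "vf_add X Y = (\<lambda>f p. X f p + Y f p)"

definition vf_scale :: "('m \<Rightarrow> real) \<Rightarrow> 'm vf \<Rightarrow> 'm vf" where
  "vf_scale h X = (\<lambda>f p. h p * X f p)"

definition bracket :: "'m vf \<Rightarrow> 'm vf \<Rightarrow> 'm vf" where
  "bracket X Y = (\<lambda>f p. X (Y f) p - Y (X f) p)"

text \<open>Covariant \<open>k\<close>-tensors are the maps on \<open>k\<close>-tuples (lists of length \<open>k\<close>) of vector
  fields that are linear over the smooth functions in each slot. Values on other lists are
  unconstrained, hence tensors are compared by \<open>tensor_eq\<close> rather than by \<open>=\<close>.\<close>

type_synonym ('m, 'k) tensor = "'m vf list \<Rightarrow> 'm \<Rightarrow> 'k"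

definition vf_tuples :: "('m, 'e::euclidean_space) atlas \<Rightarrow> nat \<Rightarrow> 'm vf list set" where
  "vf_tuples A k = {Xs. length Xs = k \<and> set Xs \<subseteq> vfields A}"

definition tensor_eq :: "('m, 'e::euclidean_space) atlas \<Rightarrow> nat \<Rightarrow> ('m, 'k) tensor \<Rightarrow> ('m, 'k) tensor \<Rightarrow> bool" where
  "tensor_eq A k \<alpha> \<beta> \<longleftrightarrow> (\<forall>Xs\<in>vf_tuples A k. \<forall>p. \<alpha> Xs p = \<beta> Xs p)"

definition is_tensor :: "('m, 'e::euclidean_space) atlas \<Rightarrow> nat \<Rightarrow> ('m, real) tensor \<Rightarrow> bool" where
  "is_tensor A k \<alpha> \<longleftrightarrow> (\<forall>Xs\<in>vf_tuples A k. \<alpha> Xs \<in> smooth_funs A \<and>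
     (\<forall>i<k. \<forall>p.
        (\<forall>Y\<in>vfields A. \<alpha> (Xs[i := vf_add (Xs ! i) Y]) p = \<alpha> Xs p + \<alpha> (Xs[i := Y]) p) \<and>
        (\<forall>h\<in>smooth_funs A. \<alpha> (Xs[i := vf_scale h (Xs ! i)]) p = h p * \<alpha> Xs p)))"

definition is_form :: "('m, 'e::euclidean_space) atlas \<Rightarrow> nat \<Rightarrow> ('m, real) tensor \<Rightarrow> bool" where
  "is_form A k \<alpha> \<longleftrightarrow> is_tensor A k \<alpha> \<and>
     (\<forall>Xs\<in>vf_tuples A k. \<forall>i j. i < j \<and> j < k \<and> Xs ! i = Xs ! j \<longrightarrow> (\<forall>p. \<alpha> Xs p = 0))"

definition re_form :: "('m, complex) tensor \<Rightarrow> ('m, real) tensor" where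
  "re_form \<alpha> = (\<lambda>Xs p. Re (\<alpha> Xs p))"

definition im_form :: "('m, complex) tensor \<Rightarrow> ('m, real) tensor" where
  "im_form \<alpha> = (\<lambda>Xs p. Im (\<alpha> Xs p))"

definition is_cform :: "('m, 'e::euclidean_space) atlas \<Rightarrow> nat \<Rightarrow> ('m, complex) tensor \<Rightarrow> bool" where
  "is_cform A k \<alpha> \<longleftrightarrow> is_form A k (re_form \<alpha>) \<and> is_form A k (im_form \<alpha>)"

text \<open>Wedge product of a \<open>k\<close>-form and an \<open>l\<close>-form, normalised so that
  \<open>(\<alpha> \<and> \<beta>)(X, Y) = \<alpha>(X) \<beta>(Y) - \<alpha>(Y) \<beta>(X)\<close> for 1-forms.\<close>

definition wedge :: "nat \<Rightarrow> nat \<Rightarrow> ('m, 'k::real_normed_field) tensor \<Rightarrow> ('m, 'k) tensor \<Rightarrow> ('m, 'k) tensor" where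
  "wedge k l \<alpha> \<beta> = (\<lambda>Xs p.
     (\<Sum>\<sigma> | \<sigma> permutes {..<k + l}.
        of_int (sign \<sigma>) * \<alpha> (map (\<lambda>i. Xs ! \<sigma> i) [0..<k]) p * \<beta> (map (\<lambda>i. Xs ! \<sigma> i) [k..<k + l]) p)
     / (fact k * fact l))"

text \<open>\<open>m\<close>-fold wedge power of a 2-form; the result has degree \<open>2 * m\<close>.\<close>

primrec form_power :: "('m, real) tensor \<Rightarrow> nat \<Rightarrow> ('m, real) tensor" where
  "form_power \<omega> 0 = (\<lambda>Xs p. 1)"
| "form_power \<omega> (Suc m) = wedge 2 (2 * m) \<omega> (form_power \<omega> m)"

definition drop_nth :: "nat \<Rightarrow> 'a list \<Rightarrow> 'a list" where
  "drop_nth i xs = take i xs @ drop (Suc i) xs"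

text \<open>The invariant (Koszul) formula, in the normalisation matching \<open>wedge\<close>:
  \<open>d\<theta>(X, Y) = X(\<theta>(Y)) - Y(\<theta>(X)) - \<theta>([X, Y])\<close> for a 1-form. The degree of \<open>d\<alpha>\<close> is the length
  of the argument list.\<close>

definition ext_d :: "('m, real) tensor \<Rightarrow> ('m, real) tensor" where
  "ext_d \<alpha> = (\<lambda>Xs p.
     (\<Sum>i<length Xs. (- 1) ^ i * (Xs ! i) (\<alpha> (drop_nth i Xs)) p) +
     (\<Sum>j<length Xs. \<Sum>i<j. (- 1) ^ (i + j) *
        \<alpha> (bracket (Xs ! i) (Xs ! j) # drop_nth i (drop_nth j Xs)) p))"

definition ext_dc :: "('m, complex) tensor \<Rightarrow> ('m, complex) tensor" where
  "ext_dc \<alpha> = (\<lambda>Xs p. Complex (ext_d (re_form \<alpha>) Xs p) (ext_d (im_form \<alpha>) Xs p))"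

definition zero_form :: "('m, 'k::zero) tensor" where
  "zero_form = (\<lambda>Xs p. 0)"


section \<open>Pull-back by local diffeomorphisms\<close>

definition related :: "('m, 'e::euclidean_space) atlas \<Rightarrow> ('n, 'f::euclidean_space) atlas \<Rightarrow> ('m \<Rightarrow> 'n) \<Rightarrow>
    'm vf \<Rightarrow> 'n vf \<Rightarrow> bool" where
  "related A B F X Y \<longleftrightarrow> X \<in> vfields A \<and> Y \<in> vfields B \<and>
     (\<forall>f\<in>smooth_funs B. X (f \<circ> F) = Y f \<circ> F)"

text \<open>\<open>\<alpha> = F\<^sup>*\<beta>\<close> for a local diffeomorphism \<open>F\<close>: every vector field on the target
  has a unique \<open>F\<close>-related lift, and at each point these lifts span the tangent space, so
  the values on related tuples determine the pull-back.\<close>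

definition is_pullback :: "('m, 'e::euclidean_space) atlas \<Rightarrow> ('n, 'f::euclidean_space) atlas \<Rightarrow> ('m \<Rightarrow> 'n) \<Rightarrow>
    nat \<Rightarrow> ('m, 'k) tensor \<Rightarrow> ('n, 'k) tensor \<Rightarrow> bool" where
  "is_pullback A B F k \<alpha> \<beta> \<longleftrightarrow>
     (\<forall>Xs Ys. length Xs = k \<and> list_all2 (related A B F) Xs Ys \<longrightarrow> (\<forall>p. \<alpha> Xs p = \<beta> Ys (F p)))"

definition is_endo_pullback :: "('m, 'e::euclidean_space) atlas \<Rightarrow> ('n, 'f::euclidean_space) atlas \<Rightarrow> ('m \<Rightarrow> 'n) \<Rightarrow>
    ('m vf \<Rightarrow> 'm vf) \<Rightarrow> ('n vf \<Rightarrow> 'n vf) \<Rightarrow> bool" where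
  "is_endo_pullback A B F J J' \<longleftrightarrow> (\<forall>X Y. related A B F X Y \<longrightarrow> related A B F (J X) (J' Y))"


section \<open>\<open>SU(n)\<close>-structures\<close>

definition riemannian_metric :: "('m, 'e::euclidean_space) atlas \<Rightarrow> ('m, real) tensor \<Rightarrow> bool" where
  "riemannian_metric A g \<longleftrightarrow> is_tensor A 2 g \<and>
     (\<forall>X\<in>vfields A. \<forall>Y\<in>vfields A. \<forall>p. g [X, Y] p = g [Y, X] p) \<and>
     (\<forall>X\<in>vfields A. \<forall>p. (\<exists>f\<in>smooth_funs A. X f p \<noteq> 0) \<longrightarrow> g [X, X] p > 0)"

definition almost_complex :: "('m, 'e::euclidean_space) atlas \<Rightarrow> ('m vf \<Rightarrow> 'm vf) \<Rightarrow> bool" where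
  "almost_complex A J \<longleftrightarrow> (\<forall>X\<in>vfields A. J X \<in> vfields A \<and>
     (\<forall>Y\<in>vfields A. J (vf_add X Y) = vf_add (J X) (J Y)) \<and>
     (\<forall>h\<in>smooth_funs A. J (vf_scale h X) = vf_scale h (J X)) \<and>
     J (J X) = vf_scale (\<lambda>p. - 1) X)"

definition almost_hermitian :: "('m, 'e::euclidean_space) atlas \<Rightarrow> ('m, real) tensor \<Rightarrow> ('m vf \<Rightarrow> 'm vf) \<Rightarrow> bool" where
  "almost_hermitian A g J \<longleftrightarrow> riemannian_metric A g \<and> almost_complex A J \<and>
     (\<forall>X\<in>vfields A. \<forall>Y\<in>vfields A. \<forall>p. g [J X, J Y] p = g [X, Y] p)"

definition fundamental_form :: "('m, real) tensor \<Rightarrow> ('m vf \<Rightarrow> 'm vf) \<Rightarrow> ('m, real) tensor" where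
  "fundamental_form g J = (\<lambda>Xs. g [J (Xs ! 0), Xs ! 1])"

text \<open>In the flat model \<open>J e\<^sub>1 = e\<^sub>2\<close>, \<open>\<omega> = g(J\<cdot>, \<cdot>)\<close> is \<open>e\<^sup>1 \<and> e\<^sup>2 + \<dots>\<close> and
  \<open>dz = e\<^sup>1 + i e\<^sup>2\<close> satisfies \<open>dz(J X) = i dz(X)\<close>; with these signs the form
  \<open>\<Psi> = dz\<^sup>1 \<and> \<dots> \<and> dz\<^sup>n\<close> satisfies the normalisation \<open>unit_norm\<close> below.\<close>

definition type_n0 :: "('m, 'e::euclidean_space) atlas \<Rightarrow> ('m vf \<Rightarrow> 'm vf) \<Rightarrow> nat \<Rightarrow> ('m, complex) tensor \<Rightarrow> bool" where
  "type_n0 A J n \<Psi> \<longleftrightarrow> is_cform A n \<Psi> \<and>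
     (\<forall>Xs\<in>vf_tuples A n. \<forall>i<n. \<forall>p. \<Psi> (Xs[i := J (Xs ! i)]) p = \<i> * \<Psi> Xs p)"

text \<open>The unit-norm condition on \<open>\<Psi>\<close>. The normalisation is only specified for
  \<open>n = 2\<close> and \<open>n = 3\<close>; for other \<open>n\<close> the predicate is left false.\<close>

definition unit_norm :: "('m, 'e::euclidean_space) atlas \<Rightarrow> nat \<Rightarrow> ('m, real) tensor \<Rightarrow> ('m, complex) tensor \<Rightarrow> bool" where
  "unit_norm A n \<omega> \<Psi> \<longleftrightarrow>
     (n = 2 \<and> tensor_eq A 4 (form_power \<omega> 2) (wedge 2 2 (re_form \<Psi>) (re_form \<Psi>))
            \<and> tensor_eq A 4 (form_power \<omega> 2) (wedge 2 2 (im_form \<Psi>) (im_form \<Psi>))) \<or>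
     (n = 3 \<and> tensor_eq A 6 (\<lambda>Xs p. 3 * wedge 3 3 (re_form \<Psi>) (im_form \<Psi>) Xs p)
                            (\<lambda>Xs p. 2 * form_power \<omega> 3 Xs p))"

definition su_structure :: "('m, 'e::euclidean_space) atlas \<Rightarrow> nat \<Rightarrow>
    ('m, real) tensor \<Rightarrow> ('m vf \<Rightarrow> 'm vf) \<Rightarrow> ('m, complex) tensor \<Rightarrow> bool" where
  "su_structure A n g J \<Psi> \<longleftrightarrow> DIM('e) = 2 * n \<and> almost_hermitian A g J \<and>
     type_n0 A J n \<Psi> \<and> unit_norm A n (fundamental_form g J) \<Psi>"

definition lee_form :: "('m, 'e::euclidean_space) atlas \<Rightarrow> nat \<Rightarrow> ('m, real) tensor \<Rightarrow> ('m, real) tensor \<Rightarrow> bool" where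
  "lee_form A n \<omega> \<theta> \<longleftrightarrow> is_form A 1 \<theta> \<and>
     tensor_eq A (2 * n - 1) (ext_d (form_power \<omega> (n - 1)))
                             (wedge 1 (2 * (n - 1)) \<theta> (form_power \<omega> (n - 1)))"

definition d_c :: "('m vf \<Rightarrow> 'm vf) \<Rightarrow> ('m, real) tensor \<Rightarrow> ('m, real) tensor" where
  "d_c J \<omega> = (\<lambda>Xs. ext_d \<omega> (map J Xs))"

definition twisted_calabi_yau :: "('m, 'e::euclidean_space) atlas \<Rightarrow> nat \<Rightarrow>
    ('m vf \<Rightarrow> 'm vf) \<Rightarrow> ('m, real) tensor \<Rightarrow> ('m, real) tensor \<Rightarrow> ('m, complex) tensor \<Rightarrow> bool" where
  "twisted_calabi_yau A n J \<omega> \<theta> \<Psi> \<longleftrightarrow>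
     tensor_eq A (n + 1) (ext_dc \<Psi>) (wedge 1 n (\<lambda>Xs p. complex_of_real (\<theta> Xs p)) \<Psi>) \<and>
     tensor_eq A 4 (ext_d (d_c J \<omega>)) zero_form \<and>
     tensor_eq A 2 (ext_d \<theta>) zero_form"

definition torsion_free :: "('m, 'e::euclidean_space) atlas \<Rightarrow> nat \<Rightarrow>
    ('m, real) tensor \<Rightarrow> ('m, complex) tensor \<Rightarrow> bool" where
  "torsion_free A n \<omega> \<Psi> \<longleftrightarrow>
     tensor_eq A 3 (ext_d \<omega>) zero_form \<and> tensor_eq A (n + 1) (ext_dc \<Psi>) zero_form"


section \<open>Compact solvmanifolds and invariant structures\<close>

definition lie_group :: "'g::{t2_space, second_countable_topology} monoid \<Rightarrow> ('g, 'e::euclidean_space) atlas \<Rightarrow> bool" where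
  "lie_group G A \<longleftrightarrow> group G \<and> carrier G = UNIV \<and> smooth_atlas A \<and>
     smooth_map_on (prod_atlas A A) A UNIV (\<lambda>(x, y). x \<otimes>\<^bsub>G\<^esub> y) \<and>
     smooth_map_on A A UNIV (\<lambda>x. inv\<^bsub>G\<^esub> x)"

text \<open>The quotient \<open>\<Gamma>\G\<close> by left translations is presented as a smooth manifold \<open>M\<close>
  (a type with atlas \<open>B\<close>) and a projection \<open>\<pi>\<close>: a surjective local diffeomorphism whose
  fibres are the cosets \<open>\<Gamma> x\<close>; this determines \<open>M\<close> up to a unique diffeomorphism
  compatible with \<open>\<pi>\<close>.\<close>

definition compact_solvmanifold ::
    "'g::{t2_space, second_countable_topology} monoid \<Rightarrow> ('g, 'e::euclidean_space) atlas \<Rightarrow> 'g set \<Rightarrow>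
     ('m::{t2_space, second_countable_topology}, 'e) atlas \<Rightarrow> ('g \<Rightarrow> 'm) \<Rightarrow> bool" where
  "compact_solvmanifold G A \<Gamma> B \<pi> \<longleftrightarrow>
     lie_group G A \<and> solvable G \<and> simply_connected (UNIV :: 'g set) \<and>
     subgroup \<Gamma> G \<and> discrete \<Gamma> \<and>
     smooth_atlas B \<and> local_diffeo A B \<pi> \<and> surj \<pi> \<and>
     (\<forall>x y. \<pi> x = \<pi> y \<longleftrightarrow> (\<exists>\<gamma>\<in>\<Gamma>. y = \<gamma> \<otimes>\<^bsub>G\<^esub> x)) \<and>
     compact (UNIV :: 'm set)"

definition left_invariant :: "'g monoid \<Rightarrow> ('g, 'e::euclidean_space) atlas \<Rightarrow> nat \<Rightarrow>
    ('g, real) tensor \<Rightarrow> ('g vf \<Rightarrow> 'g vf) \<Rightarrow> ('g, complex) tensor \<Rightarrow> bool" where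
  "left_invariant G A n g J \<Psi> \<longleftrightarrow> (\<forall>a\<in>carrier G.
     is_pullback A A (\<lambda>x. a \<otimes>\<^bsub>G\<^esub> x) 2 g g \<and>
     is_endo_pullback A A (\<lambda>x. a \<otimes>\<^bsub>G\<^esub> x) J J \<and>
     is_pullback A A (\<lambda>x. a \<otimes>\<^bsub>G\<^esub> x) n \<Psi> \<Psi>)"

definition invariant_su_structure :: "'g monoid \<Rightarrow> ('g, 'e::euclidean_space) atlas \<Rightarrow>
    ('m, 'e) atlas \<Rightarrow> ('g \<Rightarrow> 'm) \<Rightarrow> nat \<Rightarrow>
    ('m, real) tensor \<Rightarrow> ('m vf \<Rightarrow> 'm vf) \<Rightarrow> ('m, complex) tensor \<Rightarrow> bool" where
  "invariant_su_structure G A B \<pi> n g J \<Psi> \<longleftrightarrow> su_structure B n g J \<Psi> \<and>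
     (\<exists>g' J' \<Psi>'. su_structure A n g' J' \<Psi>' \<and> left_invariant G A n g' J' \<Psi>' \<and>
        is_pullback A B \<pi> 2 g' g \<and> is_endo_pullback A B \<pi> J' J \<and> is_pullback A B \<pi> n \<Psi>' \<Psi>)"

end

theory Submission
  imports Defs
begin

text \<open>An invariant structure has constant coefficients in the frame of left-invariant fields, so the
  equations become identities on the Lie algebra of \<open>G\<close>, with constant structure tensors. Let \<open>h\<close> be the form
  \<open>x \<mapsto> tr ad\<^sub>x\<close>. The equation \<open>d\<Psi> = \<theta> \<and> \<Psi>\<close> forces \<open>J\<close> to be integrable and expresses \<open>\<theta>\<close> through
  traces of \<open>ad\<close>; contracting it with the Jacobi identity and with \<open>dd\<^sup>c\<omega> = 0\<close> gives
  \<open>|d\<omega>|\<^sup>2 = 6 (|\<theta>|\<^sup>2 + \<langle>\<theta>, h\<rangle>)\<close> and \<open>R = 3/2 |\<theta>|\<^sup>2 + 5/2 \<langle>\<theta>, h\<rangle>\<close> for the scalar curvature \<open>R\<close> of the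
  left-invariant metric. For solvable algebras \<open>R \<le> 0\<close>, and if \<open>\<theta> \<noteq> 0\<close> then the kernel of the closed
  form \<open>\<theta>\<close> is an ideal and, building up the algebra by a flag ending with it, one gets
  \<open>R \<le> - 6/5 s\<^sup>2\<close> with \<open>s = h(\<theta>\<^sup>\<sharp> / |\<theta>|)\<close> in dimension at most six. The quadratic form
  \<open>3/2 t\<^sup>2 + 5/2 t s + 6/5 s\<^sup>2\<close> is positive definite, so \<open>\<theta> = 0\<close>, hence \<open>d\<omega> = 0\<close> and \<open>d\<Psi> = 0\<close>.

  Solvability passes from the group to its Lie algebra by attaching to a subgroup \<open>H\<close> the set of
  initial velocities of (arbitrary) families in \<open>H\<close>: this is a subspace, and brackets of such
  velocities are velocities of commutators, so no exponential map is needed.\<close>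

text \<open>In an orthonormal basis, R = -|c|^2/4 - Q/2 - |h|^2, where c are the structure constants
  and Q is the sum of tr(ad e_i ad e_i); \<theta> controls neither |c|^2 nor Q. Comparing
  |d\<omega>|^2 with |c|^2 brings in a J-twisted version of Q, and integrability exchanges that
  version for Q. Both unknowns then drop out: R = -|d\<omega>|^2/12 - T - |h|^2, with T the sum of
  tr(J ad e_i ad (J e_i)). The Jacobi identity for w, the sum of [e_i, J e_i], which \<theta> and h
  determine, gives T = -2|\<theta>|^2 - 3(\<theta>, h) - |h|^2. The terms |h|^2 cancel and leave the
  coefficients 3/2 and 5/2. The margin is thin: with s^2 instead of 6/5 s^2 the final quadratic form
  would be indefinite, because (5/2)^2 > 4 * 3/2. So the curvature bound has to exploit the
  symmetric part of the last adjoint map and not just its trace. A second obstacle is analytic: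
  fields are global derivations and tensors are maps on global fields. Pointwise dependence must be
  proved before values on the invariant frame can decide identities for all fields.\<close>

section \<open>Calculus of smooth maps\<close>

lemma ck_on_cong:
  assumes "open S" "\<And>x. x \<in> S \<Longrightarrow> f x = g x" "ck_on k S f"
  shows "ck_on k S g"
proof (cases k)
  case 0
  then show ?thesis using assms by (simp cong: continuous_on_cong)
next
  case (Suc m)
  then obtain f' where f': "\<And>x. x \<in> S \<Longrightarrow> (f has_derivative f' x) (at x)" "\<And>v. ck_on m S (\<lambda>x. f' x v)"
    using assms(3) by auto
  have "(g has_derivative f' x) (at x)" if "x \<in> S" for x
    using has_derivative_transform_within_open[OF f'(1)[OF that] assms(1) that assms(2)] by simp
  then show ?thesis using Suc f'(2) by auto
qed

lemma ck_on_SucD: "ck_on (Suc k) S f \<Longrightarrow> ck_on k S f"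
proof (induction k arbitrary: f)
  case 0
  then show ?case
    by (auto intro!: continuous_at_imp_continuous_on) (meson has_derivative_continuous)
next
  case (Suc k)
  then obtain f' where "\<forall>x\<in>S. (f has_derivative f' x) (at x)" "\<forall>v. ck_on (Suc k) S (\<lambda>x. f' x v)"
    by (metis ck_on.simps(2))
  then show ?case using Suc.IH by (metis ck_on.simps(2))
qed

lemma ck_on_subset: "ck_on k S f \<Longrightarrow> T \<subseteq> S \<Longrightarrow> ck_on k T f"
  by (induction k arbitrary: f) (auto intro: continuous_on_subset, meson subset_iff)

text \<open>Replaces the existential witness by \<open>frechet_derivative\<close>, so that local and
  iterated statements speak of one fixed derivative.\<close>

lemma ck_on_Suc_iff:
  assumes "open S"
  shows "ck_on (Suc k) S f \<longleftrightarrow>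
    (\<forall>x\<in>S. f differentiable (at x)) \<and> (\<forall>v. ck_on k S (\<lambda>x. frechet_derivative f (at x) v))"
    (is "?L \<longleftrightarrow> ?R")
proof
  assume ?L
  then obtain f' where f': "\<And>x. x \<in> S \<Longrightarrow> (f has_derivative f' x) (at x)" "\<And>v. ck_on k S (\<lambda>x. f' x v)"
    by auto
  have "f' x = frechet_derivative f (at x)" if "x \<in> S" for x
    using frechet_derivative_at[OF f'(1)[OF that]] .
  then have "ck_on k S (\<lambda>x. frechet_derivative f (at x) v)" for v
    by (intro ck_on_cong[OF assms _ f'(2)[of v]]) auto
  moreover have "\<forall>x\<in>S. f differentiable (at x)"
    using f'(1) differentiable_def by blast
  ultimately show ?R by auto
next
  assume ?R
  then show ?L
    using frechet_derivative_works by (auto intro!: exI[of _ "\<lambda>x. frechet_derivative f (at x)"])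
qed

lemma ck_on_local:
  assumes "open S" "\<And>x. x \<in> S \<Longrightarrow> \<exists>T. open T \<and> x \<in> T \<and> ck_on k T f"
  shows "ck_on k S f"
  using assms(2)
proof (induction k arbitrary: f)
  case 0
  then have "isCont f x" if "x \<in> S" for x
    using that 0 continuous_on_eq_continuous_at by (metis ck_on.simps(1))
  then show ?case by (simp add: continuous_at_imp_continuous_on)
next
  case (Suc k)
  have "f differentiable (at x)" if x: "x \<in> S" for x
  proof -
    obtain T where "open T" "x \<in> T" "ck_on (Suc k) T f" using Suc.prems[OF x] by blast
    then show ?thesis using ck_on_Suc_iff by blast
  qed
  moreover have "ck_on k S (\<lambda>x. frechet_derivative f (at x) v)" for v
  proof (rule Suc.IH)
    fix x assume "x \<in> S"
    then obtain T where "open T" "x \<in> T" "ck_on (Suc k) T f" using Suc.prems by blast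
    then show "\<exists>T. open T \<and> x \<in> T \<and> ck_on k T (\<lambda>x. frechet_derivative f (at x) v)"
      using ck_on_Suc_iff by blast
  qed
  ultimately show ?case using ck_on_Suc_iff[OF assms(1)] by blast
qed

lemma ck_on_const: "ck_on k S (\<lambda>x. c)"
proof (induction k arbitrary: c)
  case (Suc k)
  have "\<forall>x\<in>S. ((\<lambda>x. c) has_derivative (\<lambda>v. 0)) (at x)" by simp
  then show ?case using Suc[of 0] unfolding ck_on.simps by (intro exI[of _ "\<lambda>x v. 0"]) auto
qed simp

lemma ck_on_bounded_linear:
  assumes "bounded_linear L" "ck_on k S f"
  shows "ck_on k S (\<lambda>x. L (f x))"
  using assms(2)
proof (induction k arbitrary: f)
  case 0
  then show ?case by (simp add: bounded_linear.continuous_on[OF assms(1)])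
next
  case (Suc k)
  then obtain f' where f': "\<And>x. x \<in> S \<Longrightarrow> (f has_derivative f' x) (at x)" "\<And>v. ck_on k S (\<lambda>x. f' x v)"
    by auto
  have "((\<lambda>x. L (f x)) has_derivative (\<lambda>v. L (f' x v))) (at x)" if "x \<in> S" for x
    using bounded_linear.has_derivative[OF assms(1) f'(1)[OF that]] .
  then show ?case using Suc.IH[OF f'(2)] by (auto intro!: exI[of _ "\<lambda>x v. L (f' x v)"])
qed

lemma ck_on_add:
  assumes "ck_on k S f" "ck_on k S g"
  shows "ck_on k S (\<lambda>x. f x + g x)"
  using assms
proof (induction k arbitrary: f g)
  case 0
  then show ?case by (simp add: continuous_on_add)
next
  case (Suc k)
  obtain f' where "\<And>x. x \<in> S \<Longrightarrow> (f has_derivative f' x) (at x)" "\<And>v. ck_on k S (\<lambda>x. f' x v)"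
    using Suc.prems(1) by auto
  moreover obtain g' where "\<And>x. x \<in> S \<Longrightarrow> (g has_derivative g' x) (at x)" "\<And>v. ck_on k S (\<lambda>x. g' x v)"
    using Suc.prems(2) by auto
  ultimately show ?case using Suc.IH
    by (auto intro!: exI[of _ "\<lambda>x v. f' x v + g' x v"] has_derivative_add)
qed

lemma ck_on_sum: "(\<And>i. i \<in> I \<Longrightarrow> ck_on k S (f i)) \<Longrightarrow> ck_on k S (\<lambda>x. \<Sum>i\<in>I. f i x)"
  by (induction I rule: infinite_finite_induct) (auto intro: ck_on_const ck_on_add)

lemma ck_on_scaleR:
  fixes f :: "'a::real_normed_vector \<Rightarrow> real"
  assumes "ck_on k S f" "ck_on k S g"
  shows "ck_on k S (\<lambda>x. f x *\<^sub>R g x)"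
  using assms
proof (induction k arbitrary: f g)
  case 0
  then show ?case by (simp add: continuous_on_scaleR)
next
  case (Suc k)
  obtain f' where f': "\<And>x. x \<in> S \<Longrightarrow> (f has_derivative f' x) (at x)" "\<And>v. ck_on k S (\<lambda>x. f' x v)"
    using Suc.prems(1) by auto
  obtain g' where g': "\<And>x. x \<in> S \<Longrightarrow> (g has_derivative g' x) (at x)" "\<And>v. ck_on k S (\<lambda>x. g' x v)"
    using Suc.prems(2) by auto
  have "((\<lambda>x. f x *\<^sub>R g x) has_derivative (\<lambda>v. f x *\<^sub>R g' x v + f' x v *\<^sub>R g x)) (at x)" if "x \<in> S" for x
    using has_derivative_scaleR[OF f'(1)[OF that] g'(1)[OF that]] .
  moreover have "ck_on k S (\<lambda>x. f x *\<^sub>R g' x v + f' x v *\<^sub>R g x)" for v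
    using Suc.prems[THEN ck_on_SucD] by (intro ck_on_add Suc.IH f' g')
  ultimately show ?case by (auto intro!: exI[of _ "\<lambda>x v. f x *\<^sub>R g' x v + f' x v *\<^sub>R g x"])
qed

lemma ck_on_compose:
  fixes f :: "'b::euclidean_space \<Rightarrow> 'c::real_normed_vector" and g :: "'a::real_normed_vector \<Rightarrow> 'b"
  assumes "ck_on k T f" "ck_on k S g" "g ` S \<subseteq> T"
  shows "ck_on k S (\<lambda>x. f (g x))"
  using assms
proof (induction k arbitrary: f)
  case 0
  then show ?case using continuous_on_compose2 by (metis ck_on.simps(1))
next
  case (Suc k)
  obtain f' where f': "\<And>x. x \<in> T \<Longrightarrow> (f has_derivative f' x) (at x)" "\<And>v. ck_on k T (\<lambda>x. f' x v)"
    using Suc.prems(1) by auto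
  obtain g' where g': "\<And>x. x \<in> S \<Longrightarrow> (g has_derivative g' x) (at x)" "\<And>v. ck_on k S (\<lambda>x. g' x v)"
    using Suc.prems(2) by auto
  \<comment> \<open>\<open>ck_on\<close> controls \<open>f' y v\<close> only for a fixed direction
    \<open>v\<close>, while the chain rule produces the direction \<open>g' x v\<close>, which moves
    with \<open>x\<close>. Expanding it in the basis restores fixed directions.\<close>
  let ?h = "\<lambda>x v. \<Sum>b\<in>Basis. (g' x v \<bullet> b) *\<^sub>R f' (g x) b"
  have "((\<lambda>x. f (g x)) has_derivative ?h x) (at x)" if x: "x \<in> S" for x
  proof -
    have gx: "g x \<in> T" using x Suc.prems(3) by auto
    interpret L: linear "f' (g x)"
      using f'(1)[OF gx] has_derivative_linear by blast
    have "f' (g x) w = (\<Sum>b\<in>Basis. (w \<bullet> b) *\<^sub>R f' (g x) b)" for w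
    proof -
      have "f' (g x) w = f' (g x) (\<Sum>b\<in>Basis. (w \<bullet> b) *\<^sub>R b)" by (simp add: euclidean_representation)
      then show ?thesis by (simp add: L.sum L.scaleR)
    qed
    then have "(\<lambda>v. f' (g x) (g' x v)) = ?h x" by (rule ext)
    moreover have "((\<lambda>x. f (g x)) has_derivative (\<lambda>v. f' (g x) (g' x v))) (at x)"
      using has_derivative_compose[OF g'(1)[OF x] f'(1)[OF gx]] .
    ultimately show ?thesis by simp
  qed
  moreover have "ck_on k S (\<lambda>x. ?h x v)" for v
  proof (intro ck_on_sum ck_on_scaleR)
    fix b :: 'b
    show "ck_on k S (\<lambda>x. g' x v \<bullet> b)"
      using ck_on_bounded_linear[OF bounded_linear_inner_left g'(2)] .
    show "ck_on k S (\<lambda>x. f' (g x) b)"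
      by (rule Suc.IH[OF f'(2) ck_on_SucD[OF Suc.prems(2)] Suc.prems(3)])
  qed
  ultimately show ?case unfolding ck_on.simps by (intro exI[of _ ?h] conjI ballI allI)
qed

lemma smooth_on_cong: "open S \<Longrightarrow> (\<And>x. x \<in> S \<Longrightarrow> f x = g x) \<Longrightarrow> smooth_on S f \<Longrightarrow> smooth_on S g"
  unfolding smooth_on_def using ck_on_cong by blast

lemma smooth_on_subset: "smooth_on S f \<Longrightarrow> T \<subseteq> S \<Longrightarrow> smooth_on T f"
  unfolding smooth_on_def using ck_on_subset by blast

lemma smooth_on_local:
  assumes "open S" "\<And>x. x \<in> S \<Longrightarrow> \<exists>T. open T \<and> x \<in> T \<and> smooth_on T f"
  shows "smooth_on S f"
  using assms unfolding smooth_on_def by (meson ck_on_local)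

lemma smooth_on_differentiable: "smooth_on S f \<Longrightarrow> x \<in> S \<Longrightarrow> f differentiable (at x)"
  unfolding smooth_on_def by (metis ck_on.simps(2) differentiable_def)

lemma smooth_on_has_derivative:
  "smooth_on S f \<Longrightarrow> x \<in> S \<Longrightarrow> (f has_derivative frechet_derivative f (at x)) (at x)"
  using smooth_on_differentiable frechet_derivative_works by blast

lemma smooth_on_derivative:
  "open S \<Longrightarrow> smooth_on S f \<Longrightarrow> smooth_on S (\<lambda>x. frechet_derivative f (at x) v)"
  unfolding smooth_on_def using ck_on_Suc_iff by blast

lemma smooth_on_continuous: "smooth_on S f \<Longrightarrow> continuous_on S f"
  unfolding smooth_on_def by (metis ck_on.simps(1))

lemma smooth_on_const: "smooth_on S (\<lambda>x. c)"
  by (simp add: smooth_on_def ck_on_const)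

lemma smooth_on_bounded_linear_compose:
  "bounded_linear L \<Longrightarrow> smooth_on S f \<Longrightarrow> smooth_on S (\<lambda>x. L (f x))"
  by (simp add: smooth_on_def ck_on_bounded_linear)

lemma smooth_on_ident: "smooth_on S (\<lambda>x. x)"
  unfolding smooth_on_def
proof
  fix k show "ck_on k S (\<lambda>x. x)"
  proof (cases k)
    case (Suc m)
    then show ?thesis by (auto intro!: exI[of _ "\<lambda>x v. v"] ck_on_const)
  qed simp
qed

lemma smooth_on_bounded_linear: "bounded_linear L \<Longrightarrow> smooth_on S L"
  by (rule smooth_on_bounded_linear_compose[OF _ smooth_on_ident])

lemma smooth_on_add: "smooth_on S f \<Longrightarrow> smooth_on S g \<Longrightarrow> smooth_on S (\<lambda>x. f x + g x)"
  by (simp add: smooth_on_def ck_on_add)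

lemma smooth_on_sum: "(\<And>i. i \<in> I \<Longrightarrow> smooth_on S (f i)) \<Longrightarrow> smooth_on S (\<lambda>x. \<Sum>i\<in>I. f i x)"
  by (simp add: smooth_on_def ck_on_sum)

lemma smooth_on_scaleR:
  fixes f :: "'a::real_normed_vector \<Rightarrow> real"
  shows "smooth_on S f \<Longrightarrow> smooth_on S g \<Longrightarrow> smooth_on S (\<lambda>x. f x *\<^sub>R g x)"
  by (simp add: smooth_on_def ck_on_scaleR)

lemma smooth_on_mult:
  fixes f :: "'a::real_normed_vector \<Rightarrow> real"
  shows "smooth_on S f \<Longrightarrow> smooth_on S g \<Longrightarrow> smooth_on S (\<lambda>x. f x * g x)"
  using smooth_on_scaleR[of S f g] by simp

lemma smooth_on_compose:
  fixes f :: "'b::euclidean_space \<Rightarrow> 'c::real_normed_vector"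
  shows "smooth_on T f \<Longrightarrow> smooth_on S g \<Longrightarrow> g ` S \<subseteq> T \<Longrightarrow> smooth_on S (\<lambda>x. f (g x))"
  unfolding smooth_on_def using ck_on_compose by blast

lemma smooth_on_minus: "smooth_on S f \<Longrightarrow> smooth_on S (\<lambda>x. - f x)"
  by (rule smooth_on_bounded_linear_compose[OF bounded_linear_minus[OF bounded_linear_ident]])

lemma smooth_on_diff: "smooth_on S f \<Longrightarrow> smooth_on S g \<Longrightarrow> smooth_on S (\<lambda>x. f x - g x)"
  using smooth_on_add[OF _ smooth_on_minus] by fastforce

lemma smooth_on_inner_left: "smooth_on S f \<Longrightarrow> smooth_on S (\<lambda>x. f x \<bullet> b)"
  by (rule smooth_on_bounded_linear_compose[OF bounded_linear_inner_left])

lemma smooth_on_componentwise: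
  fixes f :: "'a::real_normed_vector \<Rightarrow> 'b::euclidean_space"
  assumes "\<And>b. b \<in> Basis \<Longrightarrow> smooth_on S (\<lambda>x. f x \<bullet> b)"
  shows "smooth_on S f"
proof -
  have "smooth_on S (\<lambda>x. \<Sum>b\<in>Basis. (f x \<bullet> b) *\<^sub>R b)"
    by (intro smooth_on_sum smooth_on_scaleR smooth_on_const assms)
  then show ?thesis by (simp add: euclidean_representation)
qed

subsection \<open>Bump functions\<close>

text \<open>The powers of \<open>1 / x\<close> make the family closed under differentiation: the
  derivative of a member is a combination of the members \<open>m + 1\<close> and
  \<open>m + 2\<close>, so smoothness follows by one induction over all \<open>m\<close> at
  once.\<close>

definition flat_exp :: "nat \<Rightarrow> real \<Rightarrow> real" where
  "flat_exp m x = (if x \<le> 0 then 0 else (1 / x) ^ m * exp (- (1 / x)))"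

lemma flat_exp_tendsto: "(flat_exp m \<longlongrightarrow> 0) (at_right 0)"
proof -
  have "((\<lambda>y::real. y ^ m / exp y) \<longlongrightarrow> 0) at_top" by (rule tendsto_power_div_exp_0)
  moreover have "filterlim (\<lambda>x::real. 1 / x) at_top (at_right 0)"
    using filterlim_inverse_at_top_right by (simp add: inverse_eq_divide)
  ultimately have "((\<lambda>x::real. (1 / x) ^ m / exp (1 / x)) \<longlongrightarrow> 0) (at_right 0)"
    by (rule filterlim_compose)
  then show ?thesis
  proof (rule Lim_transform_eventually)
    show "\<forall>\<^sub>F x in at_right 0. (1 / x) ^ m / exp (1 / x) = flat_exp m x"
      using eventually_at_right_less by (rule eventually_mono) (auto simp: flat_exp_def exp_minus divide_inverse)
  qed
qed

lemma flat_exp_has_derivative: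
  "(flat_exp m has_real_derivative (flat_exp (m + 2) x - m * flat_exp (m + 1) x)) (at x)"
proof -
  consider "x < 0" | "x = 0" | "x > 0" by linarith
  then show ?thesis
  proof cases
    case 1
    have "((\<lambda>x. 0) has_real_derivative (flat_exp (m + 2) x - m * flat_exp (m + 1) x)) (at x)"
      using 1 by (simp add: flat_exp_def)
    moreover have "open {..<0::real}" by simp
    ultimately show ?thesis
      by (rule has_field_derivative_transform_within_open) (use 1 in \<open>auto simp: flat_exp_def\<close>)
  next
    case 2
    have "((\<lambda>h. flat_exp m h / h) \<longlongrightarrow> 0) (at_left 0)"
    proof (rule Lim_transform_eventually[OF tendsto_const])
      show "\<forall>\<^sub>F x in at_left 0. 0 = flat_exp m x / x"
        by (auto simp: flat_exp_def eventually_at_filter)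
    qed
    \<comment> \<open>To the right of 0 the difference quotient is the next member of the family,
      whose limit is already known.\<close>
    moreover have "((\<lambda>h. flat_exp m h / h) \<longlongrightarrow> 0) (at_right 0)"
    proof (rule Lim_transform_eventually[OF flat_exp_tendsto[of "Suc m"]])
      show "\<forall>\<^sub>F x in at_right 0. flat_exp (Suc m) x = flat_exp m x / x"
        using eventually_at_right_less by (rule eventually_mono) (auto simp: flat_exp_def)
    qed
    ultimately have "((\<lambda>h. flat_exp m h / h) \<longlongrightarrow> 0) (at 0)"
      using filterlim_split_at_real by blast
    then have "(\<lambda>h. (flat_exp m (0 + h) - flat_exp m 0) / h) \<midarrow>0\<rightarrow> 0" by (simp add: flat_exp_def)
    then have "(flat_exp m has_real_derivative 0) (at 0)" unfolding DERIV_def .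
    then show ?thesis using 2 by (simp add: flat_exp_def)
  next
    case 3
    have "((\<lambda>x. (1 / x) ^ m * exp (- (1 / x))) has_real_derivative
       (flat_exp (m + 2) x - m * flat_exp (m + 1) x)) (at x)"
    proof -
      have "((\<lambda>x. 1 / x) has_real_derivative - ((1 / x)\<^sup>2)) (at x)"
        using 3 by (auto intro!: derivative_eq_intros simp: field_simps power2_eq_square)
      then have "((\<lambda>x. (1 / x) ^ m) has_real_derivative m * (- ((1 / x)\<^sup>2) * (1 / x) ^ (m - Suc 0))) (at x)"
        by (rule DERIV_power)
      moreover have "m * (- ((1 / x)\<^sup>2) * (1 / x) ^ (m - Suc 0)) = - real m * (1 / x) ^ (m + 1)"
        by (cases m) (simp_all add: power2_eq_square diff_divide_distrib add_divide_distrib algebra_simps)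
      ultimately have "((\<lambda>x. (1 / x) ^ m) has_real_derivative - real m * (1 / x) ^ (m + 1)) (at x)"
        by simp
      moreover have "((\<lambda>x. exp (- (1 / x))) has_real_derivative exp (- (1 / x)) * (1 / x)\<^sup>2) (at x)"
        using 3 by (auto intro!: derivative_eq_intros simp: field_simps power2_eq_square)
      ultimately have "((\<lambda>x. (1 / x) ^ m * exp (- (1 / x))) has_real_derivative
          (1 / x) ^ m * (exp (- (1 / x)) * (1 / x)\<^sup>2) + - real m * (1 / x) ^ (m + 1) * exp (- (1 / x))) (at x)"
        by (rule DERIV_mult')
      then show ?thesis using 3 by (simp add: flat_exp_def power2_eq_square algebra_simps)
    qed
    moreover have "open {(0::real)<..}" by simp
    ultimately show ?thesis
      by (rule has_field_derivative_transform_within_open) (use 3 in \<open>auto simp: flat_exp_def\<close>)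
  qed
qed

lemma smooth_on_flat_exp: "smooth_on S (flat_exp m)"
proof -
  have "ck_on k S (flat_exp m)" for k m
  proof (induction k arbitrary: m)
    case 0
    show ?case
      using flat_exp_has_derivative by (auto intro!: continuous_at_imp_continuous_on DERIV_isCont)
  next
    case (Suc k)
    have D: "(flat_exp m has_derivative (\<lambda>v. v *\<^sub>R (flat_exp (m + 2) x + (- real m) * flat_exp (m + 1) x))) (at x)" for x
      using flat_exp_has_derivative[of m x, THEN has_field_derivative_imp_has_derivative]
      by (simp add: mult.commute[of "flat_exp _ _ - _"] mult_commute_abs)
    have C: "ck_on k S (\<lambda>x. v *\<^sub>R (flat_exp (m + 2) x + (- real m) * flat_exp (m + 1) x))" for v
      by (intro ck_on_bounded_linear[OF bounded_linear_scaleR_right]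
          ck_on_bounded_linear[OF bounded_linear_mult_right] ck_on_add Suc.IH)
    show ?case
      unfolding ck_on.simps
      by (intro exI[of _ "\<lambda>x v. v *\<^sub>R (flat_exp (m + 2) x + (- real m) * flat_exp (m + 1) x)"] conjI ballI allI D C)
  qed
  then show ?thesis by (simp add: smooth_on_def)
qed

lemma smooth_bump:
  fixes c :: "'a::euclidean_space"
  assumes "0 < r"
  obtains \<beta> :: "'a \<Rightarrow> real" where "smooth_on UNIV \<beta>" "\<And>x. x \<in> ball c (r / 2) \<Longrightarrow> \<beta> x = 1"
    "\<And>x. x \<notin> ball c r \<Longrightarrow> \<beta> x = 0"
proof -
  let ?s = "\<lambda>x. (x - c) \<bullet> (x - c)"
  let ?h = "flat_exp 0"
  \<comment> \<open>Outside \<open>ball c r\<close> the inner argument is at least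
    \<open>3 / 4 * r\<^sup>2\<close>, so by monotonicity the inner value is at least
    \<open>K\<close> and the outer argument is nonpositive. Inside the half ball the inner value is
    0 and the outer one is \<open>?h 1\<close>. Only constants are divided by.\<close>
  define K where "K = ?h (3 / 4 * r\<^sup>2)"
  have hpos: "?h t > 0 \<longleftrightarrow> t > 0" and hz: "t \<le> 0 \<Longrightarrow> ?h t = 0" for t
    by (auto simp: flat_exp_def)
  have mono: "?h a \<le> ?h b" if "a \<le> b" for a b
    using that by (auto simp: flat_exp_def frac_le)
  have K: "K > 0" using assms hpos by (simp add: K_def)
  let ?\<beta> = "\<lambda>x. (1 / ?h 1) * ?h (1 - (1 / K) * ?h (?s x - r\<^sup>2 / 4))"
  have s: "smooth_on UNIV ?s"
  proof -
    have "smooth_on UNIV (\<lambda>x. \<Sum>b\<in>Basis. ((x - c) \<bullet> b) * ((x - c) \<bullet> b))"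
      by (intro smooth_on_sum smooth_on_mult smooth_on_inner_left smooth_on_diff smooth_on_ident smooth_on_const)
    then show ?thesis by (simp add: euclidean_inner[symmetric])
  qed
  have "smooth_on UNIV ?\<beta>"
    by (intro smooth_on_mult smooth_on_const smooth_on_compose[OF smooth_on_flat_exp[of UNIV]] smooth_on_diff s) auto
  moreover have "?\<beta> x = 1" if "x \<in> ball c (r / 2)" for x
  proof -
    have "norm (x - c) < r / 2" using that by (simp add: dist_norm norm_minus_commute)
    then have "norm (x - c) ^ 2 \<le> (r / 2) ^ 2" by (intro power_mono) auto
    then have "?s x - r\<^sup>2 / 4 \<le> 0" by (simp add: power2_norm_eq_inner power_divide)
    then show ?thesis using hz hpos[of 1] by simp
  qed
  moreover have "?\<beta> x = 0" if "x \<notin> ball c r" for x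
  proof -
    have "norm (x - c) \<ge> r" using that by (simp add: dist_norm norm_minus_commute)
    then have "norm (x - c) ^ 2 \<ge> r ^ 2" using assms by (intro power_mono) auto
    then have "3 / 4 * r\<^sup>2 \<le> ?s x - r\<^sup>2 / 4" by (simp add: power2_norm_eq_inner)
    then have "K \<le> ?h (?s x - r\<^sup>2 / 4)" unfolding K_def by (rule mono)
    then have "1 - (1 / K) * ?h (?s x - r\<^sup>2 / 4) \<le> 0" using K by (simp add: field_simps)
    then show ?thesis using hz by simp
  qed
  ultimately show thesis by (rule that)
qed

subsection \<open>Hadamard's lemma\<close>

text \<open>Each differentiation under the integral sign produces a factor \<open>t\<close>;
  carrying the weight \<open>t ^ m\<close> makes the statement stable under induction on the
  order.\<close>

lemma ck_on_ray_integral: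
  fixes h :: "'a::euclidean_space \<Rightarrow> real"
  assumes "smooth_on (ball c r) h"
  shows "ck_on k (ball c r) (\<lambda>x. integral {0..1} (\<lambda>t. t ^ m * h (c + t *\<^sub>R (x - c))))"
  using assms
proof (induction k arbitrary: h m)
  have inb: "c + t *\<^sub>R (x - c) \<in> ball c r" if "x \<in> ball c r" "t \<in> {0..1}" for x t
  proof -
    have "norm (t *\<^sub>R (x - c)) \<le> norm (x - c)" using that by (simp add: mult_left_le_one_le)
    then show ?thesis using that by (simp add: dist_norm norm_minus_commute)
  qed
  have cont: "continuous_on (ball c r \<times> cbox 0 1) (\<lambda>(x, t::real). t ^ m * h (c + t *\<^sub>R (x - c)))"
    if "smooth_on (ball c r) h" for h :: "'a \<Rightarrow> real" and m
  proof -
    have "continuous_on (ball c r \<times> cbox 0 1) (\<lambda>z::'a \<times> real. c + snd z *\<^sub>R (fst z - c))"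
      by (intro continuous_intros)
    have im: "(\<lambda>z::'a \<times> real. c + snd z *\<^sub>R (fst z - c)) ` (ball c r \<times> cbox 0 1) \<subseteq> ball c r"
      using inb by auto
    from continuous_on_compose2[OF smooth_on_continuous[OF that] \<open>continuous_on _ _\<close> im]
    show ?thesis by (auto simp: case_prod_unfold intro!: continuous_intros)
  qed
  case 0
  then show ?case
    using integral_continuous_on_param[OF cont[OF 0]] by simp
next
  case (Suc k)
  have inb: "c + t *\<^sub>R (x - c) \<in> ball c r" if "x \<in> ball c r" "t \<in> {0..1}" for x t
  proof -
    have "norm (t *\<^sub>R (x - c)) \<le> norm (x - c)" using that by (simp add: mult_left_le_one_le)
    then show ?thesis using that by (simp add: dist_norm norm_minus_commute)
  qed
  let ?F = "\<lambda>x. integral {0..1} (\<lambda>t. t ^ m * h (c + t *\<^sub>R (x - c)))"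
  let ?D = "\<lambda>x v. integral {0..1} (\<lambda>t. t ^ Suc m * frechet_derivative h (at (c + t *\<^sub>R (x - c))) v)"
  \<comment> \<open>The Leibniz rule wants the derivative as a continuous family of bounded linear
    maps; continuity is then checked one basis direction at a time.\<close>
  define B where "B x t = Blinfun (\<lambda>v. t ^ Suc m * frechet_derivative h (at (c + t *\<^sub>R (x - c))) v)" for x t
  have hd: "(h has_derivative frechet_derivative h (at y)) (at y)" if "y \<in> ball c r" for y
    using smooth_on_has_derivative[OF Suc.prems that] .
  have B: "blinfun_apply (B x t) = (\<lambda>v. t ^ Suc m * frechet_derivative h (at (c + t *\<^sub>R (x - c))) v)"
    if "x \<in> ball c r" "t \<in> {0..1}" for x t
    unfolding B_def
    by (rule bounded_linear_Blinfun_apply)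
       (intro bounded_linear_const_mult has_derivative_bounded_linear[OF hd[OF inb]] that)
  have fx: "((\<lambda>x. t ^ m * h (c + t *\<^sub>R (x - c))) has_derivative blinfun_apply (B x t)) (at x within ball c r)"
    if "x \<in> ball c r" "t \<in> cbox 0 1" for x t
  proof -
    have t: "t \<in> {0..1}" using that by simp
    interpret L: linear "frechet_derivative h (at (c + t *\<^sub>R (x - c)))"
      using hd[OF inb[OF that(1) t]] has_derivative_linear by blast
    have "((\<lambda>x. c + t *\<^sub>R (x - c)) has_derivative (\<lambda>v. 0 + t *\<^sub>R (v - 0))) (at x)"
      by (intro has_derivative_add has_derivative_const has_derivative_scaleR_right has_derivative_diff has_derivative_ident)
    then have "((\<lambda>x. c + t *\<^sub>R (x - c)) has_derivative (\<lambda>v. t *\<^sub>R v)) (at x)" by simp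
    from has_derivative_compose[OF this hd[OF inb[OF that(1) t]]]
    have "((\<lambda>x. t ^ m * h (c + t *\<^sub>R (x - c))) has_derivative
        (\<lambda>v. t ^ m * frechet_derivative h (at (c + t *\<^sub>R (x - c))) (t *\<^sub>R v))) (at x)"
      by (rule has_derivative_mult_right)
    then show ?thesis
      using B[OF that(1) t] by (simp add: L.scaleR mult_ac has_derivative_at_withinI)
  qed
  have contB: "continuous_on (ball c r \<times> cbox 0 1) (\<lambda>(x, t). B x t)"
  proof (rule continuous_on_blinfun_componentwise)
    fix i :: 'a
    have "continuous_on (ball c r \<times> cbox 0 1) (\<lambda>z::'a \<times> real. c + snd z *\<^sub>R (fst z - c))"
      by (intro continuous_intros)
    have im: "(\<lambda>z::'a \<times> real. c + snd z *\<^sub>R (fst z - c)) ` (ball c r \<times> cbox 0 1) \<subseteq> ball c r"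
      using inb by auto
    from continuous_on_compose2[OF smooth_on_continuous[OF smooth_on_derivative[OF open_ball Suc.prems, of i]] \<open>continuous_on _ _\<close> im]
    have "continuous_on (ball c r \<times> cbox 0 1)
        (\<lambda>(x, t::real). t ^ Suc m * frechet_derivative h (at (c + t *\<^sub>R (x - c))) i)"
      by (auto simp: case_prod_unfold intro!: continuous_intros)
    then show "continuous_on (ball c r \<times> cbox 0 1) (\<lambda>x. blinfun_apply (case x of (x, t) \<Rightarrow> B x t) i)"
      by (rule continuous_on_eq) (auto simp: B)
  qed
  have int: "(\<lambda>t. t ^ m * h (c + t *\<^sub>R (x - c))) integrable_on cbox 0 1" if "x \<in> ball c r" for x
  proof -
    have "continuous_on (cbox 0 1) (\<lambda>t::real. c + t *\<^sub>R (x - c))" by (intro continuous_intros)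
    moreover have "(\<lambda>t::real. c + t *\<^sub>R (x - c)) ` cbox 0 1 \<subseteq> ball c r" using inb[OF that] by auto
    ultimately have "continuous_on (cbox 0 1) (\<lambda>t::real. h (c + t *\<^sub>R (x - c)))"
      by (rule continuous_on_compose2[OF smooth_on_continuous[OF Suc.prems]])
    then show ?thesis by (intro integrable_continuous continuous_intros) auto
  qed
  have "(?F has_derivative ?D x) (at x)" if x: "x \<in> ball c r" for x
  proof -
    have D: "(?F has_derivative integral (cbox 0 1) (B x)) (at x within ball c r)"
      using leibniz_rule[OF fx int contB x] by simp
    have E: "blinfun_apply (integral (cbox 0 1) (B x)) v = ?D x v" for v
    proof -
      have "B x integrable_on cbox 0 1"
      proof (rule integrable_continuous)
        have "continuous_on (cbox 0 1) (\<lambda>t::real. (x, t))" by (intro continuous_intros)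
        moreover have "Pair x ` cbox 0 1 \<subseteq> ball c r \<times> cbox (0::real) 1" using x by auto
        ultimately show "continuous_on (cbox 0 1) (B x)"
          using continuous_on_compose2[OF contB] by fastforce
      qed
      then have "blinfun_apply (integral (cbox 0 1) (B x)) v = integral (cbox 0 1) (\<lambda>t. blinfun_apply (B x t) v)"
        by (rule blinfun_apply_integral)
      also have "\<dots> = integral (cbox 0 1) (\<lambda>t. t ^ Suc m * frechet_derivative h (at (c + t *\<^sub>R (x - c))) v)"
        by (rule integral_cong) (simp add: B[OF x])
      finally show ?thesis by (simp only: cbox_interval)
    qed
    have "blinfun_apply (integral (cbox 0 1) (B x)) = ?D x" by (rule ext) (rule E)
    with D show ?thesis unfolding at_within_open[OF x open_ball] by (rule back_subst)
  qed
  moreover have "ck_on k (ball c r) (\<lambda>x. ?D x v)" for v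
    using Suc.IH[OF smooth_on_derivative[OF open_ball Suc.prems]] .
  ultimately show ?case unfolding ck_on.simps by (intro exI[of _ ?D] conjI ballI allI)
qed

text \<open>Integrate the derivative along the segment from \<open>c\<close> to \<open>x\<close>.
  The smooth coefficients are what a derivation can be applied to, through its product rule.\<close>

lemma hadamard:
  fixes f :: "'a::euclidean_space \<Rightarrow> real"
  assumes "smooth_on (ball c r) f" "0 < r"
  obtains g where "\<And>b. smooth_on (ball c r) (g b)"
    "\<And>x. x \<in> ball c r \<Longrightarrow> f x = f c + (\<Sum>b\<in>Basis. ((x - c) \<bullet> b) * g b x)"
    "\<And>b. g b c = frechet_derivative f (at c) b"
proof -
  let ?g = "\<lambda>b x. integral {0..1} (\<lambda>t. t ^ 0 * frechet_derivative f (at (c + t *\<^sub>R (x - c))) b)"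
  have inb: "c + t *\<^sub>R (x - c) \<in> ball c r" if "x \<in> ball c r" "t \<in> {0..1}" for x t
  proof -
    have "norm (t *\<^sub>R (x - c)) \<le> norm (x - c)" using that by (simp add: mult_left_le_one_le)
    then show ?thesis using that by (simp add: dist_norm norm_minus_commute)
  qed
  have hd: "(f has_derivative frechet_derivative f (at y)) (at y)" if "y \<in> ball c r" for y
    using smooth_on_has_derivative[OF assms(1) that] .
  have "smooth_on (ball c r) (?g b)" for b
    unfolding smooth_on_def
    using ck_on_ray_integral[OF smooth_on_derivative[OF open_ball assms(1), of b], where m = 0] ..
  moreover have "f x = f c + (\<Sum>b\<in>Basis. ((x - c) \<bullet> b) * ?g b x)" if x: "x \<in> ball c r" for x
  proof -
    have int: "(\<lambda>t. frechet_derivative f (at (c + t *\<^sub>R (x - c))) b) integrable_on {0..1}" for b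
    proof -
      have 1: "continuous_on (ball c r) (\<lambda>y. frechet_derivative f (at y) b)"
        using smooth_on_continuous[OF smooth_on_derivative[OF open_ball assms(1)]] .
      have 2: "continuous_on {0..1} (\<lambda>t. c + t *\<^sub>R (x - c))" by (intro continuous_intros)
      show ?thesis
        using inb[OF x] by (intro integrable_continuous_interval continuous_on_compose2[OF 1 2]) auto
    qed
    have "((\<lambda>t. f (c + t *\<^sub>R (x - c))) has_vector_derivative
        frechet_derivative f (at (c + t *\<^sub>R (x - c))) (x - c)) (at t within {0..1})" if t: "t \<in> {0..1}" for t
    proof -
      interpret L: linear "frechet_derivative f (at (c + t *\<^sub>R (x - c)))"
        using hd[OF inb[OF x t]] has_derivative_linear by blast
      have "((\<lambda>t. c + t *\<^sub>R (x - c)) has_derivative (\<lambda>s. 0 + s *\<^sub>R (x - c))) (at t within {0..1})"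
        by (intro has_derivative_add has_derivative_const has_derivative_scaleR_left has_derivative_ident)
      then have "((\<lambda>t. c + t *\<^sub>R (x - c)) has_derivative (\<lambda>s. s *\<^sub>R (x - c))) (at t within {0..1})"
        by simp
      from has_derivative_compose[OF this hd[OF inb[OF x t]]]
      show ?thesis by (simp add: has_vector_derivative_def L.scaleR)
    qed
    then have "((\<lambda>t. frechet_derivative f (at (c + t *\<^sub>R (x - c))) (x - c)) has_integral
        f (c + 1 *\<^sub>R (x - c)) - f (c + 0 *\<^sub>R (x - c))) {0..1}"
      by (intro fundamental_theorem_of_calculus) auto
    then have "f x - f c = integral {0..1} (\<lambda>t. frechet_derivative f (at (c + t *\<^sub>R (x - c))) (x - c))"
      by (simp add: integral_unique)
    also have "\<dots> = integral {0..1} (\<lambda>t. \<Sum>b\<in>Basis. ((x - c) \<bullet> b) * frechet_derivative f (at (c + t *\<^sub>R (x - c))) b)"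
    proof (rule integral_cong)
      fix t :: real assume t: "t \<in> {0..1}"
      interpret L: linear "frechet_derivative f (at (c + t *\<^sub>R (x - c)))"
        using hd[OF inb[OF x t]] has_derivative_linear by blast
      have "frechet_derivative f (at (c + t *\<^sub>R (x - c))) (\<Sum>b\<in>Basis. ((x - c) \<bullet> b) *\<^sub>R b) =
          (\<Sum>b\<in>Basis. ((x - c) \<bullet> b) * frechet_derivative f (at (c + t *\<^sub>R (x - c))) b)"
        by (simp add: L.sum L.scaleR)
      then show "frechet_derivative f (at (c + t *\<^sub>R (x - c))) (x - c) =
          (\<Sum>b\<in>Basis. ((x - c) \<bullet> b) * frechet_derivative f (at (c + t *\<^sub>R (x - c))) b)"
        by (simp add: euclidean_representation)
    qed
    also have "\<dots> = (\<Sum>b\<in>Basis. ((x - c) \<bullet> b) * ?g b x)"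
      using int by (subst integral_sum) (auto intro: integrable_on_mult_right)
    finally show ?thesis by simp
  qed
  moreover have "?g b c = frechet_derivative f (at c) b" for b by simp
  ultimately show thesis by (rule that)
qed

section \<open>Derivations as tangent vectors, and why a tensor sees only the pointwise values of
  fields\<close>

section \<open>Smooth functions and derivations on a manifold\<close>

definition is_chart :: "'m::topological_space set \<Rightarrow> ('m \<Rightarrow> 'e::euclidean_space) \<Rightarrow> bool" where
  "is_chart U \<phi> \<longleftrightarrow> open U \<and> open (\<phi> ` U) \<and> homeomorphism U (\<phi> ` U) \<phi> (inv_into U \<phi>)"

lemma is_chartD:
  assumes "is_chart U \<phi>"
  shows "open U" "open (\<phi> ` U)" "continuous_on U \<phi>" "continuous_on (\<phi> ` U) (inv_into U \<phi>)"
    "\<And>q. q \<in> U \<Longrightarrow> inv_into U \<phi> (\<phi> q) = q" "\<And>x. x \<in> \<phi> ` U \<Longrightarrow> \<phi> (inv_into U \<phi> x) = x"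
    "\<And>x. x \<in> \<phi> ` U \<Longrightarrow> inv_into U \<phi> x \<in> U"
  using assms unfolding is_chart_def homeomorphism_def by (auto intro: inv_into_into)

lemma is_chart_open_image:
  assumes "is_chart U \<phi>" "open W"
  shows "open (\<phi> ` (U \<inter> W))"
proof -
  note c = is_chartD[OF assms(1)]
  have "\<phi> ` (U \<inter> W) = inv_into U \<phi> -` W \<inter> \<phi> ` U"
  proof (intro equalityI subsetI)
    fix x assume "x \<in> inv_into U \<phi> -` W \<inter> \<phi> ` U"
    then show "x \<in> \<phi> ` (U \<inter> W)" using c(6,7)[of x] by (metis IntD1 IntD2 IntI image_eqI vimageD)
  qed (use c(5) in auto)
  moreover have "open (inv_into U \<phi> -` W \<inter> \<phi> ` U)"
    using continuous_on_open_vimage[OF c(2)] c(4) assms(2) by blast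
  ultimately show ?thesis by simp
qed

lemma is_chart_open_preimage:
  assumes "is_chart U \<phi>" "open T"
  shows "open {q \<in> U. \<phi> q \<in> T}"
proof -
  have "{q \<in> U. \<phi> q \<in> T} = \<phi> -` T \<inter> U" by auto
  then show ?thesis
    using continuous_on_open_vimage[OF is_chartD(1)[OF assms(1)]] is_chartD(3)[OF assms(1)] assms(2) by metis
qed

lemma is_chart_Times:
  assumes "is_chart U \<phi>" "is_chart V \<psi>"
  shows "is_chart (U \<times> V) (map_prod \<phi> \<psi>)"
    and "\<And>x y. x \<in> \<phi> ` U \<Longrightarrow> y \<in> \<psi> ` V \<Longrightarrow>
      inv_into (U \<times> V) (map_prod \<phi> \<psi>) (x, y) = (inv_into U \<phi> x, inv_into V \<psi> y)"
proof -
  note c = is_chartD[OF assms(1)] and d = is_chartD[OF assms(2)]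
  have im: "map_prod \<phi> \<psi> ` (U \<times> V) = \<phi> ` U \<times> \<psi> ` V" by auto
  have inj: "inj_on (map_prod \<phi> \<psi>) (U \<times> V)"
    using c(5) d(5) by (intro map_prod_inj_on) (metis inj_onI)+
  show inv: "inv_into (U \<times> V) (map_prod \<phi> \<psi>) (x, y) = (inv_into U \<phi> x, inv_into V \<psi> y)"
    if "x \<in> \<phi> ` U" "y \<in> \<psi> ` V" for x y
    using that c d by (intro inv_into_f_eq[OF inj]) auto
  have "continuous_on (U \<times> V) (map_prod \<phi> \<psi>)"
  proof -
    have "continuous_on (U \<times> V) (\<lambda>z. \<phi> (fst z))" "continuous_on (U \<times> V) (\<lambda>z. \<psi> (snd z))"
      using continuous_on_compose2[OF c(3) continuous_on_fst[OF continuous_on_id], of "U \<times> V"]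
        continuous_on_compose2[OF d(3) continuous_on_snd[OF continuous_on_id], of "U \<times> V"] by auto
    then have "continuous_on (U \<times> V) (\<lambda>z. (\<phi> (fst z), \<psi> (snd z)))" by (rule continuous_on_Pair)
    then show ?thesis by (simp add: map_prod_def case_prod_unfold)
  qed
  moreover have "continuous_on (\<phi> ` U \<times> \<psi> ` V) (inv_into (U \<times> V) (map_prod \<phi> \<psi>))"
  proof -
    have "continuous_on (\<phi> ` U \<times> \<psi> ` V) (\<lambda>z. inv_into U \<phi> (fst z))"
      "continuous_on (\<phi> ` U \<times> \<psi> ` V) (\<lambda>z. inv_into V \<psi> (snd z))"
      using continuous_on_compose2[OF c(4) continuous_on_fst[OF continuous_on_id], of "\<phi> ` U \<times> \<psi> ` V"]
        continuous_on_compose2[OF d(4) continuous_on_snd[OF continuous_on_id], of "\<phi> ` U \<times> \<psi> ` V"] by auto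
    then have "continuous_on (\<phi> ` U \<times> \<psi> ` V) (\<lambda>z. (inv_into U \<phi> (fst z), inv_into V \<psi> (snd z)))"
      by (rule continuous_on_Pair)
    then show ?thesis
      by (rule continuous_on_eq) (auto simp: inv)
  qed
  moreover have "inv_into (U \<times> V) (map_prod \<phi> \<psi>) ` (\<phi> ` U \<times> \<psi> ` V) = U \<times> V"
    using inv_into_image_cancel[OF inj, of "U \<times> V"] im by simp
  moreover have "open (U \<times> V)" "open (\<phi> ` U \<times> \<psi> ` V)"
    using c d by (auto intro: open_Times)
  ultimately show "is_chart (U \<times> V) (map_prod \<phi> \<psi>)"
    unfolding is_chart_def homeomorphism_def im using inv_into_f_f[OF inj] inv c d by auto
qed

lemma smooth_atlas_chart: "smooth_atlas A \<Longrightarrow> (U, \<phi>) \<in> A \<Longrightarrow> is_chart U \<phi>"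
  unfolding smooth_atlas_def is_chart_def by auto

lemma smooth_atlas_cover:
  assumes "smooth_atlas A"
  obtains U \<phi> where "(U, \<phi>) \<in> A" "p \<in> U"
proof -
  have "p \<in> (\<Union>(U, \<phi>)\<in>A. U)" using assms unfolding smooth_atlas_def by simp
  then show thesis using that by auto
qed

lemma smooth_atlas_transition:
  assumes "smooth_atlas A" "(U, \<phi>) \<in> A" "(V, \<psi>) \<in> A"
  shows "smooth_on (\<phi> ` (U \<inter> V)) (\<lambda>x. \<psi> (inv_into U \<phi> x))"
  using assms unfolding smooth_atlas_def by (fastforce simp: o_def)

lemma smooth_funsD: "f \<in> smooth_funs A \<Longrightarrow> (U, \<phi>) \<in> A \<Longrightarrow> smooth_on (\<phi> ` U) (\<lambda>x. f (inv_into U \<phi> x))"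
  unfolding smooth_funs_def by (auto simp: o_def)

lemma smooth_funsI:
  "(\<And>U \<phi>. (U, \<phi>) \<in> A \<Longrightarrow> smooth_on (\<phi> ` U) (\<lambda>x. f (inv_into U \<phi> x))) \<Longrightarrow> f \<in> smooth_funs A"
  unfolding smooth_funs_def by (auto simp: o_def)

lemma smooth_funs_const: "(\<lambda>p. c) \<in> smooth_funs A"
  by (intro smooth_funsI smooth_on_const)

lemma smooth_funs_add: "f \<in> smooth_funs A \<Longrightarrow> h \<in> smooth_funs A \<Longrightarrow> (\<lambda>p. f p + h p) \<in> smooth_funs A"
  using smooth_on_add[OF smooth_funsD[of f A] smooth_funsD[of h A]] by (intro smooth_funsI)

lemma smooth_funs_mult: "f \<in> smooth_funs A \<Longrightarrow> h \<in> smooth_funs A \<Longrightarrow> (\<lambda>p. f p * h p) \<in> smooth_funs A"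
  using smooth_on_mult[OF smooth_funsD[of f A] smooth_funsD[of h A]] by (intro smooth_funsI)

lemma smooth_funs_diff: "f \<in> smooth_funs A \<Longrightarrow> h \<in> smooth_funs A \<Longrightarrow> (\<lambda>p. f p - h p) \<in> smooth_funs A"
  using smooth_on_diff[OF smooth_funsD[of f A] smooth_funsD[of h A]] by (intro smooth_funsI)

lemma smooth_funs_sum: "(\<And>i. i \<in> I \<Longrightarrow> f i \<in> smooth_funs A) \<Longrightarrow> (\<lambda>p. \<Sum>i\<in>I. f i p) \<in> smooth_funs A"
proof (rule smooth_funsI)
  fix U \<phi> assume f: "\<And>i. i \<in> I \<Longrightarrow> f i \<in> smooth_funs A" and c: "(U, \<phi>) \<in> A"
  show "smooth_on (\<phi> ` U) (\<lambda>x. \<Sum>i\<in>I. f i (inv_into U \<phi> x))"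
    by (rule smooth_on_sum) (rule smooth_funsD[OF f c])
qed

lemma smooth_funs_local:
  assumes A: "smooth_atlas A"
    and loc: "\<And>p. \<exists>W. open W \<and> p \<in> W \<and>
      (\<forall>U \<phi>. (U, \<phi>) \<in> A \<longrightarrow> smooth_on (\<phi> ` (U \<inter> W)) (\<lambda>x. f (inv_into U \<phi> x)))"
  shows "f \<in> smooth_funs A"
proof (rule smooth_funsI)
  fix U \<phi> assume c: "(U, \<phi>) \<in> A"
  note chart = smooth_atlas_chart[OF A c]
  show "smooth_on (\<phi> ` U) (\<lambda>x. f (inv_into U \<phi> x))"
  proof (rule smooth_on_local)
    show "open (\<phi> ` U)" using is_chartD(2)[OF chart] .
    fix x assume x: "x \<in> \<phi> ` U"
    obtain W where W: "open W" "inv_into U \<phi> x \<in> W"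
      "smooth_on (\<phi> ` (U \<inter> W)) (\<lambda>x. f (inv_into U \<phi> x))"
      using loc[of "inv_into U \<phi> x"] c by auto
    have "x \<in> \<phi> ` (U \<inter> W)"
      using W(2) is_chartD(6,7)[OF chart x] by (metis IntI image_eqI)
    then show "\<exists>T. open T \<and> x \<in> T \<and> smooth_on T (\<lambda>x. f (inv_into U \<phi> x))"
      using W(3) is_chart_open_image[OF chart W(1)] by blast
  qed
qed

lemma smooth_funs_compose:
  fixes B :: "('n::topological_space, 'f::euclidean_space) atlas"
  assumes B: "smooth_atlas B" and f: "f \<in> smooth_funs B" and F: "smooth_map_on A B W F"
    and W: "open W" and c: "(U, \<phi>) \<in> A" and chart: "is_chart U \<phi>"
  shows "smooth_on (\<phi> ` (U \<inter> W)) (\<lambda>x. f (F (inv_into U \<phi> x)))"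
proof (rule smooth_on_local)
  show "open (\<phi> ` (U \<inter> W))" by (rule is_chart_open_image[OF chart W])
  fix x assume "x \<in> \<phi> ` (U \<inter> W)"
  then obtain q where q: "q \<in> U" "q \<in> W" "x = \<phi> q" by auto
  obtain V \<psi> where V: "(V, \<psi>) \<in> B" "F q \<in> V" using smooth_atlas_cover[OF B] .
  note cV = smooth_atlas_chart[OF B V(1)]
  have contF: "continuous_on W F" using F unfolding smooth_map_on_def by simp
  have "open (W \<inter> F -` V)"
    using continuous_on_open_vimage[OF W] contF is_chartD(1)[OF cV] by (metis inf_commute)
  then have o: "open (\<phi> ` (U \<inter> (W \<inter> F -` V)))" by (rule is_chart_open_image[OF chart])
  have sm: "smooth_on (\<phi> ` (U \<inter> (W \<inter> F -` V))) (\<lambda>x. \<psi> (F (inv_into U \<phi> x)))"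
    using F c V(1) unfolding smooth_map_on_def by (fastforce simp: o_def Int_assoc)
  have "smooth_on (\<phi> ` (U \<inter> (W \<inter> F -` V))) (\<lambda>x. f (inv_into V \<psi> (\<psi> (F (inv_into U \<phi> x)))))"
    by (rule smooth_on_compose[OF smooth_funsD[OF f V(1)] sm])
       (use is_chartD(5)[OF chart] in auto)
  then have "smooth_on (\<phi> ` (U \<inter> (W \<inter> F -` V))) (\<lambda>x. f (F (inv_into U \<phi> x)))"
    by (rule smooth_on_cong[OF o, rotated]) (use is_chartD(5)[OF chart] is_chartD(5)[OF cV] in auto)
  moreover have "x \<in> \<phi> ` (U \<inter> (W \<inter> F -` V))" using q V by auto
  ultimately show "\<exists>T. open T \<and> x \<in> T \<and> smooth_on T (\<lambda>x. f (F (inv_into U \<phi> x)))"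
    using o by blast
qed

subsection \<open>Extension of germs\<close>

text \<open>The gap between \<open>s\<close> and \<open>r\<close> gives two open sets that cover the
  manifold: the chart piece over the large ball, and the complement of the image of the small closed
  ball. That image is compact, hence closed because the manifold is Hausdorff.\<close>

lemma smooth_funs_extend:
  fixes A :: "('m::t2_space, 'e::euclidean_space) atlas"
  assumes A: "smooth_atlas A" and c: "(U, \<phi>) \<in> A" and sub: "ball x0 r \<subseteq> \<phi> ` U" and s: "s < r"
    and h: "smooth_on (ball x0 r) h" "\<And>x. x \<in> ball x0 r \<Longrightarrow> x \<notin> ball x0 s \<Longrightarrow> h x = 0"
  shows "(\<lambda>q. if q \<in> U \<and> \<phi> q \<in> ball x0 r then h (\<phi> q) else 0) \<in> smooth_funs A" (is "?F \<in> _")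
proof (rule smooth_funs_local[OF A])
  note chart = smooth_atlas_chart[OF A c]
  fix p
  let ?W = "{q \<in> U. \<phi> q \<in> ball x0 r}"
  let ?K = "inv_into U \<phi> ` cball x0 s"
  have cs: "cball x0 s \<subseteq> ball x0 r" using s by auto
  have "compact ?K"
    by (intro compact_continuous_image compact_cball continuous_on_subset[OF is_chartD(4)[OF chart]])
       (use cs sub in blast)
  then have K: "open (- ?K)" by (simp add: compact_imp_closed open_Compl)
  have Wo: "open ?W" by (rule is_chart_open_preimage[OF chart open_ball])
  have onW: "smooth_on (\<psi> ` (V \<inter> ?W)) (\<lambda>x. ?F (inv_into V \<psi> x))" if V: "(V, \<psi>) \<in> A" for V \<psi>
  proof -
    note cV = smooth_atlas_chart[OF A V]
    have o: "open (\<psi> ` (V \<inter> ?W))" by (rule is_chart_open_image[OF cV Wo])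
    have "smooth_on (\<psi> ` (V \<inter> ?W)) (\<lambda>x. h (\<phi> (inv_into V \<psi> x)))"
      by (rule smooth_on_compose[OF h(1) smooth_on_subset[OF smooth_atlas_transition[OF A V c]]])
         (use is_chartD(5)[OF cV] in auto)
    then show ?thesis
      by (rule smooth_on_cong[OF o, rotated]) (use is_chartD(5)[OF cV] in auto)
  qed
  have onK: "smooth_on (\<psi> ` (V \<inter> - ?K)) (\<lambda>x. ?F (inv_into V \<psi> x))" if V: "(V, \<psi>) \<in> A" for V \<psi>
  proof -
    note cV = smooth_atlas_chart[OF A V]
    have o: "open (\<psi> ` (V \<inter> - ?K))" by (rule is_chart_open_image[OF cV K])
    have z: "?F q = 0" if "q \<notin> ?K" for q
    proof (cases "q \<in> ?W")
      case True
      then have "\<phi> q \<notin> ball x0 s"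
        using that is_chartD(5)[OF chart, of q] by (metis (no_types, lifting) ball_subset_cball image_eqI mem_Collect_eq subsetD)
      then show ?thesis using True h(2) by auto
    qed auto
    show ?thesis
      by (rule smooth_on_cong[OF o _ smooth_on_const[of _ 0]])
         (use z is_chartD(5)[OF cV] in fastforce)
  qed
  have "p \<in> ?W \<or> p \<in> - ?K"
  proof -
    have "q \<in> ?W" if "q \<in> ?K" for q
    proof -
      obtain x where "x \<in> cball x0 s" "q = inv_into U \<phi> x" using \<open>q \<in> ?K\<close> by auto
      then have "x \<in> ball x0 r" "x \<in> \<phi> ` U" using cs sub by auto
      then show ?thesis using is_chartD(6,7)[OF chart, of x] \<open>q = _\<close> by auto
    qed
    then show ?thesis by blast
  qed
  then show "\<exists>W. open W \<and> p \<in> W \<and>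
      (\<forall>U' \<phi>'. (U', \<phi>') \<in> A \<longrightarrow> smooth_on (\<phi>' ` (U' \<inter> W)) (\<lambda>x. ?F (inv_into U' \<phi>' x)))"
  proof
    assume "p \<in> ?W"
    then show ?thesis using Wo onW by (intro exI[of _ ?W] conjI allI impI)
  next
    assume "p \<in> - ?K"
    then show ?thesis using K onK by (intro exI[of _ "- ?K"] conjI allI impI)
  qed
qed

text \<open>Vector fields act on global functions only, so every function given in a chart must
  first be traded for a global one with the same germ.\<close>

lemma smooth_germ_extend:
  fixes A :: "('m::t2_space, 'e::euclidean_space) atlas"
  assumes A: "smooth_atlas A" and c: "(U, \<phi>) \<in> A" and p: "p \<in> U"
    and T: "open T" "\<phi> p \<in> T" "smooth_on T h"
  obtains F W where "F \<in> smooth_funs A" "open W" "p \<in> W" "W \<subseteq> U" "\<And>q. q \<in> W \<Longrightarrow> F q = h (\<phi> q)"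
proof -
  note chart = smooth_atlas_chart[OF A c]
  have "open (T \<inter> \<phi> ` U)" "\<phi> p \<in> T \<inter> \<phi> ` U" using T p is_chartD(2)[OF chart] by auto
  then obtain r where r: "r > 0" "ball (\<phi> p) r \<subseteq> T \<inter> \<phi> ` U" by (meson openE)
  obtain \<beta> :: "'e \<Rightarrow> real" where \<beta>: "smooth_on UNIV \<beta>" "\<And>x. x \<in> ball (\<phi> p) ((r / 2) / 2) \<Longrightarrow> \<beta> x = 1"
    "\<And>x. x \<notin> ball (\<phi> p) (r / 2) \<Longrightarrow> \<beta> x = 0"
    using smooth_bump[of "r / 2" "\<phi> p"] half_gt_zero[OF r(1)] by blast
  let ?F = "\<lambda>q. if q \<in> U \<and> \<phi> q \<in> ball (\<phi> p) r then \<beta> (\<phi> q) * h (\<phi> q) else 0"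
  have "?F \<in> smooth_funs A"
  proof (rule smooth_funs_extend[OF A c, where s = "r / 2" and h = "\<lambda>x. \<beta> x * h x"])
    show "smooth_on (ball (\<phi> p) r) (\<lambda>x. \<beta> x * h x)"
      using r by (intro smooth_on_mult smooth_on_subset[OF \<beta>(1)] smooth_on_subset[OF T(3)]) auto
  qed (use r \<beta>(3) in auto)
  moreover have "?F q = h (\<phi> q)" if "q \<in> {q \<in> U. \<phi> q \<in> ball (\<phi> p) (r / 2 / 2)}" for q
    using that \<beta>(2)[of "\<phi> q"] r by auto
  moreover have "p \<in> {q \<in> U. \<phi> q \<in> ball (\<phi> p) (r / 2 / 2)}" using p r by auto
  ultimately show thesis
    by (intro that[of ?F "{q \<in> U. \<phi> q \<in> ball (\<phi> p) (r / 2 / 2)}"] is_chart_open_preimage[OF chart open_ball])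
      blast+
qed

lemma smooth_funs_bump:
  fixes A :: "('m::t2_space, 'e::euclidean_space) atlas"
  assumes A: "smooth_atlas A" and W: "open W" "p \<in> W"
  obtains \<eta> where "\<eta> \<in> smooth_funs A" "\<eta> p = 1" "\<And>q. q \<notin> W \<Longrightarrow> \<eta> q = 0"
proof -
  obtain U \<phi> where c: "(U, \<phi>) \<in> A" "p \<in> U" using smooth_atlas_cover[OF A] .
  note chart = smooth_atlas_chart[OF A c(1)]
  obtain r where r: "r > 0" "ball (\<phi> p) r \<subseteq> \<phi> ` (U \<inter> W)"
    using is_chart_open_image[OF chart W(1)] c(2) W(2) by (meson IntI image_eqI openE)
  obtain \<beta> :: "'e \<Rightarrow> real" where \<beta>: "smooth_on UNIV \<beta>" "\<And>x. x \<in> ball (\<phi> p) ((r / 2) / 2) \<Longrightarrow> \<beta> x = 1"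
    "\<And>x. x \<notin> ball (\<phi> p) (r / 2) \<Longrightarrow> \<beta> x = 0"
    using smooth_bump[of "r / 2" "\<phi> p"] half_gt_zero[OF r(1)] by blast
  let ?F = "\<lambda>q. if q \<in> U \<and> \<phi> q \<in> ball (\<phi> p) r then \<beta> (\<phi> q) else 0"
  have "?F \<in> smooth_funs A"
  proof (rule smooth_funs_extend[OF A c(1), where s = "r / 2" and h = \<beta>])
    show "smooth_on (ball (\<phi> p) r) \<beta>" using smooth_on_subset[OF \<beta>(1)] by simp
  qed (use r \<beta>(3) in auto)
  moreover have "?F q = 0" if "q \<notin> W" for q
  proof -
    have "\<not> (q \<in> U \<and> \<phi> q \<in> ball (\<phi> p) r)"
    proof
      assume q: "q \<in> U \<and> \<phi> q \<in> ball (\<phi> p) r"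
      then obtain q' where "q' \<in> U \<inter> W" "\<phi> q' = \<phi> q" using r by force
      then show False using q that is_chartD(5)[OF chart] by (metis IntD1 IntD2)
    qed
    then show ?thesis by (rule if_not_P)
  qed
  moreover have "?F p = 1" using c(2) r \<beta>(2)[of "\<phi> p"] by simp
  ultimately show thesis using that by blast
qed

subsection \<open>Derivations\<close>

lemma vfieldsD:
  assumes "X \<in> vfields A"
  shows "f \<in> smooth_funs A \<Longrightarrow> X f \<in> smooth_funs A"
    "f \<notin> smooth_funs A \<Longrightarrow> X f = (\<lambda>p. 0)"
    "f \<in> smooth_funs A \<Longrightarrow> h \<in> smooth_funs A \<Longrightarrow> X (\<lambda>q. a * f q + b * h q) p = a * X f p + b * X h p"
    "f \<in> smooth_funs A \<Longrightarrow> h \<in> smooth_funs A \<Longrightarrow> X (\<lambda>q. f q * h q) p = f p * X h p + h p * X f p"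
  using assms unfolding vfields_def by blast+

lemma vf_plus:
  "X \<in> vfields A \<Longrightarrow> f \<in> smooth_funs A \<Longrightarrow> h \<in> smooth_funs A \<Longrightarrow> X (\<lambda>q. f q + h q) p = X f p + X h p"
  using vfieldsD(3)[of X A f h 1 1 p] by simp

lemma vf_minus:
  "X \<in> vfields A \<Longrightarrow> f \<in> smooth_funs A \<Longrightarrow> h \<in> smooth_funs A \<Longrightarrow> X (\<lambda>q. f q - h q) p = X f p - X h p"
  using vfieldsD(3)[of X A f h 1 "-1" p] by simp

lemma vf_const:
  assumes "X \<in> vfields A"
  shows "X (\<lambda>q. c) p = 0"
proof -
  have "X (\<lambda>q. 1 * 1) p = 1 * X (\<lambda>q. 1) p + 1 * X (\<lambda>q. 1) p"
    using vfieldsD(4)[OF assms smooth_funs_const smooth_funs_const] .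
  then have "X (\<lambda>q. 1) p = 0" by simp
  then show ?thesis
    using vfieldsD(3)[OF assms smooth_funs_const smooth_funs_const, of c 1 0 1 p] by simp
qed

lemma vf_sum:
  assumes X: "X \<in> vfields A" and "\<And>i. i \<in> I \<Longrightarrow> f i \<in> smooth_funs A"
  shows "X (\<lambda>q. \<Sum>i\<in>I. f i q) p = (\<Sum>i\<in>I. X (f i) p)"
  using assms(2)
proof (induction I rule: infinite_finite_induct)
  case (insert i I)
  then show ?case using vf_plus[OF X, of "f i" "\<lambda>q. \<Sum>i\<in>I. f i q" p] smooth_funs_sum[of I f A] by simp
qed (simp_all add: vf_const[OF X])

lemma vf_local:
  fixes A :: "('m::t2_space, 'e::euclidean_space) atlas"
  assumes A: "smooth_atlas A" and X: "X \<in> vfields A" and f: "f \<in> smooth_funs A" "h \<in> smooth_funs A"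
    and W: "open W" "p \<in> W" "\<And>q. q \<in> W \<Longrightarrow> f q = h q"
  shows "X f p = X h p"
proof -
  obtain \<eta> where \<eta>: "\<eta> \<in> smooth_funs A" "\<eta> p = 1" "\<And>q. q \<notin> W \<Longrightarrow> \<eta> q = 0"
    using smooth_funs_bump[OF A W(1,2)] by blast
  let ?d = "\<lambda>q. f q - h q"
  have d: "?d \<in> smooth_funs A" using smooth_funs_diff f by blast
  \<comment> \<open>The product with the bump function vanishes identically, and the product rule at
    \<open>p\<close> isolates the value of \<open>X\<close> on the difference.\<close>
  have "(\<lambda>q. \<eta> q * ?d q) = (\<lambda>q. 0)" using \<eta>(3) W(3) by fastforce
  then have "0 = \<eta> p * X ?d p + ?d p * X \<eta> p"
    using vfieldsD(4)[OF X \<eta>(1) d, of p] vf_const[OF X, of 0 p] by simp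
  then show ?thesis using \<eta>(2) W vf_minus[OF X f] by simp
qed

text \<open>Hadamard's lemma writes \<open>f\<close> near \<open>p\<close> as a constant plus
  products of coordinates vanishing at \<open>p\<close> with smooth functions; the product rule
  leaves only the values of \<open>X\<close> on the coordinates, and these are the components of
  \<open>w\<close>.\<close>

lemma vf_local_representation:
  fixes A :: "('m::t2_space, 'e::euclidean_space) atlas"
  assumes A: "smooth_atlas A" and X: "X \<in> vfields A" and c: "(U, \<phi>) \<in> A" and p: "p \<in> U"
  obtains w where
    "\<And>f. f \<in> smooth_funs A \<Longrightarrow> X f p = frechet_derivative (\<lambda>x. f (inv_into U \<phi> x)) (at (\<phi> p)) w"
proof -
  note chart = smooth_atlas_chart[OF A c]
  have "\<exists>F W. F \<in> smooth_funs A \<and> open W \<and> p \<in> W \<and> W \<subseteq> U \<and> (\<forall>q\<in>W. F q = (\<phi> q - \<phi> p) \<bullet> b)" for b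
  proof -
    have "smooth_on UNIV (\<lambda>x. (x - \<phi> p) \<bullet> b)"
      by (intro smooth_on_inner_left smooth_on_diff smooth_on_ident smooth_on_const)
    from smooth_germ_extend[OF A c p open_UNIV UNIV_I this] show ?thesis by metis
  qed
  then obtain u Wu where u: "\<And>b. u b \<in> smooth_funs A" "\<And>b. open (Wu b)" "\<And>b. p \<in> Wu b" "\<And>b. Wu b \<subseteq> U"
    "\<And>b q. q \<in> Wu b \<Longrightarrow> u b q = (\<phi> q - \<phi> p) \<bullet> b"
    by metis
  define w where "w = (\<Sum>b\<in>Basis. X (u b) p *\<^sub>R b)"
  have "X f p = frechet_derivative (\<lambda>x. f (inv_into U \<phi> x)) (at (\<phi> p)) w" if f: "f \<in> smooth_funs A" for f
  proof -
    let ?f = "\<lambda>x. f (inv_into U \<phi> x)"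
    obtain r where r: "r > 0" "ball (\<phi> p) r \<subseteq> \<phi> ` U"
      using is_chartD(2)[OF chart] p by (meson image_eqI openE)
    have fs: "smooth_on (ball (\<phi> p) r) ?f" using smooth_on_subset[OF smooth_funsD[OF f c] r(2)] .
    obtain g where g: "\<And>b. smooth_on (ball (\<phi> p) r) (g b)"
      "\<And>x. x \<in> ball (\<phi> p) r \<Longrightarrow> ?f x = ?f (\<phi> p) + (\<Sum>b\<in>Basis. ((x - \<phi> p) \<bullet> b) * g b x)"
      "\<And>b. g b (\<phi> p) = frechet_derivative ?f (at (\<phi> p)) b"
      using hadamard[OF fs r(1)] by blast
    have "\<exists>F W. F \<in> smooth_funs A \<and> open W \<and> p \<in> W \<and> W \<subseteq> U \<and> (\<forall>q\<in>W. F q = g b (\<phi> q))" for b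
      using smooth_germ_extend[OF A c p open_ball _ g(1)[of b]] r(1) by (metis centre_in_ball)
    then obtain G Wg where G: "\<And>b. G b \<in> smooth_funs A" "\<And>b. open (Wg b)" "\<And>b. p \<in> Wg b" "\<And>b. Wg b \<subseteq> U"
      "\<And>b q. q \<in> Wg b \<Longrightarrow> G b q = g b (\<phi> q)"
      by metis
    define W where "W = {q \<in> U. \<phi> q \<in> ball (\<phi> p) r} \<inter> (\<Inter>b\<in>Basis. Wu b \<inter> Wg b)"
    have W: "open W" "p \<in> W"
      unfolding W_def using u(2,3) G(2,3) p r(1) is_chart_open_preimage[OF chart open_ball]
      by (auto intro!: open_Int open_INT simp del: mem_ball)
    let ?h = "\<lambda>q. f p + (\<Sum>b\<in>Basis. u b q * G b q)"
    have hs: "(\<lambda>q. \<Sum>b\<in>Basis. u b q * G b q) \<in> smooth_funs A"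
      by (intro smooth_funs_sum smooth_funs_mult u G)
    have "f q = ?h q" if "q \<in> W" for q
    proof -
      have "f q = ?f (\<phi> q)" using that is_chartD(5)[OF chart] by (simp add: W_def)
      also have "\<dots> = f p + (\<Sum>b\<in>Basis. ((\<phi> q - \<phi> p) \<bullet> b) * g b (\<phi> q))"
        using that g(2)[of "\<phi> q"] is_chartD(5)[OF chart p] by (simp add: W_def)
      also have "\<dots> = ?h q" using that u(5) G(5) by (simp add: W_def)
      finally show ?thesis .
    qed
    then have "X f p = X ?h p"
      using smooth_funs_add[OF smooth_funs_const hs] by (intro vf_local[OF A X f _ W]) auto
    also have "\<dots> = (\<Sum>b\<in>Basis. X (\<lambda>q. u b q * G b q) p)"
      using vf_plus[OF X smooth_funs_const hs] vf_const[OF X] vf_sum[OF X smooth_funs_mult[OF u(1) G(1)]] by simp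
    also have "\<dots> = (\<Sum>b\<in>Basis. X (u b) p * frechet_derivative ?f (at (\<phi> p)) b)"
      using vfieldsD(4)[OF X u(1) G(1)] u(3,5) G(3,5) g(3) by (simp add: mult.commute)
    also have "\<dots> = frechet_derivative ?f (at (\<phi> p)) w"
    proof -
      interpret L: linear "frechet_derivative ?f (at (\<phi> p))"
        using has_derivative_linear[OF smooth_on_has_derivative[OF fs, of "\<phi> p"]] r(1) by simp
      show ?thesis by (simp add: w_def L.sum L.scaleR)
    qed
    finally show ?thesis .
  qed
  then show thesis by (rule that)
qed

subsection \<open>Tensors are pointwise\<close>

lemma vfieldsI:
  assumes "\<And>f. f \<in> smooth_funs A \<Longrightarrow> X f \<in> smooth_funs A"
    "\<And>f. f \<notin> smooth_funs A \<Longrightarrow> X f = (\<lambda>p. 0)"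
    "\<And>f h a b p. f \<in> smooth_funs A \<Longrightarrow> h \<in> smooth_funs A \<Longrightarrow>
      X (\<lambda>q. a * f q + b * h q) p = a * X f p + b * X h p"
    "\<And>f h p. f \<in> smooth_funs A \<Longrightarrow> h \<in> smooth_funs A \<Longrightarrow> X (\<lambda>q. f q * h q) p = f p * X h p + h p * X f p"
  shows "X \<in> vfields A"
  using assms unfolding vfields_def by blast

lemma vf_add_vfields:
  assumes X: "X \<in> vfields A" and Y: "Y \<in> vfields A"
  shows "vf_add X Y \<in> vfields A"
  unfolding vf_add_def
proof (rule vfieldsI)
  fix f assume "f \<in> smooth_funs A"
  then show "(\<lambda>p. X f p + Y f p) \<in> smooth_funs A"
    using smooth_funs_add[OF vfieldsD(1)[OF X] vfieldsD(1)[OF Y]] by blast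
qed (simp_all add: vfieldsD(2,3,4)[OF X] vfieldsD(2,3,4)[OF Y] algebra_simps)

lemma vf_scale_vfields:
  assumes h: "h \<in> smooth_funs A" and X: "X \<in> vfields A"
  shows "vf_scale h X \<in> vfields A"
  unfolding vf_scale_def
proof (rule vfieldsI)
  fix f assume "f \<in> smooth_funs A"
  then show "(\<lambda>p. h p * X f p) \<in> smooth_funs A"
    using smooth_funs_mult[OF h vfieldsD(1)[OF X]] by blast
qed (simp_all add: vfieldsD(2,3,4)[OF X] algebra_simps)

lemma bracket_vfields:
  assumes X: "X \<in> vfields A" and Y: "Y \<in> vfields A"
  shows "bracket X Y \<in> vfields A"
  unfolding bracket_def
proof (rule vfieldsI)
  fix f assume "f \<in> smooth_funs A"
  then show "(\<lambda>p. X (Y f) p - Y (X f) p) \<in> smooth_funs A"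
    by (intro smooth_funs_diff vfieldsD(1)[OF X] vfieldsD(1)[OF Y])
next
  fix f assume "f \<notin> smooth_funs A"
  then show "(\<lambda>p. X (Y f) p - Y (X f) p) = (\<lambda>p. 0)"
    using vfieldsD(2)[OF X] vfieldsD(2)[OF Y] vf_const[OF X] vf_const[OF Y] by auto
next
  fix f h a b p assume f: "f \<in> smooth_funs A" "h \<in> smooth_funs A"
  note XY = vfieldsD(1)[OF X f(1)] vfieldsD(1)[OF X f(2)] vfieldsD(1)[OF Y f(1)] vfieldsD(1)[OF Y f(2)]
  have "Y (\<lambda>q. a * f q + b * h q) = (\<lambda>q. a * Y f q + b * Y h q)"
    "X (\<lambda>q. a * f q + b * h q) = (\<lambda>q. a * X f q + b * X h q)"
    using vfieldsD(3)[OF X f] vfieldsD(3)[OF Y f] by auto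
  then show "X (Y (\<lambda>q. a * f q + b * h q)) p - Y (X (\<lambda>q. a * f q + b * h q)) p =
       a * (X (Y f) p - Y (X f) p) + b * (X (Y h) p - Y (X h) p)"
    using vfieldsD(3)[OF X XY(3,4), of a b p] vfieldsD(3)[OF Y XY(1,2), of a b p] by (simp add: algebra_simps)
next
  fix f h p assume f: "f \<in> smooth_funs A" "h \<in> smooth_funs A"
  note XY = vfieldsD(1)[OF X f(1)] vfieldsD(1)[OF X f(2)] vfieldsD(1)[OF Y f(1)] vfieldsD(1)[OF Y f(2)]
  have e: "Y (\<lambda>q. f q * h q) = (\<lambda>q. f q * Y h q + h q * Y f q)"
    "X (\<lambda>q. f q * h q) = (\<lambda>q. f q * X h q + h q * X f q)"
    using vfieldsD(4)[OF X f] vfieldsD(4)[OF Y f] by auto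
  show "X (Y (\<lambda>q. f q * h q)) p - Y (X (\<lambda>q. f q * h q)) p =
       f p * (X (Y h) p - Y (X h) p) + h p * (X (Y f) p - Y (X f) p)"
    unfolding e
    using vf_plus[OF X smooth_funs_mult[OF f(1) XY(4)] smooth_funs_mult[OF f(2) XY(3)], of p]
      vf_plus[OF Y smooth_funs_mult[OF f(1) XY(2)] smooth_funs_mult[OF f(2) XY(1)], of p]
      vfieldsD(4)[OF X f(1) XY(4), of p] vfieldsD(4)[OF X f(2) XY(3), of p]
      vfieldsD(4)[OF Y f(1) XY(2), of p] vfieldsD(4)[OF Y f(2) XY(1), of p]
    by (simp add: algebra_simps)
qed

lemma vf_zero_vfields: "(\<lambda>f p. 0) \<in> vfields A"
  by (rule vfieldsI) (auto intro: smooth_funs_const)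

definition vf_sum_fields :: "('i \<Rightarrow> 'm vf) \<Rightarrow> 'i set \<Rightarrow> 'm vf" where
  "vf_sum_fields X I = (\<lambda>f p. \<Sum>i\<in>I. X i f p)"

lemma vf_sum_fields_insert:
  "finite I \<Longrightarrow> i \<notin> I \<Longrightarrow> vf_sum_fields X (insert i I) = vf_add (X i) (vf_sum_fields X I)"
  by (simp add: vf_sum_fields_def vf_add_def)

lemma vf_sum_fields_vfields:
  "(\<And>i. i \<in> I \<Longrightarrow> X i \<in> vfields A) \<Longrightarrow> vf_sum_fields X I \<in> vfields A"
proof (induction I rule: infinite_finite_induct)
  case (insert i I)
  then show ?case by (simp add: vf_sum_fields_insert vf_add_vfields)
qed (simp_all add: vf_sum_fields_def vf_zero_vfields)

lemma vf_tuples_update: "Xs \<in> vf_tuples A k \<Longrightarrow> X \<in> vfields A \<Longrightarrow> Xs[i := X] \<in> vf_tuples A k"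
  unfolding vf_tuples_def using set_update_subset_insert[of Xs i X] by auto

lemma is_tensorD:
  assumes "is_tensor A k \<alpha>" "Xs \<in> vf_tuples A k" "i < k" "X \<in> vfields A"
  shows "Y \<in> vfields A \<Longrightarrow> \<alpha> (Xs[i := vf_add X Y]) p = \<alpha> (Xs[i := X]) p + \<alpha> (Xs[i := Y]) p"
    "h \<in> smooth_funs A \<Longrightarrow> \<alpha> (Xs[i := vf_scale h X]) p = h p * \<alpha> (Xs[i := X]) p"
proof -
  have u: "Xs[i := X] \<in> vf_tuples A k" using vf_tuples_update assms by blast
  have i: "Xs[i := X] ! i = X" using assms unfolding vf_tuples_def by simp
  show "Y \<in> vfields A \<Longrightarrow> \<alpha> (Xs[i := vf_add X Y]) p = \<alpha> (Xs[i := X]) p + \<alpha> (Xs[i := Y]) p"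
    "h \<in> smooth_funs A \<Longrightarrow> \<alpha> (Xs[i := vf_scale h X]) p = h p * \<alpha> (Xs[i := X]) p"
    using assms(1,3) u i unfolding is_tensor_def by (metis list_update_overwrite)+
qed

lemma is_tensor_zero:
  fixes A :: "('m, 'e::euclidean_space) atlas"
  assumes "is_tensor A k \<alpha>" "Xs \<in> vf_tuples A k" "i < k"
  shows "\<alpha> (Xs[i := (\<lambda>f p. 0)]) p = 0"
proof -
  have "vf_scale (\<lambda>p. 0) (\<lambda>f p. 0) = ((\<lambda>f p. 0) :: 'm vf)" by (simp add: vf_scale_def)
  then show ?thesis
    using is_tensorD(2)[OF assms vf_zero_vfields smooth_funs_const[of 0], of p] by simp
qed

lemma is_tensor_sum:
  assumes "is_tensor A k \<alpha>" "Xs \<in> vf_tuples A k" "i < k"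
    "\<And>j. j \<in> I \<Longrightarrow> X j \<in> vfields A"
  shows "\<alpha> (Xs[i := vf_sum_fields X I]) p = (\<Sum>j\<in>I. \<alpha> (Xs[i := X j]) p)"
  using assms(4)
proof (induction I rule: infinite_finite_induct)
  case (insert j I)
  then show ?case
    using is_tensorD(1)[OF assms(1-3), of "X j" "vf_sum_fields X I" p] vf_sum_fields_vfields[of I X A]
    by (simp add: vf_sum_fields_insert)
qed (simp_all add: vf_sum_fields_def is_tensor_zero[OF assms(1-3)])

text \<open>A bump function reduces to a chart: the cut-off field is a combination of cut-off
  coordinate fields \<open>D b\<close> whose coefficients \<open>Z (u b)\<close> are global smooth
  functions vanishing at \<open>p\<close>. Linearity over functions then finishes.\<close>

lemma is_tensor_vanishing_field:
  fixes A :: "('m::t2_space, 'e::euclidean_space) atlas"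
  assumes A: "smooth_atlas A" and \<alpha>: "is_tensor A k \<alpha>" and Xs: "Xs \<in> vf_tuples A k" and i: "i < k"
    and Z: "Z \<in> vfields A" "\<And>f. f \<in> smooth_funs A \<Longrightarrow> Z f p = 0"
  shows "\<alpha> (Xs[i := Z]) p = 0"
proof -
  obtain U \<phi> where c: "(U, \<phi>) \<in> A" and p: "p \<in> U" using smooth_atlas_cover[OF A] .
  note chart = smooth_atlas_chart[OF A c]
  obtain R where R: "R > 0" "ball (\<phi> p) R \<subseteq> \<phi> ` U"
    using is_chartD(2)[OF chart] p by (meson image_eqI openE)
  \<comment> \<open>The radii are nested: \<open>\<beta>\<close> is supported in the ball of radius
    \<open>r\<close>, where \<open>\<beta>1\<close> is 1 and the \<open>u b\<close> are true
    coordinates, while \<open>\<beta>1\<close> is supported within \<open>2 * r\<close>. The balls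
    of radius \<open>2 * r\<close> and \<open>4 * r\<close> leave room for extension by
    zero.\<close>
  define r where "r = R / 4"
  have r: "r > 0" "ball (\<phi> p) (4 * r) \<subseteq> \<phi> ` U" using R by (auto simp: r_def)
  obtain \<beta>1 :: "'e \<Rightarrow> real" where \<beta>1: "smooth_on UNIV \<beta>1" "\<And>x. x \<in> ball (\<phi> p) (2 * r / 2) \<Longrightarrow> \<beta>1 x = 1"
    "\<And>x. x \<notin> ball (\<phi> p) (2 * r) \<Longrightarrow> \<beta>1 x = 0"
    using smooth_bump[of "2 * r" "\<phi> p"] r(1) by (metis mult_pos_pos zero_less_numeral)
  obtain \<beta> :: "'e \<Rightarrow> real" where \<beta>: "smooth_on UNIV \<beta>" "\<And>x. x \<in> ball (\<phi> p) (r / 2) \<Longrightarrow> \<beta> x = 1"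
    "\<And>x. x \<notin> ball (\<phi> p) r \<Longrightarrow> \<beta> x = 0"
    using smooth_bump[of r "\<phi> p"] r(1) by blast
  define B where "B q = (if q \<in> U \<and> \<phi> q \<in> ball (\<phi> p) (2 * r) then \<beta> (\<phi> q) else 0)" for q
  have sub2: "ball (\<phi> p) (2 * r) \<subseteq> \<phi> ` U" using r by (auto intro: subset_trans[OF subset_ball])
  have B: "B \<in> smooth_funs A" unfolding B_def
  proof (rule smooth_funs_extend[OF A c sub2, where s = r and h = \<beta>])
    show "smooth_on (ball (\<phi> p) (2 * r)) \<beta>" using smooth_on_subset[OF \<beta>(1)] by simp
  qed (use r \<beta>(3) in auto)
  define u where "u b q = (if q \<in> U \<and> \<phi> q \<in> ball (\<phi> p) (4 * r) then \<beta>1 (\<phi> q) * (\<phi> q \<bullet> b) else 0)" for b q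
  have u: "u b \<in> smooth_funs A" for b unfolding u_def
  proof (rule smooth_funs_extend[OF A c r(2), where s = "2 * r" and h = "\<lambda>x. \<beta>1 x * (x \<bullet> b)"])
    show "smooth_on (ball (\<phi> p) (4 * r)) (\<lambda>x. \<beta>1 x * (x \<bullet> b))"
      by (intro smooth_on_mult smooth_on_inner_left smooth_on_ident smooth_on_subset[OF \<beta>1(1)]) simp
  qed (use r \<beta>1(3) in auto)
  define D where "D b f = (if f \<in> smooth_funs A then
      (\<lambda>q. if q \<in> U \<and> \<phi> q \<in> ball (\<phi> p) (2 * r)
        then \<beta> (\<phi> q) * frechet_derivative (\<lambda>x. f (inv_into U \<phi> x)) (at (\<phi> q)) b else 0)
      else (\<lambda>q. 0))" for b f
  have hd: "((\<lambda>x. f (inv_into U \<phi> x)) has_derivative frechet_derivative (\<lambda>x. f (inv_into U \<phi> x)) (at (\<phi> q))) (at (\<phi> q))"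
    if "f \<in> smooth_funs A" "q \<in> U" for f q
    using smooth_on_has_derivative[OF smooth_funsD[OF that(1) c]] that(2) by simp
  have D: "D b \<in> vfields A" for b
  proof (rule vfieldsI)
    fix f assume f: "f \<in> smooth_funs A"
    have "(\<lambda>q. if q \<in> U \<and> \<phi> q \<in> ball (\<phi> p) (2 * r)
        then \<beta> (\<phi> q) * frechet_derivative (\<lambda>x. f (inv_into U \<phi> x)) (at (\<phi> q)) b else 0) \<in> smooth_funs A"
    proof (rule smooth_funs_extend[OF A c sub2, where s = r and
          h = "\<lambda>y. \<beta> y * frechet_derivative (\<lambda>x. f (inv_into U \<phi> x)) (at y) b"])
      show "smooth_on (ball (\<phi> p) (2 * r)) (\<lambda>y. \<beta> y * frechet_derivative (\<lambda>x. f (inv_into U \<phi> x)) (at y) b)"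
        by (intro smooth_on_mult smooth_on_derivative open_ball smooth_on_subset[OF smooth_funsD[OF f c] sub2]
            smooth_on_subset[OF \<beta>(1)]) simp
    qed (use r \<beta>(3) in auto)
    then show "D b f \<in> smooth_funs A" using f by (simp add: D_def)
  next
    fix f assume "f \<notin> smooth_funs A" then show "D b f = (\<lambda>p. 0)" by (simp add: D_def)
  next
    fix f h a e q assume f: "f \<in> smooth_funs A" "h \<in> smooth_funs A"
    have s: "(\<lambda>q. a * f q + e * h q) \<in> smooth_funs A"
      by (intro smooth_funs_add smooth_funs_mult smooth_funs_const f)
    have "frechet_derivative (\<lambda>x. a * f (inv_into U \<phi> x) + e * h (inv_into U \<phi> x)) (at (\<phi> q)) =
      (\<lambda>v. a * frechet_derivative (\<lambda>x. f (inv_into U \<phi> x)) (at (\<phi> q)) v +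
           e * frechet_derivative (\<lambda>x. h (inv_into U \<phi> x)) (at (\<phi> q)) v)" if "q \<in> U"
      by (rule frechet_derivative_at[symmetric])
         (intro has_derivative_add has_derivative_mult_right hd f that)
    then show "D b (\<lambda>q. a * f q + e * h q) q = a * D b f q + e * D b h q"
      using f s by (simp add: D_def algebra_simps)
  next
    fix f h q assume f: "f \<in> smooth_funs A" "h \<in> smooth_funs A"
    have s: "(\<lambda>q. f q * h q) \<in> smooth_funs A" by (intro smooth_funs_mult f)
    have "frechet_derivative (\<lambda>x. f (inv_into U \<phi> x) * h (inv_into U \<phi> x)) (at (\<phi> q)) =
      (\<lambda>v. f (inv_into U \<phi> (\<phi> q)) * frechet_derivative (\<lambda>x. h (inv_into U \<phi> x)) (at (\<phi> q)) v +
           frechet_derivative (\<lambda>x. f (inv_into U \<phi> x)) (at (\<phi> q)) v * h (inv_into U \<phi> (\<phi> q)))" if "q \<in> U"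
      by (rule frechet_derivative_at[symmetric])
         (intro has_derivative_mult hd f that)
    then show "D b (\<lambda>q. f q * h q) q = f q * D b h q + h q * D b f q"
      using f s is_chartD(5)[OF chart] by (simp add: D_def algebra_simps)
  qed
  let ?S = "vf_sum_fields (\<lambda>b. vf_scale (Z (u b)) (D b)) Basis"
  have eq: "vf_scale B Z = ?S"
  proof (intro ext)
    fix f q
    show "vf_scale B Z f q = ?S f q"
    proof (cases "f \<in> smooth_funs A \<and> q \<in> U \<and> \<phi> q \<in> ball (\<phi> p) r")
      case True
      then have f: "f \<in> smooth_funs A" and q: "q \<in> U" "\<phi> q \<in> ball (\<phi> p) r" by auto
      obtain w where w: "\<And>f. f \<in> smooth_funs A \<Longrightarrow> Z f q = frechet_derivative (\<lambda>x. f (inv_into U \<phi> x)) (at (\<phi> q)) w"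
        using vf_local_representation[OF A Z(1) c q(1)] by blast
      have "Z (u b) q = w \<bullet> b" for b
      proof -
        have "((\<lambda>x. x \<bullet> b) has_derivative (\<lambda>v. v \<bullet> b)) (at (\<phi> q))"
          by (intro has_derivative_inner_left has_derivative_ident)
        then have "((\<lambda>x. u b (inv_into U \<phi> x)) has_derivative (\<lambda>v. v \<bullet> b)) (at (\<phi> q))"
        proof (rule has_derivative_transform_within_open[OF _ open_ball q(2)])
          fix x assume x: "x \<in> ball (\<phi> p) r"
          then have xU: "x \<in> \<phi> ` U" using r by auto
          show "x \<bullet> b = u b (inv_into U \<phi> x)"
            using x \<beta>1(2)[of x] is_chartD(6,7)[OF chart xU] r(1) by (simp add: u_def)
        qed
        then show ?thesis using w[OF u, of b] frechet_derivative_at by metis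
      qed
      moreover interpret L: linear "frechet_derivative (\<lambda>x. f (inv_into U \<phi> x)) (at (\<phi> q))"
        using has_derivative_linear[OF hd[OF f q(1)]] .
      have "Z f q = frechet_derivative (\<lambda>x. f (inv_into U \<phi> x)) (at (\<phi> q)) (\<Sum>b\<in>Basis. (w \<bullet> b) *\<^sub>R b)"
        using w[OF f] by (simp add: euclidean_representation)
      then have "Z f q = (\<Sum>b\<in>Basis. (w \<bullet> b) * frechet_derivative (\<lambda>x. f (inv_into U \<phi> x)) (at (\<phi> q)) b)"
        by (simp add: L.sum L.scaleR)
      moreover have "\<phi> q \<in> ball (\<phi> p) (2 * r)" using q r by auto
      ultimately show ?thesis
        using f q by (simp add: vf_scale_def vf_sum_fields_def D_def B_def sum_distrib_left mult_ac)
    next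
      case False
      then consider "f \<notin> smooth_funs A" | "f \<in> smooth_funs A" "\<not> (q \<in> U \<and> \<phi> q \<in> ball (\<phi> p) r)" by blast
      then show ?thesis
      proof cases
        case 1
        then show ?thesis using vfieldsD(2)[OF Z(1)] by (simp add: vf_scale_def vf_sum_fields_def D_def)
      next
        case 2
        then have "B q = 0" "D b f q = 0" for b using \<beta>(3)[of "\<phi> q"] by (auto simp: B_def D_def)
        then show ?thesis by (simp add: vf_scale_def vf_sum_fields_def)
      qed
    qed
  qed
  have "B p = 1" using p r(1) \<beta>(2)[of "\<phi> p"] by (simp add: B_def)
  then have "\<alpha> (Xs[i := Z]) p = \<alpha> (Xs[i := vf_scale B Z]) p"
    using is_tensorD(2)[OF \<alpha> Xs i Z(1) B, of p] by simp
  also have "\<dots> = (\<Sum>b\<in>Basis. \<alpha> (Xs[i := vf_scale (Z (u b)) (D b)]) p)"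
    unfolding eq by (intro is_tensor_sum[OF \<alpha> Xs i] vf_scale_vfields D vfieldsD(1)[OF Z(1)] u)
  also have "\<dots> = (\<Sum>b\<in>Basis. Z (u b) p * \<alpha> (Xs[i := D b]) p)"
    using is_tensorD(2)[OF \<alpha> Xs i D vfieldsD(1)[OF Z(1) u]] by simp
  also have "\<dots> = 0" using Z(2)[OF u] by simp
  finally show ?thesis .
qed

lemma is_tensor_pointwise:
  fixes A :: "('m::t2_space, 'e::euclidean_space) atlas"
  assumes A: "smooth_atlas A" and \<alpha>: "is_tensor A k \<alpha>" and Xs: "Xs \<in> vf_tuples A k" and i: "i < k"
    and X: "X \<in> vfields A" and Y: "Y \<in> vfields A"
    and eq: "\<And>f. f \<in> smooth_funs A \<Longrightarrow> X f p = Y f p"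
  shows "\<alpha> (Xs[i := X]) p = \<alpha> (Xs[i := Y]) p"
proof -
  let ?Z = "vf_add X (vf_scale (\<lambda>p. -1) Y)"
  have mY: "vf_scale (\<lambda>p. -1) Y \<in> vfields A" by (intro vf_scale_vfields smooth_funs_const Y)
  have "\<alpha> (Xs[i := ?Z]) p = 0"
    by (rule is_tensor_vanishing_field[OF A \<alpha> Xs i vf_add_vfields[OF X mY]])
       (simp add: vf_add_def vf_scale_def eq)
  then show ?thesis
    using is_tensorD(1)[OF \<alpha> Xs i X mY, of p] is_tensorD(2)[OF \<alpha> Xs i Y smooth_funs_const[of "-1"], of p] by simp
qed

section \<open>The Lie algebra of the group, realised on the model space \<open>'e\<close>\<close>

section \<open>Left-invariant vector fields\<close>

lemma smooth_on_Pair: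
  fixes f :: "'a::real_normed_vector \<Rightarrow> 'b::euclidean_space" and g :: "'a \<Rightarrow> 'c::euclidean_space"
  assumes "smooth_on S f" "smooth_on S g"
  shows "smooth_on S (\<lambda>x. (f x, g x))"
proof (rule smooth_on_componentwise)
  fix b :: "'b \<times> 'c"
  show "smooth_on S (\<lambda>x. (f x, g x) \<bullet> b)"
    using smooth_on_add[OF smooth_on_inner_left[OF assms(1), of "fst b"] smooth_on_inner_left[OF assms(2), of "snd b"]]
    by (simp add: inner_prod_def)
qed

lemma frechet_derivative_snd:
  fixes F :: "'a::euclidean_space \<times> 'b::euclidean_space \<Rightarrow> 'c::real_normed_vector"
  assumes "smooth_on Q F" "(x, y) \<in> Q"
  shows "((\<lambda>y. F (x, y)) has_derivative (\<lambda>v. frechet_derivative F (at (x, y)) (0, v))) (at y)"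
    and "frechet_derivative (\<lambda>y. F (x, y)) (at y) v = frechet_derivative F (at (x, y)) (0, v)"
proof -
  have "((\<lambda>y. (x, y)) has_derivative (\<lambda>v. (0, v))) (at y)"
    by (intro has_derivative_Pair has_derivative_const has_derivative_ident)
  from has_derivative_compose[OF this smooth_on_has_derivative[OF assms]]
  show "((\<lambda>y. F (x, y)) has_derivative (\<lambda>v. frechet_derivative F (at (x, y)) (0, v))) (at y)" .
  then show "frechet_derivative (\<lambda>y. F (x, y)) (at y) v = frechet_derivative F (at (x, y)) (0, v)"
    using frechet_derivative_at by metis
qed

lemma smooth_on_frechet_derivative_snd:
  fixes F :: "'a::euclidean_space \<times> 'b::euclidean_space \<Rightarrow> 'c::real_normed_vector"
  assumes Q: "open Q" "smooth_on Q F" and S: "open S" "\<And>x. x \<in> S \<Longrightarrow> (x, y) \<in> Q"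
  shows "smooth_on S (\<lambda>x. frechet_derivative (\<lambda>y. F (x, y)) (at y) v)"
proof -
  have "smooth_on S (\<lambda>x. (x, y))"
    by (intro smooth_on_Pair smooth_on_ident smooth_on_const)
  then have "smooth_on S (\<lambda>x. frechet_derivative F (at (x, y)) (0, v))"
    by (intro smooth_on_compose[OF smooth_on_derivative[OF Q, of "(0, v)"]]) (use S in auto)
  then show ?thesis
    by (rule smooth_on_cong[OF S(1), rotated]) (simp add: frechet_derivative_snd(2)[OF Q(2) S(2)])
qed

lemma related_bracket:
  assumes "related A B F X X'" "related A B F Y Y'"
  shows "related A B F (bracket X Y) (bracket X' Y')"
proof -
  have X: "X \<in> vfields A" "X' \<in> vfields B" "\<And>f. f \<in> smooth_funs B \<Longrightarrow> X (f \<circ> F) = X' f \<circ> F"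
    and Y: "Y \<in> vfields A" "Y' \<in> vfields B" "\<And>f. f \<in> smooth_funs B \<Longrightarrow> Y (f \<circ> F) = Y' f \<circ> F"
    using assms unfolding related_def by auto
  have "bracket X Y (f \<circ> F) = bracket X' Y' f \<circ> F" if f: "f \<in> smooth_funs B" for f
  proof -
    have "bracket X Y (f \<circ> F) = (\<lambda>p. X (Y' f \<circ> F) p - Y (X' f \<circ> F) p)"
      by (simp only: bracket_def X(3)[OF f] Y(3)[OF f])
    also have "\<dots> = bracket X' Y' f \<circ> F"
      unfolding bracket_def X(3)[OF vfieldsD(1)[OF Y(2) f]] Y(3)[OF vfieldsD(1)[OF X(2) f]] by (simp add: o_def)
    finally show ?thesis .
  qed
  then show ?thesis
    unfolding related_def using bracket_vfields[OF X(1) Y(1)] bracket_vfields[OF X(2) Y(2)] by blast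
qed

locale charted_lie_group =
  fixes G :: "'g::{t2_space, second_countable_topology} monoid" (structure)
    and A :: "('g, 'e::euclidean_space) atlas" and U :: "'g set" and \<phi> :: "'g \<Rightarrow> 'e"
  assumes lie: "lie_group G A" and chart_in: "(U, \<phi>) \<in> A" and one_in: "\<one> \<in> U"
begin

lemma group_G: "group G" and carrier_G [simp]: "carrier G = UNIV" and atlas: "smooth_atlas A"
  and mult_smooth_map: "smooth_map_on (prod_atlas A A) A UNIV (\<lambda>(x, y). x \<otimes> y)"
  and inv_smooth_map: "smooth_map_on A A UNIV (\<lambda>x. inv x)"
  using lie unfolding lie_group_def by auto

sublocale group G by (rule group_G)

lemma chart: "is_chart U \<phi>" by (rule smooth_atlas_chart[OF atlas chart_in])

text \<open>\<open>dom\<close>, \<open>\<iota>\<close> and \<open>\<kappa>\<close> recentre the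
  chart so that the identity sits at 0; the model space \<open>'e\<close> then serves as the Lie
  algebra.\<close>

definition dom :: "'e set" where "dom = {y. \<phi> \<one> + y \<in> \<phi> ` U}"

definition \<iota> :: "'e \<Rightarrow> 'g" where "\<iota> y = inv_into U \<phi> (\<phi> \<one> + y)"

definition \<kappa> :: "'g \<Rightarrow> 'e" where "\<kappa> q = \<phi> q - \<phi> \<one>"

lemma open_dom: "open dom"
proof -
  have "dom = (\<lambda>y. \<phi> \<one> + y) -` (\<phi> ` U)" by (auto simp: dom_def)
  then show ?thesis using is_chartD(2)[OF chart] by (simp add: open_vimage continuous_on_add)
qed

lemma zero_in_dom: "0 \<in> dom" using one_in by (simp add: dom_def)

lemma \<iota>_zero [simp]: "\<iota> 0 = \<one>" using is_chartD(5)[OF chart one_in] by (simp add: \<iota>_def)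

lemma \<kappa>_one [simp]: "\<kappa> \<one> = 0" by (simp add: \<kappa>_def)

lemma \<iota>_in: "y \<in> dom \<Longrightarrow> \<iota> y \<in> U" using is_chartD(7)[OF chart] by (simp add: dom_def \<iota>_def)

lemma \<kappa>_\<iota>: "y \<in> dom \<Longrightarrow> \<kappa> (\<iota> y) = y" using is_chartD(6)[OF chart] by (simp add: dom_def \<iota>_def \<kappa>_def)

lemma \<iota>_\<kappa>: "q \<in> U \<Longrightarrow> \<iota> (\<kappa> q) = q" and \<kappa>_in: "q \<in> U \<Longrightarrow> \<kappa> q \<in> dom"
  using is_chartD(5)[OF chart] by (simp_all add: dom_def \<iota>_def \<kappa>_def)

lemma continuous_\<iota>: "continuous_on dom \<iota>"
proof -
  have "continuous_on dom (\<lambda>y. \<phi> \<one> + y)" by (intro continuous_intros)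
  from continuous_on_compose2[OF is_chartD(4)[OF chart] this] show ?thesis
    unfolding \<iota>_def[abs_def] by (auto simp: dom_def)
qed

lemma continuous_\<kappa>: "continuous_on U \<kappa>"
  unfolding \<kappa>_def[abs_def] by (intro continuous_intros is_chartD(3)[OF chart])

lemma continuous_mult: "continuous_on UNIV (\<lambda>(x, y). x \<otimes> y)"
  using mult_smooth_map unfolding smooth_map_on_def by simp

lemma smooth_mult_charts:
  assumes f: "f \<in> smooth_funs A" and V: "(V, \<psi>) \<in> A" and V': "(V', \<psi>') \<in> A"
  shows "smooth_on (\<psi> ` V \<times> \<psi>' ` V') (\<lambda>z. f (inv_into V \<psi> (fst z) \<otimes> inv_into V' \<psi>' (snd z)))"
proof -
  note c = smooth_atlas_chart[OF atlas V] and c' = smooth_atlas_chart[OF atlas V']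
  have "(V \<times> V', map_prod \<psi> \<psi>') \<in> prod_atlas A A" using V V' unfolding prod_atlas_def by blast
  from smooth_funs_compose[OF atlas f mult_smooth_map open_UNIV this is_chart_Times(1)[OF c c']]
  have *: "smooth_on (\<psi> ` V \<times> \<psi>' ` V')
      (\<lambda>z. f (case inv_into (V \<times> V') (map_prod \<psi> \<psi>') z of (x, y) \<Rightarrow> x \<otimes> y))"
    by (simp add: map_prod_surj_on[OF refl refl])
  have "open (\<psi> ` V \<times> \<psi>' ` V')" using is_chartD(2)[OF c] is_chartD(2)[OF c'] by (rule open_Times)
  then show ?thesis
    by (rule smooth_on_cong[OF _ _ *]) (auto simp: is_chart_Times(2)[OF c c'])
qed

lemma smooth_mult_\<iota>:
  assumes f: "f \<in> smooth_funs A" and V: "(V, \<psi>) \<in> A"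
  shows "smooth_on (\<psi> ` V \<times> dom) (\<lambda>z. f (inv_into V \<psi> (fst z) \<otimes> \<iota> (snd z)))"
proof -
  have "smooth_on (\<psi> ` V \<times> dom) (\<lambda>z. (fst z, \<phi> \<one> + snd z))"
    by (intro smooth_on_Pair smooth_on_add smooth_on_const smooth_on_bounded_linear
        bounded_linear_fst bounded_linear_snd)
  moreover have "(\<lambda>z. (fst z, \<phi> \<one> + snd z)) ` (\<psi> ` V \<times> dom) \<subseteq> \<psi> ` V \<times> \<phi> ` U"
    by (auto simp: dom_def)
  ultimately have "smooth_on (\<psi> ` V \<times> dom)
      (\<lambda>z. f (inv_into V \<psi> (fst (fst z, \<phi> \<one> + snd z)) \<otimes> inv_into U \<phi> (snd (fst z, \<phi> \<one> + snd z))))"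
    by (rule smooth_on_compose[OF smooth_mult_charts[OF f V chart_in]])
  then show ?thesis by (simp add: \<iota>_def)
qed

lemma smooth_funs_translate:
  assumes f: "f \<in> smooth_funs A"
  shows "(\<lambda>q. f (a \<otimes> q)) \<in> smooth_funs A"
proof (rule smooth_funsI)
  fix V \<psi> assume V: "(V, \<psi>) \<in> A"
  obtain V' \<psi>' where V': "(V', \<psi>') \<in> A" "a \<in> V'" using smooth_atlas_cover[OF atlas] .
  have "smooth_on (\<psi> ` V) (\<lambda>x. (\<psi>' a, x))"
    by (intro smooth_on_Pair smooth_on_ident smooth_on_const)
  from smooth_on_compose[OF smooth_mult_charts[OF f V'(1) V] this]
  show "smooth_on (\<psi> ` V) (\<lambda>x. f (a \<otimes> inv_into V \<psi> x))"
    using V'(2) is_chartD(5)[OF smooth_atlas_chart[OF atlas V'(1)]] by auto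
qed

text \<open>Differentiation along right multiplication by curves leaving the identity with velocity
  \<open>v\<close>; this commutes with left translations. The value 0 on non-smooth arguments is the
  extensionality that \<open>vfields\<close> demands.\<close>

definition lfield :: "'e \<Rightarrow> 'g vf" where
  "lfield v = (\<lambda>f p. if f \<in> smooth_funs A then frechet_derivative (\<lambda>y. f (p \<otimes> \<iota> y)) (at 0) v else 0)"

lemma lfield_has_derivative:
  assumes "f \<in> smooth_funs A"
  shows "((\<lambda>y. f (p \<otimes> \<iota> y)) has_derivative (\<lambda>v. lfield v f p)) (at 0)"
proof -
  obtain V \<psi> where V: "(V, \<psi>) \<in> A" "p \<in> V" using smooth_atlas_cover[OF atlas] .
  have "(\<psi> p, 0) \<in> \<psi> ` V \<times> dom" using V zero_in_dom by auto
  from frechet_derivative_snd(1)[OF smooth_mult_\<iota>[OF assms V(1)] this]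
  have "(\<lambda>y. f (p \<otimes> \<iota> y)) differentiable (at 0)"
    using is_chartD(5)[OF smooth_atlas_chart[OF atlas V(1)] V(2)] by (auto simp: differentiable_def)
  then show ?thesis using assms by (simp add: lfield_def frechet_derivative_works[symmetric] eta_contract_eq)
qed

lemma lfield_eqI:
  assumes "f \<in> smooth_funs A" "((\<lambda>y. f (p \<otimes> \<iota> y)) has_derivative D) (at 0)"
  shows "lfield v f p = D v"
  using has_derivative_unique[OF lfield_has_derivative[OF assms(1)] assms(2)] by metis

lemma lfield_vfields: "lfield v \<in> vfields A"
proof (rule vfieldsI)
  fix f assume f: "f \<in> smooth_funs A"
  show "lfield v f \<in> smooth_funs A"
  proof (rule smooth_funsI)
    fix V \<psi> assume V: "(V, \<psi>) \<in> A"
    note o = is_chartD(2)[OF smooth_atlas_chart[OF atlas V]]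
    from smooth_on_frechet_derivative_snd[OF open_Times[OF o open_dom] smooth_mult_\<iota>[OF f V] o, of 0 v]
    show "smooth_on (\<psi> ` V) (\<lambda>x. lfield v f (inv_into V \<psi> x))"
      using zero_in_dom f by (simp add: lfield_def)
  qed
next
  fix f assume "f \<notin> smooth_funs A" then show "lfield v f = (\<lambda>p. 0)" by (simp add: lfield_def)
next
  fix f h a b p assume f: "f \<in> smooth_funs A" "h \<in> smooth_funs A"
  show "lfield v (\<lambda>q. a * f q + b * h q) p = a * lfield v f p + b * lfield v h p"
    by (rule lfield_eqI)
       (intro smooth_funs_add smooth_funs_mult smooth_funs_const f has_derivative_add has_derivative_mult_right
          lfield_has_derivative)+
next
  fix f h p assume f: "f \<in> smooth_funs A" "h \<in> smooth_funs A"
  have "lfield v (\<lambda>q. f q * h q) p = f (p \<otimes> \<iota> 0) * lfield v h p + lfield v f p * h (p \<otimes> \<iota> 0)"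
    by (rule lfield_eqI[OF smooth_funs_mult[OF f] has_derivative_mult[OF lfield_has_derivative[OF f(1)] lfield_has_derivative[OF f(2)]]])
  then show "lfield v (\<lambda>q. f q * h q) p = f p * lfield v h p + h p * lfield v f p" by simp
qed

lemma lfield_translate:
  assumes "f \<in> smooth_funs A"
  shows "lfield v (\<lambda>q. f (a \<otimes> q)) p = lfield v f (a \<otimes> p)"
  using assms smooth_funs_translate[OF assms] by (simp add: lfield_def m_assoc)

lemma lfield_related: "related A A (\<lambda>x. a \<otimes> x) (lfield v) (lfield v)"
  unfolding related_def using lfield_vfields lfield_translate by (auto simp: o_def)

text \<open>At the identity a derivation is a directional derivative along some \<open>w\<close>,
  and left translations carry the equality with \<open>lfield w\<close> to every other
  point.\<close>

lemma left_invariant_is_lfield: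
  assumes X: "X \<in> vfields A" and inv: "\<And>a. related A A (\<lambda>x. a \<otimes> x) X X"
  obtains v where "X = lfield v"
proof -
  obtain w where w: "\<And>f. f \<in> smooth_funs A \<Longrightarrow> X f \<one> = frechet_derivative (\<lambda>x. f (inv_into U \<phi> x)) (at (\<phi> \<one>)) w"
    using vf_local_representation[OF atlas X chart_in one_in] by blast
  have one: "X f \<one> = lfield w f \<one>" if f: "f \<in> smooth_funs A" for f
  proof -
    have 1: "((\<lambda>x. f (inv_into U \<phi> x)) has_derivative frechet_derivative (\<lambda>x. f (inv_into U \<phi> x)) (at (\<phi> \<one>))) (at (\<phi> \<one> + 0))"
      using smooth_on_has_derivative[OF smooth_funsD[OF f chart_in], of "\<phi> \<one>"] one_in by simp
    have "((\<lambda>y. \<phi> \<one> + y) has_derivative (\<lambda>v. 0 + v)) (at 0)"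
      by (rule has_derivative_add[OF has_derivative_const has_derivative_ident])
    from has_derivative_compose[OF this 1]
    have "((\<lambda>y. f (inv_into U \<phi> (\<phi> \<one> + y))) has_derivative
        (\<lambda>v. frechet_derivative (\<lambda>x. f (inv_into U \<phi> x)) (at (\<phi> \<one>)) (0 + v))) (at 0)" .
    then have "((\<lambda>y. f (\<one> \<otimes> \<iota> y)) has_derivative
        (\<lambda>v. frechet_derivative (\<lambda>x. f (inv_into U \<phi> x)) (at (\<phi> \<one>)) v)) (at 0)"
      by (simp add: \<iota>_def)
    from lfield_eqI[OF f this] w[OF f] show ?thesis by simp
  qed
  have "X f a = lfield w f a" for f a
  proof (cases "f \<in> smooth_funs A")
    case True
    have "X f a = (X f \<circ> (\<lambda>x. a \<otimes> x)) \<one>" by simp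
    also have "\<dots> = X (f \<circ> (\<lambda>x. a \<otimes> x)) \<one>" using inv[of a] True unfolding related_def by metis
    also have "\<dots> = lfield w (\<lambda>x. f (a \<otimes> x)) \<one>" using one[OF smooth_funs_translate[OF True]] by (simp add: o_def)
    also have "\<dots> = lfield w f a" using lfield_translate[OF True] by simp
    finally show ?thesis .
  next
    case False
    then show ?thesis using vfieldsD(2)[OF X] by (simp add: lfield_def)
  qed
  then have "X = lfield w" by blast
  then show thesis by (rule that)
qed

lemma lfield_add: "lfield (v + w) = vf_add (lfield v) (lfield w)"
  and lfield_scale: "lfield (c *\<^sub>R v) = vf_scale (\<lambda>p. c) (lfield v)"
proof -
  have lin: "linear (\<lambda>v. lfield v f p)" if "f \<in> smooth_funs A" for f p
    using has_derivative_linear[OF lfield_has_derivative[OF that]] .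
  have "lfield (v + w) f p = lfield v f p + lfield w f p" "lfield (c *\<^sub>R v) f p = c * lfield v f p"
    if "f \<in> smooth_funs A" for f p
    using linear_add[OF lin[OF that]] linear_scale[OF lin[OF that]] by simp_all
  moreover have "lfield v f p = 0" if "f \<notin> smooth_funs A" for v f p
    using that by (simp add: lfield_def)
  ultimately have "lfield (v + w) f p = vf_add (lfield v) (lfield w) f p"
    "lfield (c *\<^sub>R v) f p = vf_scale (\<lambda>p. c) (lfield v) f p" for f p
    by (cases "f \<in> smooth_funs A"; simp add: vf_add_def vf_scale_def)+
  then show "lfield (v + w) = vf_add (lfield v) (lfield w)" "lfield (c *\<^sub>R v) = vf_scale (\<lambda>p. c) (lfield v)"
    by blast+
qed

lemma coordinate_function:
  obtains f W where "f \<in> smooth_funs A" "open W" "\<one> \<in> W" "W \<subseteq> U" "\<And>q. q \<in> W \<Longrightarrow> f q = \<kappa> q \<bullet> b"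
proof -
  have "smooth_on UNIV (\<lambda>x. (x - \<phi> \<one>) \<bullet> b)"
    by (intro smooth_on_inner_left smooth_on_diff smooth_on_ident smooth_on_const)
  from smooth_germ_extend[OF atlas chart_in one_in open_UNIV UNIV_I this] that
  show thesis unfolding \<kappa>_def by metis
qed

lemma open_\<iota>_preimage: "open W \<Longrightarrow> open {y \<in> dom. \<iota> y \<in> W}"
proof -
  assume "open W"
  then have "open (\<iota> -` W \<inter> dom)"
    using continuous_on_open_vimage[OF open_dom] continuous_\<iota> by blast
  then show ?thesis by (simp add: Int_def conj_commute vimage_def)
qed

lemma lfield_coordinate:
  assumes f: "f \<in> smooth_funs A" and W: "open W" "\<one> \<in> W" "W \<subseteq> U" "\<And>q. q \<in> W \<Longrightarrow> f q = \<kappa> q \<bullet> b"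
  shows "lfield v f \<one> = v \<bullet> b"
proof (rule lfield_eqI[OF f, of \<one> "\<lambda>v. v \<bullet> b" v])
  have "((\<lambda>y. y \<bullet> b) has_derivative (\<lambda>v. v \<bullet> b)) (at 0)"
    by (intro has_derivative_inner_left has_derivative_ident)
  then show "((\<lambda>y. f (\<one> \<otimes> \<iota> y)) has_derivative (\<lambda>v. v \<bullet> b)) (at 0)"
    by (rule has_derivative_transform_within_open[OF _ open_\<iota>_preimage[OF W(1)]])
       (use W zero_in_dom \<kappa>_\<iota> in auto)
qed

lemma lfield_inject: "lfield v = lfield w \<longleftrightarrow> v = w"
proof
  assume eq: "lfield v = lfield w"
  have "v \<bullet> b = w \<bullet> b" for b
  proof -
    obtain f W where fW: "f \<in> smooth_funs A" "open W" "\<one> \<in> W" "W \<subseteq> U" "\<And>q. q \<in> W \<Longrightarrow> f q = \<kappa> q \<bullet> b"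
      using coordinate_function[of b] by blast
    show ?thesis using lfield_coordinate[OF fW, of v] lfield_coordinate[OF fW, of w] eq by simp
  qed
  then show "v = w" by (rule euclidean_eqI)
qed simp

text \<open>The choice is legitimate because a bracket of left-invariant fields is left-invariant,
  and unambiguous because \<open>lfield\<close> is injective. Thus the Lie algebra laws are
  inherited from derivations.\<close>

definition br :: "'e \<Rightarrow> 'e \<Rightarrow> 'e" where "br v w = (SOME u. bracket (lfield v) (lfield w) = lfield u)"

lemma bracket_lfield: "bracket (lfield v) (lfield w) = lfield (br v w)"
proof -
  have "\<exists>u. bracket (lfield v) (lfield w) = lfield u"
    by (rule left_invariant_is_lfield[OF bracket_vfields[OF lfield_vfields lfield_vfields]
          related_bracket[OF lfield_related lfield_related], of v w]) blast
  then show ?thesis unfolding br_def by (rule someI_ex)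
qed

definition \<mu> :: "'e \<times> 'e \<Rightarrow> 'e" where "\<mu> z = \<kappa> (\<iota> (fst z) \<otimes> \<iota> (snd z))"

definition mdom :: "'g set \<Rightarrow> ('e \<times> 'e) set" where
  "mdom W = {z \<in> dom \<times> dom. \<iota> (fst z) \<otimes> \<iota> (snd z) \<in> W}"

lemma open_mdom: "open W \<Longrightarrow> open (mdom W)"
proof -
  assume W: "open W"
  have "continuous_on (dom \<times> dom) (\<lambda>z. (\<iota> (fst z), \<iota> (snd z)))"
    using continuous_on_compose2[OF continuous_\<iota> continuous_on_fst[OF continuous_on_id], of "dom \<times> dom"]
      continuous_on_compose2[OF continuous_\<iota> continuous_on_snd[OF continuous_on_id], of "dom \<times> dom"]
    by (intro continuous_on_Pair) auto
  from continuous_on_compose2[OF continuous_mult this]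
  have "continuous_on (dom \<times> dom) (\<lambda>z. \<iota> (fst z) \<otimes> \<iota> (snd z))" by simp
  then have "open ((\<lambda>z. \<iota> (fst z) \<otimes> \<iota> (snd z)) -` W \<inter> dom \<times> dom)"
    using continuous_on_open_vimage[OF open_Times[OF open_dom open_dom]] W by blast
  moreover have "mdom W = (\<lambda>z. \<iota> (fst z) \<otimes> \<iota> (snd z)) -` W \<inter> dom \<times> dom" by (auto simp: mdom_def)
  ultimately show ?thesis by simp
qed

lemma zero_in_mdom: "\<one> \<in> W \<Longrightarrow> (0, 0) \<in> mdom W" using zero_in_dom by (simp add: mdom_def)

lemma smooth_\<mu>: "smooth_on (mdom U) \<mu>"
proof -
  let ?m = "\<lambda>(x, y). x \<otimes> y"
  have "(U \<times> U, map_prod \<phi> \<phi>) \<in> prod_atlas A A" using chart_in unfolding prod_atlas_def by blast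
  then have sm: "smooth_on (map_prod \<phi> \<phi> ` (U \<times> U \<inter> UNIV \<inter> ?m -` U)) (\<phi> \<circ> ?m \<circ> inv_into (U \<times> U) (map_prod \<phi> \<phi>))"
    using mult_smooth_map chart_in unfolding smooth_map_on_def by blast
  have sh: "smooth_on (mdom U) (\<lambda>z. (\<phi> \<one>, \<phi> \<one>) + z)"
    by (intro smooth_on_add smooth_on_const smooth_on_ident)
  have im: "(\<lambda>z. (\<phi> \<one>, \<phi> \<one>) + z) ` mdom U \<subseteq> map_prod \<phi> \<phi> ` (U \<times> U \<inter> UNIV \<inter> ?m -` U)"
  proof
    fix z assume "z \<in> (\<lambda>z. (\<phi> \<one>, \<phi> \<one>) + z) ` mdom U"
    then obtain x y where xy: "(x, y) \<in> mdom U" "z = (\<phi> \<one> + x, \<phi> \<one> + y)" by auto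
    then have "z = map_prod \<phi> \<phi> (\<iota> x, \<iota> y)" using \<kappa>_\<iota>[of x] \<kappa>_\<iota>[of y] by (simp add: mdom_def \<kappa>_def algebra_simps)
    moreover have "(\<iota> x, \<iota> y) \<in> U \<times> U \<inter> UNIV \<inter> ?m -` U" using xy \<iota>_in by (simp add: mdom_def)
    ultimately show "z \<in> map_prod \<phi> \<phi> ` (U \<times> U \<inter> UNIV \<inter> ?m -` U)" by blast
  qed
  have "smooth_on (mdom U) (\<lambda>z. (\<phi> \<circ> ?m \<circ> inv_into (U \<times> U) (map_prod \<phi> \<phi>)) ((\<phi> \<one>, \<phi> \<one>) + z) - \<phi> \<one>)"
    by (intro smooth_on_diff smooth_on_const smooth_on_compose[OF sm sh im])
  then show ?thesis
    by (rule smooth_on_cong[OF open_mdom[OF is_chartD(1)[OF chart]], rotated])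
       (auto simp: mdom_def dom_def \<mu>_def \<kappa>_def \<iota>_def is_chart_Times(2)[OF chart chart])
qed

lemma \<mu>_zero: "x \<in> dom \<Longrightarrow> \<mu> (x, 0) = x" "y \<in> dom \<Longrightarrow> \<mu> (0, y) = y"
  by (simp_all add: \<mu>_def \<kappa>_\<iota>)

text \<open>The mixed second derivative of multiplication at the identity: the bilinear term in its
  expansion \<open>x + y + bl x y + ...\<close>.\<close>

definition bl :: "'e \<Rightarrow> 'e \<Rightarrow> 'e" where
  "bl v w = frechet_derivative (\<lambda>z. frechet_derivative \<mu> (at z) (0, w)) (at (0, 0)) (v, 0)"

text \<open>Near the identity, applying \<open>lfield w\<close> to a coordinate differentiates
  \<open>\<mu>\<close> in its second argument at 0; applying \<open>lfield v\<close> then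
  differentiates in the first.\<close>

lemma second_derivative_coordinate:
  assumes f: "f \<in> smooth_funs A" and W: "open W" "\<one> \<in> W" "W \<subseteq> U" "\<And>q. q \<in> W \<Longrightarrow> f q = \<kappa> q \<bullet> b"
  shows "lfield v (lfield w f) \<one> = bl v w \<bullet> b"
proof (rule lfield_eqI[OF vfieldsD(1)[OF lfield_vfields[of w] f], of \<one> "\<lambda>v. bl v w \<bullet> b" v])
  let ?B = "\<lambda>z. frechet_derivative \<mu> (at z) (0, w)"
  have oU: "open (mdom U)" by (rule open_mdom[OF is_chartD(1)[OF chart]])
  have sub: "mdom W \<subseteq> mdom U" using W(3) by (auto simp: mdom_def)
  have near: "lfield w f (\<iota> x) = ?B (x, 0) \<bullet> b" if x: "(x, 0) \<in> mdom W" for x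
  proof (rule lfield_eqI[OF f, of "\<iota> x" "\<lambda>w. frechet_derivative \<mu> (at (x, 0)) (0, w) \<bullet> b" w])
    have "((\<lambda>y. \<mu> (x, y) \<bullet> b) has_derivative (\<lambda>w. frechet_derivative \<mu> (at (x, 0)) (0, w) \<bullet> b)) (at 0)"
      using frechet_derivative_snd(1)[OF smooth_\<mu>] x sub by (intro has_derivative_inner_left) blast
    moreover have "open ((\<lambda>y. (x, y)) -` mdom W)"
      by (intro open_vimage open_mdom W(1) continuous_intros)
    ultimately show "((\<lambda>y. f (\<iota> x \<otimes> \<iota> y)) has_derivative (\<lambda>w. frechet_derivative \<mu> (at (x, 0)) (0, w) \<bullet> b)) (at 0)"
      by (rule has_derivative_transform_within_open) (use x W(4) in \<open>auto simp: mdom_def \<mu>_def\<close>)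
  qed
  have "(?B has_derivative frechet_derivative ?B (at (0, 0))) (at (0, 0))"
    by (rule smooth_on_has_derivative[OF smooth_on_derivative[OF oU smooth_\<mu>] zero_in_mdom[OF one_in]])
  moreover have "((\<lambda>x::'e. (x, 0::'e)) has_derivative (\<lambda>v. (v, 0))) (at 0)"
    by (intro has_derivative_Pair has_derivative_const has_derivative_ident)
  ultimately have "((\<lambda>x. ?B (x, 0)) has_derivative (\<lambda>v. frechet_derivative ?B (at (0, 0)) (v, 0))) (at 0)"
    by (rule has_derivative_compose[rotated])
  then have "((\<lambda>x. ?B (x, 0) \<bullet> b) has_derivative (\<lambda>v. bl v w \<bullet> b)) (at 0)"
    unfolding bl_def by (rule has_derivative_inner_left)
  moreover have "open ((\<lambda>x. (x, 0)) -` mdom W)"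
    by (intro open_vimage open_mdom W(1) continuous_intros)
  ultimately show "((\<lambda>y. lfield w f (\<one> \<otimes> \<iota> y)) has_derivative (\<lambda>v. bl v w \<bullet> b)) (at 0)"
    by (rule has_derivative_transform_within_open) (use near zero_in_mdom[OF W(2)] in auto)
qed

text \<open>Ties the bracket of derivations to group multiplication, so that it can be recognised
  inside group commutators.\<close>

lemma br_eq_bl: "br v w = bl v w - bl w v"
proof -
  have "br v w \<bullet> b = (bl v w - bl w v) \<bullet> b" for b
  proof -
    obtain f W where fW: "f \<in> smooth_funs A" "open W" "\<one> \<in> W" "W \<subseteq> U" "\<And>q. q \<in> W \<Longrightarrow> f q = \<kappa> q \<bullet> b"
      using coordinate_function[of b] by blast
    have "br v w \<bullet> b = bracket (lfield v) (lfield w) f \<one>"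
      using lfield_coordinate[OF fW] bracket_lfield by simp
    then show ?thesis
      using second_derivative_coordinate[OF fW] by (simp add: bracket_def inner_diff_left)
  qed
  then show ?thesis by (rule euclidean_eqI)
qed

lemma br_add_left: "br (v + v') w = br v w + br v' w"
  and br_scale_left: "br (c *\<^sub>R v) w = c *\<^sub>R br v w"
  and br_skew: "br v w = - br w v"
proof -
  show "br v w = - br w v" by (simp add: br_eq_bl)
  have "lfield (br (v + v') w) = lfield (br v w + br v' w)"
  proof -
    have "lfield w (\<lambda>p. lfield v f p + lfield v' f p) p = lfield w (lfield v f) p + lfield w (lfield v' f) p"
      if "f \<in> smooth_funs A" for f p
      by (intro vf_plus[OF lfield_vfields] vfieldsD(1)[OF lfield_vfields that])
    moreover have "lfield v f = (\<lambda>p. 0)" if "f \<notin> smooth_funs A" for v f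
      using that by (auto simp: lfield_def)
    ultimately have "bracket (vf_add (lfield v) (lfield v')) (lfield w) f p =
        vf_add (bracket (lfield v) (lfield w)) (bracket (lfield v') (lfield w)) f p" for f p
      by (cases "f \<in> smooth_funs A") (simp_all add: bracket_def vf_add_def vf_const[OF lfield_vfields])
    then show ?thesis unfolding bracket_lfield[symmetric] lfield_add by blast
  qed
  then show "br (v + v') w = br v w + br v' w" by (simp add: lfield_inject)
  have "lfield (br (c *\<^sub>R v) w) = lfield (c *\<^sub>R br v w)"
  proof -
    have "lfield w (\<lambda>p. c * lfield v f p) p = c * lfield w (lfield v f) p" if "f \<in> smooth_funs A" for f p
      using vfieldsD(3)[OF lfield_vfields[of w] vfieldsD(1)[OF lfield_vfields that, of v] smooth_funs_const, of c 0 0 p] by simp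
    moreover have "lfield v f = (\<lambda>p. 0)" if "f \<notin> smooth_funs A" for v f
      using that by (auto simp: lfield_def)
    ultimately have "bracket (vf_scale (\<lambda>p. c) (lfield v)) (lfield w) f p =
        vf_scale (\<lambda>p. c) (bracket (lfield v) (lfield w)) f p" for f p
      by (cases "f \<in> smooth_funs A")
         (simp_all add: bracket_def vf_scale_def vf_const[OF lfield_vfields] right_diff_distrib)
    then show ?thesis unfolding bracket_lfield[symmetric] lfield_scale by blast
  qed
  then show "br (c *\<^sub>R v) w = c *\<^sub>R br v w" by (simp add: lfield_inject)
qed

lemma br_jacobi: "br (br u v) w + br (br v w) u + br (br w u) v = 0"
proof -
  have "lfield (br (br u v) w + br (br v w) u + br (br w u) v) f p = lfield 0 f p" for f p
  proof (cases "f \<in> smooth_funs A")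
    case True
    have X: "lfield a (\<lambda>p. lfield b (lfield c f) p - lfield c (lfield b f) p) p =
        lfield a (lfield b (lfield c f)) p - lfield a (lfield c (lfield b f)) p" for a b c p
      by (intro vf_minus[OF lfield_vfields] vfieldsD(1)[OF lfield_vfields] True)
    have "lfield 0 f p = 0" using lfield_scale[of 0 0] by (simp add: vf_scale_def)
    then show ?thesis
      unfolding lfield_add bracket_lfield[symmetric] vf_add_def bracket_def by (simp add: X)
  qed (simp add: lfield_def)
  then have "lfield (br (br u v) w + br (br v w) u + br (br w u) v) = lfield 0" by blast
  then show ?thesis by (simp add: lfield_inject)
qed

end

section \<open>Velocities of families in subgroups, with the bracket as the leading term of a
  commutator\<close>

section \<open>Solvability of the Lie algebra\<close>

context charted_lie_group
begin

lemma open_mdom_U: "open (mdom U)" by (rule open_mdom[OF is_chartD(1)[OF chart]])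

lemma origin_in_mdom: "(0, 0) \<in> mdom U" by (rule zero_in_mdom[OF one_in])

definition pd :: "'e \<Rightarrow> 'e \<times> 'e \<Rightarrow> 'e" where "pd w z = frechet_derivative \<mu> (at z) (0, w)"

lemma linear_pd: "z \<in> mdom U \<Longrightarrow> linear (\<lambda>w. pd w z)"
proof -
  assume z: "z \<in> mdom U"
  interpret L: linear "frechet_derivative \<mu> (at z)"
    using has_derivative_linear[OF smooth_on_has_derivative[OF smooth_\<mu> z]] .
  show ?thesis unfolding pd_def
    by (rule linearI) (use L.add[of "(0, _)" "(0, _)"] L.scaleR[of _ "(0, _)"] in auto)
qed

lemma smooth_pd: "smooth_on (mdom U) (pd w)"
  unfolding pd_def[abs_def] by (rule smooth_on_derivative[OF open_mdom_U smooth_\<mu>])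

lemma pd_zero: "y \<in> dom \<Longrightarrow> pd w (0, y) = w"
proof -
  assume y: "y \<in> dom"
  then have m: "(0, y) \<in> mdom U" using zero_in_dom \<iota>_in by (simp add: mdom_def)
  have "((\<lambda>y. y) has_derivative (\<lambda>w. w)) (at y)" by (rule has_derivative_ident)
  then have "((\<lambda>y. \<mu> (0, y)) has_derivative (\<lambda>w. w)) (at y)"
    by (rule has_derivative_transform_within_open[OF _ open_dom y]) (simp add: \<mu>_zero)
  then show ?thesis
    using frechet_derivative_snd(1)[OF smooth_\<mu> m] has_derivative_unique unfolding pd_def by metis
qed

lemma bl_eq: "bl v w = frechet_derivative (pd w) (at (0, 0)) (v, 0)"
  by (simp add: bl_def pd_def[abs_def])

text \<open>Multiplication by the identity is exact, so \<open>pd w\<close> is constant along the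
  second axis and only the first component of the increment contributes.\<close>

lemma pd_has_derivative: "(pd w has_derivative (\<lambda>z. bl (fst z) w)) (at (0, 0))"
proof -
  have hd: "(pd w has_derivative frechet_derivative (pd w) (at (0, 0))) (at (0, 0))"
    by (rule smooth_on_has_derivative[OF smooth_pd origin_in_mdom])
  interpret L: linear "frechet_derivative (pd w) (at (0, 0))" using has_derivative_linear[OF hd] .
  have "((\<lambda>y. w) has_derivative (\<lambda>y. 0)) (at (0::'e))" by (rule has_derivative_const)
  then have "((\<lambda>y. pd w (0, y)) has_derivative (\<lambda>y. 0)) (at 0)"
    by (rule has_derivative_transform_within_open[OF _ open_dom zero_in_dom]) (simp add: pd_zero)
  then have z: "frechet_derivative (pd w) (at (0, 0)) (0, y) = 0" for y
    using frechet_derivative_snd(1)[OF smooth_pd origin_in_mdom] has_derivative_unique by metis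
  have "frechet_derivative (pd w) (at (0, 0)) z = bl (fst z) w" for z
    using L.add[of "(fst z, 0)" "(0, snd z)"] z[of "snd z"] by (simp add: bl_eq)
  then have "frechet_derivative (pd w) (at (0, 0)) = (\<lambda>z. bl (fst z) w)" by (rule ext)
  with hd show ?thesis by simp
qed

lemma bilinear_bl: "bilinear bl"
  unfolding bilinear_def
proof (intro conjI allI)
  fix v
  have pdl: "pd (a + b) z = pd a z + pd b z" "pd (c *\<^sub>R a) z = c *\<^sub>R pd a z" if "z \<in> mdom U" for a b c z
    using linear_add[OF linear_pd[OF that]] linear_scale[OF linear_pd[OF that]] by auto
  have a: "bl v (a + b) = bl v a + bl v b" for a b
  proof -
    have "(pd (a + b) has_derivative (\<lambda>z. bl (fst z) a + bl (fst z) b)) (at (0, 0))"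
      by (rule has_derivative_transform_within_open[OF has_derivative_add[OF pd_has_derivative pd_has_derivative] open_mdom_U origin_in_mdom])
         (simp add: pdl)
    from fun_cong[OF has_derivative_unique[OF pd_has_derivative this], of "(v, 0)"]
    show ?thesis by simp
  qed
  have "bl v (c *\<^sub>R a) = c *\<^sub>R bl v a" for a c
  proof -
    have "(pd (c *\<^sub>R a) has_derivative (\<lambda>z. c *\<^sub>R bl (fst z) a)) (at (0, 0))"
      by (rule has_derivative_transform_within_open[OF has_derivative_scaleR_right[OF pd_has_derivative] open_mdom_U origin_in_mdom])
         (simp add: pdl)
    from fun_cong[OF has_derivative_unique[OF pd_has_derivative this], of "(v, 0)"]
    show ?thesis by simp
  qed
  with a show "linear (bl v)" by (intro linearI)
next
  fix w
  interpret L: linear "frechet_derivative (pd w) (at (0, 0))"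
    using has_derivative_linear[OF smooth_on_has_derivative[OF smooth_pd origin_in_mdom]] .
  show "linear (\<lambda>v. bl v w)" unfolding bl_eq
    by (rule linearI) (use L.add[of "(_, 0)" "(_, 0)"] L.scaleR[of _ "(_, 0)"] in auto)
qed

text \<open>The mean value inequality in \<open>y\<close> alone. The error vanishes at
  \<open>y = 0\<close>, since the identity is neutral, which gives the factor \<open>norm y\<close>.
  It is applied with \<open>L = 0\<close> for first order and with \<open>L = bl x\<close> for
  second order.\<close>

lemma \<mu>_remainder:
  assumes "linear L" "(x, 0) \<in> mdom U" "0 \<le> c"
    and seg: "\<And>y'. norm y' \<le> norm y \<Longrightarrow> (x, y') \<in> mdom U \<and> (\<Sum>i\<in>Basis. norm (pd i (x, y') - i - L i)) \<le> c"
  shows "norm (\<mu> (x, y) - x - y - L y) \<le> c * norm y"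
proof -
  let ?f = "\<lambda>y. \<mu> (x, y) - x - y - L y"
  interpret L: linear L by fact
  have b: "norm (?f y - ?f 0) \<le> c * norm (y - 0)"
  proof (rule differentiable_bound[where S = "cball 0 (norm y)" and f' = "\<lambda>y' w. pd w (x, y') - 0 - w - L w"])
    show "convex (cball (0::'e) (norm y))" by simp
    show "y \<in> cball 0 (norm y)" "0 \<in> cball 0 (norm y)" by simp_all
    fix y' :: 'e assume "y' \<in> cball 0 (norm y)"
    then have y': "norm y' \<le> norm y" by simp
    note m = seg[OF y']
    have "((\<lambda>y. \<mu> (x, y)) has_derivative (\<lambda>w. pd w (x, y'))) (at y' within cball 0 (norm y))"
      using frechet_derivative_snd(1)[OF smooth_\<mu>] m unfolding pd_def by (blast intro: has_derivative_at_withinI)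
    then show "(?f has_derivative (\<lambda>w. pd w (x, y') - 0 - w - L w)) (at y' within cball 0 (norm y))"
      by (intro has_derivative_diff has_derivative_const has_derivative_ident
          bounded_linear_imp_has_derivative linear_conv_bounded_linear[THEN iffD1] assms(1))
    interpret P: linear "\<lambda>w. pd w (x, y')" using linear_pd m by blast
    show "onorm (\<lambda>w. pd w (x, y') - 0 - w - L w) \<le> c"
    proof (rule onorm_bound[OF assms(3)])
      fix w
      have "pd w (x, y') - 0 - w - L w = pd (\<Sum>i\<in>Basis. (w \<bullet> i) *\<^sub>R i) (x, y') -
          (\<Sum>i\<in>Basis. (w \<bullet> i) *\<^sub>R i) - L (\<Sum>i\<in>Basis. (w \<bullet> i) *\<^sub>R i)"
        by (simp only: euclidean_representation diff_zero)
      also have "\<dots> = (\<Sum>i\<in>Basis. (w \<bullet> i) *\<^sub>R (pd i (x, y') - i - L i))"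
        by (simp only: P.sum P.scaleR L.sum L.scaleR scaleR_diff_right sum_subtractf)
      also have "norm \<dots> \<le> (\<Sum>i\<in>Basis. norm w * norm (pd i (x, y') - i - L i))"
        by (rule sum_norm_le) (simp add: mult_right_mono Basis_le_norm)
      also have "\<dots> \<le> c * norm w"
        using mult_left_mono[OF conjunct2[OF m], of "norm w"] by (simp add: sum_distrib_left mult.commute)
      finally show "norm (pd w (x, y') - 0 - w - L w) \<le> c * norm w" .
    qed
  qed
  have "?f 0 = 0"
    using assms(2) by (simp add: mdom_def \<mu>_zero L.zero)
  with b show ?thesis by (simp only: diff_zero)
qed

lemma \<mu>_first_order:
  assumes "0 < \<epsilon>"
  obtains \<delta> where "0 < \<delta>" "\<And>x y. norm x < \<delta> \<Longrightarrow> norm y < \<delta> \<Longrightarrow> (x, y) \<in> mdom U"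
    "\<And>x y. norm x < \<delta> \<Longrightarrow> norm y < \<delta> \<Longrightarrow> norm (\<mu> (x, y) - x - y) \<le> \<epsilon> * norm y"
proof -
  let ?h = "\<lambda>z. \<Sum>i\<in>Basis. norm (pd i z - i)"
  have "continuous_on (mdom U) ?h"
    by (intro continuous_intros smooth_on_continuous[OF smooth_pd])
  then have "isCont ?h (0, 0)"
    using open_mdom_U origin_in_mdom continuous_on_eq_continuous_at by blast
  then have "(?h \<longlongrightarrow> ?h (0, 0)) (nhds (0, 0))"
    using tendsto_at_iff_tendsto_nhds[of ?h "(0, 0)"] by (simp only: isCont_def)
  moreover have "?h (0, 0) = 0" using pd_zero[OF zero_in_dom] by simp
  ultimately have "(?h \<longlongrightarrow> 0) (nhds (0, 0))" by (simp only:)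
  then have "\<forall>\<^sub>F z in nhds (0, 0). ?h z < \<epsilon>" using assms by (rule order_tendstoD)
  moreover have "\<forall>\<^sub>F z in nhds (0, 0). z \<in> mdom U"
    using open_mdom_U origin_in_mdom by (rule eventually_nhds_in_open)
  ultimately have "\<forall>\<^sub>F z in nhds (0, 0). z \<in> mdom U \<and> ?h z < \<epsilon>" by eventually_elim simp
  then obtain d where d: "d > 0" "\<And>z. dist z (0, 0) < d \<Longrightarrow> z \<in> mdom U \<and> ?h z < \<epsilon>"
    unfolding eventually_nhds_metric by blast
  have key: "(x, y) \<in> mdom U \<and> ?h (x, y) < \<epsilon>" if "norm x < d / 2" "norm y < d / 2" for x y :: 'e
  proof (rule d(2))
    have "norm (x, y) \<le> norm x + norm y" by (rule norm_Pair_le)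
    then show "dist (x, y) (0, 0) < d" using that by (simp add: dist_norm)
  qed
  show thesis
  proof (rule that[of "d / 2"])
    fix x y :: 'e assume xy: "norm x < d / 2" "norm y < d / 2"
    show "(x, y) \<in> mdom U" using key[OF xy] by blast
    have "norm (\<mu> (x, y) - x - y - 0) \<le> \<epsilon> * norm y"
    proof (rule \<mu>_remainder[of "\<lambda>_. 0"])
      show "linear (\<lambda>_::'e. 0::'e)" by (rule linear_zero)
      show "(x, 0) \<in> mdom U" using key[OF xy(1), of 0] d(1) by simp
      fix y' :: 'e assume "norm y' \<le> norm y"
      then have "norm y' < d / 2" using xy by linarith
      from key[OF xy(1) this] show "(x, y') \<in> mdom U \<and> (\<Sum>i\<in>Basis. norm (pd i (x, y') - i - 0)) \<le> \<epsilon>"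
        by simp
    qed (use assms in simp)
    then show "norm (\<mu> (x, y) - x - y) \<le> \<epsilon> * norm y" by simp
  qed (use d in simp)
qed

text \<open>Differentiability of the partial derivatives at the origin bounds their error by a small
  multiple of the distance; integrating once in \<open>y\<close> supplies the second small
  factor.\<close>

lemma \<mu>_second_order:
  assumes "0 < \<epsilon>"
  obtains \<delta> where "0 < \<delta>"
    "\<And>x y. norm x < \<delta> \<Longrightarrow> norm y < \<delta> \<Longrightarrow> norm (\<mu> (x, y) - x - y - bl x y) \<le> \<epsilon> * (norm x + norm y) * norm y"
proof -
  have D: "DIM('e) > 0" by simp
  define e where "e = \<epsilon> / DIM('e)"
  have e: "e > 0" using assms by (simp add: e_def)
  have "\<forall>\<^sub>F z in nhds (0, 0). norm (pd i z - i - bl (fst z) i) \<le> e * norm z" for i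
  proof -
    obtain d where "d > 0" "\<And>z. norm (z - (0, 0)) < d \<Longrightarrow>
        norm (pd i z - pd i (0, 0) - bl (fst (z - (0, 0))) i) \<le> e * norm (z - (0, 0))"
      using pd_has_derivative[of i] e unfolding has_derivative_at_alt by blast
    then show ?thesis
      unfolding eventually_nhds_metric using pd_zero[OF zero_in_dom, of i]
      by (intro exI[of _ d]) (auto simp: dist_norm zero_prod_def[symmetric])
  qed
  then have "\<forall>\<^sub>F z in nhds (0, 0). \<forall>i\<in>Basis. norm (pd i z - i - bl (fst z) i) \<le> e * norm z"
    by (intro eventually_ball_finite) auto
  moreover have "\<forall>\<^sub>F z in nhds (0, 0). z \<in> mdom U"
    using open_mdom_U origin_in_mdom by (rule eventually_nhds_in_open)
  ultimately have "\<forall>\<^sub>F z in nhds (0, 0). z \<in> mdom U \<and> (\<forall>i\<in>Basis. norm (pd i z - i - bl (fst z) i) \<le> e * norm z)"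
    by eventually_elim simp
  then obtain d where d: "d > 0" "\<And>z. dist z (0, 0) < d \<Longrightarrow>
      z \<in> mdom U \<and> (\<forall>i\<in>Basis. norm (pd i z - i - bl (fst z) i) \<le> e * norm z)"
    unfolding eventually_nhds_metric by blast
  have key: "(x, y) \<in> mdom U \<and> (\<Sum>i\<in>Basis. norm (pd i (x, y) - i - bl x i)) \<le> \<epsilon> * (norm x + norm y)"
    if "norm x < d / 2" "norm y < d / 2" for x y :: 'e
  proof -
    have n: "norm (x, y) \<le> norm x + norm y" by (rule norm_Pair_le)
    then have "dist (x, y) (0, 0) < d" using that by (simp add: dist_norm)
    from d(2)[OF this] have m: "(x, y) \<in> mdom U"
      and b: "\<And>i. i \<in> Basis \<Longrightarrow> norm (pd i (x, y) - i - bl x i) \<le> e * norm (x, y)" by auto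
    have "(\<Sum>i\<in>Basis. norm (pd i (x, y) - i - bl x i)) \<le> (\<Sum>i\<in>(Basis::'e set). e * norm (x, y))"
      by (rule sum_mono) (rule b)
    also have "\<dots> = \<epsilon> * norm (x, y)" by (simp add: e_def)
    also have "\<dots> \<le> \<epsilon> * (norm x + norm y)" using n assms by simp
    finally show ?thesis using m by blast
  qed
  show thesis
  proof (rule that[of "d / 2"])
    fix x y :: 'e assume xy: "norm x < d / 2" "norm y < d / 2"
    show "norm (\<mu> (x, y) - x - y - bl x y) \<le> \<epsilon> * (norm x + norm y) * norm y"
    proof (rule \<mu>_remainder)
      show "linear (bl x)" using bilinear_bl by (simp add: bilinear_def)
      show "(x, 0) \<in> mdom U" using key[OF xy(1), of 0] d(1) by simp
      show "0 \<le> \<epsilon> * (norm x + norm y)" using assms by simp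
      fix y' :: 'e assume y': "norm y' \<le> norm y"
      then have "norm y' < d / 2" using xy by linarith
      moreover have "\<epsilon> * (norm x + norm y') \<le> \<epsilon> * (norm x + norm y)" using y' assms by simp
      ultimately show "(x, y') \<in> mdom U \<and> (\<Sum>i\<in>Basis. norm (pd i (x, y') - i - bl x i)) \<le> \<epsilon> * (norm x + norm y)"
        using key[OF xy(1), of y'] by linarith
    qed
  qed (use d in simp)
qed

text \<open>The families need not be continuous in \<open>t\<close>. They are one-sided because
  commutators are of order \<open>t\<^sup>2\<close> and must be reparametrised by a square root;
  membership in \<open>U\<close> is required because \<open>\<kappa>\<close> means nothing outside
  it.\<close>

definition tangent :: "'g set \<Rightarrow> 'e set" where
  "tangent H = {v. \<exists>\<gamma>::real \<Rightarrow> 'g. (\<forall>t. \<gamma> t \<in> H) \<and> (\<forall>\<^sub>F t in at_right 0. \<gamma> t \<in> U) \<and>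
     ((\<lambda>t. \<kappa> (\<gamma> t) /\<^sub>R t) \<longlongrightarrow> v) (at_right 0)}"

lemma quotient_tendsto_imp_tendsto_zero:
  fixes X :: "real \<Rightarrow> 'a::real_normed_vector"
  assumes "((\<lambda>t. X t /\<^sub>R t) \<longlongrightarrow> v) (at_right 0)"
  shows "(X \<longlongrightarrow> 0) (at_right 0)"
proof -
  have "((\<lambda>t. t *\<^sub>R (X t /\<^sub>R t)) \<longlongrightarrow> 0 *\<^sub>R v) (at_right 0)"
    by (intro tendsto_scaleR assms tendsto_ident_at)
  then have "((\<lambda>t. t *\<^sub>R (X t /\<^sub>R t)) \<longlongrightarrow> 0) (at_right 0)" by simp
  then show ?thesis
  proof (rule Lim_transform_eventually)
    show "\<forall>\<^sub>F t in at_right 0. t *\<^sub>R (X t /\<^sub>R t) = X t"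
      using eventually_at_right_less[of "0::real"] by eventually_elim simp
  qed
qed

lemma tendsto_norm_less:
  "(X \<longlongrightarrow> 0) F \<Longrightarrow> 0 < \<delta> \<Longrightarrow> \<forall>\<^sub>F t in F. norm (X t) < \<delta>"
  using tendstoD[of X 0 F \<delta>] by simp

lemma tendsto_zero_boundI:
  fixes R :: "real \<Rightarrow> 'a::real_normed_vector"
  assumes q: "(q \<longlongrightarrow> (l::real)) F"
    and b: "\<And>\<epsilon>. 0 < \<epsilon> \<Longrightarrow> \<forall>\<^sub>F t in F. norm (R t) \<le> \<epsilon> * q t"
  shows "(R \<longlongrightarrow> 0) F"
proof (rule tendstoI)
  fix e :: real assume e: "e > 0"
  define \<epsilon> where "\<epsilon> = e / (2 * (\<bar>l\<bar> + 1))"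
  have \<epsilon>: "\<epsilon> > 0" using e by (simp add: \<epsilon>_def)
  have "\<forall>\<^sub>F t in F. q t < \<bar>l\<bar> + 1" using q by (rule order_tendstoD) linarith
  with b[OF \<epsilon>] show "\<forall>\<^sub>F t in F. dist (R t) 0 < e"
  proof eventually_elim
    fix t assume "norm (R t) \<le> \<epsilon> * q t" "q t < \<bar>l\<bar> + 1"
    moreover from this have "\<epsilon> * q t \<le> \<epsilon> * (\<bar>l\<bar> + 1)" using \<epsilon> by simp
    moreover have "\<epsilon> * (\<bar>l\<bar> + 1) = e / 2" by (simp add: \<epsilon>_def field_simps)
    ultimately show "dist (R t) 0 < e" using e by simp
  qed
qed

lemma \<mu>_near:
  assumes "(X \<longlongrightarrow> 0) F" "(Y \<longlongrightarrow> 0) F"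
  shows "\<forall>\<^sub>F t in F. (X t, Y t) \<in> mdom U"
proof -
  obtain \<delta> where \<delta>: "0 < \<delta>" "\<And>x y. norm x < \<delta> \<Longrightarrow> norm y < \<delta> \<Longrightarrow> (x, y) \<in> mdom U"
    using \<mu>_first_order[of 1] by (metis zero_less_one)
  show ?thesis
    using tendsto_norm_less[OF assms(1) \<delta>(1)] tendsto_norm_less[OF assms(2) \<delta>(1)]
    by eventually_elim (rule \<delta>(2))
qed

text \<open>The pointwise product of two families has the sum of their velocities, as multiplication
  is addition to first order.\<close>

lemma tangent_add:
  assumes H: "subgroup H G" and v: "v \<in> tangent H" and w: "w \<in> tangent H"
  shows "v + w \<in> tangent H"
proof -
  obtain \<gamma> where \<gamma>: "\<And>t. \<gamma> t \<in> H" "\<forall>\<^sub>F t in at_right (0::real). \<gamma> t \<in> U"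
    "((\<lambda>t. \<kappa> (\<gamma> t) /\<^sub>R t) \<longlongrightarrow> v) (at_right 0)" using v unfolding tangent_def by blast
  obtain \<eta> where \<eta>: "\<And>t. \<eta> t \<in> H" "\<forall>\<^sub>F t in at_right (0::real). \<eta> t \<in> U"
    "((\<lambda>t. \<kappa> (\<eta> t) /\<^sub>R t) \<longlongrightarrow> w) (at_right 0)" using w unfolding tangent_def by blast
  let ?X = "\<lambda>t. \<kappa> (\<gamma> t)" and ?Y = "\<lambda>t. \<kappa> (\<eta> t)"
  note X0 = quotient_tendsto_imp_tendsto_zero[OF \<gamma>(3)] and Y0 = quotient_tendsto_imp_tendsto_zero[OF \<eta>(3)]
  have e: "\<forall>\<^sub>F t in at_right 0. \<gamma> t \<otimes> \<eta> t \<in> U \<and> \<kappa> (\<gamma> t \<otimes> \<eta> t) = \<mu> (?X t, ?Y t)"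
    using \<mu>_near[OF X0 Y0] \<gamma>(2) \<eta>(2)
    by eventually_elim (simp add: mdom_def \<mu>_def \<iota>_\<kappa>)
  have "((\<lambda>t. (\<mu> (?X t, ?Y t) - ?X t - ?Y t) /\<^sub>R t) \<longlongrightarrow> 0) (at_right 0)"
  proof (rule tendsto_zero_boundI[OF tendsto_norm[OF \<eta>(3)]])
    fix \<epsilon> :: real assume \<epsilon>: "0 < \<epsilon>"
    obtain \<delta> where \<delta>: "0 < \<delta>"
      "\<And>x y. norm x < \<delta> \<Longrightarrow> norm y < \<delta> \<Longrightarrow> norm (\<mu> (x, y) - x - y) \<le> \<epsilon> * norm y"
      using \<mu>_first_order[OF \<epsilon>] by metis
    show "\<forall>\<^sub>F t in at_right 0. norm ((\<mu> (?X t, ?Y t) - ?X t - ?Y t) /\<^sub>R t) \<le> \<epsilon> * norm (?Y t /\<^sub>R t)"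
      using tendsto_norm_less[OF X0 \<delta>(1)] tendsto_norm_less[OF Y0 \<delta>(1)] eventually_at_right_less[of "0::real"]
    proof eventually_elim
      fix t :: real assume t: "norm (?X t) < \<delta>" "norm (?Y t) < \<delta>" "0 < t"
      show "norm ((\<mu> (?X t, ?Y t) - ?X t - ?Y t) /\<^sub>R t) \<le> \<epsilon> * norm (?Y t /\<^sub>R t)"
        using mult_left_mono[OF \<delta>(2)[OF t(1,2)], of "inverse t"] t(3) by (simp add: mult_ac)
    qed
  qed
  from tendsto_add[OF this tendsto_add[OF \<gamma>(3) \<eta>(3)]]
  have "((\<lambda>t. \<mu> (?X t, ?Y t) /\<^sub>R t) \<longlongrightarrow> v + w) (at_right 0)"
    by (simp add: scaleR_diff_right algebra_simps)
  then have "((\<lambda>t. \<kappa> (\<gamma> t \<otimes> \<eta> t) /\<^sub>R t) \<longlongrightarrow> v + w) (at_right 0)"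
    by (rule Lim_transform_eventually) (use e in \<open>auto elim!: eventually_mono\<close>)
  moreover have "\<gamma> t \<otimes> \<eta> t \<in> H" for t using subgroup.m_closed[OF H \<gamma>(1) \<eta>(1)] .
  moreover have "\<forall>\<^sub>F t in at_right 0. \<gamma> t \<otimes> \<eta> t \<in> U" using e by (auto elim: eventually_mono)
  ultimately show ?thesis unfolding tangent_def by (auto intro!: exI[of _ "\<lambda>t. \<gamma> t \<otimes> \<eta> t"])
qed

lemma tangent_zero: "subgroup H G \<Longrightarrow> 0 \<in> tangent H"
  unfolding tangent_def using one_in subgroup.one_closed by (auto intro!: exI[of _ "\<lambda>_. \<one>"])

lemma tangent_UNIV: "v \<in> tangent UNIV"
proof -
  have l: "((\<lambda>t. t *\<^sub>R v) \<longlongrightarrow> 0 *\<^sub>R v) (at_right 0)" by (intro tendsto_intros)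
  have "\<forall>\<^sub>F t in at_right 0. t *\<^sub>R v \<in> dom"
    using topological_tendstoD[OF l open_dom] zero_in_dom by simp
  then have d: "\<forall>\<^sub>F t in at_right 0. \<iota> (t *\<^sub>R v) \<in> U \<and> \<kappa> (\<iota> (t *\<^sub>R v)) /\<^sub>R t = v"
    using eventually_at_right_less[of "0::real"] by eventually_elim (simp add: \<iota>_in \<kappa>_\<iota>)
  have "((\<lambda>t. \<kappa> (\<iota> (t *\<^sub>R v)) /\<^sub>R t) \<longlongrightarrow> v) (at_right 0)"
    by (rule Lim_transform_eventually[OF tendsto_const]) (use d in \<open>auto elim!: eventually_mono\<close>)
  moreover have "\<forall>\<^sub>F t in at_right 0. \<iota> (t *\<^sub>R v) \<in> U" using d by (auto elim: eventually_mono)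
  ultimately show ?thesis unfolding tangent_def by (auto intro!: exI[of _ "\<lambda>t. \<iota> (t *\<^sub>R v)"])
qed

lemma tangent_trivial: "tangent {\<one>} \<subseteq> {0}"
proof
  fix v assume "v \<in> tangent {\<one>}"
  then obtain \<gamma> :: "real \<Rightarrow> 'g" where "\<And>t. \<gamma> t = \<one>" "((\<lambda>t. \<kappa> (\<gamma> t) /\<^sub>R t) \<longlongrightarrow> v) (at_right 0)"
    unfolding tangent_def by auto
  then have "((\<lambda>t::real. 0) \<longlongrightarrow> v) (at_right 0)" by simp
  then show "v \<in> {0}" by (simp add: tendsto_const_iff)
qed

lemma tendsto_one:
  assumes "(X \<longlongrightarrow> 0) F"
  shows "((\<lambda>t. \<iota> (X t)) \<longlongrightarrow> \<one>) F"
proof -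
  have "isCont \<iota> 0" using continuous_\<iota> open_dom zero_in_dom continuous_on_eq_continuous_at by blast
  from isCont_tendsto_compose[OF this assms] show ?thesis by simp
qed

lemma tendsto_mult: "(f \<longlongrightarrow> a) F \<Longrightarrow> (g \<longlongrightarrow> b) F \<Longrightarrow> ((\<lambda>t. f t \<otimes> g t) \<longlongrightarrow> a \<otimes> b) F"
proof -
  assume fg: "(f \<longlongrightarrow> a) F" "(g \<longlongrightarrow> b) F"
  have "isCont (\<lambda>(x, y). x \<otimes> y) (a, b)"
    using continuous_mult continuous_on_eq_continuous_at[OF open_UNIV] by blast
  from isCont_tendsto_compose[OF this tendsto_Pair[OF fg]] show ?thesis by simp
qed

lemma tendsto_inv: "(f \<longlongrightarrow> a) F \<Longrightarrow> ((\<lambda>t. inv (f t)) \<longlongrightarrow> inv a) F"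
proof -
  assume f: "(f \<longlongrightarrow> a) F"
  have "continuous_on UNIV (\<lambda>x. inv x)" using inv_smooth_map unfolding smooth_map_on_def by simp
  then have "isCont (\<lambda>x. inv x) a" using continuous_on_eq_continuous_at[OF open_UNIV] by blast
  from isCont_tendsto_compose[OF this f] show ?thesis .
qed

text \<open>The quadratic term of one product of two families. Exchanging the factors and
  subtracting turns \<open>bl\<close> into \<open>br\<close>.\<close>

lemma commutator_expansion:
  assumes X: "((\<lambda>s. X s /\<^sub>R s) \<longlongrightarrow> v) (at_right 0)" and Y: "((\<lambda>s. Y s /\<^sub>R s) \<longlongrightarrow> w) (at_right 0)"
  shows "((\<lambda>s. (\<mu> (X s, Y s) - X s - Y s) /\<^sub>R s\<^sup>2) \<longlongrightarrow> bl v w) (at_right 0)"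
proof -
  note X0 = quotient_tendsto_imp_tendsto_zero[OF X] and Y0 = quotient_tendsto_imp_tendsto_zero[OF Y]
  have "((\<lambda>s. (\<mu> (X s, Y s) - X s - Y s - bl (X s) (Y s)) /\<^sub>R s\<^sup>2) \<longlongrightarrow> 0) (at_right 0)"
  proof (rule tendsto_zero_boundI)
    show "((\<lambda>s. (norm (X s /\<^sub>R s) + norm (Y s /\<^sub>R s)) * norm (Y s /\<^sub>R s)) \<longlongrightarrow> (norm v + norm w) * norm w) (at_right 0)"
      by (intro Limits.tendsto_mult tendsto_add tendsto_norm X Y)
    fix \<epsilon> :: real assume \<epsilon>: "0 < \<epsilon>"
    obtain \<delta> where \<delta>: "0 < \<delta>"
      "\<And>x y. norm x < \<delta> \<Longrightarrow> norm y < \<delta> \<Longrightarrow> norm (\<mu> (x, y) - x - y - bl x y) \<le> \<epsilon> * (norm x + norm y) * norm y"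
      using \<mu>_second_order[OF \<epsilon>] by metis
    show "\<forall>\<^sub>F s in at_right 0. norm ((\<mu> (X s, Y s) - X s - Y s - bl (X s) (Y s)) /\<^sub>R s\<^sup>2) \<le>
        \<epsilon> * ((norm (X s /\<^sub>R s) + norm (Y s /\<^sub>R s)) * norm (Y s /\<^sub>R s))"
      using tendsto_norm_less[OF X0 \<delta>(1)] tendsto_norm_less[OF Y0 \<delta>(1)] eventually_at_right_less[of "0::real"]
    proof eventually_elim
      fix s :: real assume s: "norm (X s) < \<delta>" "norm (Y s) < \<delta>" "0 < s"
      have "norm ((\<mu> (X s, Y s) - X s - Y s - bl (X s) (Y s)) /\<^sub>R s\<^sup>2) \<le>
          (\<epsilon> * (norm (X s) + norm (Y s)) * norm (Y s)) / s\<^sup>2"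
        using divide_right_mono[OF \<delta>(2)[OF s(1,2)], of "s\<^sup>2"] by (simp add: divide_inverse_commute)
      also have "\<dots> = \<epsilon> * ((norm (X s /\<^sub>R s) + norm (Y s /\<^sub>R s)) * norm (Y s /\<^sub>R s))"
        using s(3) by (simp add: power2_eq_square field_simps)
      finally show "norm ((\<mu> (X s, Y s) - X s - Y s - bl (X s) (Y s)) /\<^sub>R s\<^sup>2) \<le>
          \<epsilon> * ((norm (X s /\<^sub>R s) + norm (Y s /\<^sub>R s)) * norm (Y s /\<^sub>R s))" .
    qed
  qed
  moreover have "((\<lambda>s. bl (X s /\<^sub>R s) (Y s /\<^sub>R s)) \<longlongrightarrow> bl v w) (at_right 0)"
    using bounded_bilinear.tendsto[OF bilinear_conv_bounded_bilinear[THEN iffD1, OF bilinear_bl] X Y] .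
  ultimately have "((\<lambda>s. (\<mu> (X s, Y s) - X s - Y s - bl (X s) (Y s)) /\<^sub>R s\<^sup>2 + bl (X s /\<^sub>R s) (Y s /\<^sub>R s))
      \<longlongrightarrow> 0 + bl v w) (at_right 0)" by (rule tendsto_add)
  moreover have "bl (x /\<^sub>R s) (y /\<^sub>R s) = bl x y /\<^sub>R s\<^sup>2" for x y s
    using bilinear_bl by (simp add: bilinear_lmul bilinear_rmul power2_eq_square)
  ultimately show ?thesis by (simp add: scaleR_diff_right)
qed

text \<open>The commutator \<open>c\<close> measures the failure of the two products to agree. To
  leading order its coordinate is the difference of their coordinates, hence
  \<open>t\<^sup>2\<close> times the bracket.\<close>

lemma tangent_br:
  assumes v: "v \<in> tangent H" and w: "w \<in> tangent H" and H: "subgroup H G"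
  shows "br v w \<in> tangent (derived G H)"
proof -
  obtain \<gamma> where \<gamma>: "\<And>t. \<gamma> t \<in> H" "\<forall>\<^sub>F t in at_right (0::real). \<gamma> t \<in> U"
    "((\<lambda>t. \<kappa> (\<gamma> t) /\<^sub>R t) \<longlongrightarrow> v) (at_right 0)" using v unfolding tangent_def by blast
  obtain \<eta> where \<eta>: "\<And>t. \<eta> t \<in> H" "\<forall>\<^sub>F t in at_right (0::real). \<eta> t \<in> U"
    "((\<lambda>t. \<kappa> (\<eta> t) /\<^sub>R t) \<longlongrightarrow> w) (at_right 0)" using w unfolding tangent_def by blast
  let ?X = "\<lambda>t. \<kappa> (\<gamma> t)" and ?Y = "\<lambda>t. \<kappa> (\<eta> t)"
  note X0 = quotient_tendsto_imp_tendsto_zero[OF \<gamma>(3)] and Y0 = quotient_tendsto_imp_tendsto_zero[OF \<eta>(3)]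
  \<comment> \<open>Taking inverses as the two entries gives literally the shape of a generator of
    the derived subgroup while still satisfying the product identity \<open>c_eq\<close>
    below.\<close>
  define c where "c t = inv (\<gamma> t) \<otimes> inv (\<eta> t) \<otimes> inv (inv (\<gamma> t)) \<otimes> inv (inv (\<eta> t))" for t
  have c_in: "c t \<in> derived G H" for t
    unfolding derived_def c_def
    using subgroup.m_inv_closed[OF H \<gamma>(1)] subgroup.m_inv_closed[OF H \<eta>(1)] by (intro generate.incl) blast
  have c_eq: "(\<eta> t \<otimes> \<gamma> t) \<otimes> c t = \<gamma> t \<otimes> \<eta> t" for t
    by (simp add: c_def m_assoc[symmetric] r_inv) (simp add: m_assoc r_inv)
  have lim1: "(\<gamma> \<longlongrightarrow> \<one>) (at_right 0)"
    by (rule Lim_transform_eventually[OF tendsto_one[OF X0]]) (use \<gamma>(2) \<iota>_\<kappa> in \<open>auto elim!: eventually_mono\<close>)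
  have lim2: "(\<eta> \<longlongrightarrow> \<one>) (at_right 0)"
    by (rule Lim_transform_eventually[OF tendsto_one[OF Y0]]) (use \<eta>(2) \<iota>_\<kappa> in \<open>auto elim!: eventually_mono\<close>)
  have "(c \<longlongrightarrow> inv \<one> \<otimes> inv \<one> \<otimes> inv (inv \<one>) \<otimes> inv (inv \<one>)) (at_right 0)"
    unfolding c_def[abs_def] by (intro tendsto_mult tendsto_inv lim1 lim2)
  then have limc: "(c \<longlongrightarrow> \<one>) (at_right 0)" by simp
  have limq: "((\<lambda>t. \<eta> t \<otimes> \<gamma> t) \<longlongrightarrow> \<one>) (at_right 0)" using tendsto_mult[OF lim2 lim1] by simp
  have evc: "\<forall>\<^sub>F t in at_right 0. c t \<in> U" "\<forall>\<^sub>F t in at_right 0. \<eta> t \<otimes> \<gamma> t \<in> U"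
    using topological_tendstoD[OF limc is_chartD(1)[OF chart] one_in]
      topological_tendstoD[OF limq is_chartD(1)[OF chart] one_in] by auto
  have \<kappa>cont: "isCont \<kappa> \<one>"
    using continuous_\<kappa> is_chartD(1)[OF chart] one_in continuous_on_eq_continuous_at by blast
  let ?Z = "\<lambda>t. \<kappa> (c t)" and ?Q = "\<lambda>t. \<kappa> (\<eta> t \<otimes> \<gamma> t)"
  let ?D = "\<lambda>t. \<mu> (?X t, ?Y t) - \<mu> (?Y t, ?X t)"
  have Z0: "(?Z \<longlongrightarrow> 0) (at_right 0)" and Q0: "(?Q \<longlongrightarrow> 0) (at_right 0)"
    using isCont_tendsto_compose[OF \<kappa>cont limc] isCont_tendsto_compose[OF \<kappa>cont limq] by simp_all
  have D: "((\<lambda>t. ?D t /\<^sub>R t\<^sup>2) \<longlongrightarrow> br v w) (at_right 0)"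
  proof -
    have "(\<mu> (?X t, ?Y t) - ?X t - ?Y t) /\<^sub>R t\<^sup>2 - (\<mu> (?Y t, ?X t) - ?Y t - ?X t) /\<^sub>R t\<^sup>2 = ?D t /\<^sub>R t\<^sup>2" for t
      by (simp add: scaleR_diff_right)
    then show ?thesis
      using tendsto_diff[OF commutator_expansion[OF \<gamma>(3) \<eta>(3)] commutator_expansion[OF \<eta>(3) \<gamma>(3)]]
      by (simp only: br_eq_bl)
  qed
  \<comment> \<open>Reading \<open>c_eq\<close> in the chart: the difference of the two products is
    the effect of multiplying \<open>?Q t\<close> by the commutator.\<close>
  have rel: "\<forall>\<^sub>F t in at_right 0. \<mu> (?Q t, ?Z t) - ?Q t = ?D t"
    using evc \<gamma>(2) \<eta>(2) by eventually_elim (simp add: \<mu>_def \<iota>_\<kappa> c_eq)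
  have "((\<lambda>t. (?D t - ?Z t) /\<^sub>R t\<^sup>2) \<longlongrightarrow> 0) (at_right 0)"
  proof (rule tendsto_zero_boundI[OF tendsto_norm[OF D]])
    fix \<epsilon> :: real assume \<epsilon>: "0 < \<epsilon>"
    \<comment> \<open>The first-order error is relative to the unknown \<open>?Z\<close>. The bound
      \<open>1 / 2\<close> gives \<open>norm ?Z\<close> at most twice \<open>norm ?D\<close>, and
      \<open>\<epsilon> / 2\<close> compensates for that factor 2.\<close>
    define e where "e = min (1 / 2) (\<epsilon> / 2)"
    have e: "0 < e" "e \<le> 1 / 2" "e \<le> \<epsilon> / 2" using \<epsilon> by (auto simp: e_def)
    obtain \<delta> where \<delta>: "0 < \<delta>"
      "\<And>x y. norm x < \<delta> \<Longrightarrow> norm y < \<delta> \<Longrightarrow> norm (\<mu> (x, y) - x - y) \<le> e * norm y"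
      using \<mu>_first_order[OF e(1)] by metis
    show "\<forall>\<^sub>F t in at_right 0. norm ((?D t - ?Z t) /\<^sub>R t\<^sup>2) \<le> \<epsilon> * norm (?D t /\<^sub>R t\<^sup>2)"
      using tendsto_norm_less[OF Z0 \<delta>(1)] tendsto_norm_less[OF Q0 \<delta>(1)] eventually_at_right_less[of "0::real"] rel
    proof eventually_elim
      fix t :: real assume t: "norm (?Z t) < \<delta>" "norm (?Q t) < \<delta>" "0 < t" "\<mu> (?Q t, ?Z t) - ?Q t = ?D t"
      have 1: "norm (?D t - ?Z t) \<le> e * norm (?Z t)" using \<delta>(2)[OF t(2,1)] t(4) by simp
      also have "\<dots> \<le> 1 / 2 * norm (?Z t)" by (rule mult_right_mono[OF e(2)]) simp
      finally have "norm (?D t - ?Z t) \<le> 1 / 2 * norm (?Z t)" .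
      moreover have "norm (?Z t) \<le> norm (?D t) + norm (?D t - ?Z t)"
        using norm_triangle_ineq4[of "?D t" "?D t - ?Z t"] by simp
      ultimately have "norm (?Z t) \<le> 2 * norm (?D t)" by linarith
      then have "e * norm (?Z t) \<le> (\<epsilon> / 2) * (2 * norm (?D t))"
        by (intro mult_mono e) (use \<epsilon> in auto)
      with 1 have "norm (?D t - ?Z t) \<le> \<epsilon> * norm (?D t)" by simp
      from mult_left_mono[OF this, of "inverse (t\<^sup>2)"]
      show "norm ((?D t - ?Z t) /\<^sub>R t\<^sup>2) \<le> \<epsilon> * norm (?D t /\<^sub>R t\<^sup>2)" by (simp add: mult_ac)
    qed
  qed
  from tendsto_diff[OF D this] have Zlim: "((\<lambda>t. ?Z t /\<^sub>R t\<^sup>2) \<longlongrightarrow> br v w) (at_right 0)"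
    by (simp add: scaleR_diff_right)
  \<comment> \<open>A family with coordinate of order \<open>t\<^sup>2\<close> has velocity only
    after substituting the square root of \<open>t\<close>.\<close>
  have sq: "filterlim sqrt (at_right 0) (at_right 0)"
  proof -
    have "(sqrt \<longlongrightarrow> sqrt 0) (at_right 0)" by (intro tendsto_intros)
    moreover have "\<forall>\<^sub>F t in at_right 0. sqrt t > 0"
      using eventually_at_right_less[of "0::real"] by eventually_elim simp
    ultimately show ?thesis by (simp add: filterlim_at) (auto elim: eventually_mono)
  qed
  have "((\<lambda>t. ?Z (sqrt t) /\<^sub>R (sqrt t)\<^sup>2) \<longlongrightarrow> br v w) (at_right 0)"
    by (rule filterlim_compose[OF Zlim sq])
  then have "((\<lambda>t. \<kappa> (c (sqrt t)) /\<^sub>R t) \<longlongrightarrow> br v w) (at_right 0)"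
  proof (rule Lim_transform_eventually)
    show "\<forall>\<^sub>F t in at_right 0. \<kappa> (c (sqrt t)) /\<^sub>R (sqrt t)\<^sup>2 = \<kappa> (c (sqrt t)) /\<^sub>R t"
      using eventually_at_right_less[of "0::real"] by eventually_elim simp
  qed
  moreover have "\<forall>\<^sub>F t in at_right 0. c (sqrt t) \<in> U"
    using evc(1) sq by (rule eventually_compose_filterlim)
  ultimately show ?thesis unfolding tangent_def using c_in by (auto intro!: exI[of _ "\<lambda>t. c (sqrt t)"])
qed

lemma subgroup_derived_power: "subgroup ((derived G ^^ n) (carrier G)) G"
  by (rule exp_of_derived_is_subgroup[OF subgroup_self])

text \<open>Solvability in the form that no nonzero subspace is contained in the span of its own
  brackets. Such a subspace would remain tangent to every derived subgroup, and the last of these is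
  trivial.\<close>

lemma solvable_lie_algebra:
  assumes sol: "solvable G" and V: "subspace V" and sub: "V \<subseteq> span {br v w |v w. v \<in> V \<and> w \<in> V}"
  shows "V \<subseteq> {0}"
proof -
  have step: "V \<subseteq> tangent (derived G H)" if H: "subgroup H G" "V \<subseteq> tangent H" for H
  proof
    fix x assume "x \<in> V"
    then have "x \<in> span {br v w |v w. v \<in> V \<and> w \<in> V}" using sub by auto
    then show "x \<in> tangent (derived G H)"
    proof (induction rule: span_induct_alt)
      case base
      have "subgroup (derived G H) G" by (rule derived_is_subgroup[OF subgroup.subset[OF H(1)]])
      then show ?case by (rule tangent_zero)
    next
      case (step c x y)
      then obtain v w where vw: "v \<in> V" "w \<in> V" "x = br v w" by blast
      \<comment> \<open>\<open>tangent\<close> is only known to be closed under addition, so the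
        scalar is moved into the bracket.\<close>
      have "c *\<^sub>R x = br (c *\<^sub>R v) w" by (simp add: vw br_scale_left)
      moreover have "c *\<^sub>R v \<in> V" using V vw by (simp add: subspace_scale)
      ultimately have "c *\<^sub>R x \<in> tangent (derived G H)" using tangent_br[OF _ _ H(1)] vw H(2) by auto
      then show ?case
        using tangent_add[OF derived_is_subgroup[OF subgroup.subset[OF H(1)]]] step.IH by blast
    qed
  qed
  have V: "V \<subseteq> tangent ((derived G ^^ n) (carrier G))" for n
  proof (induction n)
    case 0
    then show ?case using tangent_UNIV by auto
  next
    case (Suc n)
    then show ?case using step[OF subgroup_derived_power] by simp
  qed
  obtain n where n: "(derived G ^^ n) (carrier G) = {\<one>}"
    using solvable_imp_trivial_derived_seq sol unfolding solvable_def by blast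
  show ?thesis using V[of n] tangent_trivial unfolding n by (rule subset_trans)
qed

end

section \<open>Orthonormal flags and the scalar curvature of solvable metric Lie algebras\<close>

section \<open>Metric Lie algebras\<close>

text \<open>The metric \<open>gm\<close> is unrelated to the inner product of the model space, so
  orthonormal systems are developed for \<open>gm\<close> separately.\<close>

locale metric_lie_algebra =
  fixes br :: "'e::euclidean_space \<Rightarrow> 'e \<Rightarrow> 'e" and gm :: "'e \<Rightarrow> 'e \<Rightarrow> real"
  assumes bilinear_br: "bilinear br" and br_skew: "\<And>x y. br x y = - br y x"
    and jacobi: "\<And>x y z. br (br x y) z + br (br y z) x + br (br z x) y = 0"
    and bilinear_gm: "bilinear gm" and gm_sym: "\<And>x y. gm x y = gm y x"
    and gm_pos: "\<And>x. x \<noteq> 0 \<Longrightarrow> gm x x > 0"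
begin

lemma linear_br_left: "linear (\<lambda>x. br x y)" and linear_br_right: "linear (br x)"
  and linear_gm_left: "linear (\<lambda>x. gm x y)" and linear_gm_right: "linear (gm x)"
  using bilinear_br bilinear_gm by (auto simp: bilinear_def)

lemmas br_lin = linear_add[OF linear_br_left] linear_add[OF linear_br_right]
  linear_scale[OF linear_br_left] linear_scale[OF linear_br_right]
  linear_neg[OF linear_br_left] linear_neg[OF linear_br_right]
  linear_sum[OF linear_br_left] linear_sum[OF linear_br_right]
  linear_diff[OF linear_br_left] linear_diff[OF linear_br_right]
  linear_0[OF linear_br_left] linear_0[OF linear_br_right]

lemmas gm_lin = linear_add[OF linear_gm_left] linear_add[OF linear_gm_right]
  linear_scale[OF linear_gm_left] linear_scale[OF linear_gm_right]
  linear_neg[OF linear_gm_left] linear_neg[OF linear_gm_right]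
  linear_sum[OF linear_gm_left] linear_sum[OF linear_gm_right]
  linear_diff[OF linear_gm_left] linear_diff[OF linear_gm_right]
  linear_0[OF linear_gm_left] linear_0[OF linear_gm_right]

definition ons :: "(nat \<Rightarrow> 'e) \<Rightarrow> nat \<Rightarrow> bool" where
  "ons e k \<longleftrightarrow> (\<forall>i<k. \<forall>l<k. gm (e i) (e l) = (if i = l then 1 else 0))"

lemma onsD: "ons e k \<Longrightarrow> i < k \<Longrightarrow> l < k \<Longrightarrow> gm (e i) (e l) = (if i = l then 1 else 0)"
  by (simp add: ons_def)

lemma ons_sum:
  assumes "ons e k" "l < k"
  shows "gm (\<Sum>i<k. c i *\<^sub>R e i) (e l) = c l"
proof -
  have "gm (\<Sum>i<k. c i *\<^sub>R e i) (e l) = (\<Sum>i<k. c i * (if i = l then 1 else 0))"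
    using assms by (simp add: gm_lin onsD)
  also have "\<dots> = c l" using assms(2) by (simp add: if_distrib cong: if_cong)
  finally show ?thesis .
qed

lemma ons_expand:
  assumes "ons e k" "x \<in> span (e ` {..<k})"
  shows "x = (\<Sum>i<k. gm x (e i) *\<^sub>R e i)"
proof -
  from assms(2) have "\<exists>c. x = (\<Sum>i<k. c i *\<^sub>R e i)"
  proof (induction rule: span_induct_alt)
    case base
    show ?case by (intro exI[of _ "\<lambda>i. 0"]) simp
  next
    case (step a b y)
    then obtain l c where l: "l < k" "b = e l" "y = (\<Sum>i<k. c i *\<^sub>R e i)" by auto
    have "a *\<^sub>R b = (\<Sum>i<k. (if i = l then a else 0) *\<^sub>R e i)"
      using l by (simp add: if_distrib[of "\<lambda>r. r *\<^sub>R _"] cong: if_cong)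
    then have "a *\<^sub>R b + y = (\<Sum>i<k. ((if i = l then a else 0) + c i) *\<^sub>R e i)"
      using l by (simp add: scaleR_add_left sum.distrib)
    then show ?case by (intro exI)
  qed
  then obtain c where c: "x = (\<Sum>i<k. c i *\<^sub>R e i)" ..
  then have "gm x (e l) = c l" if "l < k" for l using ons_sum[OF assms(1) that] by simp
  then show ?thesis using c by simp
qed

lemma ons_independent: "ons e k \<Longrightarrow> inj_on e {..<k} \<and> independent (e ` {..<k})"
proof
  assume e: "ons e k"
  show inj: "inj_on e {..<k}"
  proof (rule inj_onI)
    fix i l assume "i \<in> {..<k}" "l \<in> {..<k}" "e i = e l"
    then show "i = l" using onsD[OF e, of i l] onsD[OF e, of l l] by (auto split: if_splits)
  qed
  show "independent (e ` {..<k})"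
  proof (rule independent_if_scalars_zero)
    fix f x assume s: "(\<Sum>x\<in>e ` {..<k}. f x *\<^sub>R x) = 0" and "x \<in> e ` {..<k}"
    then obtain l where l: "l < k" "x = e l" by auto
    have "(\<Sum>i<k. f (e i) *\<^sub>R e i) = 0" using s by (simp add: sum.reindex[OF inj])
    then show "f x = 0" using ons_sum[OF e l(1), of "\<lambda>i. f (e i)"] l by (simp add: gm_lin)
  qed simp
qed

lemma ons_dim: "ons e k \<Longrightarrow> dim (span (e ` {..<k})) = k"
  using ons_independent[of e k] by (simp add: dim_eq_card_independent card_image)

definition onb :: "(nat \<Rightarrow> 'e) \<Rightarrow> nat \<Rightarrow> bool" where
  "onb e k \<longleftrightarrow> ons e k \<and> span (e ` {..<k}) = UNIV"

lemma onb_dim: "onb e k \<Longrightarrow> k = DIM('e)"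
  using ons_dim unfolding onb_def by (metis dim_UNIV)

lemma ons_onb: "ons e DIM('e) \<Longrightarrow> onb e DIM('e)"
  unfolding onb_def using dim_eq_full[of "span (e ` {..<DIM('e)})"] ons_dim[of e "DIM('e)"] by (simp add: span_span)

lemma onb_expand: "onb e k \<Longrightarrow> x = (\<Sum>i<k. gm x (e i) *\<^sub>R e i)"
  using ons_expand unfolding onb_def by blast

lemma onb_linear_expand:
  fixes f :: "'e \<Rightarrow> real"
  assumes "onb e k" "linear f"
  shows "f x = (\<Sum>i<k. gm x (e i) * f (e i))"
  using arg_cong[OF onb_expand[OF assms(1), of x], of f] by (simp add: linear_sum[OF assms(2)] linear_scale[OF assms(2)])

lemma parseval: "onb e k \<Longrightarrow> gm x y = (\<Sum>i<k. gm x (e i) * gm y (e i))"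
  using onb_linear_expand[OF _ linear_gm_right, of e k x y] by (simp only: mult.commute)

lemma ons_complement:
  assumes e: "ons e k" and y: "y \<notin> span (e ` {..<k})"
  obtains z c where "gm z z = 1" "\<And>i. i < k \<Longrightarrow> gm z (e i) = 0" "c \<noteq> 0"
    "c *\<^sub>R z = y - (\<Sum>i<k. gm y (e i) *\<^sub>R e i)"
proof -
  define u where "u = y - (\<Sum>i<k. gm y (e i) *\<^sub>R e i)"
  have "(\<Sum>i<k. gm y (e i) *\<^sub>R e i) \<in> span (e ` {..<k})"
    by (intro span_sum span_scale span_base) auto
  then have "u \<noteq> 0" using y by (auto simp: u_def)
  then have p: "gm u u > 0" by (rule gm_pos)
  have o: "gm u (e i) = 0" if "i < k" for i
    using ons_sum[OF e that, of "\<lambda>i. gm y (e i)"] by (simp add: u_def gm_lin)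
  show thesis
  proof (rule that[of "(1 / sqrt (gm u u)) *\<^sub>R u" "sqrt (gm u u)"])
    show "gm ((1 / sqrt (gm u u)) *\<^sub>R u) ((1 / sqrt (gm u u)) *\<^sub>R u) = 1"
      using p by (simp add: gm_lin)
    show "gm ((1 / sqrt (gm u u)) *\<^sub>R u) (e i) = 0" if "i < k" for i
      by (simp add: gm_lin o[OF that])
    show "sqrt (gm u u) \<noteq> 0" using p by simp
    show "sqrt (gm u u) *\<^sub>R (1 / sqrt (gm u u)) *\<^sub>R u = y - (\<Sum>i<k. gm y (e i) *\<^sub>R e i)"
      unfolding u_def[symmetric] using p by simp
  qed
qed

lemma ons_extend:
  assumes e: "ons e k" and z: "gm z z = 1" "\<And>i. i < k \<Longrightarrow> gm z (e i) = 0"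
  shows "ons (e(k := z)) (Suc k)"
proof -
  have "gm (e i) z = 0" if "i < k" for i using z(2)[OF that] gm_sym by metis
  then show ?thesis using assms by (auto simp: ons_def less_Suc_eq)
qed

text \<open>One Gram-Schmidt step: the kernel of \<open>l\<close> has codimension one in
  \<open>V\<close>, so the normalised part of \<open>u\<close> orthogonal to that kernel completes
  the basis.\<close>

lemma flag_extend:
  assumes e: "ons e k" and V: "subspace V" and l: "linear (l :: 'e \<Rightarrow> real)"
    and sp: "span (e ` {..<k}) = {v \<in> V. l v = 0}" and u: "u \<in> V" "l u \<noteq> 0"
  obtains z where "ons (e(k := z)) (Suc k)" "span ((e(k := z)) ` {..<Suc k}) = V"
proof -
  have "u \<notin> span (e ` {..<k})" using sp u by simp
  then obtain z c where z: "gm z z = 1" "\<And>i. i < k \<Longrightarrow> gm z (e i) = 0" "c \<noteq> 0"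
    "c *\<^sub>R z = u - (\<Sum>i<k. gm u (e i) *\<^sub>R e i)"
    using ons_complement[OF e] by metis
  have eV: "e i \<in> V" "l (e i) = 0" if "i < k" for i
    using sp span_base[of "e i" "e ` {..<k}"] that by auto
  have sV: "(\<Sum>i<k. gm u (e i) *\<^sub>R e i) \<in> V"
    using V eV by (intro subspace_sum subspace_scale) auto
  have zV: "z \<in> V"
  proof -
    have "c *\<^sub>R z \<in> V" unfolding z(4) using V u sV by (intro subspace_diff)
    then show ?thesis using subspace_scale[OF V, of "c *\<^sub>R z" "1 / c"] z(3) by simp
  qed
  have "c * l z = l u"
    using arg_cong[OF z(4), of l] eV(2)
    by (simp add: linear_diff[OF l] linear_sum[OF l] linear_scale[OF l])
  then have lz: "l z \<noteq> 0" using u by auto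
  have im: "(e(k := z)) ` {..<Suc k} = insert z (e ` {..<k})"
    by (auto simp: lessThan_Suc image_iff)
  have "span (insert z (e ` {..<k})) = V"
  proof (intro equalityI subsetI)
    fix v assume "v \<in> span (insert z (e ` {..<k}))"
    then show "v \<in> V" using span_minimal[OF _ V, of "insert z (e ` {..<k})"] zV eV by auto
  next
    fix v assume v: "v \<in> V"
    have "v - (l v / l z) *\<^sub>R z \<in> {v \<in> V. l v = 0}"
      using v zV V lz by (auto simp: subspace_diff subspace_scale linear_diff[OF l] linear_scale[OF l])
    then have "v - (l v / l z) *\<^sub>R z \<in> span (e ` {..<k})" using sp by simp
    then show "v \<in> span (insert z (e ` {..<k}))"
      unfolding span_insert by blast
  qed
  then show thesis using that[of z] ons_extend[OF e z(1,2)] im by simp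
qed

text \<open>The spans of the initial segments of the basis form a flag of subalgebras, each of which is
  an ideal of the next.\<close>

lemma adapted_basis:
  assumes sol: "\<And>V. subspace V \<Longrightarrow> V \<subseteq> span {br v w |v w. v \<in> V \<and> w \<in> V} \<Longrightarrow> V \<subseteq> {0}"
  shows "subspace V \<Longrightarrow> (\<And>v w. v \<in> V \<Longrightarrow> w \<in> V \<Longrightarrow> br v w \<in> V) \<Longrightarrow>
    \<exists>e k. ons e k \<and> span (e ` {..<k}) = V \<and>
      (\<forall>i<k. \<forall>l<k. br (e i) (e l) \<in> span (e ` {..<max i l}))"
proof (induction "dim V" arbitrary: V rule: less_induct)
  case less
  show ?case
  proof (cases "V \<subseteq> {0}")
    case True
    then have "V = {0}" using subspace_0[OF less.prems(1)] by auto
    then show ?thesis by (intro exI[of _ "\<lambda>_. 0"] exI[of _ 0]) (simp add: ons_def)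
  next
    case False
    let ?W = "span {br v w |v w. v \<in> V \<and> w \<in> V}"
    have WV: "?W \<subseteq> V" using less.prems by (intro span_minimal) auto
    have "\<not> V \<subseteq> ?W" using sol[OF less.prems(1)] False by blast
    then have "?W \<subset> V" using WV by blast
    then have "span ?W \<subset> span V" using less.prems(1) by (simp add: span_eq_iff[THEN iffD2])
    then obtain x where x: "x \<noteq> 0" "x \<in> span V" "\<And>y. y \<in> span ?W \<Longrightarrow> orthogonal x y"
      using orthogonal_to_subspace_exists_gen[of ?W V] by blast
    \<comment> \<open>Any hyperplane containing all brackets of \<open>V\<close> is an ideal of
      \<open>V\<close>. The inner product of the model space provides a functional that cuts out
      such a hyperplane.\<close>
    define l where "l = (\<lambda>v. x \<bullet> v)"
    have l: "linear l" unfolding l_def by (rule bounded_linear.linear[OF bounded_linear_inner_right])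
    have xV: "x \<in> V" "l x \<noteq> 0" using x less.prems(1) by (auto simp: l_def span_eq_iff[THEN iffD2])
    let ?V = "{v \<in> V. l v = 0}"
    have sub: "subspace ?V"
      using less.prems(1) unfolding subspace_def by (auto simp: linear_0[OF l] linear_add[OF l] linear_scale[OF l])
    have bW: "br v w \<in> ?W" if "v \<in> V" "w \<in> V" for v w using that by (intro span_base) blast
    have WV': "?W \<subseteq> ?V" using WV x(3) by (auto simp: l_def orthogonal_def span_span)
    have "?V \<subset> V" using xV by blast
    then have dless: "dim ?V < dim V"
      using less.prems(1) sub by (intro dim_psubset) (simp add: span_eq_iff[THEN iffD2])
    have closed: "br v w \<in> ?V" if "v \<in> ?V" "w \<in> ?V" for v w using bW[of v w] WV' that by blast
    obtain e k where e: "ons e k" "span (e ` {..<k}) = ?V"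
      "\<And>i m. i < k \<Longrightarrow> m < k \<Longrightarrow> br (e i) (e m) \<in> span (e ` {..<max i m})"
      using less.hyps[OF dless sub closed] by blast
    obtain z where z: "ons (e(k := z)) (Suc k)" "span ((e(k := z)) ` {..<Suc k}) = V"
      using flag_extend[OF e(1) less.prems(1) l e(2) xV] by blast
    have eV: "(e(k := z)) i \<in> V" if "i < Suc k" for i
      using z(2) span_base[of "(e(k := z)) i" "(e(k := z)) ` {..<Suc k}"] that by blast
    have im: "(e(k := z)) ` {..<m} = e ` {..<m}" if "m \<le> k" for m using that by auto
    have "br ((e(k := z)) i) ((e(k := z)) m) \<in> span ((e(k := z)) ` {..<max i m})"
      if "i < Suc k" "m < Suc k" for i m
    proof (cases "i < k \<and> m < k")
      case True
      then show ?thesis using e(3)[of i m] im[of "max i m"] by simp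
    next
      case False
      then have "max i m = k" using that by auto
      then show ?thesis using bW[OF eV[OF that(1)] eV[OF that(2)]] WV' e(2) im[of k] by auto
    qed
    then show ?thesis using z by blast
  qed
qed

text \<open>In the notation of the adapted basis, \<open>Rs n\<close> is the scalar curvature of the \<open>n\<close>-dimensional
  member of the flag.\<close>

definition Rs :: "(nat \<Rightarrow> nat \<Rightarrow> nat \<Rightarrow> real) \<Rightarrow> nat \<Rightarrow> real" where
  "Rs c n = - (\<Sum>i<n. \<Sum>k<n. \<Sum>l<n. (c i k l)\<^sup>2) / 4 - (\<Sum>i<n. \<Sum>k<n. \<Sum>l<n. c i k l * c i l k) / 2
     - (\<Sum>i<n. (\<Sum>k<n. c i k k)\<^sup>2)"

text \<open>A bracket has no component along the new vector. The new index can therefore occupy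
  either input slot in the sum of squares, which gives the factor 2, but only the first slot in the
  sum of products, and each earlier trace is unchanged.\<close>

lemma Rs_Suc:
  fixes c :: "nat \<Rightarrow> nat \<Rightarrow> nat \<Rightarrow> real"
  assumes skew: "\<And>i k l. c i k l = - c k i l" and flag: "\<And>i k l. i \<le> l \<Longrightarrow> k \<le> l \<Longrightarrow> c i k l = 0"
  shows "Rs c (Suc n) = Rs c n - (\<Sum>k<n. \<Sum>l<n. (c n k l)\<^sup>2 + c n k l * c n l k) / 2 - (\<Sum>k<n. c n k k)\<^sup>2"
proof -
  have z: "c i k n = 0" if "i < Suc n" "k < Suc n" for i k using that flag by simp
  have z': "c n n l = 0" for l using skew[of n n l] by simp
  have P: "(\<Sum>i<Suc n. \<Sum>k<Suc n. \<Sum>l<Suc n. (c i k l)\<^sup>2) =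
      (\<Sum>i<n. \<Sum>k<n. \<Sum>l<n. (c i k l)\<^sup>2) + 2 * (\<Sum>k<n. \<Sum>l<n. (c n k l)\<^sup>2)"
  proof -
    have "(c i n l)\<^sup>2 = (c n i l)\<^sup>2" for i l using skew[of i n l] by simp
    then show ?thesis using z z' by (simp add: sum.distrib)
  qed
  have Q: "(\<Sum>i<Suc n. \<Sum>k<Suc n. \<Sum>l<Suc n. c i k l * c i l k) =
      (\<Sum>i<n. \<Sum>k<n. \<Sum>l<n. c i k l * c i l k) + (\<Sum>k<n. \<Sum>l<n. c n k l * c n l k)"
    using z z' by (simp add: sum.distrib)
  have h: "(\<Sum>i<Suc n. (\<Sum>k<Suc n. c i k k)\<^sup>2) = (\<Sum>i<n. (\<Sum>k<n. c i k k)\<^sup>2) + (\<Sum>k<n. c n k k)\<^sup>2"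
    using z by simp
  show ?thesis unfolding Rs_def P Q h by (simp add: sum.distrib field_simps)
qed

text \<open>The double sum is half the squared norm of \<open>a\<close> plus its transpose. Discard
  the off-diagonal entries and apply Cauchy-Schwarz to the diagonal.\<close>

lemma symmetric_part_bound:
  fixes a :: "nat \<Rightarrow> nat \<Rightarrow> real"
  shows "2 * (\<Sum>k<n. a k k)\<^sup>2 \<le> real n * (\<Sum>k<n. \<Sum>l<n. (a k l)\<^sup>2 + a k l * a l k)"
proof -
  have "(\<Sum>k<n. \<Sum>l<n. (a k l)\<^sup>2) = (\<Sum>k<n. \<Sum>l<n. (a l k)\<^sup>2)" by (rule sum.swap)
  then have "2 * (\<Sum>k<n. \<Sum>l<n. (a k l)\<^sup>2 + a k l * a l k) = (\<Sum>k<n. \<Sum>l<n. (a k l + a l k)\<^sup>2)"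
    by (simp add: power2_sum sum.distrib sum_distrib_left[symmetric] mult.assoc)
  also have "\<dots> \<ge> (\<Sum>k<n. (a k k + a k k)\<^sup>2)"
    by (intro sum_mono member_le_sum) auto
  finally have 1: "2 * (\<Sum>k<n. (a k k)\<^sup>2) \<le> (\<Sum>k<n. \<Sum>l<n. (a k l)\<^sup>2 + a k l * a l k)"
    by (simp add: power_mult_distrib sum_distrib_left[symmetric] flip: mult_2)
  have "(\<Sum>k<n. a k k)\<^sup>2 \<le> real n * (\<Sum>k<n. (a k k)\<^sup>2)"
    using Cauchy_Schwarz_ineq_sum[of "\<lambda>_. 1" "\<lambda>k. a k k" "{..<n}"] by simp
  also have "2 * \<dots> \<le> real n * (\<Sum>k<n. \<Sum>l<n. (a k l)\<^sup>2 + a k l * a l k)"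
    using mult_left_mono[OF 1, of "real n"] by simp
  finally show ?thesis by simp
qed

lemma Rs_nonpos:
  fixes c :: "nat \<Rightarrow> nat \<Rightarrow> nat \<Rightarrow> real"
  assumes skew: "\<And>i k l. c i k l = - c k i l" and flag: "\<And>i k l. i \<le> l \<Longrightarrow> k \<le> l \<Longrightarrow> c i k l = 0"
  shows "Rs c n \<le> 0"
proof (induction n)
  case (Suc n)
  have "0 \<le> (\<Sum>k<n. \<Sum>l<n. (c n k l)\<^sup>2 + c n k l * c n l k)"
  proof (cases "n = 0")
    case False
    have "0 \<le> real n * (\<Sum>k<n. \<Sum>l<n. (c n k l)\<^sup>2 + c n k l * c n l k)"
      using symmetric_part_bound[of "c n" n] zero_le_power2[of "\<Sum>k<n. c n k k"] by linarith
    then show ?thesis using False by (simp add: zero_le_mult_iff)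
  qed simp
  then show ?case using Suc Rs_Suc[of c, OF assms, where n = n] zero_le_power2[of "\<Sum>k<n. c n k k"] by linarith
qed (simp add: Rs_def)

text \<open>The symmetric part of the last \<open>c n\<close> has trace \<open>s\<close> and size at most \<open>5\<close>, so its norm
  squared is at least \<open>s\<^sup>2 / 5\<close>; this is where dimension at most six enters.\<close>

lemma Rs_bound:
  fixes c :: "nat \<Rightarrow> nat \<Rightarrow> nat \<Rightarrow> real"
  assumes skew: "\<And>i k l. c i k l = - c k i l" and flag: "\<And>i k l. i \<le> l \<Longrightarrow> k \<le> l \<Longrightarrow> c i k l = 0"
    and n: "n \<le> 5"
  shows "Rs c (Suc n) \<le> - (6 / 5) * (\<Sum>k<n. c n k k)\<^sup>2"
proof (cases "n = 0")
  case True
  then show ?thesis using Rs_nonpos[of c, OF assms(1,2), where n = 1] by simp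
next
  case False
  let ?S = "\<Sum>k<n. \<Sum>l<n. (c n k l)\<^sup>2 + c n k l * c n l k"
  have b: "2 * (\<Sum>k<n. c n k k)\<^sup>2 \<le> real n * ?S" by (rule symmetric_part_bound)
  have "0 \<le> real n * ?S" using b zero_le_power2[of "\<Sum>k<n. c n k k"] by linarith
  then have "0 \<le> ?S" using False by (simp add: zero_le_mult_iff)
  then have "real n * ?S \<le> 5 * ?S" using n by (intro mult_right_mono) auto
  with b have "(\<Sum>k<n. c n k k)\<^sup>2 / 5 \<le> ?S / 2" by linarith
  then show ?thesis using Rs_Suc[of c, OF assms(1,2), where n = n] Rs_nonpos[of c, OF assms(1,2), where n = n] by linarith
qed

subsection \<open>Traces\<close>

text \<open>Permits a change of orthonormal basis: the structure equations are read off in a unitary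
  basis, but the curvature is estimated in one adapted to a flag.\<close>

lemma bilinear_trace_invariant:
  fixes B :: "'e \<Rightarrow> 'e \<Rightarrow> real"
  assumes e: "onb e k" and f: "onb f m" and B: "bilinear B"
  shows "(\<Sum>i<m. B (f i) (f i)) = (\<Sum>i<k. B (e i) (e i))"
proof -
  have B1: "linear (\<lambda>x. B x y)" and B2: "linear (B x)" for x y using B by (auto simp: bilinear_def)
  have "B (f i) (f i) = (\<Sum>p<k. \<Sum>q<k. gm (f i) (e p) * (gm (f i) (e q) * B (e p) (e q)))" for i
  proof -
    have "B (f i) (f i) = (\<Sum>p<k. gm (f i) (e p) * B (e p) (f i))"
      by (rule onb_linear_expand[OF e B1])
    also have "\<dots> = (\<Sum>p<k. gm (f i) (e p) * (\<Sum>q<k. gm (f i) (e q) * B (e p) (e q)))"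
      by (intro sum.cong refl arg_cong2[where f = times] onb_linear_expand[OF e B2])
    finally show ?thesis by (simp only: sum_distrib_left)
  qed
  then have "(\<Sum>i<m. B (f i) (f i)) = (\<Sum>i<m. \<Sum>p<k. \<Sum>q<k. gm (f i) (e p) * (gm (f i) (e q) * B (e p) (e q)))"
    by (simp only:)
  also have "\<dots> = (\<Sum>p<k. \<Sum>q<k. \<Sum>i<m. gm (f i) (e p) * (gm (f i) (e q) * B (e p) (e q)))"
    by (subst sum.swap, rule sum.cong[OF refl], rule sum.swap)
  also have "\<dots> = (\<Sum>p<k. \<Sum>q<k. gm (e p) (e q) * B (e p) (e q))"
  proof (intro sum.cong refl)
    fix p q
    have "gm (e p) (e q) = (\<Sum>i<m. gm (f i) (e p) * gm (f i) (e q))"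
      unfolding gm_sym[of "f _"] by (rule parseval[OF f])
    then show "(\<Sum>i<m. gm (f i) (e p) * (gm (f i) (e q) * B (e p) (e q))) = gm (e p) (e q) * B (e p) (e q)"
      by (simp only: sum_distrib_right mult.assoc)
  qed
  also have "\<dots> = (\<Sum>p<k. \<Sum>q<k. (if p = q then 1 else 0) * B (e p) (e q))"
    using e onsD unfolding onb_def by (intro sum.cong refl) auto
  also have "\<dots> = (\<Sum>p<k. B (e p) (e p))" by (simp add: if_distrib[of "\<lambda>r. r * _"] cong: if_cong)
  finally show ?thesis .
qed

definition tr :: "(nat \<Rightarrow> 'e) \<Rightarrow> nat \<Rightarrow> ('e \<Rightarrow> 'e) \<Rightarrow> real" where
  "tr e k f = (\<Sum>i<k. gm (f (e i)) (e i))"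

lemma tr_eq_sum:
  assumes "onb e k" "linear f"
  shows "tr e k (\<lambda>x. f (g x)) = (\<Sum>i<k. \<Sum>l<k. gm (g (e i)) (e l) * gm (f (e l)) (e i))"
proof -
  have l: "linear (\<lambda>x. gm (f x) y)" for y
    using linear_compose[OF assms(2) linear_gm_left] by (simp add: o_def)
  show ?thesis unfolding tr_def by (intro sum.cong refl onb_linear_expand[OF assms(1) l])
qed

lemma tr_commute:
  assumes "onb e k" "linear f" "linear g"
  shows "tr e k (\<lambda>x. f (g x)) = tr e k (\<lambda>x. g (f x))"
  unfolding tr_eq_sum[OF assms(1,2)] tr_eq_sum[OF assms(1,3)]
  by (subst sum.swap) (simp add: mult.commute)

lemma tr_add: "tr e k (\<lambda>x. f x + g x) = tr e k f + tr e k g"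
  and tr_diff: "tr e k (\<lambda>x. f x - g x) = tr e k f - tr e k g"
  and tr_neg: "tr e k (\<lambda>x. - f x) = - tr e k f"
  and tr_sum: "tr e k (\<lambda>x. \<Sum>i\<in>I. F i x) = (\<Sum>i\<in>I. tr e k (F i))"
  by (simp_all add: tr_def gm_lin sum.distrib sum_subtractf sum_negf sum_distrib_left sum.swap[of _ I])

lemma tr_invariant: "onb e k \<Longrightarrow> onb f m \<Longrightarrow> linear g \<Longrightarrow> tr f m g = tr e k g"
  unfolding tr_def
  by (rule bilinear_trace_invariant)
     (auto simp: bilinear_def intro: linear_gm_right linear_compose[OF _ linear_gm_left, unfolded o_def])

end


section \<open>The trace identities of a Hermitian Lie algebra carrying a twisted structure\<close>

section \<open>Hermitian Lie algebras\<close>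

locale hermitian_lie_algebra = metric_lie_algebra br gm
  for br :: "'e::euclidean_space \<Rightarrow> 'e \<Rightarrow> 'e" and gm +
  fixes j :: "'e \<Rightarrow> 'e"
  assumes linear_j: "linear j" and j_isometry: "\<And>x y. gm (j x) (j y) = gm x y" and j_j [simp]: "\<And>x. j (j x) = - x"
begin

lemmas j_lin = linear_add[OF linear_j] linear_scale[OF linear_j] linear_neg[OF linear_j]
  linear_sum[OF linear_j] linear_diff[OF linear_j] linear_0[OF linear_j]

lemma j_skew: "gm (j x) y = - gm x (j y)"
  using j_isometry[of x "j y"] by (simp add: gm_lin)

lemma gm_j_self: "gm (j x) x = 0"
  using j_skew[of x x] gm_sym[of x "j x"] by simp

lemma ons_j: "ons e k \<Longrightarrow> ons (\<lambda>i. j (e i)) k"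
  by (simp add: ons_def j_isometry)

lemma onb_j: "onb e k \<Longrightarrow> onb (\<lambda>i. j (e i)) k"
  using ons_onb[OF ons_j] onb_dim unfolding onb_def by metis

lemma sum_j_invariant:
  fixes B :: "'e \<Rightarrow> 'e \<Rightarrow> real"
  shows "onb e k \<Longrightarrow> bilinear B \<Longrightarrow> (\<Sum>i<k. B (j (e i)) (j (e i))) = (\<Sum>i<k. B (e i) (e i))"
  using bilinear_trace_invariant[OF _ onb_j] by blast

text \<open>The exterior derivative of the invariant form
  \<open>\<omega>(x, y) = gm (j x) y\<close>; on constant coefficients only the bracket terms of the
  Koszul formula remain.\<close>

definition dom3 :: "'e \<Rightarrow> 'e \<Rightarrow> 'e \<Rightarrow> real" where
  "dom3 x y z = - gm (j (br x y)) z + gm (j (br x z)) y - gm (j (br y z)) x"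

text \<open>The exterior derivative of the 3-form obtained from \<open>dom3\<close> by applying
  \<open>j\<close> to all arguments, that is, dd^c\<omega> on the Lie algebra.\<close>

definition ddc :: "'e \<Rightarrow> 'e \<Rightarrow> 'e \<Rightarrow> 'e \<Rightarrow> real" where
  "ddc x y z u = - dom3 (j (br x y)) (j z) (j u) + dom3 (j (br x z)) (j y) (j u)
     - dom3 (j (br x u)) (j y) (j z) - dom3 (j (br y z)) (j x) (j u)
     + dom3 (j (br y u)) (j x) (j z) - dom3 (j (br z u)) (j x) (j y)"

lemma dom3_lin: "linear (\<lambda>x. dom3 x y z)" "linear (\<lambda>y. dom3 x y z)" "linear (\<lambda>z. dom3 x y z)"
  by (rule linearI; simp add: dom3_def br_lin j_lin gm_lin algebra_simps)+

lemma dom3_skew: "dom3 x y z = - dom3 y x z" "dom3 x y z = - dom3 x z y"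
proof -
  have s: "gm (j (br y x)) z = - gm (j (br x y)) z" for x y z
    by (subst br_skew) (simp only: j_lin gm_lin)
  show "dom3 x y z = - dom3 y x z" "dom3 x y z = - dom3 x z y"
    using s[of y x z] s[of z x y] s[of z y x] by (simp_all add: dom3_def)
qed

lemma dom3_cyclic: "dom3 x y z = dom3 y z x"
  using dom3_skew(1)[of x y z] dom3_skew(2)[of y x z] by simp

lemma dom3_neg: "dom3 (- x) y z = - dom3 x y z" "dom3 x (- y) z = - dom3 x y z" "dom3 x y (- z) = - dom3 x y z"
  by (fact linear_neg[OF dom3_lin(1)], fact linear_neg[OF dom3_lin(2)], fact linear_neg[OF dom3_lin(3)])

lemma dom3_zero_if_basis:
  assumes "onb e k" "\<And>i l m. i < k \<Longrightarrow> l < k \<Longrightarrow> m < k \<Longrightarrow> dom3 (e i) (e l) (e m) = 0"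
  shows "dom3 x y z = 0"
proof -
  have 1: "dom3 (e i) (e l) z = 0" if "i < k" "l < k" for i l z
    using onb_linear_expand[OF assms(1) dom3_lin(3), of "e i" "e l" z] assms(2)[OF that] by simp
  have 2: "dom3 (e i) y z = 0" if "i < k" for i y z
    using onb_linear_expand[OF assms(1) dom3_lin(2), of "e i" y z] 1[OF that] by simp
  show ?thesis
    using onb_linear_expand[OF assms(1) dom3_lin(1), of x y z] 2 by simp
qed

end

text \<open>The assumptions express, in this order: integrability of \<open>J\<close>, the two formulas for the Lee form
  coming from \<open>d\<Psi> = \<theta> \<and> \<Psi>\<close> and from \<open>d\<omega>\<^sup>n\<^sup>-\<^sup>1 = \<theta> \<and> \<omega>\<^sup>n\<^sup>-\<^sup>1\<close>, and \<open>dd\<^sup>c\<omega> = 0\<close>.\<close>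

locale twisted_lie_algebra = hermitian_lie_algebra br gm j
  for br :: "'e::euclidean_space \<Rightarrow> 'e \<Rightarrow> 'e" and gm j +
  fixes e :: "nat \<Rightarrow> 'e" and k :: nat and \<theta> :: "'e \<Rightarrow> real"
  assumes basis: "onb e k" and linear_\<theta>: "linear \<theta>"
    and nijenhuis: "\<And>x y. br x y - br (j x) (j y) + j (br (j x) y) + j (br x (j y)) = 0"
    and theta_psi: "\<And>x. \<theta> x = - (tr e k (br x) + tr e k (\<lambda>y. j (br (j x) y))) / 2"
    and theta_lee: "\<And>x. (\<Sum>i<k. dom3 (e i) (j (e i)) x) = 2 * \<theta> x"
    and skt: "\<And>x y z u. ddc x y z u = 0"
begin

definition h :: "'e \<Rightarrow> real" where "h x = tr e k (br x)"

text \<open>This vector links the two descriptions of the Lee form: up to \<open>h\<close>, the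
  covector \<open>\<theta>\<close> is a multiple of the metric dual of \<open>j w\<close>.\<close>

definition w :: 'e where "w = (\<Sum>i<k. br (e i) (j (e i)))"

lemma linear_h: "linear h"
  by (rule linearI) (simp_all add: h_def tr_def br_lin gm_lin sum.distrib sum_distrib_left)

lemma lin_compose2:
  "linear (\<lambda>x. j (br x y))" "linear (\<lambda>y. j (br x y))" "linear (\<lambda>x. br (j x) y)" "linear (\<lambda>y. br x (j y))"
  "linear (\<lambda>y. j (br (j x) y))"
  by (rule linearI; simp add: br_lin j_lin)+

text \<open>In the contraction of \<open>dom3\<close> the first term assembles \<open>w\<close>; the
  other two each give \<open>- h x\<close>, the second of them after replacing the basis by its
  image under \<open>j\<close>.\<close>

lemma lee_trace: "- gm (j w) x - 2 * h x = 2 * \<theta> x"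
proof -
  have B: "bilinear (\<lambda>y z. gm (br y x) z)"
    by (auto simp: bilinear_def intro!: linearI simp: br_lin gm_lin)
  have 1: "gm (j (br (e i) x)) (j (e i)) = gm (br (e i) x) (e i)" for i by (rule j_isometry)
  have 2: "gm (j (br (j (e i)) x)) (e i) = - gm (br (j (e i)) x) (j (e i))" for i by (rule j_skew)
  have "gm (br (e i) x) (e i) = - gm (br x (e i)) (e i)" for i using br_skew[of "e i" x] by (simp add: gm_lin)
  then have "(\<Sum>i<k. gm (br (e i) x) (e i)) = - h x" by (simp add: h_def tr_def sum_negf)
  then show ?thesis
    using theta_lee[of x] sum_j_invariant[OF basis B]
    by (simp add: dom3_def 1 2 w_def sum.distrib sum_subtractf sum_negf j_lin gm_lin)
qed

text \<open>Evaluate \<open>theta_psi\<close> and \<open>lee_trace\<close> at \<open>j x\<close> and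
  eliminate \<theta>. What remains expresses the trace of J ad x through \<open>w\<close> and
  \<open>h\<close>.\<close>

lemma kappa: "tr e k (\<lambda>y. j (br x y)) + gm w x + h (j x) = 0"
proof -
  have "j (br (j (j x)) y) = - j (br x y)" for y by (simp add: br_lin j_lin)
  then have "tr e k (\<lambda>y. j (br (j (j x)) y)) = - tr e k (\<lambda>y. j (br x y))" by (simp add: tr_neg)
  then have "2 * \<theta> (j x) = - h (j x) + tr e k (\<lambda>y. j (br x y))"
    using theta_psi[of "j x"] by (simp add: h_def)
  moreover have "gm (j w) (j x) = gm w x" by (rule j_isometry)
  ultimately show ?thesis using lee_trace[of "j x"] by simp
qed

text \<open>The one second-order trace that survives in the curvature: eliminating \<open>P\<close>,
  \<open>Q\<close> and \<open>Q1\<close> below gives R = - DD / 12 - T - |h|^2.\<close>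

definition T :: real where "T = (\<Sum>i<k. tr e k (\<lambda>y. j (br (e i) (br (j (e i)) y))))"

lemma T_flip: "(\<Sum>i<k. tr e k (\<lambda>y. j (br (j (e i)) (br (e i) y)))) = - T"
proof -
  have "bilinear (\<lambda>x z. tr e k (\<lambda>y. j (br x (br (j z) y))))"
    by (auto simp: bilinear_def tr_def intro!: linearI
        simp: br_lin j_lin gm_lin sum.distrib sum_distrib_left)
  from sum_j_invariant[OF basis this]
  have "(\<Sum>i<k. tr e k (\<lambda>y. - j (br (j (e i)) (br (e i) y)))) = T"
    by (simp add: T_def br_lin j_lin)
  then show ?thesis by (simp add: tr_neg sum_negf)
qed

text \<open>The Jacobi identity makes ad of [e_i, J e_i] a commutator of adjoint maps; its two
  halves, traced against J, are \<open>T\<close> and, by \<open>T_flip\<close>,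
  \<open>- T\<close>.\<close>

lemma tr_ad_w: "tr e k (\<lambda>y. j (br w y)) = 2 * T"
proof -
  have "br (br x z) y = br x (br z y) - br z (br x y)" for x z y
  proof -
    have "br (br z y) x = - br x (br z y)" by (rule br_skew)
    moreover have "br (br y x) z = br z (br x y)"
      using br_skew[of "br y x" z] br_skew[of y x] by (simp add: br_lin)
    ultimately have "br (br x z) y - (br x (br z y) - br z (br x y)) =
        br (br x z) y + br (br z y) x + br (br y x) z" by simp
    then show ?thesis unfolding jacobi by (simp only: right_minus_eq)
  qed
  then have "tr e k (\<lambda>y. j (br w y)) =
      (\<Sum>i<k. tr e k (\<lambda>y. j (br (e i) (br (j (e i)) y))) - tr e k (\<lambda>y. j (br (j (e i)) (br (e i) y))))"
    by (simp add: w_def br_lin j_lin tr_sum tr_diff)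
  then show ?thesis using T_flip by (simp add: sum_subtractf T_def)
qed

text \<open>\<open>kappa\<close> at \<open>w\<close> itself gives 2T + |w|^2 + h(Jw) = 0. The last
  two terms follow from |w| = |Jw| and from the dual of Jw, which is -2\<theta> - 2h by
  \<open>lee_trace\<close>.\<close>

lemma tr_formula:
  "T = - 2 * (\<Sum>i<k. (\<theta> (e i))\<^sup>2) - 3 * (\<Sum>i<k. \<theta> (e i) * h (e i)) - (\<Sum>i<k. (h (e i))\<^sup>2)"
  and theta_jw: "\<theta> (j w) = - 2 * (\<Sum>i<k. (\<theta> (e i))\<^sup>2) - 2 * (\<Sum>i<k. \<theta> (e i) * h (e i))"
proof -
  have g: "gm (j w) (e i) = - 2 * \<theta> (e i) - 2 * h (e i)" for i using lee_trace[of "e i"] by simp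
  have "gm w w = gm (j w) (j w)" by (simp add: j_isometry)
  also have "\<dots> = (\<Sum>i<k. gm (j w) (e i) * gm (j w) (e i))" by (rule parseval[OF basis])
  finally have ww: "gm w w = 4 * (\<Sum>i<k. (\<theta> (e i))\<^sup>2) + 8 * (\<Sum>i<k. \<theta> (e i) * h (e i)) + 4 * (\<Sum>i<k. (h (e i))\<^sup>2)"
    by (simp add: g sum_distrib_left sum.distrib[symmetric] power2_eq_square algebra_simps)
  have "h (j w) = (\<Sum>i<k. gm (j w) (e i) * h (e i))" by (rule onb_linear_expand[OF basis linear_h])
  then have hw: "h (j w) = - 2 * (\<Sum>i<k. \<theta> (e i) * h (e i)) - 2 * (\<Sum>i<k. (h (e i))\<^sup>2)"
    by (simp add: g sum_distrib_left sum_subtractf[symmetric] sum_negf[symmetric] power2_eq_square algebra_simps)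
  have "\<theta> (j w) = (\<Sum>i<k. gm (j w) (e i) * \<theta> (e i))" by (rule onb_linear_expand[OF basis linear_\<theta>])
  then show "\<theta> (j w) = - 2 * (\<Sum>i<k. (\<theta> (e i))\<^sup>2) - 2 * (\<Sum>i<k. \<theta> (e i) * h (e i))"
    by (simp add: g sum_distrib_left sum_subtractf[symmetric] sum_negf[symmetric] power2_eq_square algebra_simps)
  show "T = - 2 * (\<Sum>i<k. (\<theta> (e i))\<^sup>2) - 3 * (\<Sum>i<k. \<theta> (e i) * h (e i)) - (\<Sum>i<k. (h (e i))\<^sup>2)"
    using kappa[of w] tr_ad_w ww hw by simp
qed

text \<open>\<open>P\<close> is the squared norm of the structure constants, \<open>Q\<close> the
  metric trace of the Killing form, \<open>Q1\<close> its analogue for J ad. \<open>DD\<close> runs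
  over ordered triples, hence is six times the norm of a 3-form counted over increasing
  triples.\<close>

definition P :: real where "P = (\<Sum>i<k. \<Sum>l<k. \<Sum>m<k. (gm (br (e i) (e l)) (e m))\<^sup>2)"
definition Q :: real where "Q = (\<Sum>i<k. tr e k (\<lambda>y. br (e i) (br (e i) y)))"
definition Q1 :: real where "Q1 = (\<Sum>i<k. tr e k (\<lambda>y. j (br (e i) (j (br (e i) y)))))"
definition DD :: real where "DD = (\<Sum>i<k. \<Sum>l<k. \<Sum>m<k. (dom3 (e i) (e l) (e m))\<^sup>2)"

text \<open>Integrability, composed with J, is applied to the pair x, J[x, y] and traced over y. The
  four traces are \<open>Q1\<close>, \<open>Q\<close> and two forms of \<open>T\<close>, related by
  cyclicity of the trace and \<open>T_flip\<close>.\<close>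

lemma Q1_eq: "Q1 = 2 * T - Q"
proof -
  have m: "j (br x y) - br x (j y) - br (j x) y - j (br (j x) (j y)) = 0" for x y
    using arg_cong[OF nijenhuis[of x y], of j] by (simp add: j_lin algebra_simps)
  have "tr e k (\<lambda>y. j (br x (j (br x y)))) + tr e k (\<lambda>y. br x (br x y))
      - tr e k (\<lambda>y. br (j x) (j (br x y))) + tr e k (\<lambda>y. j (br (j x) (br x y))) = 0" for x
  proof -
    have "tr e k (\<lambda>y. j (br x (j (br x y))) + br x (br x y) - br (j x) (j (br x y)) + j (br (j x) (br x y))) =
        tr e k (\<lambda>y. 0)"
    proof (rule arg_cong[where f = "tr e k"], rule ext)
      fix y
      show "j (br x (j (br x y))) + br x (br x y) - br (j x) (j (br x y)) + j (br (j x) (br x y)) = 0"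
        using m[of x "j (br x y)"] by (simp add: br_lin j_lin)
    qed
    moreover have "tr e k (\<lambda>y. 0) = 0" by (simp add: tr_def gm_lin)
    ultimately show ?thesis by (simp add: tr_add tr_diff)
  qed
  moreover have "tr e k (\<lambda>y. br (j x) (j (br x y))) = tr e k (\<lambda>y. j (br x (br (j x) y)))" for x
    using tr_commute[OF basis linear_br_right lin_compose2(2), of "j x" x] .
  ultimately have "(\<Sum>i<k. tr e k (\<lambda>y. j (br (e i) (j (br (e i) y)))) + tr e k (\<lambda>y. br (e i) (br (e i) y))
      - tr e k (\<lambda>y. j (br (e i) (br (j (e i)) y))) + tr e k (\<lambda>y. j (br (j (e i)) (br (e i) y)))) = 0"
    by simp
  then show ?thesis using T_flip by (simp add: sum.distrib sum_subtractf Q1_def Q_def T_def)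
qed

text \<open>Components of J composed with the bracket; d\<omega> is minus their cyclic sum.\<close>

definition a :: "nat \<Rightarrow> nat \<Rightarrow> nat \<Rightarrow> real" where "a i l m = gm (j (br (e i) (e l))) (e m)"

lemma dom3_a: "dom3 (e i) (e l) (e m) = - (a i l m + a l m i + a m i l)"
  using br_skew[of "e i" "e m"] by (simp add: dom3_def a_def j_lin gm_lin)

lemma sum_cyclic:
  fixes F :: "nat \<Rightarrow> nat \<Rightarrow> nat \<Rightarrow> real"
  shows "(\<Sum>i<k. \<Sum>l<k. \<Sum>m<k. F l m i) = (\<Sum>i<k. \<Sum>l<k. \<Sum>m<k. F i l m)"
  by (subst sum.swap, rule sum.cong[OF refl], rule sum.swap)

text \<open>Squaring the cyclic sum gives three squares, each summing to \<open>P\<close>, and three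
  doubled cross terms, each product summing to \<open>- Q1\<close>.\<close>

lemma DD_eq: "DD = 3 * P - 6 * Q1"
proof -
  have "P = (\<Sum>i<k. \<Sum>l<k. gm (br (e i) (e l)) (br (e i) (e l)))"
    unfolding P_def power2_eq_square by (intro sum.cong refl parseval[OF basis, symmetric])
  also have "\<dots> = (\<Sum>i<k. \<Sum>l<k. gm (j (br (e i) (e l))) (j (br (e i) (e l))))"
    by (simp only: j_isometry)
  also have "\<dots> = (\<Sum>i<k. \<Sum>l<k. \<Sum>m<k. (a i l m)\<^sup>2)"
    unfolding a_def power2_eq_square by (intro sum.cong refl parseval[OF basis])
  finally have P: "P = (\<Sum>i<k. \<Sum>l<k. \<Sum>m<k. (a i l m)\<^sup>2)" .
  have "Q1 = (\<Sum>l<k. \<Sum>i<k. \<Sum>m<k. gm (j (br (e l) (e i))) (e m) * gm (j (br (e l) (e m))) (e i))"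
    unfolding Q1_def by (intro sum.cong refl tr_eq_sum[OF basis lin_compose2(2)])
  also have "\<dots> = (\<Sum>i<k. \<Sum>l<k. \<Sum>m<k. gm (j (br (e l) (e i))) (e m) * gm (j (br (e l) (e m))) (e i))"
    by (rule sum.swap)
  also have "\<dots> = (\<Sum>i<k. \<Sum>l<k. \<Sum>m<k. - (a i l m * a l m i))"
  proof (intro sum.cong refl)
    fix i l m
    show "gm (j (br (e l) (e i))) (e m) * gm (j (br (e l) (e m))) (e i) = - (a i l m * a l m i)"
      using br_skew[of "e l" "e i"] by (simp add: a_def j_lin gm_lin)
  qed
  finally have Q1: "(\<Sum>i<k. \<Sum>l<k. \<Sum>m<k. a i l m * a l m i) = - Q1" by (simp add: sum_negf)
  have c1: "(\<Sum>i<k. \<Sum>l<k. \<Sum>m<k. (a l m i)\<^sup>2) = P" unfolding P by (rule sum_cyclic)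
  have c2: "(\<Sum>i<k. \<Sum>l<k. \<Sum>m<k. (a m i l)\<^sup>2) = P"
    unfolding c1[symmetric] by (rule sum_cyclic[of "\<lambda>i l m. (a l m i)\<^sup>2", simplified])
  have c3: "(\<Sum>i<k. \<Sum>l<k. \<Sum>m<k. a l m i * a m i l) = - Q1"
    unfolding Q1[symmetric] by (rule sum_cyclic[of "\<lambda>i l m. a i l m * a l m i"])
  have c4: "(\<Sum>i<k. \<Sum>l<k. \<Sum>m<k. a m i l * a i l m) = - Q1"
    unfolding c3[symmetric] by (rule sum_cyclic[of "\<lambda>i l m. a l m i * a m i l", simplified])
  have "DD = (\<Sum>i<k. \<Sum>l<k. \<Sum>m<k. (a i l m)\<^sup>2 + (a l m i)\<^sup>2 + (a m i l)\<^sup>2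
      + 2 * (a i l m * a l m i) + 2 * (a l m i * a m i l) + 2 * (a m i l * a i l m))"
    unfolding DD_def dom3_a by (intro sum.cong refl) (simp add: power2_eq_square algebra_simps)
  also have "\<dots> = P + P + P + 2 * - Q1 + 2 * - Q1 + 2 * - Q1"
    using c1 c2 c3 c4 Q1 P by (simp only: sum.distrib sum_distrib_left[symmetric])
  finally show ?thesis by simp
qed

text \<open>Contract dd^c\<omega> = 0 over e_i, J e_i, e_l, J e_l. Four of the six terms become the
  same sum \<open>K\<close> and the other two give 2\<theta>(Jw) each, so K = \<theta>(Jw). Since
  d\<omega> is cyclic, each third of its cyclic expansion against itself gives the same sum, and DD
  = -3K.\<close>

lemma DD_skt: "DD = 6 * ((\<Sum>i<k. (\<theta> (e i))\<^sup>2) + (\<Sum>i<k. \<theta> (e i) * h (e i)))"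
proof -
  let ?J = "\<lambda>i. j (e i)"
  define K where "K = (\<Sum>i<k. \<Sum>l<k. dom3 (j (br (e i) (e l))) (e i) (e l))"
  have lw: "(\<Sum>l<k. dom3 (j w) (e l) (?J l)) = 2 * \<theta> (j w)"
    using theta_lee[of "j w"] dom3_cyclic[of "j w"] by simp
  have lin1: "linear (\<lambda>x. dom3 (j x) y z)" for y z
    using linear_compose[OF linear_j dom3_lin(1)] by (simp add: o_def)
  have t1: "(\<Sum>i<k. \<Sum>l<k. dom3 (j (br (e i) (?J i))) (e l) (?J l)) = 2 * \<theta> (j w)"
  proof -
    have "(\<Sum>i<k. dom3 (j (br (e i) (?J i))) (e l) (?J l)) = dom3 (j w) (e l) (?J l)" for l
      by (simp add: w_def linear_sum[OF lin1, symmetric])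
    then show ?thesis using lw by (subst sum.swap) simp
  qed
  have t2: "(\<Sum>i<k. \<Sum>l<k. dom3 (j (br (e l) (?J l))) (e i) (?J i)) = 2 * \<theta> (j w)"
    using t1 by (subst sum.swap)
  have bi: "bilinear (\<lambda>y z. dom3 (j (br x y)) u z)" "bilinear (\<lambda>y z. dom3 (j (br y x)) z u)" for x u
    unfolding bilinear_def
    using linear_compose[OF lin_compose2(2) dom3_lin(1)] linear_compose[OF lin_compose2(1) dom3_lin(1)]
    by (auto simp: o_def intro: dom3_lin)
  have k1: "(\<Sum>l<k. dom3 (j (br x (?J l))) u (?J l)) = (\<Sum>l<k. dom3 (j (br x (e l))) u (e l))" for x u
    using sum_j_invariant[OF basis bi(1)] .
  have k2: "(\<Sum>i<k. dom3 (j (br (?J i) x)) (?J i) u) = (\<Sum>i<k. dom3 (j (br (e i) x)) (e i) u)" for x u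
    using sum_j_invariant[OF basis bi(2)] .
  have K1: "(\<Sum>i<k. \<Sum>l<k. dom3 (j (br (e i) (?J l))) (e i) (?J l)) = K" unfolding K_def k1 ..
  have K2: "(\<Sum>i<k. \<Sum>l<k. dom3 (j (br (?J i) (e l))) (?J i) (e l)) = K"
    unfolding K_def by (subst (1 2) sum.swap) (simp only: k2)
  have K3: "(\<Sum>i<k. \<Sum>l<k. dom3 (j (br (?J i) (?J l))) (?J i) (?J l)) = K"
    unfolding k1 by (rule K2)
  have "ddc (e i) (?J i) (e l) (?J l) =
      dom3 (j (br (e i) (?J i))) (?J l) (e l) + dom3 (j (br (e i) (e l))) (e i) (e l)
      + dom3 (j (br (e i) (?J l))) (e i) (?J l) + dom3 (j (br (?J i) (e l))) (?J i) (e l)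
      + dom3 (j (br (?J i) (?J l))) (?J i) (?J l) + dom3 (j (br (e l) (?J l))) (?J i) (e i)" for i l
    by (simp add: ddc_def dom3_neg)
  then have "0 = dom3 (j (br (e i) (e l))) (e i) (e l)
      + dom3 (j (br (e i) (?J l))) (e i) (?J l) + dom3 (j (br (?J i) (e l))) (?J i) (e l)
      + dom3 (j (br (?J i) (?J l))) (?J i) (?J l)
      - dom3 (j (br (e i) (?J i))) (e l) (?J l) - dom3 (j (br (e l) (?J l))) (e i) (?J i)" for i l
    using skt[of "e i" "?J i" "e l" "?J l"] dom3_skew(2)[of "j (br (e i) (?J i))" "?J l" "e l"]
      dom3_skew(2)[of "j (br (e l) (?J l))" "?J i" "e i"] by simp
  then have "0 = (\<Sum>i<k. \<Sum>l<k. dom3 (j (br (e i) (e l))) (e i) (e l)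
      + dom3 (j (br (e i) (?J l))) (e i) (?J l) + dom3 (j (br (?J i) (e l))) (?J i) (e l)
      + dom3 (j (br (?J i) (?J l))) (?J i) (?J l)
      - dom3 (j (br (e i) (?J i))) (e l) (?J l) - dom3 (j (br (e l) (?J l))) (e i) (?J i))"
    by simp
  also have "\<dots> = K + K + K + K - 2 * \<theta> (j w) - 2 * \<theta> (j w)"
    by (simp only: sum.distrib sum_subtractf K1 K2 K3 t1 t2 K_def[symmetric])
  finally have K: "K = \<theta> (j w)" by simp
  have "K = (\<Sum>i<k. \<Sum>l<k. \<Sum>m<k. a i l m * dom3 (e i) (e l) (e m))"
    unfolding K_def
  proof (intro sum.cong refl)
    fix i l
    have "dom3 (j (br (e i) (e l))) (e i) (e l) =
        (\<Sum>m<k. gm (j (br (e i) (e l))) (e m) * dom3 (e m) (e i) (e l))"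
      by (rule onb_linear_expand[OF basis dom3_lin(1)])
    then show "dom3 (j (br (e i) (e l))) (e i) (e l) = (\<Sum>m<k. a i l m * dom3 (e i) (e l) (e m))"
      by (simp add: a_def dom3_cyclic[symmetric])
  qed
  moreover have c: "(\<Sum>i<k. \<Sum>l<k. \<Sum>m<k. a l m i * dom3 (e i) (e l) (e m)) =
      (\<Sum>i<k. \<Sum>l<k. \<Sum>m<k. a i l m * dom3 (e i) (e l) (e m))"
  proof -
    have "(\<Sum>i<k. \<Sum>l<k. \<Sum>m<k. a l m i * dom3 (e i) (e l) (e m)) =
        (\<Sum>i<k. \<Sum>l<k. \<Sum>m<k. a l m i * dom3 (e l) (e m) (e i))"
      by (intro sum.cong refl arg_cong2[where f = times] dom3_cyclic)
    also have "\<dots> = (\<Sum>i<k. \<Sum>l<k. \<Sum>m<k. a i l m * dom3 (e i) (e l) (e m))" by (rule sum_cyclic)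
    finally show ?thesis .
  qed
  moreover have "(\<Sum>i<k. \<Sum>l<k. \<Sum>m<k. a m i l * dom3 (e i) (e l) (e m)) =
      (\<Sum>i<k. \<Sum>l<k. \<Sum>m<k. a l m i * dom3 (e i) (e l) (e m))"
  proof -
    have "(\<Sum>i<k. \<Sum>l<k. \<Sum>m<k. a m i l * dom3 (e i) (e l) (e m)) =
        (\<Sum>i<k. \<Sum>l<k. \<Sum>m<k. a m i l * dom3 (e l) (e m) (e i))"
      by (intro sum.cong refl arg_cong2[where f = times] dom3_cyclic)
    also have "\<dots> = (\<Sum>i<k. \<Sum>l<k. \<Sum>m<k. a l m i * dom3 (e i) (e l) (e m))"
      by (rule sum_cyclic[of "\<lambda>i l m. a l m i * dom3 (e i) (e l) (e m)"])
    finally show ?thesis .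
  qed
  moreover have "DD = - (\<Sum>i<k. \<Sum>l<k. \<Sum>m<k. a i l m * dom3 (e i) (e l) (e m)
      + a l m i * dom3 (e i) (e l) (e m) + a m i l * dom3 (e i) (e l) (e m))"
  proof -
    have "(dom3 (e i) (e l) (e m))\<^sup>2 = - (a i l m * dom3 (e i) (e l) (e m)
        + a l m i * dom3 (e i) (e l) (e m) + a m i l * dom3 (e i) (e l) (e m))" for i l m
      unfolding power2_eq_square by (subst (1) dom3_a) (simp add: algebra_simps)
    then show ?thesis unfolding DD_def by (simp only: sum_negf)
  qed
  ultimately have "DD = - (K + K + K)" by (simp only: sum.distrib)
  then show ?thesis using K theta_jw by simp
qed

text \<open>With P = DD/3 + 2 Q1 and Q1 + Q = 2T the curvature reduces to -DD/12 - T - |h|^2, and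
  the value of \<open>T\<close> cancels the term |h|^2.\<close>

lemma Rs_eq:
  "Rs (\<lambda>i l m. gm (br (e i) (e l)) (e m)) k =
    3 / 2 * (\<Sum>i<k. (\<theta> (e i))\<^sup>2) + 5 / 2 * (\<Sum>i<k. \<theta> (e i) * h (e i))"
proof -
  have "Q = (\<Sum>i<k. \<Sum>l<k. \<Sum>m<k. gm (br (e i) (e l)) (e m) * gm (br (e i) (e m)) (e l))"
    unfolding Q_def by (intro sum.cong refl tr_eq_sum[OF basis linear_br_right])
  then have "Rs (\<lambda>i l m. gm (br (e i) (e l)) (e m)) k = - P / 4 - Q / 2 - (\<Sum>i<k. (h (e i))\<^sup>2)"
    by (simp add: Rs_def P_def h_def tr_def)
  then show ?thesis using DD_eq Q1_eq DD_skt tr_formula by simp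
qed

end

section \<open>From the curvature identity to torsion-freeness, and linear algebra over a unitary
  basis\<close>

context hermitian_lie_algebra
begin

subsection \<open>Vanishing of the Lee form\<close>

lemma ons_mono: "ons e k \<Longrightarrow> m \<le> k \<Longrightarrow> ons e m"
  by (simp add: ons_def)

text \<open>As \<theta> annihilates brackets, its kernel is an ideal containing all of them. A flag
  of this kernel followed by its unit normal is again a flag of ideals, so \<theta> is concentrated
  on the last basis vector.\<close>

lemma theta_basis:
  assumes sol: "\<And>V. subspace V \<Longrightarrow> V \<subseteq> span {br v w |v w. v \<in> V \<and> w \<in> V} \<Longrightarrow> V \<subseteq> {0}"
    and \<theta>: "linear \<theta>" "\<And>x y. \<theta> (br x y) = (0::real)" and nz: "\<theta> x0 \<noteq> 0"
  obtains e m where "onb e (Suc m)" "\<And>i. i < m \<Longrightarrow> \<theta> (e i) = 0" "\<theta> (e m) \<noteq> 0"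
    "\<And>i l q. i < Suc m \<Longrightarrow> l < Suc m \<Longrightarrow> q < Suc m \<Longrightarrow> i \<le> q \<Longrightarrow> l \<le> q \<Longrightarrow> gm (br (e i) (e l)) (e q) = 0"
proof -
  let ?V = "{x. \<theta> x = 0}"
  have V: "subspace ?V" unfolding subspace_def by (auto simp: linear_0[OF \<theta>(1)] linear_add[OF \<theta>(1)] linear_scale[OF \<theta>(1)])
  obtain e m where e: "ons e m" "span (e ` {..<m}) = ?V"
    "\<And>i l. i < m \<Longrightarrow> l < m \<Longrightarrow> br (e i) (e l) \<in> span (e ` {..<max i l})"
    using adapted_basis[OF sol V] \<theta>(2) by blast
  have "span (e ` {..<m}) = {v \<in> UNIV. \<theta> v = 0}" using e(2) by simp
  then obtain z where z: "ons (e(m := z)) (Suc m)" "span ((e(m := z)) ` {..<Suc m}) = UNIV"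
    using flag_extend[OF e(1) subspace_UNIV \<theta>(1) _ UNIV_I nz] by blast
  let ?e = "e(m := z)"
  have b: "onb ?e (Suc m)" using z by (simp add: onb_def)
  have th0: "\<theta> (?e i) = 0" if "i < m" for i using that e(2) span_base[of "e i" "e ` {..<m}"] by auto
  have nzm: "\<theta> (?e m) \<noteq> 0"
  proof -
    have "\<theta> x0 = (\<Sum>i<Suc m. gm x0 (?e i) * \<theta> (?e i))" by (rule onb_linear_expand[OF b \<theta>(1)])
    also have "\<dots> = gm x0 (?e m) * \<theta> (?e m)" using th0 by simp
    finally show ?thesis using nz by auto
  qed
  have "gm (br (?e i) (?e l)) (?e q) = 0"
    if q: "i < Suc m" "l < Suc m" "q < Suc m" "i \<le> q" "l \<le> q" for i l q
  proof -
    have "br (?e i) (?e l) \<in> span (?e ` {..<q})"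
    proof (cases "q = m")
      case True
      have "?e ` {..<m} = e ` {..<m}" by auto
      then show ?thesis using True e(2) \<theta>(2) by auto
    next
      case False
      then have "q < m" "i < m" "l < m" using q by auto
      have m: "br (e i) (e l) \<in> span (e ` {..<max i l})" by (rule e(3)) fact+
      have "e ` {..<max i l} \<subseteq> ?e ` {..<q}" using q \<open>q < m\<close> by auto
      from subsetD[OF span_mono[OF this] m] show ?thesis using \<open>i < m\<close> \<open>l < m\<close> by simp
    qed
    moreover have "ons ?e q" using ons_mono[OF z(1)] q by simp
    ultimately have "br (?e i) (?e l) = (\<Sum>p<q. gm (br (?e i) (?e l)) (?e p) *\<^sub>R ?e p)"
      using ons_expand by blast
    then have "gm (br (?e i) (?e l)) (?e q) = gm (\<Sum>p<q. gm (br (?e i) (?e l)) (?e p) *\<^sub>R ?e p) (?e q)" by simp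
    also have "\<dots> = (\<Sum>p<q. gm (br (?e i) (?e l)) (?e p) * gm (?e p) (?e q))" by (simp only: gm_lin real_scaleR_def)
    also have "\<dots> = 0"
    proof (intro sum.neutral ballI)
      fix p assume "p \<in> {..<q}"
      then have "gm (?e p) (?e q) = 0" using onsD[OF z(1), of p q] q by (simp del: fun_upd_apply)
      then show "gm (br (?e i) (?e l)) (?e p) * gm (?e p) (?e q) = 0" by (simp only: mult_zero_right)
    qed
    finally show ?thesis .
  qed
  with b th0 nzm show thesis by (rule that)
qed

lemma solvable_twisted_torsion_free:
  assumes sol: "\<And>V. subspace V \<Longrightarrow> V \<subseteq> span {br v w |v w. v \<in> V \<and> w \<in> V} \<Longrightarrow> V \<subseteq> {0}"
    and dim: "DIM('e) \<le> 6"
    and \<theta>: "linear \<theta>" "\<And>x y. \<theta> (br x y) = 0"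
    and nij: "\<And>x y. br x y - br (j x) (j y) + j (br (j x) y) + j (br x (j y)) = 0"
    and f: "onb f m"
    and psi: "\<And>x. \<theta> x = - (tr f m (br x) + tr f m (\<lambda>y. j (br (j x) y))) / 2"
    and lee: "\<And>x. (\<Sum>i<m. dom3 (f i) (j (f i)) x) = 2 * \<theta> x"
    and skt: "\<And>x y z u. ddc x y z u = 0"
  shows "\<theta> x = 0" "dom3 x y z = 0"
proof -
  \<comment> \<open>All hypotheses are traces, so they hold in every orthonormal basis; this is used
    for the flag basis in the estimate and for the given basis at the end.\<close>
  have tw: "twisted_lie_algebra br gm j e k \<theta>" if e: "onb e k" for e k
  proof (intro twisted_lie_algebra.intro twisted_lie_algebra_axioms.intro hermitian_lie_algebra_axioms)
    show "onb e k" "linear \<theta>" by fact+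
    show "br x y - br (j x) (j y) + j (br (j x) y) + j (br x (j y)) = 0" for x y by (rule nij)
    have l: "linear (\<lambda>y. j (br (j x) y))" for x by (rule linearI) (simp_all add: br_lin j_lin)
    show "\<theta> x = - (tr e k (br x) + tr e k (\<lambda>y. j (br (j x) y))) / 2" for x
      unfolding psi[of x] tr_invariant[OF e f linear_br_right] tr_invariant[OF e f l] ..
    have "bilinear (\<lambda>y z. dom3 y (j z) x)" for x
      unfolding bilinear_def using linear_compose[OF linear_j dom3_lin(2)] by (auto simp: o_def intro: dom3_lin)
    from bilinear_trace_invariant[OF e f this]
    show "(\<Sum>i<k. dom3 (e i) (j (e i)) x) = 2 * \<theta> x" for x using lee by simp
    show "ddc x y z u = 0" for x y z u by (rule skt)
  qed
  have t0: "\<theta> x = 0" for x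
  proof (rule ccontr)
    assume "\<theta> x \<noteq> 0"
    from theta_basis[OF sol \<theta> this] obtain e n where e: "onb e (Suc n)" "\<And>i. i < n \<Longrightarrow> \<theta> (e i) = 0" "\<theta> (e n) \<noteq> 0"
      "\<And>i l q. i < Suc n \<Longrightarrow> l < Suc n \<Longrightarrow> q < Suc n \<Longrightarrow> i \<le> q \<Longrightarrow> l \<le> q \<Longrightarrow> gm (br (e i) (e l)) (e q) = 0"
      by blast
    interpret tw: twisted_lie_algebra br gm j e "Suc n" \<theta> by (rule tw[OF e(1)])
    \<comment> \<open>Extended by zero, because the curvature lemmas ask for skewness and the flag
      condition at all indices.\<close>
    define c where "c i l q = (if i < Suc n \<and> l < Suc n \<and> q < Suc n then gm (br (e i) (e l)) (e q) else 0)" for i l q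
    have skew: "c i l q = - c l i q" for i l q
      using br_skew[of "e i" "e l"] by (simp add: c_def gm_lin)
    have flag: "c i l q = 0" if "i \<le> q" "l \<le> q" for i l q using e(4) that by (simp add: c_def)
    have "n \<le> 5" using onb_dim[OF e(1)] dim by simp
    then have "Rs c (Suc n) \<le> - (6 / 5) * (\<Sum>l<n. c n l l)\<^sup>2" using Rs_bound[of c n] skew flag by blast
    moreover have "Rs c (Suc n) = Rs (\<lambda>i l q. gm (br (e i) (e l)) (e q)) (Suc n)"
      unfolding Rs_def by (intro arg_cong2[where f = "(-)"] arg_cong[where f = uminus] arg_cong2[where f = "(/)"]
          sum.cong refl arg_cong[where f = "\<lambda>r. r\<^sup>2"]) (auto simp: c_def)
    moreover have "(\<Sum>i<Suc n. (\<theta> (e i))\<^sup>2) = (\<theta> (e n))\<^sup>2" using e(2) by simp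
    moreover have "(\<Sum>i<Suc n. \<theta> (e i) * tw.h (e i)) = \<theta> (e n) * tw.h (e n)" using e(2) by simp
    moreover have "tw.h (e n) = (\<Sum>l<n. c n l l)"
      by (simp add: tw.h_def tr_def c_def e(4))
    ultimately have A: "3 / 2 * (\<theta> (e n))\<^sup>2 + 5 / 2 * (\<theta> (e n) * tw.h (e n)) \<le> - (6 / 5) * (tw.h (e n))\<^sup>2"
      using tw.Rs_eq by simp
    \<comment> \<open>Completing the square in \<open>s\<close>: the shift is (5/2) / (2 * 6/5) =
      25/24, and the remainder is 3/2 - 6/5 * (25/24)^2 = 19/96.\<close>
    have B: "3 / 2 * a\<^sup>2 + 5 / 2 * (a * s) + 6 / 5 * s\<^sup>2 = 6 / 5 * (s + 25 / 24 * a)\<^sup>2 + 19 / 96 * a\<^sup>2" for a s :: real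
      by (simp add: power2_eq_square field_simps)
    have "6 / 5 * (tw.h (e n) + 25 / 24 * \<theta> (e n))\<^sup>2 + 19 / 96 * (\<theta> (e n))\<^sup>2 > 0"
      using e(3) by (intro add_nonneg_pos) auto
    then show False using A B[of "\<theta> (e n)" "tw.h (e n)"] by linarith
  qed
  show "\<theta> x = 0" by (rule t0)
  interpret tw: twisted_lie_algebra br gm j f m \<theta> by (rule tw[OF f])
  have "(\<Sum>i<m. \<Sum>l<m. \<Sum>q<m. (dom3 (f i) (f l) (f q))\<^sup>2) = 0"
    using tw.DD_skt t0 unfolding tw.DD_def by simp
  then have "\<forall>i\<in>{..<m}. \<forall>l\<in>{..<m}. \<forall>q\<in>{..<m}. dom3 (f i) (f l) (f q) = 0"
    by (simp add: sum_nonneg_eq_0_iff sum_nonneg)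
  then have "dom3 (f i) (f l) (f q) = 0" if "i < m" "l < m" "q < m" for i l q
    using that by blast
  then show "dom3 x y z = 0" by (rule dom3_zero_if_basis[OF f])
qed

subsection \<open>Unitary bases\<close>

definition unitary :: "(nat \<Rightarrow> 'e) \<Rightarrow> nat \<Rightarrow> bool" where
  "unitary u n \<longleftrightarrow> (\<forall>a<n. \<forall>b<n. gm (u a) (u b) = (if a = b then 1 else 0) \<and> gm (j (u a)) (u b) = 0)"

definition real_basis :: "(nat \<Rightarrow> 'e) \<Rightarrow> nat \<Rightarrow> 'e" where
  "real_basis u i = (if even i then u (i div 2) else j (u (i div 2)))"

lemma unitary_ons:
  assumes "unitary u n"
  shows "ons (real_basis u) (2 * n)"
  unfolding ons_def
proof (intro allI impI)
  fix i l assume il: "i < 2 * n" "l < 2 * n"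
  then have d: "i div 2 < n" "l div 2 < n" by auto
  have g: "gm (u (i div 2)) (u (l div 2)) = (if i div 2 = l div 2 then 1 else 0)"
    "gm (j (u (i div 2))) (u (l div 2)) = 0" "gm (j (u (l div 2))) (u (i div 2)) = 0"
    using assms d unfolding unitary_def by auto
  have g': "gm (u (i div 2)) (j (u (l div 2))) = 0" using g(3) gm_sym by metis
  have "i = l \<longleftrightarrow> i div 2 = l div 2 \<and> (even i \<longleftrightarrow> even l)" by (metis even_two_times_div_two odd_two_times_div_two_succ)
  then show "gm (real_basis u i) (real_basis u l) = (if i = l then 1 else 0)"
    using g g' by (auto simp: real_basis_def j_isometry)
qed

text \<open>Gram-Schmidt two dimensions at a time. A unit vector orthogonal to every
  \<open>u a\<close> and \<open>j (u a)\<close> brings along its image under \<open>j\<close>, which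
  is orthogonal to them as well because \<open>j\<close> is skew.\<close>

lemma unitary_exists:
  assumes "2 * n \<le> DIM('e)"
  shows "\<exists>u. unitary u n"
  using assms
proof (induction n)
  case 0
  then show ?case by (simp add: unitary_def)
next
  case (Suc n)
  then obtain u where u: "unitary u n" by auto
  note o = unitary_ons[OF u]
  have "dim (span (real_basis u ` {..<2 * n})) < DIM('e)" using ons_dim[OF o] Suc.prems by simp
  then have "span (real_basis u ` {..<2 * n}) \<noteq> UNIV" by (metis dim_UNIV less_irrefl)
  then obtain y where "y \<notin> span (real_basis u ` {..<2 * n})" by auto
  from ons_complement[OF o this] obtain z where z: "gm z z = 1" "\<And>i. i < 2 * n \<Longrightarrow> gm z (real_basis u i) = 0"
    by metis
  have z1: "gm z (u a) = 0" "gm z (j (u a)) = 0" if "a < n" for a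
    using z(2)[of "2 * a"] z(2)[of "2 * a + 1"] that by (simp_all add: real_basis_def)
  have "unitary (u(n := z)) (Suc n)"
    unfolding unitary_def
  proof (intro allI impI)
    fix a b assume "a < Suc n" "b < Suc n"
    then consider "a < n" "b < n" | "a < n" "b = n" | "a = n" "b < n" | "a = n" "b = n" by linarith
    then show "gm ((u(n := z)) a) ((u(n := z)) b) = (if a = b then 1 else 0) \<and> gm (j ((u(n := z)) a)) ((u(n := z)) b) = 0"
    proof cases
      case 1 then show ?thesis using u by (simp add: unitary_def)
    next
      case 2 then show ?thesis using z1[of a] gm_sym[of "u a" z] gm_sym[of "j (u a)" z] by simp
    next
      case 3 then show ?thesis using z1[of b] j_skew[of z "u b"] by simp
    next
      case 4 then show ?thesis using z(1) gm_j_self by simp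
    qed
  qed
  then show ?case by blast
qed

lemma sum_real_basis:
  fixes F :: "'e \<Rightarrow> real"
  shows "(\<Sum>i<2 * n. F (real_basis u i)) = (\<Sum>a<n. F (u a) + F (j (u a)))"
  by (induction n) (simp_all add: real_basis_def)

lemma unitary_onb: "unitary u n \<Longrightarrow> DIM('e) = 2 * n \<Longrightarrow> onb (real_basis u) (2 * n)"
  using ons_onb[of "real_basis u"] unitary_ons[of u n] by simp

text \<open>The last two hypotheses say that \<open>f\<close> is complex linear for the structure
  \<open>j\<close>, over which the \<open>u a\<close> form a basis; the complex coefficient has real
  and imaginary parts along \<open>u a\<close> and \<open>j (u a)\<close>.\<close>

lemma complex_linear_expand:
  fixes f :: "'e \<Rightarrow> complex"
  assumes u: "unitary u n" "DIM('e) = 2 * n" and f: "linear f" "\<And>x. f (j x) = \<i> * f x"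
  shows "f x = (\<Sum>a<n. Complex (gm x (u a)) (gm x (j (u a))) * f (u a))"
proof -
  have R: "linear (\<lambda>x. Re (f x))" "linear (\<lambda>x. Im (f x))"
    by (rule linearI; simp add: linear_add[OF f(1)] linear_scale[OF f(1)])+
  have "Re (f x) = (\<Sum>a<n. gm x (u a) * Re (f (u a)) + gm x (j (u a)) * Re (f (j (u a))))"
    using onb_linear_expand[OF unitary_onb[OF u] R(1), of x] sum_real_basis[of "\<lambda>y. gm x y * Re (f y)" u n] by simp
  moreover have "Im (f x) = (\<Sum>a<n. gm x (u a) * Im (f (u a)) + gm x (j (u a)) * Im (f (j (u a))))"
    using onb_linear_expand[OF unitary_onb[OF u] R(2), of x] sum_real_basis[of "\<lambda>y. gm x y * Im (f y)" u n] by simp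
  ultimately show ?thesis by (simp add: complex_eq_iff f(2) sum.distrib[symmetric] sum_subtractf[symmetric])
qed

text \<open>The \<open>J\<close>-linear part of \<open>ad\<close>: for integrable \<open>J\<close> this is the action of the \<open>(0,1)\<close>-part
  of \<open>x\<close> on the quotient by the \<open>(0,1)\<close>-vectors.\<close>

definition ad01 :: "'e \<Rightarrow> 'e \<Rightarrow> 'e" where "ad01 x y = br x y + j (br (j x) y)"

text \<open>The Nijenhuis tensor up to sign.\<close>

definition nij :: "'e \<Rightarrow> 'e \<Rightarrow> 'e" where
  "nij x y = br x y - br (j x) (j y) + j (br (j x) y) + j (br x (j y))"

lemma ad01_j: "nij x y = 0 \<Longrightarrow> ad01 x (j y) = j (ad01 x y)"
proof -
  assume "nij x y = 0"
  then have "j (nij x y) = 0" by (simp add: j_lin)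
  then show ?thesis by (simp add: nij_def ad01_def j_lin algebra_simps)
qed

text \<open>For a map commuting with J, the real trace is twice the sum over the vectors
  \<open>u a\<close> alone.\<close>

lemma theta_from_trace:
  assumes u: "unitary u n" and nij: "\<And>x y. nij x y = 0"
    and t: "\<theta> x = - (\<Sum>a<n. gm (ad01 x (u a)) (u a))"
  shows "\<theta> x = - (tr (real_basis u) (2 * n) (br x) + tr (real_basis u) (2 * n) (\<lambda>y. j (br (j x) y))) / 2"
proof -
  have "tr (real_basis u) (2 * n) (br x) + tr (real_basis u) (2 * n) (\<lambda>y. j (br (j x) y)) =
      tr (real_basis u) (2 * n) (ad01 x)"
    unfolding ad01_def by (rule tr_add[symmetric])
  also have "\<dots> = (\<Sum>a<n. gm (ad01 x (u a)) (u a) + gm (ad01 x (j (u a))) (j (u a)))"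
    unfolding tr_def by (rule sum_real_basis)
  also have "\<dots> = (\<Sum>a<n. gm (ad01 x (u a)) (u a) + gm (ad01 x (u a)) (u a))"
    by (simp add: ad01_j[OF nij] j_isometry)
  finally show ?thesis using t by (simp add: sum_distrib_left[symmetric] flip: mult_2)
qed

text \<open>The contributions of \<open>u b\<close> and \<open>j (u b)\<close> to the full
  contraction coincide, which is the factor 2.\<close>

lemma lee_from_trace:
  assumes u: "unitary u n" "DIM('e) = 2 * n" and \<theta>: "linear \<theta>"
    and l: "\<And>a. a < n \<Longrightarrow> (\<Sum>b<n. dom3 (u b) (j (u b)) (u a)) = \<theta> (u a)"
    "\<And>a. a < n \<Longrightarrow> (\<Sum>b<n. dom3 (u b) (j (u b)) (j (u a))) = \<theta> (j (u a))"
  shows "(\<Sum>i<2 * n. dom3 (real_basis u i) (j (real_basis u i)) x) = 2 * \<theta> x"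
proof -
  have lin: "linear (\<lambda>x. \<Sum>b<n. dom3 (u b) (j (u b)) x)"
    by (intro linear_compose_sum ballI dom3_lin)
  have "(\<Sum>b<n. dom3 (u b) (j (u b)) x) = \<theta> x" for x
  proof -
    have "(\<Sum>b<n. dom3 (u b) (j (u b)) (real_basis u i)) = \<theta> (real_basis u i)" if "i < 2 * n" for i
      using l that by (simp add: real_basis_def)
    then show ?thesis
      using onb_linear_expand[OF unitary_onb[OF u] lin, of x] onb_linear_expand[OF unitary_onb[OF u] \<theta>, of x]
      by simp
  qed
  moreover have "dom3 (j y) (j (j y)) x = dom3 y (j y) x" for y
    using dom3_skew(1)[of "j y" y x] by (simp add: dom3_neg)
  ultimately show ?thesis
    using sum_real_basis[of "\<lambda>y. dom3 y (j y) x" u n] by (simp add: sum_distrib_left[symmetric])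
qed

end

section \<open>What d\<Psi> = \<theta> \<and> \<Psi> says on the Lie algebra: integrability and a
  trace formula for \<theta>\<close>

subsection \<open>The structure equation of the complex volume form\<close>

context hermitian_lie_algebra
begin

lemma unitary_coefficients_zero:
  assumes u: "unitary u n" "DIM('e) = 2 * n"
    and z: "\<And>a. a < n \<Longrightarrow> Complex (gm x (u a)) (gm x (j (u a))) = 0"
  shows "x = 0"
proof -
  have "gm x (real_basis u i) = 0" if "i < 2 * n" for i
    using z[of "i div 2"] that by (simp add: real_basis_def complex_eq_iff)
  then show ?thesis using onb_expand[OF unitary_onb[OF u], of x] by simp
qed

text \<open>Combine the equation at (x, y), (Jx, Jy), (Jx, y) and (x, Jy) as in the Nijenhuis
  tensor: being complex linear in every slot, \<Psi> cancels everything except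
  \<Psi>(\<open>nij x y\<close>, z), and nondegeneracy makes \<open>nij\<close> vanish.\<close>

lemma volume_form_2:
  fixes \<Psi> :: "'e \<Rightarrow> 'e \<Rightarrow> complex" and \<theta> :: "'e \<Rightarrow> real"
  assumes u: "unitary u 2" "DIM('e) = 2 * 2"
    and lin: "\<And>y. linear (\<lambda>x. \<Psi> x y)" and alt: "\<And>x y. \<Psi> x y = - \<Psi> y x"
    and J: "\<And>x y. \<Psi> (j x) y = \<i> * \<Psi> x y" and nz: "\<Psi> (u 0) (u 1) \<noteq> 0"
    and eq: "\<And>x y z. - \<Psi> (br x y) z + \<Psi> (br x z) y - \<Psi> (br y z) x =
      \<theta> x * \<Psi> y z - \<theta> y * \<Psi> x z + \<theta> z * \<Psi> x y"
  shows "nij x y = 0" "\<theta> x = - (\<Sum>a<2. gm (ad01 x (u a)) (u a))"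
proof -
  have self: "\<Psi> x x = 0" for x using alt[of x x] by simp
  have J2: "\<Psi> x (j y) = \<i> * \<Psi> x y" for x y
    using J[of y x] alt[of x "j y"] alt[of y x] by simp
  have add: "\<Psi> (a + b) y = \<Psi> a y + \<Psi> b y" "\<Psi> (a - b) y = \<Psi> a y - \<Psi> b y" for a b y
    using linear_add[OF lin] linear_diff[OF lin] by auto
  let ?c = "\<lambda>v a. Complex (gm v (u a)) (gm v (j (u a)))"
  let ?p = "\<Psi> (u 0) (u 1)"
  have ex: "\<Psi> v y = ?c v 0 * \<Psi> (u 0) y + ?c v 1 * \<Psi> (u 1) y" for v y
    using complex_linear_expand[OF u lin J, of v y] by (simp add: numeral_2_eq_2)
  have ex0: "\<Psi> v (u 1) = ?c v 0 * ?p" and ex1: "\<Psi> v (u 0) = - ?c v 1 * ?p" for v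
    using ex[of v "u 1"] ex[of v "u 0"] self alt[of "u 1" "u 0"] by simp_all
  have "\<Psi> (nij x y) z = 0" for z
  proof -
    have e: "\<Psi> (br x y) z = \<Psi> (br x z) y - \<Psi> (br y z) x - (\<theta> x * \<Psi> y z - \<theta> y * \<Psi> x z + \<theta> z * \<Psi> x y)" for x y
      using eq[of x y z] by (simp add: algebra_simps)
    show ?thesis
      unfolding nij_def add J e by (simp add: J J2 algebra_simps)
  qed
  then have "?c (nij x y) a = 0" if "a < 2" for a
    using ex0[of "nij x y"] ex1[of "nij x y"] nz that by (auto simp: less_2_cases_iff)
  then show "nij x y = 0" by (rule unitary_coefficients_zero[OF u])
  \<comment> \<open>Adding \<i> times the equation at \<open>j x\<close> kills every term that has
    \<open>x\<close> inside \<Psi>; the brackets with \<open>x\<close> assemble into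
    \<open>ad01\<close>. As \<theta> is real, taking real parts afterwards separates
    \<open>\<theta> x\<close> from \<open>\<theta> (j x)\<close>.\<close>
  have "- \<Psi> (ad01 x (u 0)) (u 1) + \<Psi> (ad01 x (u 1)) (u 0) = (\<theta> x + \<i> * \<theta> (j x)) * ?p"
    using arg_cong2[OF eq[of x "u 0" "u 1"] arg_cong[OF eq[of "j x" "u 0" "u 1"], of "\<lambda>z. \<i> * z"], of "(+)"]
    by (simp add: ad01_def add J J2 algebra_simps)
  then have "- (?c (ad01 x (u 0)) 0 + ?c (ad01 x (u 1)) 1) * ?p = (\<theta> x + \<i> * \<theta> (j x)) * ?p"
    unfolding ex0[of "ad01 x (u 0)"] ex1[of "ad01 x (u 1)"] by (simp add: algebra_simps)
  then have "- (?c (ad01 x (u 0)) 0 + ?c (ad01 x (u 1)) 1) = \<theta> x + \<i> * \<theta> (j x)"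
    by (rule mult_right_cancel[OF nz, THEN iffD1])
  then show "\<theta> x = - (\<Sum>a<2. gm (ad01 x (u a)) (u a))"
    by (simp add: complex_eq_iff numeral_2_eq_2)
qed

text \<open>The same two contractions as in complex dimension two, with one more argument carried
  along.\<close>

lemma volume_form_3:
  fixes \<Psi> :: "'e \<Rightarrow> 'e \<Rightarrow> 'e \<Rightarrow> complex" and \<theta> :: "'e \<Rightarrow> real"
  assumes u: "unitary u 3" "DIM('e) = 2 * 3"
    and lin: "\<And>y z. linear (\<lambda>x. \<Psi> x y z)"
    and alt: "\<And>x y z. \<Psi> x y z = - \<Psi> y x z" "\<And>x y z. \<Psi> x y z = - \<Psi> x z y"
    and J: "\<And>x y z. \<Psi> (j x) y z = \<i> * \<Psi> x y z" and nz: "\<Psi> (u 0) (u 1) (u 2) \<noteq> 0"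
    and eq: "\<And>x y z t. - \<Psi> (br x y) z t + \<Psi> (br x z) y t - \<Psi> (br x t) y z - \<Psi> (br y z) x t
        + \<Psi> (br y t) x z - \<Psi> (br z t) x y =
      \<theta> x * \<Psi> y z t - \<theta> y * \<Psi> x z t + \<theta> z * \<Psi> x y t - \<theta> t * \<Psi> x y z"
  shows "nij x y = 0" "\<theta> x = - (\<Sum>a<3. gm (ad01 x (u a)) (u a))"
proof -
  have self: "\<Psi> x x y = 0" "\<Psi> x y y = 0" "\<Psi> x y x = 0" for x y
    using alt(1)[of x x y] alt(2)[of x y y] alt(1)[of x y x] alt(2)[of y x x] by simp_all
  have J2: "\<Psi> x (j y) z = \<i> * \<Psi> x y z" for x y z
    using J[of y x z] alt(1)[of x "j y" z] alt(1)[of y x z] by simp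
  have J3: "\<Psi> x y (j z) = \<i> * \<Psi> x y z" for x y z
    using J2[of x z y] alt(2)[of x y "j z"] alt(2)[of x z y] by simp
  have add: "\<Psi> (a + b) y z = \<Psi> a y z + \<Psi> b y z" "\<Psi> (a - b) y z = \<Psi> a y z - \<Psi> b y z" for a b y z
    using linear_add[OF lin] linear_diff[OF lin] by auto
  let ?c = "\<lambda>v a. Complex (gm v (u a)) (gm v (j (u a)))"
  let ?p = "\<Psi> (u 0) (u 1) (u 2)"
  have ex: "\<Psi> v y z = ?c v 0 * \<Psi> (u 0) y z + ?c v 1 * \<Psi> (u 1) y z + ?c v 2 * \<Psi> (u 2) y z" for v y z
    using complex_linear_expand[OF u lin J, of v y z] by (simp add: numeral_3_eq_3 numeral_2_eq_2)
  have p: "\<Psi> (u 1) (u 0) (u 2) = - ?p" "\<Psi> (u 2) (u 0) (u 1) = ?p"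
    using alt(1)[of "u 1" "u 0" "u 2"] alt(1)[of "u 2" "u 0" "u 1"] alt(2)[of "u 0" "u 2" "u 1"] by simp_all
  have ex0: "\<Psi> v (u 1) (u 2) = ?c v 0 * ?p" and ex1: "\<Psi> v (u 0) (u 2) = - ?c v 1 * ?p"
    and ex2: "\<Psi> v (u 0) (u 1) = ?c v 2 * ?p" for v
    using ex[of v "u 1" "u 2"] ex[of v "u 0" "u 2"] ex[of v "u 0" "u 1"] self p by simp_all
  have "\<Psi> (nij x y) z t = 0" for z t
  proof -
    have e: "\<Psi> (br x y) z t = \<Psi> (br x z) y t - \<Psi> (br x t) y z - \<Psi> (br y z) x t
        + \<Psi> (br y t) x z - \<Psi> (br z t) x y
        - (\<theta> x * \<Psi> y z t - \<theta> y * \<Psi> x z t + \<theta> z * \<Psi> x y t - \<theta> t * \<Psi> x y z)" for x y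
      using eq[of x y z t] by (simp add: algebra_simps)
    show ?thesis
      unfolding nij_def add J e[of x y] e[of "j x" y] e[of x "j y"] e[of "j x" "j y"]
      by (simp add: J J2 J3 algebra_simps)
  qed
  then have "?c (nij x y) a = 0" if "a < 3" for a
    using ex0[of "nij x y"] ex1[of "nij x y"] ex2[of "nij x y"] nz that
    by (auto simp: numeral_3_eq_3 numeral_2_eq_2 less_Suc_eq)
  then show "nij x y = 0" by (rule unitary_coefficients_zero[OF u])
  have "- \<Psi> (ad01 x (u 0)) (u 1) (u 2) + \<Psi> (ad01 x (u 1)) (u 0) (u 2) - \<Psi> (ad01 x (u 2)) (u 0) (u 1) =
      (\<theta> x + \<i> * \<theta> (j x)) * ?p"
    using arg_cong2[OF eq[of x "u 0" "u 1" "u 2"] arg_cong[OF eq[of "j x" "u 0" "u 1" "u 2"], of "\<lambda>z. \<i> * z"], of "(+)"]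
    by (simp add: ad01_def add J J2 J3 algebra_simps)
  then have "- (?c (ad01 x (u 0)) 0 + ?c (ad01 x (u 1)) 1 + ?c (ad01 x (u 2)) 2) * ?p = (\<theta> x + \<i> * \<theta> (j x)) * ?p"
    unfolding ex0[of "ad01 x (u 0)"] ex1[of "ad01 x (u 1)"] ex2[of "ad01 x (u 2)"] by (simp add: algebra_simps)
  then have "- (?c (ad01 x (u 0)) 0 + ?c (ad01 x (u 1)) 1 + ?c (ad01 x (u 2)) 2) = \<theta> x + \<i> * \<theta> (j x)"
    by (rule mult_right_cancel[OF nz, THEN iffD1])
  then show "\<theta> x = - (\<Sum>a<3. gm (ad01 x (u a)) (u a))"
    by (simp add: complex_eq_iff numeral_3_eq_3 numeral_2_eq_2)
qed

end

section \<open>Closed forms of the signed permutation sums in \<open>wedge\<close>, up to six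
  arguments\<close>

section \<open>Wedge products on few arguments\<close>

text \<open>Every permutation of \<open>Suc n\<close> points is uniquely one that fixes
  \<open>n\<close> followed by a transposition of \<open>n\<close> with some \<open>b\<close>. This
  gives a recursion that never enumerates a set of permutations.\<close>

lemma sum_permutes_Suc:
  fixes F :: "(nat \<Rightarrow> nat) \<Rightarrow> 'k::comm_ring_1"
  shows "(\<Sum>\<sigma> | \<sigma> permutes {..<Suc n}. of_int (sign \<sigma>) * F \<sigma>) =
    (\<Sum>b<Suc n. (if b = n then 1 else - 1) *
      (\<Sum>q | q permutes {..<n}. of_int (sign q) * F (Transposition.transpose n b \<circ> q)))"
proof -
  have s: "of_int (sign (Transposition.transpose n b \<circ> q)) = (if b = n then 1 else - 1) * (of_int (sign q) :: 'k)"
    if "q permutes {..<n}" for b q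
    using sign_compose[OF permutation_swap_id permutes_imp_permutation[OF finite_lessThan that], of n b]
    by (simp add: sign_swap_id)
  have "(\<Sum>\<sigma> | \<sigma> permutes {..<Suc n}. of_int (sign \<sigma>) * F \<sigma>) =
      (\<Sum>b\<in>insert n {..<n}. \<Sum>q | q permutes {..<n}.
        of_int (sign (Transposition.transpose n b \<circ> q)) * F (Transposition.transpose n b \<circ> q))"
    unfolding lessThan_Suc by (subst sum_over_permutations_insert) auto
  also have "\<dots> = (\<Sum>b<Suc n. \<Sum>q | q permutes {..<n}.
      (if b = n then 1 else - 1) * (of_int (sign q) * F (Transposition.transpose n b \<circ> q)))"
    unfolding lessThan_Suc by (intro sum.cong refl) (simp add: s)
  finally show ?thesis by (simp only: sum_distrib_left)
qed

lemma sum_permutes_0: "(\<Sum>\<sigma> | \<sigma> permutes {}. of_int (sign \<sigma>) * F \<sigma>) = F id"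
  by (simp add: permutes_empty)

lemmas permutation_sum = sum_permutes_Suc sum_permutes_0

lemma sum_permutes_2:
  fixes F :: "nat \<Rightarrow> nat \<Rightarrow> 'k::comm_ring_1"
  shows "(\<Sum>\<sigma> | \<sigma> permutes {..<2}. of_int (sign \<sigma>) * F (\<sigma> 0) (\<sigma> 1)) = F 0 1 - F 1 0"
  by (simp add: numeral_2_eq_2 permutation_sum Transposition.transpose_def)

text \<open>Sums over all arrangements of the arguments with signs, without normalising factor;
  \<open>alt4\<close> expands along the first argument.\<close>

definition alt3 :: "(nat \<Rightarrow> nat \<Rightarrow> nat \<Rightarrow> 'k::comm_ring_1) \<Rightarrow> nat \<Rightarrow> nat \<Rightarrow> nat \<Rightarrow> 'k" where
 "alt3 F a b c = F a b c - F a c b - F b a c + F b c a + F c a b - F c b a"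
definition alt4 :: "(nat \<Rightarrow> nat \<Rightarrow> nat \<Rightarrow> nat \<Rightarrow> 'k::comm_ring_1) \<Rightarrow> nat \<Rightarrow> nat \<Rightarrow> nat \<Rightarrow> nat \<Rightarrow> 'k" where
 "alt4 F a b c d = alt3 (F a) b c d - alt3 (F b) a c d + alt3 (F c) a b d - alt3 (F d) a b c"

lemma sum_permutes_3:
  fixes F :: "nat \<Rightarrow> nat \<Rightarrow> nat \<Rightarrow> 'k::comm_ring_1"
  shows "(\<Sum>\<sigma> | \<sigma> permutes {..<3}. of_int (sign \<sigma>) * F (\<sigma> 0) (\<sigma> 1) (\<sigma> 2)) = alt3 F 0 1 2"
  by (simp add: numeral_3_eq_3 numeral_2_eq_2 permutation_sum Transposition.transpose_def alt3_def algebra_simps)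

lemma sum_permutes_4:
  fixes F :: "nat \<Rightarrow> nat \<Rightarrow> nat \<Rightarrow> nat \<Rightarrow> 'k::comm_ring_1"
  shows "(\<Sum>\<sigma> | \<sigma> permutes {..<4}. of_int (sign \<sigma>) * F (\<sigma> 0) (\<sigma> 1) (\<sigma> 2) (\<sigma> 3)) = alt4 F 0 1 2 3"
  by (simp add: eval_nat_numeral permutation_sum Transposition.transpose_def alt4_def alt3_def algebra_simps)

text \<open>Expansion along the last argument. Exchanging it with one of the others is a
  transposition, hence the uniform minus signs; this is the shape that
  \<open>sum_permutes_Suc\<close> delivers.\<close>

definition alt5 where
  "alt5 F a b c d e = alt4 (\<lambda>x y z w. F x y z w e) a b c d - alt4 (\<lambda>x y z w. F x y z w a) e b c d
     - alt4 (\<lambda>x y z w. F x y z w b) a e c d - alt4 (\<lambda>x y z w. F x y z w c) a b e d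
     - alt4 (\<lambda>x y z w. F x y z w d) a b c e"

definition alt6 where
  "alt6 F a b c d e f = alt5 (\<lambda>x y z w v. F x y z w v f) a b c d e - alt5 (\<lambda>x y z w v. F x y z w v a) f b c d e
     - alt5 (\<lambda>x y z w v. F x y z w v b) a f c d e - alt5 (\<lambda>x y z w v. F x y z w v c) a b f d e
     - alt5 (\<lambda>x y z w v. F x y z w v d) a b c f e - alt5 (\<lambda>x y z w v. F x y z w v e) a b c d f"

lemma sum_permutes_5:
  fixes F :: "nat \<Rightarrow> nat \<Rightarrow> nat \<Rightarrow> nat \<Rightarrow> nat \<Rightarrow> 'k::comm_ring_1"
  shows "(\<Sum>\<sigma> | \<sigma> permutes {..<5}. of_int (sign \<sigma>) * F (\<sigma> 0) (\<sigma> 1) (\<sigma> 2) (\<sigma> 3) (\<sigma> 4)) =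
    alt5 F 0 1 2 3 4"
proof -
  let ?t = "Transposition.transpose (4::nat)"
  have 5: "{..<5} = {..<Suc 4}" by simp
  have "(\<Sum>\<sigma> | \<sigma> permutes {..<5}. of_int (sign \<sigma>) * F (\<sigma> 0) (\<sigma> 1) (\<sigma> 2) (\<sigma> 3) (\<sigma> 4)) =
      (\<Sum>b<Suc 4. (if b = 4 then 1 else - 1) * (\<Sum>q | q permutes {..<4}. of_int (sign q) *
        F (?t b (q 0)) (?t b (q 1)) (?t b (q 2)) (?t b (q 3)) b))"
    unfolding 5 sum_permutes_Suc[of "\<lambda>\<sigma>. F (\<sigma> 0) (\<sigma> 1) (\<sigma> 2) (\<sigma> 3) (\<sigma> 4)"]
  proof (intro sum.cong refl arg_cong2[where f = times])
    fix b q :: _ assume "q \<in> {\<sigma>. \<sigma> permutes {..<4::nat}}"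
    then have "q 4 = 4" by (auto simp: permutes_def)
    then show "F ((?t b \<circ> q) 0) ((?t b \<circ> q) 1) ((?t b \<circ> q) 2) ((?t b \<circ> q) 3) ((?t b \<circ> q) 4) =
      F (?t b (q 0)) (?t b (q 1)) (?t b (q 2)) (?t b (q 3)) b" by simp
  qed
  also have "\<dots> = (\<Sum>b<Suc 4. (if b = 4 then 1 else - 1) *
      alt4 (\<lambda>x y z w. F x y z w b) (?t b 0) (?t b 1) (?t b 2) (?t b 3))"
    by (simp only: sum_permutes_4[of "\<lambda>x y z w. F (?t _ x) (?t _ y) (?t _ z) (?t _ w) _"] alt4_def alt3_def)
  also have "\<dots> = alt5 F 0 1 2 3 4"
    by (simp add: alt5_def eval_nat_numeral Transposition.transpose_def)
  finally show ?thesis .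
qed

lemma sum_permutes_6:
  fixes F :: "nat \<Rightarrow> nat \<Rightarrow> nat \<Rightarrow> nat \<Rightarrow> nat \<Rightarrow> nat \<Rightarrow> 'k::comm_ring_1"
  shows "(\<Sum>\<sigma> | \<sigma> permutes {..<6}. of_int (sign \<sigma>) * F (\<sigma> 0) (\<sigma> 1) (\<sigma> 2) (\<sigma> 3) (\<sigma> 4) (\<sigma> 5)) =
    alt6 F 0 1 2 3 4 5"
proof -
  let ?t = "Transposition.transpose (5::nat)"
  have 6: "{..<6} = {..<Suc 5}" by simp
  have "(\<Sum>\<sigma> | \<sigma> permutes {..<6}. of_int (sign \<sigma>) * F (\<sigma> 0) (\<sigma> 1) (\<sigma> 2) (\<sigma> 3) (\<sigma> 4) (\<sigma> 5)) =
      (\<Sum>b<Suc 5. (if b = 5 then 1 else - 1) * (\<Sum>q | q permutes {..<5}. of_int (sign q) *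
        F (?t b (q 0)) (?t b (q 1)) (?t b (q 2)) (?t b (q 3)) (?t b (q 4)) b))"
    unfolding 6 sum_permutes_Suc[of "\<lambda>\<sigma>. F (\<sigma> 0) (\<sigma> 1) (\<sigma> 2) (\<sigma> 3) (\<sigma> 4) (\<sigma> 5)"]
  proof (intro sum.cong refl arg_cong2[where f = times])
    fix b q :: _ assume "q \<in> {\<sigma>. \<sigma> permutes {..<5::nat}}"
    then have "q 5 = 5" by (auto simp: permutes_def)
    then show "F ((?t b \<circ> q) 0) ((?t b \<circ> q) 1) ((?t b \<circ> q) 2) ((?t b \<circ> q) 3) ((?t b \<circ> q) 4) ((?t b \<circ> q) 5) =
      F (?t b (q 0)) (?t b (q 1)) (?t b (q 2)) (?t b (q 3)) (?t b (q 4)) b" by simp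
  qed
  also have "\<dots> = (\<Sum>b<Suc 5. (if b = 5 then 1 else - 1) *
      alt5 (\<lambda>x y z w v. F x y z w v b) (?t b 0) (?t b 1) (?t b 2) (?t b 3) (?t b 4))"
    by (simp only: sum_permutes_5[of "\<lambda>x y z w v. F (?t _ x) (?t _ y) (?t _ z) (?t _ w) (?t _ v) _"]
        alt5_def alt4_def alt3_def)
  also have "\<dots> = alt6 F 0 1 2 3 4 5"
    by (simp add: alt6_def eval_nat_numeral Transposition.transpose_def)
  finally show ?thesis .
qed
text \<open>The values of \<open>\<omega>\<close> on a unitary basis \<open>u\<^sub>0, J u\<^sub>0, u\<^sub>1, J u\<^sub>1, u\<^sub>2, J u\<^sub>2\<close>.\<close>

definition tab :: "nat \<Rightarrow> nat \<Rightarrow> int" where "tab a b = (if a = 0 \<and> b = 1 \<or> a = 2 \<and> b = 3 \<or> a = 4 \<and> b = 5 then 1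
     else if a = 1 \<and> b = 0 \<or> a = 3 \<and> b = 2 \<or> a = 5 \<and> b = 4 then - 1 else 0)"

lemma tab_values [simp]:
  "tab 0 0 = 0" "tab 0 (Suc 0) = 1" "tab 0 2 = 0" "tab 0 3 = 0" "tab 0 4 = 0" "tab 0 5 = 0"
  "tab (Suc 0) 0 = - 1" "tab (Suc 0) (Suc 0) = 0" "tab (Suc 0) 2 = 0" "tab (Suc 0) 3 = 0" "tab (Suc 0) 4 = 0" "tab (Suc 0) 5 = 0"
  "tab 2 0 = 0" "tab 2 (Suc 0) = 0" "tab 2 2 = 0" "tab 2 3 = 1" "tab 2 4 = 0" "tab 2 5 = 0"
  "tab 3 0 = 0" "tab 3 (Suc 0) = 0" "tab 3 2 = - 1" "tab 3 3 = 0" "tab 3 4 = 0" "tab 3 5 = 0"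
  "tab 4 0 = 0" "tab 4 (Suc 0) = 0" "tab 4 2 = 0" "tab 4 3 = 0" "tab 4 4 = 0" "tab 4 5 = 1"
  "tab 5 0 = 0" "tab 5 (Suc 0) = 0" "tab 5 2 = 0" "tab 5 3 = 0" "tab 5 4 = - 1" "tab 5 5 = 0"
  by (simp_all add: tab_def)


text \<open>Each of the three products contributes 48: one sign-consistent term for every ordering
  of the three pairs (3!) and of the two members in each pair (2^3).\<close>

lemma alt6_tab:
  fixes W :: "nat \<Rightarrow> nat \<Rightarrow> real"
  assumes W: "\<And>a b. a < 6 \<Longrightarrow> b < 6 \<Longrightarrow> W a b = of_int (tab a b)"
  shows "alt6 (\<lambda>a b c d e f. W a b * (W c d * W e f - W c e * W d f + W c f * W d e)) 0 1 2 3 4 5 = 144"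
  by (simp add: alt6_def alt5_def alt4_def alt3_def W)

text \<open>Index 4 pairs to zero with everything, so it must be taken by \<open>T\<close>. Each of
  the three products then contributes 2! * 2^2 = 8.\<close>

lemma alt5_tab:
  fixes T :: "nat \<Rightarrow> real" and W :: "nat \<Rightarrow> nat \<Rightarrow> real"
  assumes W: "\<And>a b. a < 5 \<Longrightarrow> b < 5 \<Longrightarrow> W a b = of_int (if a < 4 \<and> b < 4 then tab a b else 0)"
  shows "alt5 (\<lambda>a b c d e. T a * (W b c * W d e - W b d * W c e + W b e * W c d)) 0 1 2 3 4 = 24 * T 4"
  by (simp add: alt5_def alt4_def alt3_def W)

text \<open>Each of the three perfect matchings of four indices is hit by 8 of the 24
  permutations.\<close>

lemma alt4_square:
  fixes W :: "nat \<Rightarrow> nat \<Rightarrow> 'k::comm_ring_1"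
  assumes "\<And>a b. a < 4 \<Longrightarrow> b < 4 \<Longrightarrow> W a b = - W b a"
  shows "alt4 (\<lambda>a b c d. W a b * W c d) 0 1 2 3 = 8 * (W 0 1 * W 2 3 - W 0 2 * W 1 3 + W 0 3 * W 1 2)"
proof -
  have r: "W 1 0 = - W 0 1" "W 2 0 = - W 0 2" "W 3 0 = - W 0 3" "W 2 1 = - W 1 2" "W 3 1 = - W 1 3" "W 3 2 = - W 2 3"
    by (rule assms; simp)+
  show ?thesis unfolding alt4_def alt3_def r by (simp add: algebra_simps)
qed

lemma alt4_alternating:
  fixes T :: "nat \<Rightarrow> 'k::comm_ring_1" and P :: "nat \<Rightarrow> nat \<Rightarrow> nat \<Rightarrow> 'k"
  assumes a1: "\<And>a b c. a < 4 \<Longrightarrow> b < 4 \<Longrightarrow> c < 4 \<Longrightarrow> P a b c = - P b a c"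
    and a2: "\<And>a b c. a < 4 \<Longrightarrow> b < 4 \<Longrightarrow> c < 4 \<Longrightarrow> P a b c = - P a c b"
  shows "alt4 (\<lambda>a b c d. T a * P b c d) 0 1 2 3 = 6 * (T 0 * P 1 2 3 - T 1 * P 0 2 3 + T 2 * P 0 1 3 - T 3 * P 0 1 2)"
proof -
  have e: "alt3 (\<lambda>b c d. t * P b c d) x y z = 6 * (t * P x y z)" if "x < 4" "y < 4" "z < 4" for t x y z
  proof -
    have r: "P x z y = - P x y z" "P y x z = - P x y z"
      by (rule a2[OF that(1,3,2)], rule a1[OF that(2,1,3)])
    have r': "P y z x = P x y z" "P z x y = P x y z" "P z y x = - P x y z"
      by (simp_all only: a2[OF that(2,3,1)] a1[OF that(3,1,2)] a1[OF that(3,2,1)] r minus_minus)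
    show ?thesis unfolding alt3_def r r' by (simp add: algebra_simps)
  qed
  have "alt3 (\<lambda>b c d. T 0 * P b c d) 1 2 3 = 6 * (T 0 * P 1 2 3)"
    "alt3 (\<lambda>b c d. T 1 * P b c d) 0 2 3 = 6 * (T 1 * P 0 2 3)"
    "alt3 (\<lambda>b c d. T 2 * P b c d) 0 1 3 = 6 * (T 2 * P 0 1 3)"
    "alt3 (\<lambda>b c d. T 3 * P b c d) 0 1 2 = 6 * (T 3 * P 0 1 2)"
    by (rule e; simp)+
  then show ?thesis by (simp only: alt4_def right_diff_distrib distrib_left)
qed

lemma alt3_alternating:
  fixes T :: "nat \<Rightarrow> 'k::comm_ring_1" and P :: "nat \<Rightarrow> nat \<Rightarrow> 'k"
  assumes "\<And>a b. a < 3 \<Longrightarrow> b < 3 \<Longrightarrow> P a b = - P b a"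
  shows "alt3 (\<lambda>a b c. T a * P b c) 0 1 2 = 2 * (T 0 * P 1 2 - T 1 * P 0 2 + T 2 * P 0 1)"
proof -
  have r: "P 1 0 = - P 0 1" "P 2 0 = - P 0 2" "P 2 1 = - P 1 2" by (rule assms; simp)+
  show ?thesis unfolding alt3_def r by (simp add: algebra_simps)
qed

subsection \<open>Wedge products in low degree\<close>

lemma wedge_1_2:
  fixes \<alpha> \<beta> :: "('m, 'k::real_normed_field) tensor"
  assumes skew: "\<And>X Y. X \<in> S \<Longrightarrow> Y \<in> S \<Longrightarrow> \<beta> [X, Y] p = - \<beta> [Y, X] p" and S: "set [X, Y, Z] \<subseteq> S"
  shows "wedge 1 2 \<alpha> \<beta> [X, Y, Z] p = \<alpha> [X] p * \<beta> [Y, Z] p - \<alpha> [Y] p * \<beta> [X, Z] p + \<alpha> [Z] p * \<beta> [X, Y] p"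
proof -
  let ?L = "[X, Y, Z]"
  have in_S: "?L ! a \<in> S" if "a < 3" for a using S nth_mem[of a ?L] that by auto
  have "wedge 1 2 \<alpha> \<beta> ?L p = alt3 (\<lambda>a b c. \<alpha> [?L ! a] p * \<beta> [?L ! b, ?L ! c] p) 0 1 2 / 2"
    unfolding sum_permutes_3[symmetric] by (simp add: wedge_def mult.assoc upt_rec eval_nat_numeral)
  also have "\<dots> = \<alpha> [X] p * \<beta> [Y, Z] p - \<alpha> [Y] p * \<beta> [X, Z] p + \<alpha> [Z] p * \<beta> [X, Y] p"
    using alt3_alternating[of "\<lambda>a b. \<beta> [?L ! a, ?L ! b] p" "\<lambda>a. \<alpha> [?L ! a] p", OF skew[OF in_S in_S]] by simp
  finally show ?thesis .
qed

lemma wedge_1_3: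
  fixes \<alpha> \<beta> :: "('m, 'k::real_normed_field) tensor"
  assumes skew1: "\<And>X Y Z. X \<in> S \<Longrightarrow> Y \<in> S \<Longrightarrow> Z \<in> S \<Longrightarrow> \<beta> [X, Y, Z] p = - \<beta> [Y, X, Z] p"
    and skew2: "\<And>X Y Z. X \<in> S \<Longrightarrow> Y \<in> S \<Longrightarrow> Z \<in> S \<Longrightarrow> \<beta> [X, Y, Z] p = - \<beta> [X, Z, Y] p"
    and S: "set [X, Y, Z, T] \<subseteq> S"
  shows "wedge 1 3 \<alpha> \<beta> [X, Y, Z, T] p = \<alpha> [X] p * \<beta> [Y, Z, T] p - \<alpha> [Y] p * \<beta> [X, Z, T] p
    + \<alpha> [Z] p * \<beta> [X, Y, T] p - \<alpha> [T] p * \<beta> [X, Y, Z] p"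
proof -
  let ?L = "[X, Y, Z, T]"
  have in_S: "?L ! a \<in> S" if "a < 4" for a using S nth_mem[of a ?L] that by auto
  have "wedge 1 3 \<alpha> \<beta> ?L p = alt4 (\<lambda>a b c d. \<alpha> [?L ! a] p * \<beta> [?L ! b, ?L ! c, ?L ! d] p) 0 1 2 3 / 6"
    unfolding sum_permutes_4[symmetric] by (simp add: wedge_def mult.assoc upt_rec eval_nat_numeral)
  also have "\<dots> = \<alpha> [X] p * \<beta> [Y, Z, T] p - \<alpha> [Y] p * \<beta> [X, Z, T] p
    + \<alpha> [Z] p * \<beta> [X, Y, T] p - \<alpha> [T] p * \<beta> [X, Y, Z] p"
    using alt4_alternating[of "\<lambda>a b c. \<beta> [?L ! a, ?L ! b, ?L ! c] p" "\<lambda>a. \<alpha> [?L ! a] p",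
        OF skew1[OF in_S in_S in_S] skew2[OF in_S in_S in_S]] by simp
  finally show ?thesis .
qed

text \<open>The wedge square of a 2-form, that is, twice the Pfaffian of its values on four
  vectors.\<close>

definition square2 :: "('b \<Rightarrow> 'b \<Rightarrow> real) \<Rightarrow> 'b \<Rightarrow> 'b \<Rightarrow> 'b \<Rightarrow> 'b \<Rightarrow> real" where
  "square2 W x y z t = 2 * (W x y * W z t - W x z * W y t + W x t * W y z)"

context
  fixes \<omega> :: "('m, real) tensor" and S :: "'m vf set" and p :: 'm
  assumes skew: "\<And>X Y. X \<in> S \<Longrightarrow> Y \<in> S \<Longrightarrow> \<omega> [X, Y] p = - \<omega> [Y, X] p"
begin

text \<open>Not true by definition: the first power is the wedge of \<omega> with the constant 1,
  which antisymmetrises \<omega> and divides by 2.\<close>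

lemma form_power_1:
  assumes "X \<in> S" "Y \<in> S"
  shows "form_power \<omega> 1 [X, Y] p = \<omega> [X, Y] p"
proof -
  let ?L = "[X, Y]"
  have "form_power \<omega> 1 ?L p = (\<Sum>\<sigma> | \<sigma> permutes {..<2}. of_int (sign \<sigma>) * \<omega> [?L ! \<sigma> 0, ?L ! \<sigma> 1] p) / 2"
    by (simp add: wedge_def upt_rec eval_nat_numeral)
  also have "\<dots> = (\<omega> [X, Y] p - \<omega> [Y, X] p) / 2"
    by (simp add: sum_permutes_2[of "\<lambda>a b. \<omega> [?L ! a, ?L ! b] p", simplified])
  finally show ?thesis using skew[OF assms] by simp
qed

lemma form_power_2:
  assumes S: "set [X, Y, Z, T] \<subseteq> S"
  shows "form_power \<omega> 2 [X, Y, Z, T] p = square2 (\<lambda>X Y. \<omega> [X, Y] p) X Y Z T"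
proof -
  let ?L = "[X, Y, Z, T]"
  have in_S: "?L ! a \<in> S" if "a < 4" for a using S nth_mem[of a ?L] that by auto
  have "form_power \<omega> 2 ?L p = wedge 2 2 \<omega> (form_power \<omega> 1) ?L p"
    by (simp only: numeral_2_eq_2 One_nat_def form_power.simps(2) mult_Suc_right) simp
  also have "\<dots> = (\<Sum>\<sigma> | \<sigma> permutes {..<4}. of_int (sign \<sigma>) *
      (\<omega> [?L ! \<sigma> 0, ?L ! \<sigma> 1] p * \<omega> [?L ! \<sigma> 2, ?L ! \<sigma> 3] p)) / 4"
  proof -
    have "form_power \<omega> 1 [?L ! \<sigma> 2, ?L ! \<sigma> 3] p = \<omega> [?L ! \<sigma> 2, ?L ! \<sigma> 3] p" if "\<sigma> permutes {..<4}" for \<sigma>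
      using permutes_in_image[OF that, of 2] permutes_in_image[OF that, of 3] by (intro form_power_1 in_S) auto
    then have "(\<Sum>\<sigma> | \<sigma> permutes {..<4}. of_int (sign \<sigma>) *
        (\<omega> [?L ! \<sigma> 0, ?L ! \<sigma> 1] p * form_power \<omega> 1 [?L ! \<sigma> 2, ?L ! \<sigma> 3] p)) =
      (\<Sum>\<sigma> | \<sigma> permutes {..<4}. of_int (sign \<sigma>) *
        (\<omega> [?L ! \<sigma> 0, ?L ! \<sigma> 1] p * \<omega> [?L ! \<sigma> 2, ?L ! \<sigma> 3] p))"
      by (intro sum.cong refl) simp
    moreover have "wedge 2 2 \<omega> (form_power \<omega> 1) ?L p = (\<Sum>\<sigma> | \<sigma> permutes {..<4}. of_int (sign \<sigma>) *
        (\<omega> [?L ! \<sigma> 0, ?L ! \<sigma> 1] p * form_power \<omega> 1 [?L ! \<sigma> 2, ?L ! \<sigma> 3] p)) / 4"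
      by (simp add: wedge_def mult.assoc upt_rec eval_nat_numeral del: form_power.simps)
    ultimately show ?thesis by simp
  qed
  also have "\<dots> = square2 (\<lambda>X Y. \<omega> [X, Y] p) X Y Z T"
    unfolding sum_permutes_4[of "\<lambda>a b c d. \<omega> [?L ! a, ?L ! b] p * \<omega> [?L ! c, ?L ! d] p"] square2_def
    using alt4_square[of "\<lambda>a b. \<omega> [?L ! a, ?L ! b] p", OF skew[OF in_S in_S]] by simp
  finally show ?thesis .
qed

text \<open>The fifth vector is orthogonal for \<omega> to the other four, so it must go into the
  1-form; \<omega> \<and> \<omega> takes the value 2 on the two complex lines that remain.\<close>

lemma wedge_1_4_unitary:
  assumes S: "set [X, Y, Z, T, R] \<subseteq> S"
    and tab: "\<And>a b. a < 5 \<Longrightarrow> b < 5 \<Longrightarrow>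
      \<omega> [[X, Y, Z, T, R] ! a, [X, Y, Z, T, R] ! b] p = of_int (if a < 4 \<and> b < 4 then tab a b else 0)"
  shows "wedge 1 4 \<alpha> (form_power \<omega> 2) [X, Y, Z, T, R] p = 2 * \<alpha> [R] p"
proof -
  let ?L = "[X, Y, Z, T, R]"
  let ?W = "\<lambda>a b. \<omega> [?L ! a, ?L ! b] p"
  have in_S: "?L ! a \<in> S" if "a < 5" for a using S nth_mem[of a ?L] that by auto
  have m: "map (\<lambda>i. ?L ! \<sigma> i) [1..<1 + 4] = [?L ! \<sigma> 1, ?L ! \<sigma> 2, ?L ! \<sigma> 3, ?L ! \<sigma> 4]"
    "map (\<lambda>i. ?L ! \<sigma> i) [0..<1] = [?L ! \<sigma> 0]" for \<sigma> by (simp_all add: upt_rec eval_nat_numeral)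
  have f: "fact 1 * fact 4 = (24::real)" "1 + 4 = (5::nat)" by (simp_all add: fact_numeral)
  have "wedge 1 4 \<alpha> (form_power \<omega> 2) ?L p = (\<Sum>\<sigma> | \<sigma> permutes {..<5}. of_int (sign \<sigma>) *
      (\<alpha> [?L ! \<sigma> 0] p * form_power \<omega> 2 [?L ! \<sigma> 1, ?L ! \<sigma> 2, ?L ! \<sigma> 3, ?L ! \<sigma> 4] p)) / 24"
    using m f by (simp only: wedge_def mult.assoc)
  also have "\<dots> = (\<Sum>\<sigma> | \<sigma> permutes {..<5}. of_int (sign \<sigma>) *
      (2 * \<alpha> [?L ! \<sigma> 0] p * (?W (\<sigma> 1) (\<sigma> 2) * ?W (\<sigma> 3) (\<sigma> 4) - ?W (\<sigma> 1) (\<sigma> 3) * ?W (\<sigma> 2) (\<sigma> 4)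
        + ?W (\<sigma> 1) (\<sigma> 4) * ?W (\<sigma> 2) (\<sigma> 3)))) / 24"
  proof (intro arg_cong2[where f = "(/)"] sum.cong refl)
    fix \<sigma> assume "\<sigma> \<in> {\<sigma>. \<sigma> permutes {..<5::nat}}"
    then have "\<sigma> a < 5" if "a < 5" for a using permutes_in_image[of \<sigma> "{..<5}" a] that by auto
    then have "set [?L ! \<sigma> 1, ?L ! \<sigma> 2, ?L ! \<sigma> 3, ?L ! \<sigma> 4] \<subseteq> S" using in_S by simp
    then show "of_int (sign \<sigma>) * (\<alpha> [?L ! \<sigma> 0] p * form_power \<omega> 2 [?L ! \<sigma> 1, ?L ! \<sigma> 2, ?L ! \<sigma> 3, ?L ! \<sigma> 4] p) =
      of_int (sign \<sigma>) * (2 * \<alpha> [?L ! \<sigma> 0] p * (?W (\<sigma> 1) (\<sigma> 2) * ?W (\<sigma> 3) (\<sigma> 4) - ?W (\<sigma> 1) (\<sigma> 3) * ?W (\<sigma> 2) (\<sigma> 4)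
        + ?W (\<sigma> 1) (\<sigma> 4) * ?W (\<sigma> 2) (\<sigma> 3)))"
      using form_power_2[of "?L ! \<sigma> 1" "?L ! \<sigma> 2" "?L ! \<sigma> 3" "?L ! \<sigma> 4"] by (simp only: square2_def mult_ac)
  qed
  also have "\<dots> = 2 * \<alpha> [R] p"
    unfolding sum_permutes_5[of "\<lambda>a b c d e. 2 * \<alpha> [?L ! a] p * (?W b c * ?W d e - ?W b d * ?W c e + ?W b e * ?W c d)"]
    by (subst alt5_tab[of ?W "\<lambda>a. 2 * \<alpha> [?L ! a] p", OF tab]) simp_all
  finally show ?thesis .
qed

lemma form_power_3_unitary:
  assumes S: "set [X, Y, Z, T, R, Q] \<subseteq> S"
    and tab: "\<And>a b. a < 6 \<Longrightarrow> b < 6 \<Longrightarrow>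
      \<omega> [[X, Y, Z, T, R, Q] ! a, [X, Y, Z, T, R, Q] ! b] p = of_int (tab a b)"
  shows "form_power \<omega> 3 [X, Y, Z, T, R, Q] p = 6"
proof -
  let ?L = "[X, Y, Z, T, R, Q]"
  let ?W = "\<lambda>a b. \<omega> [?L ! a, ?L ! b] p"
  have in_S: "?L ! a \<in> S" if "a < 6" for a using S nth_mem[of a ?L] that by auto
  have m: "map (\<lambda>i. ?L ! \<sigma> i) [2..<2 + 4] = [?L ! \<sigma> 2, ?L ! \<sigma> 3, ?L ! \<sigma> 4, ?L ! \<sigma> 5]"
    "map (\<lambda>i. ?L ! \<sigma> i) [0..<2] = [?L ! \<sigma> 0, ?L ! \<sigma> 1]" for \<sigma> by (simp_all add: upt_rec eval_nat_numeral)
  have f: "fact 2 * fact 4 = (48::real)" "2 + 4 = (6::nat)" by (simp_all add: fact_numeral)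
  have "form_power \<omega> 3 ?L p = wedge 2 4 \<omega> (form_power \<omega> 2) ?L p"
    using form_power.simps(2)[of \<omega> 2] by (simp del: form_power.simps)
  also have "\<dots> = (\<Sum>\<sigma> | \<sigma> permutes {..<6}. of_int (sign \<sigma>) *
      (?W (\<sigma> 0) (\<sigma> 1) * form_power \<omega> 2 [?L ! \<sigma> 2, ?L ! \<sigma> 3, ?L ! \<sigma> 4, ?L ! \<sigma> 5] p)) / 48"
    using m f by (simp only: wedge_def mult.assoc)
  also have "\<dots> = (\<Sum>\<sigma> | \<sigma> permutes {..<6}. of_int (sign \<sigma>) *
      (?W (\<sigma> 0) (\<sigma> 1) * (?W (\<sigma> 2) (\<sigma> 3) * ?W (\<sigma> 4) (\<sigma> 5) - ?W (\<sigma> 2) (\<sigma> 4) * ?W (\<sigma> 3) (\<sigma> 5)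
        + ?W (\<sigma> 2) (\<sigma> 5) * ?W (\<sigma> 3) (\<sigma> 4)))) * 2 / 48"
    unfolding sum_distrib_right
  proof (intro arg_cong2[where f = "(/)"] sum.cong refl)
    fix \<sigma> assume "\<sigma> \<in> {\<sigma>. \<sigma> permutes {..<6::nat}}"
    then have "\<sigma> a < 6" if "a < 6" for a using permutes_in_image[of \<sigma> "{..<6}" a] that by auto
    then have "set [?L ! \<sigma> 2, ?L ! \<sigma> 3, ?L ! \<sigma> 4, ?L ! \<sigma> 5] \<subseteq> S" using in_S by simp
    then show "of_int (sign \<sigma>) * (?W (\<sigma> 0) (\<sigma> 1) * form_power \<omega> 2 [?L ! \<sigma> 2, ?L ! \<sigma> 3, ?L ! \<sigma> 4, ?L ! \<sigma> 5] p) =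
      of_int (sign \<sigma>) * (?W (\<sigma> 0) (\<sigma> 1) * (?W (\<sigma> 2) (\<sigma> 3) * ?W (\<sigma> 4) (\<sigma> 5) - ?W (\<sigma> 2) (\<sigma> 4) * ?W (\<sigma> 3) (\<sigma> 5)
        + ?W (\<sigma> 2) (\<sigma> 5) * ?W (\<sigma> 3) (\<sigma> 4))) * 2"
      using form_power_2[of "?L ! \<sigma> 2" "?L ! \<sigma> 3" "?L ! \<sigma> 4" "?L ! \<sigma> 5"] by (simp only: square2_def mult_ac)
  qed
  also have "\<dots> = 6"
    unfolding sum_permutes_6[of "\<lambda>a b c d e f. ?W a b * (?W c d * ?W e f - ?W c e * ?W d f + ?W c f * ?W d e)"]
    by (subst alt6_tab[of ?W, OF tab]) simp_all
  finally show ?thesis .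
qed

end

section \<open>Descent of the left-invariant frame to the quotient\<close>

section \<open>The invariant frame on the quotient\<close>

locale lie_quotient = charted_lie_group G A U \<phi>
  for G :: "'g::{t2_space, second_countable_topology} monoid" (structure)
    and A :: "('g, 'e::euclidean_space) atlas" and U \<phi> +
  fixes \<Gamma> :: "'g set" and B :: "('m::{t2_space, second_countable_topology}, 'e) atlas" and \<pi> :: "'g \<Rightarrow> 'm"
  assumes atlas_B: "smooth_atlas B" and local_diffeo_\<pi>: "local_diffeo A B \<pi>" and surj_\<pi>: "surj \<pi>"
    and fibres: "\<And>x y. \<pi> x = \<pi> y \<longleftrightarrow> (\<exists>\<gamma>\<in>\<Gamma>. y = \<gamma> \<otimes> x)"
begin

lemma local_inverse:
  obtains W where "x \<in> W" "open W" "open (\<pi> ` W)" "inj_on \<pi> W" "smooth_map_on A B W \<pi>"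
    "smooth_map_on B A (\<pi> ` W) (inv_into W \<pi>)"
  using local_diffeo_\<pi> unfolding local_diffeo_def by meson

lemma smooth_funs_\<pi>:
  assumes f: "f \<in> smooth_funs B"
  shows "(\<lambda>x. f (\<pi> x)) \<in> smooth_funs A"
proof (rule smooth_funs_local[OF atlas])
  fix x
  obtain W where W: "x \<in> W" "open W" "smooth_map_on A B W \<pi>" using local_inverse[of x] by blast
  have "smooth_on (\<psi> ` (V \<inter> W)) (\<lambda>y. f (\<pi> (inv_into V \<psi> y)))" if "(V, \<psi>) \<in> A" for V \<psi>
    by (rule smooth_funs_compose[OF atlas_B f W(3,2) that smooth_atlas_chart[OF atlas that]])
  then show "\<exists>W. open W \<and> x \<in> W \<and>
      (\<forall>V \<psi>. (V, \<psi>) \<in> A \<longrightarrow> smooth_on (\<psi> ` (V \<inter> W)) (\<lambda>y. f (\<pi> (inv_into V \<psi> y))))"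
    using W(1,2) by blast
qed

definition sec :: "'m \<Rightarrow> 'g" where "sec p = (SOME x. \<pi> x = p)"

lemma \<pi>_sec [simp]: "\<pi> (sec p) = p"
  unfolding sec_def by (rule someI_ex) (use surj_\<pi> in \<open>metis surjD\<close>)

text \<open>The push-forward of \<open>lfield v\<close>, computed at an arbitrarily chosen preimage.
  Points of one fibre differ by a left translation, under which \<open>lfield v\<close> is
  invariant, so the choice does not matter.\<close>

definition frame :: "'e \<Rightarrow> 'm vf" where
  "frame v = (\<lambda>f p. if f \<in> smooth_funs B then lfield v (\<lambda>x. f (\<pi> x)) (sec p) else 0)"

lemma frame_at:
  assumes f: "f \<in> smooth_funs B"
  shows "frame v f (\<pi> x) = lfield v (\<lambda>x. f (\<pi> x)) x"
proof -
  obtain \<gamma> where \<gamma>: "\<gamma> \<in> \<Gamma>" "x = \<gamma> \<otimes> sec (\<pi> x)" using fibres[of "sec (\<pi> x)" x] by auto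
  have "\<pi> (\<gamma> \<otimes> q) = \<pi> q" for q using fibres[of q "\<gamma> \<otimes> q"] \<gamma>(1) by auto
  then have "lfield v (\<lambda>x. f (\<pi> x)) (sec (\<pi> x)) = lfield v (\<lambda>x. f (\<pi> (\<gamma> \<otimes> x))) (sec (\<pi> x))" by simp
  also have "\<dots> = lfield v (\<lambda>x. f (\<pi> x)) (\<gamma> \<otimes> sec (\<pi> x))"
    by (rule lfield_translate[OF smooth_funs_\<pi>[OF f]])
  finally show ?thesis using f \<gamma>(2) by (simp add: frame_def)
qed

lemma frame_smooth:
  assumes f: "f \<in> smooth_funs B"
  shows "frame v f \<in> smooth_funs B"
proof (rule smooth_funs_local[OF atlas_B])
  fix p
  obtain W where W: "sec p \<in> W" "open W" "open (\<pi> ` W)" "inj_on \<pi> W" "smooth_map_on B A (\<pi> ` W) (inv_into W \<pi>)"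
    using local_inverse[of "sec p"] by blast
  have "smooth_on (\<psi> ` (V \<inter> \<pi> ` W)) (\<lambda>y. frame v f (inv_into V \<psi> y))" if V: "(V, \<psi>) \<in> B" for V \<psi>
  proof -
    note c = smooth_atlas_chart[OF atlas_B V]
    have "smooth_on (\<psi> ` (V \<inter> \<pi> ` W)) (\<lambda>y. lfield v (\<lambda>x. f (\<pi> x)) (inv_into W \<pi> (inv_into V \<psi> y)))"
      by (rule smooth_funs_compose[OF atlas vfieldsD(1)[OF lfield_vfields smooth_funs_\<pi>[OF f]] W(5,3) V c])
    then show ?thesis
    proof (rule smooth_on_cong[OF is_chart_open_image[OF c W(3)], rotated])
      fix y assume "y \<in> \<psi> ` (V \<inter> \<pi> ` W)"
      then obtain x where x: "x \<in> W" "\<pi> x \<in> V" "y = \<psi> (\<pi> x)" by auto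
      then show "lfield v (\<lambda>x. f (\<pi> x)) (inv_into W \<pi> (inv_into V \<psi> y)) = frame v f (inv_into V \<psi> y)"
        using frame_at[OF f] is_chartD(5)[OF c x(2)] inv_into_f_f[OF W(4) x(1)] by simp
    qed
  qed
  moreover have "p \<in> \<pi> ` W" using W(1) \<pi>_sec by (metis image_eqI)
  ultimately show "\<exists>W. open W \<and> p \<in> W \<and>
      (\<forall>V \<psi>. (V, \<psi>) \<in> B \<longrightarrow> smooth_on (\<psi> ` (V \<inter> W)) (\<lambda>y. frame v f (inv_into V \<psi> y)))"
    using W(3) by (intro exI[of _ "\<pi> ` W"]) simp
qed

lemma frame_vfields: "frame v \<in> vfields B"
proof (rule vfieldsI)
  fix f h a b p assume f: "f \<in> smooth_funs B" "h \<in> smooth_funs B"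
  have s: "(\<lambda>q. a * f q + b * h q) \<in> smooth_funs B"
    by (intro smooth_funs_add smooth_funs_mult smooth_funs_const f)
  then show "frame v (\<lambda>q. a * f q + b * h q) p = a * frame v f p + b * frame v h p"
    using f vfieldsD(3)[OF lfield_vfields smooth_funs_\<pi>[OF f(1)] smooth_funs_\<pi>[OF f(2)]] by (simp add: frame_def)
next
  fix f h p assume f: "f \<in> smooth_funs B" "h \<in> smooth_funs B"
  show "frame v (\<lambda>q. f q * h q) p = f p * frame v h p + h p * frame v f p"
    using f smooth_funs_mult[OF f] vfieldsD(4)[OF lfield_vfields smooth_funs_\<pi>[OF f(1)] smooth_funs_\<pi>[OF f(2)]]
    by (simp add: frame_def)
qed (simp_all add: frame_smooth, simp add: frame_def)

lemma frame_related: "related A B \<pi> (lfield v) (frame v)"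
  unfolding related_def using lfield_vfields frame_vfields frame_at by (auto simp: o_def)

lemma related_frame:
  assumes "related A B \<pi> (lfield v) Y"
  shows "Y = frame v"
proof (intro ext)
  fix f p
  show "Y f p = frame v f p"
  proof (cases "f \<in> smooth_funs B")
    case True
    then have "lfield v (f \<circ> \<pi>) = Y f \<circ> \<pi>" using assms unfolding related_def by blast
    from fun_cong[OF this, of "sec p"] show ?thesis using True by (simp add: frame_def o_def)
  next
    case False
    then show ?thesis using assms vfieldsD(2) unfolding related_def by (fastforce simp: frame_def)
  qed
qed

lemma frame_add: "frame (v + w) = vf_add (frame v) (frame w)"
  and frame_scale: "frame (c *\<^sub>R v) = vf_scale (\<lambda>p. c) (frame v)"
  by (auto simp: frame_def vf_add_def vf_scale_def lfield_add lfield_scale fun_eq_iff)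

lemma bracket_frame: "bracket (frame v) (frame w) = frame (br v w)"
proof (rule related_frame)
  show "related A B \<pi> (lfield (br v w)) (bracket (frame v) (frame w))"
    unfolding bracket_lfield[symmetric] by (rule related_bracket[OF frame_related frame_related])
qed

text \<open>A coordinate function at the identity is moved to the preimage of \<open>p\<close> by
  left translation, carried down by a local inverse of the projection, and extended from its germ.
  Such functions separate the frame vectors at every point.\<close>

lemma frame_detect:
  obtains f where "f \<in> smooth_funs B" "\<And>v. frame v f p = v \<bullet> b"
proof -
  obtain F W0 where F: "F \<in> smooth_funs A" "open W0" "\<one> \<in> W0" "W0 \<subseteq> U" "\<And>q. q \<in> W0 \<Longrightarrow> F q = \<kappa> q \<bullet> b"
    using coordinate_function[of b] by blast
  let ?x = "sec p"
  let ?F = "\<lambda>q. F (inv ?x \<otimes> q)"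
  have Fs: "?F \<in> smooth_funs A" by (rule smooth_funs_translate[OF F(1)])
  obtain W where W: "?x \<in> W" "open W" "open (\<pi> ` W)" "inj_on \<pi> W" "smooth_map_on A B W \<pi>"
    "smooth_map_on B A (\<pi> ` W) (inv_into W \<pi>)"
    using local_inverse[of ?x] by blast
  obtain V \<psi> where V: "(V, \<psi>) \<in> B" "p \<in> V" using smooth_atlas_cover[OF atlas_B] .
  note c = smooth_atlas_chart[OF atlas_B V(1)]
  have pW: "p \<in> \<pi> ` W" using W(1) \<pi>_sec by (metis image_eqI)
  have "smooth_on (\<psi> ` (V \<inter> \<pi> ` W)) (\<lambda>y. ?F (inv_into W \<pi> (inv_into V \<psi> y)))"
    by (rule smooth_funs_compose[OF atlas Fs W(6,3) V(1) c])
  then obtain f W' where f: "f \<in> smooth_funs B" "open W'" "p \<in> W'" "W' \<subseteq> V"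
    "\<And>q. q \<in> W' \<Longrightarrow> f q = ?F (inv_into W \<pi> (inv_into V \<psi> (\<psi> q)))"
    using smooth_germ_extend[OF atlas_B V is_chart_open_image[OF c W(3)]] V(2) pW by blast
  have cont: "continuous_on W \<pi>" using W(5) unfolding smooth_map_on_def by simp
  have oN: "open (\<pi> -` W' \<inter> W)" using continuous_on_open_vimage[OF W(2)] cont f(2) by blast
  have "frame v f p = v \<bullet> b" for v
  proof -
    have "frame v f p = lfield v (\<lambda>x. f (\<pi> x)) ?x" using frame_at[OF f(1), of v ?x] by simp
    also have "\<dots> = lfield v ?F ?x"
    proof (rule vf_local[OF atlas lfield_vfields smooth_funs_\<pi>[OF f(1)] Fs oN])
      show "?x \<in> \<pi> -` W' \<inter> W" using W(1) f(3) by simp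
      fix q assume q: "q \<in> \<pi> -` W' \<inter> W"
      then have "f (\<pi> q) = ?F (inv_into W \<pi> (inv_into V \<psi> (\<psi> (\<pi> q))))" using f(5) by simp
      moreover have "inv_into V \<psi> (\<psi> (\<pi> q)) = \<pi> q" using q f(4) is_chartD(5)[OF c] by blast
      moreover have "inv_into W \<pi> (\<pi> q) = q" using q inv_into_f_f[OF W(4)] by simp
      ultimately show "f (\<pi> q) = ?F q" by simp
    qed
    also have "\<dots> = lfield v F (inv ?x \<otimes> ?x)" by (rule lfield_translate[OF F(1)])
    also have "\<dots> = v \<bullet> b" using lfield_coordinate[OF F] by (simp add: l_inv)
    finally show ?thesis .
  qed
  with f(1) show thesis by (rule that)
qed

lemma frame_nonzero:
  assumes "v \<noteq> 0"
  shows "\<exists>f\<in>smooth_funs B. frame v f p \<noteq> 0"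
proof -
  obtain f where "f \<in> smooth_funs B" "\<And>w. frame w f p = w \<bullet> v" using frame_detect[of p v] by blast
  then show ?thesis using assms by (intro bexI[of _ f]) auto
qed

text \<open>Sending a frame vector to its direction in a chart at \<open>p\<close> is an injective
  linear map of \<open>'e\<close> into itself, hence onto; every derivation at \<open>p\<close> is
  such a direction.\<close>

lemma frame_span:
  assumes X: "X \<in> vfields B"
  obtains v where "\<And>f. f \<in> smooth_funs B \<Longrightarrow> X f p = frame v f p"
proof -
  obtain V \<psi> where V: "(V, \<psi>) \<in> B" "p \<in> V" using smooth_atlas_cover[OF atlas_B] .
  note c = smooth_atlas_chart[OF atlas_B V(1)]
  let ?D = "\<lambda>f. frechet_derivative (\<lambda>y. f (inv_into V \<psi> y)) (at (\<psi> p))"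
  have lD: "linear (?D f)" if "f \<in> smooth_funs B" for f
    using has_derivative_linear[OF smooth_on_has_derivative[OF smooth_funsD[OF that V(1)]]] V(2) by simp
  have "\<exists>w. \<forall>f\<in>smooth_funs B. frame v f p = ?D f w" for v
    using vf_local_representation[OF atlas_B frame_vfields V] by metis
  then obtain L where L: "\<And>v f. f \<in> smooth_funs B \<Longrightarrow> frame v f p = ?D f (L v)" by metis
  have D0: "w = 0" if w: "\<And>f. f \<in> smooth_funs B \<Longrightarrow> ?D f w = 0" for w
  proof (rule euclidean_eqI)
    fix b :: 'e assume "b \<in> Basis"
    have "smooth_on UNIV (\<lambda>y::'e. y \<bullet> b)" by (intro smooth_on_inner_left smooth_on_ident)
    then obtain f W where f: "f \<in> smooth_funs B" "open W" "p \<in> W" "W \<subseteq> V" "\<And>q. q \<in> W \<Longrightarrow> f q = \<psi> q \<bullet> b"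
      using smooth_germ_extend[OF atlas_B V open_UNIV UNIV_I] by metis
    have "((\<lambda>y. y \<bullet> b) has_derivative (\<lambda>w. w \<bullet> b)) (at (\<psi> p))"
      by (intro has_derivative_inner_left has_derivative_ident)
    then have "((\<lambda>y. f (inv_into V \<psi> y)) has_derivative (\<lambda>w. w \<bullet> b)) (at (\<psi> p))"
      by (rule has_derivative_transform_within_open[OF _ is_chart_open_image[OF c f(2)]])
         (use f V is_chartD(5)[OF c] in auto)
    then have "?D f = (\<lambda>w. w \<bullet> b)" by (rule frechet_derivative_at[symmetric])
    then show "w \<bullet> b = 0 \<bullet> b" using w[OF f(1)] by simp
  qed
  have linL: "linear L"
  proof (rule linearI)
    fix v w c
    have "L (v + w) - (L v + L w) = 0"
    proof (rule D0)
      fix f assume f: "f \<in> smooth_funs B"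
      show "?D f (L (v + w) - (L v + L w)) = 0"
        using L[OF f, of "v + w"] L[OF f, of v] L[OF f, of w]
        by (simp add: linear_diff[OF lD[OF f]] linear_add[OF lD[OF f]] frame_add vf_add_def)
    qed
    then show "L (v + w) = L v + L w" by simp
    have "L (c *\<^sub>R v) - c *\<^sub>R L v = 0"
    proof (rule D0)
      fix f assume f: "f \<in> smooth_funs B"
      show "?D f (L (c *\<^sub>R v) - c *\<^sub>R L v) = 0"
        using L[OF f, of "c *\<^sub>R v"] L[OF f, of v]
        by (simp add: linear_diff[OF lD[OF f]] linear_scale[OF lD[OF f]] frame_scale vf_scale_def)
    qed
    then show "L (c *\<^sub>R v) = c *\<^sub>R L v" by simp
  qed
  have "inj L"
    unfolding linear_injective_0[OF linL]
  proof (intro allI impI)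
    fix v assume "L v = 0"
    then have "frame v f p = 0" if "f \<in> smooth_funs B" for f
      using L[OF that, of v] linear_0[OF lD[OF that]] by simp
    then show "v = 0" using frame_nonzero[of v p] by blast
  qed
  then have "surj L" using linear_injective_imp_surjective[OF linL] by simp
  obtain w where w: "\<And>f. f \<in> smooth_funs B \<Longrightarrow> X f p = ?D f w"
    using vf_local_representation[OF atlas_B X V] by blast
  obtain v where "w = L v" using \<open>surj L\<close> by (metis surjD)
  then show thesis using that[of v] w L by simp
qed

end

section \<open>Koszul formulas in low degree and tensoriality of d\<omega>\<close>

section \<open>Exterior derivatives on frames\<close>

lemma ext_d_1: "ext_d \<alpha> [X, Y] p = X (\<alpha> [Y]) p - Y (\<alpha> [X]) p - \<alpha> [bracket X Y] p"
  by (simp add: ext_d_def drop_nth_def)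

lemma ext_d_2:
  "ext_d \<alpha> [X, Y, Z] p = X (\<alpha> [Y, Z]) p - Y (\<alpha> [X, Z]) p + Z (\<alpha> [X, Y]) p
    - \<alpha> [bracket X Y, Z] p + \<alpha> [bracket X Z, Y] p - \<alpha> [bracket Y Z, X] p"
  by (simp add: ext_d_def drop_nth_def)

lemma ext_d_3:
  "ext_d \<alpha> [X, Y, Z, T] p = X (\<alpha> [Y, Z, T]) p - Y (\<alpha> [X, Z, T]) p + Z (\<alpha> [X, Y, T]) p - T (\<alpha> [X, Y, Z]) p
    - \<alpha> [bracket X Y, Z, T] p + \<alpha> [bracket X Z, Y, T] p - \<alpha> [bracket X T, Y, Z] p
    - \<alpha> [bracket Y Z, X, T] p + \<alpha> [bracket Y T, X, Z] p - \<alpha> [bracket Z T, X, Y] p"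
  by (simp add: ext_d_def drop_nth_def)

lemma ext_d_4:
  "ext_d \<alpha> [X, Y, Z, T, R] p = X (\<alpha> [Y, Z, T, R]) p - Y (\<alpha> [X, Z, T, R]) p + Z (\<alpha> [X, Y, T, R]) p
    - T (\<alpha> [X, Y, Z, R]) p + R (\<alpha> [X, Y, Z, T]) p
    - \<alpha> [bracket X Y, Z, T, R] p + \<alpha> [bracket X Z, Y, T, R] p - \<alpha> [bracket X T, Y, Z, R] p
    + \<alpha> [bracket X R, Y, Z, T] p - \<alpha> [bracket Y Z, X, T, R] p + \<alpha> [bracket Y T, X, Z, R] p
    - \<alpha> [bracket Y R, X, Z, T] p - \<alpha> [bracket Z T, X, Y, R] p + \<alpha> [bracket Z R, X, Y, T] p
    - \<alpha> [bracket T R, X, Y, Z] p"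
  by (simp add: ext_d_def drop_nth_def)

lemma is_tensor_2:
  assumes "is_tensor A 2 \<alpha>" "X \<in> vfields A" "Y \<in> vfields A" "Z \<in> vfields A" "h \<in> smooth_funs A"
  shows "\<alpha> [vf_add X Y, Z] p = \<alpha> [X, Z] p + \<alpha> [Y, Z] p" "\<alpha> [Z, vf_add X Y] p = \<alpha> [Z, X] p + \<alpha> [Z, Y] p"
    "\<alpha> [vf_scale h X, Z] p = h p * \<alpha> [X, Z] p" "\<alpha> [Z, vf_scale h X] p = h p * \<alpha> [Z, X] p"
  using is_tensorD(1)[OF assms(1), of "[X, Z]" 0 X Y p] is_tensorD(1)[OF assms(1), of "[Z, X]" 1 X Y p]
    is_tensorD(2)[OF assms(1), of "[X, Z]" 0 X h p] is_tensorD(2)[OF assms(1), of "[Z, X]" 1 X h p] assms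
  by (simp_all add: vf_tuples_def)

lemma is_tensor_3:
  assumes "is_tensor A 3 \<alpha>" "X \<in> vfields A" "Y \<in> vfields A" "Z \<in> vfields A" "T \<in> vfields A" "h \<in> smooth_funs A"
  shows "\<alpha> [vf_add X Y, Z, T] p = \<alpha> [X, Z, T] p + \<alpha> [Y, Z, T] p"
    "\<alpha> [Z, vf_add X Y, T] p = \<alpha> [Z, X, T] p + \<alpha> [Z, Y, T] p"
    "\<alpha> [Z, T, vf_add X Y] p = \<alpha> [Z, T, X] p + \<alpha> [Z, T, Y] p"
    "\<alpha> [vf_scale h X, Z, T] p = h p * \<alpha> [X, Z, T] p"
  using is_tensorD(1)[OF assms(1), of "[X, Z, T]" 0 X Y p] is_tensorD(1)[OF assms(1), of "[Z, X, T]" 1 X Y p]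
    is_tensorD(1)[OF assms(1), of "[Z, T, X]" 2 X Y p]
    is_tensorD(2)[OF assms(1), of "[X, Z, T]" 0 X h p] assms
  by (simp_all add: vf_tuples_def)

lemma is_form_repeat:
  "is_form A k \<alpha> \<Longrightarrow> Xs \<in> vf_tuples A k \<Longrightarrow> i < l \<Longrightarrow> l < k \<Longrightarrow> Xs ! i = Xs ! l \<Longrightarrow> \<alpha> Xs p = 0"
  unfolding is_form_def by blast

lemma is_form_2_skew:
  assumes "is_form A 2 \<alpha>" and X: "X \<in> vfields A" and Y: "Y \<in> vfields A"
  shows "\<alpha> [X, Y] p = - \<alpha> [Y, X] p"
proof -
  have t: "is_tensor A 2 \<alpha>" using assms unfolding is_form_def by blast
  have z: "\<alpha> [Z, Z] p = 0" if "Z \<in> vfields A" for Z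
    using is_form_repeat[OF assms(1), of "[Z, Z]" 0 1] that by (simp add: vf_tuples_def)
  note XY = vf_add_vfields[OF X Y]
  show ?thesis
    using z[OF XY] z[OF X] z[OF Y] is_tensor_2(1)[OF t X Y XY smooth_funs_const]
      is_tensor_2(2)[OF t X Y X smooth_funs_const] is_tensor_2(2)[OF t X Y Y smooth_funs_const] by simp
qed

lemma is_form_3_skew:
  assumes "is_form A 3 \<alpha>" and X: "X \<in> vfields A" and Y: "Y \<in> vfields A" and Z: "Z \<in> vfields A"
  shows "\<alpha> [X, Y, Z] p = - \<alpha> [Y, X, Z] p" "\<alpha> [X, Y, Z] p = - \<alpha> [X, Z, Y] p"
proof -
  have t: "is_tensor A 3 \<alpha>" using assms unfolding is_form_def by blast
  have z1: "\<alpha> [R, R, T] p = 0" if "R \<in> vfields A" "T \<in> vfields A" for R T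
    using is_form_repeat[OF assms(1), of "[R, R, T]" 0 1] that by (simp add: vf_tuples_def)
  have z2: "\<alpha> [T, R, R] p = 0" if "R \<in> vfields A" "T \<in> vfields A" for R T
    using is_form_repeat[OF assms(1), of "[T, R, R]" 1 2] that by (simp add: vf_tuples_def)
  note XY = vf_add_vfields[OF X Y] and YZ = vf_add_vfields[OF Y Z]
  show "\<alpha> [X, Y, Z] p = - \<alpha> [Y, X, Z] p"
    using z1[OF XY Z] z1[OF X Z] z1[OF Y Z] is_tensor_3(1)[OF t X Y XY Z smooth_funs_const]
      is_tensor_3(2)[OF t X Y X Z smooth_funs_const] is_tensor_3(2)[OF t X Y Y Z smooth_funs_const] by simp
  show "\<alpha> [X, Y, Z] p = - \<alpha> [X, Z, Y] p"
    using z2[OF YZ X] z2[OF Y X] z2[OF Z X] is_tensor_3(2)[OF t Y Z X YZ smooth_funs_const]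
      is_tensor_3(3)[OF t Y Z X Y smooth_funs_const] is_tensor_3(3)[OF t Y Z X Z smooth_funs_const] by simp
qed

lemma bracket_vf_add:
  assumes X: "X \<in> vfields A" and Y: "Y \<in> vfields A" and Z: "Z \<in> vfields A"
  shows "bracket (vf_add X Y) Z = vf_add (bracket X Z) (bracket Y Z)"
proof (intro ext)
  fix f p
  show "bracket (vf_add X Y) Z f p = vf_add (bracket X Z) (bracket Y Z) f p"
  proof (cases "f \<in> smooth_funs A")
    case True
    then show ?thesis
      using vf_plus[OF Z vfieldsD(1)[OF X True] vfieldsD(1)[OF Y True], of p] by (simp add: bracket_def vf_add_def)
  next
    case False
    then show ?thesis
      using vfieldsD(2)[OF X] vfieldsD(2)[OF Y] vfieldsD(2)[OF Z] vf_const[OF Z]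
      by (simp add: bracket_def vf_add_def)
  qed
qed

lemma bracket_vf_scale:
  assumes X: "X \<in> vfields A" and Z: "Z \<in> vfields A" and h: "h \<in> smooth_funs A"
  shows "bracket (vf_scale h X) Z = vf_add (vf_scale h (bracket X Z)) (vf_scale (\<lambda>p. - Z h p) X)"
proof (intro ext)
  fix f p
  show "bracket (vf_scale h X) Z f p = vf_add (vf_scale h (bracket X Z)) (vf_scale (\<lambda>p. - Z h p) X) f p"
  proof (cases "f \<in> smooth_funs A")
    case True
    then show ?thesis
      using vfieldsD(4)[OF Z h vfieldsD(1)[OF X True], of p]
      by (simp add: bracket_def vf_add_def vf_scale_def algebra_simps)
  next
    case False
    then show ?thesis
      using vfieldsD(2)[OF X] vfieldsD(2)[OF Z] vf_const[OF Z]
      by (simp add: bracket_def vf_add_def vf_scale_def)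
  qed
qed

lemma bracket_skew: "bracket X Y = vf_scale (\<lambda>p. - 1) (bracket Y X)"
  by (simp add: bracket_def vf_scale_def fun_eq_iff)

context
  fixes A :: "('m, 'e::euclidean_space) atlas" and \<alpha> :: "('m, real) tensor"
  assumes \<alpha>: "is_form A 2 \<alpha>"
begin

lemma form_tensor: "is_tensor A 2 \<alpha>" using \<alpha> unfolding is_form_def by blast

lemma form_smooth: "X \<in> vfields A \<Longrightarrow> Y \<in> vfields A \<Longrightarrow> \<alpha> [X, Y] \<in> smooth_funs A"
  using form_tensor unfolding is_tensor_def vf_tuples_def by auto

lemma ext_d_2_skew:
  assumes X: "X \<in> vfields A" and Y: "Y \<in> vfields A" and Z: "Z \<in> vfields A"
  shows "ext_d \<alpha> [X, Y, Z] p = - ext_d \<alpha> [Y, X, Z] p" "ext_d \<alpha> [X, Y, Z] p = - ext_d \<alpha> [X, Z, Y] p"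
proof -
  note form_tensor = form_tensor
  have sk: "\<alpha> [U, V] = (\<lambda>p. - \<alpha> [V, U] p)" if "U \<in> vfields A" "V \<in> vfields A" for U V
    using is_form_2_skew[OF \<alpha> that] by (rule ext)
  have neg: "W (\<lambda>p. - f p) p = - W f p" if "W \<in> vfields A" "f \<in> smooth_funs A" for W f
    using vf_minus[OF that(1) smooth_funs_const[of 0] that(2), of p] vf_const[OF that(1)] by simp
  have b: "\<alpha> [bracket U V, W] p = - \<alpha> [bracket V U, W] p"
    if "U \<in> vfields A" "V \<in> vfields A" "W \<in> vfields A" for U V W
    using is_tensor_2(3)[OF form_tensor bracket_vfields[OF that(2,1)] that(3) that(3) smooth_funs_const[of "-1"], of p]
    by (simp add: bracket_skew[of U V])
  show "ext_d \<alpha> [X, Y, Z] p = - ext_d \<alpha> [Y, X, Z] p"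
    unfolding ext_d_2 sk[OF X Y] neg[OF Z form_smooth[OF Y X]] b[OF X Y Z] by simp
  show "ext_d \<alpha> [X, Y, Z] p = - ext_d \<alpha> [X, Z, Y] p"
    unfolding ext_d_2 sk[OF Y Z] neg[OF X form_smooth[OF Z Y]] b[OF Y Z X] by simp
qed

lemma ext_d_2_add:
  assumes X: "X \<in> vfields A" and X': "X' \<in> vfields A" and Y: "Y \<in> vfields A" and Z: "Z \<in> vfields A"
  shows "ext_d \<alpha> [vf_add X X', Y, Z] p = ext_d \<alpha> [X, Y, Z] p + ext_d \<alpha> [X', Y, Z] p"
proof -
  note c = smooth_funs_const[of 0 A]
  have a: "\<alpha> [vf_add X X', W] = (\<lambda>p. \<alpha> [X, W] p + \<alpha> [X', W] p)" if "W \<in> vfields A" for W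
    by (rule ext) (rule is_tensor_2(1)[OF form_tensor X X' that c])
  show ?thesis
    unfolding ext_d_2 a[OF Y] a[OF Z] bracket_vf_add[OF X X' Y] bracket_vf_add[OF X X' Z]
      is_tensor_2(1)[OF form_tensor bracket_vfields[OF X Y] bracket_vfields[OF X' Y] Z c]
      is_tensor_2(1)[OF form_tensor bracket_vfields[OF X Z] bracket_vfields[OF X' Z] Y c]
      is_tensor_2(2)[OF form_tensor X X' bracket_vfields[OF Y Z] c]
      vf_plus[OF Y form_smooth[OF X Z] form_smooth[OF X' Z]] vf_plus[OF Z form_smooth[OF X Y] form_smooth[OF X' Y]]
    by (simp add: vf_add_def)
qed

text \<open>The derivatives of \<open>h\<close> produced by the product rule cancel those produced
  by the brackets. So the exterior derivative is linear over functions, and its values on a frame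
  determine it.\<close>

lemma ext_d_2_scale:
  assumes X: "X \<in> vfields A" and Y: "Y \<in> vfields A" and Z: "Z \<in> vfields A" and h: "h \<in> smooth_funs A"
  shows "ext_d \<alpha> [vf_scale h X, Y, Z] p = h p * ext_d \<alpha> [X, Y, Z] p"
proof -
  have a: "\<alpha> [vf_scale h X, W] = (\<lambda>p. h p * \<alpha> [X, W] p)" if "W \<in> vfields A" for W
    by (rule ext) (rule is_tensor_2(3)[OF form_tensor X X that h])
  have m: "(\<lambda>p. - W h p) \<in> smooth_funs A" if "W \<in> vfields A" for W
    using smooth_funs_diff[OF smooth_funs_const[of 0] vfieldsD(1)[OF that h]] by simp
  have b: "\<alpha> [bracket (vf_scale h X) W, V] p = h p * \<alpha> [bracket X W, V] p - W h p * \<alpha> [X, V] p"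
    if W: "W \<in> vfields A" and V: "V \<in> vfields A" for W V
    unfolding bracket_vf_scale[OF X W h]
      is_tensor_2(1)[OF form_tensor vf_scale_vfields[OF h bracket_vfields[OF X W]] vf_scale_vfields[OF m[OF W] X] V h]
      is_tensor_2(3)[OF form_tensor bracket_vfields[OF X W] X V h] is_tensor_2(3)[OF form_tensor X X V m[OF W]]
    by simp
  show ?thesis
    unfolding ext_d_2 a[OF Y] a[OF Z] b[OF Y Z] b[OF Z Y]
      is_tensor_2(4)[OF form_tensor X X bracket_vfields[OF Y Z] h]
      vfieldsD(4)[OF Y h form_smooth[OF X Z]] vfieldsD(4)[OF Z h form_smooth[OF X Y]]
    by (simp add: vf_scale_def algebra_simps)
qed

lemma ext_d_2_sum:
  assumes "finite I" "\<And>i. i \<in> I \<Longrightarrow> E i \<in> vfields A" "\<And>i. i \<in> I \<Longrightarrow> c i \<in> smooth_funs A"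
    and Y: "Y \<in> vfields A" and Z: "Z \<in> vfields A"
    and z: "\<And>i. i \<in> I \<Longrightarrow> ext_d \<alpha> [E i, Y, Z] p = 0"
  shows "ext_d \<alpha> [vf_sum_fields (\<lambda>i. vf_scale (c i) (E i)) I, Y, Z] p = 0"
  using assms(1,2,3) z
proof (induction I rule: finite_induct)
  case empty
  have e: "vf_sum_fields (\<lambda>i. vf_scale (c i) (E i)) {} = vf_scale (\<lambda>p. 0) Y"
    by (simp add: vf_sum_fields_def vf_scale_def)
  show ?case
    unfolding e using ext_d_2_scale[OF Y Y Z smooth_funs_const[of 0], of p] by (simp only: mult_zero_left)
next
  case (insert i I)
  have v: "vf_scale (c k) (E k) \<in> vfields A" if "k \<in> insert i I" for k
    by (rule vf_scale_vfields[OF insert.prems(2)[OF that] insert.prems(1)[OF that]])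
  have "vf_scale (c i) (E i) \<in> vfields A" "vf_sum_fields (\<lambda>i. vf_scale (c i) (E i)) I \<in> vfields A"
    using v by (auto intro!: vf_sum_fields_vfields)
  from ext_d_2_add[OF this Y Z, of p] show ?case
    unfolding vf_sum_fields_insert[OF insert.hyps(1,2)]
    using ext_d_2_scale[OF insert.prems(1)[of i] Y Z insert.prems(2)[of i], of p] insert.prems(3)[of i]
      insert.IH[OF insert.prems] by simp
qed

end

section \<open>Translation of the differential equations into the Lie algebra\<close>

section \<open>Invariant structures\<close>

context lie_quotient
begin

lemma frame_inject: "frame v = frame w \<longleftrightarrow> v = w"
proof
  assume eq: "frame v = frame w"
  show "v = w"
  proof (rule euclidean_eqI)
    fix b :: 'e
    obtain f where "\<And>v. frame v f undefined = v \<bullet> b" using frame_detect[of undefined b] by blast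
    then show "v \<bullet> b = w \<bullet> b" using eq by metis
  qed
qed simp

text \<open>Upstairs the value on left-invariant fields does not change under left translations,
  which act transitively; the projection transports this to the quotient frame.\<close>

lemma pullback_constant:
  assumes inv: "\<And>a. is_pullback A A (\<lambda>x. a \<otimes> x) k \<alpha>' \<alpha>'" and pb: "is_pullback A B \<pi> k \<alpha>' \<alpha>"
    and len: "length vs = k"
  shows "\<alpha> (map frame vs) p = \<alpha> (map frame vs) (\<pi> \<one>)"
proof -
  have "\<alpha>' (map lfield vs) x = \<alpha> (map frame vs) (\<pi> x)" for x
    using pb frame_related len unfolding is_pullback_def by (simp add: list_all2_map1 list_all2_map2 list.rel_refl)
  moreover have "\<alpha>' (map lfield vs) \<one> = \<alpha>' (map lfield vs) a" for a
  proof -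
    have "list_all2 (related A A (\<lambda>x. a \<otimes> x)) (map lfield vs) (map lfield vs)"
      using lfield_related by (simp add: list_all2_map1 list_all2_map2 list.rel_refl)
    moreover have "length (map lfield vs) = k" using len by simp
    ultimately have "\<alpha>' (map lfield vs) \<one> = \<alpha>' (map lfield vs) (a \<otimes> \<one>)"
      using inv[of a] unfolding is_pullback_def by blast
    then show ?thesis by (simp only: r_one carrier_G UNIV_I)
  qed
  ultimately show ?thesis by (metis \<pi>_sec)
qed

lemma endo_pullback_frame:
  assumes J': "\<And>X. X \<in> vfields A \<Longrightarrow> J' X \<in> vfields A"
    and inv: "\<And>a. is_endo_pullback A A (\<lambda>x. a \<otimes> x) J' J'" and pb: "is_endo_pullback A B \<pi> J' J"
  shows "\<exists>u. J (frame v) = frame u"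
proof -
  obtain u where u: "J' (lfield v) = lfield u"
    using left_invariant_is_lfield[OF J'[OF lfield_vfields]] inv lfield_related
    unfolding is_endo_pullback_def by metis
  have "related A B \<pi> (J' (lfield v)) (J (frame v))"
    using pb frame_related unfolding is_endo_pullback_def by blast
  then show ?thesis using related_frame u by metis
qed

lemma br_bilinear: "bilinear br"
proof -
  have "br v (w + w') = br v w + br v w'" for v w w'
    using br_add_left[of w w' v] br_skew[of v "w + w'"] br_skew[of v w] br_skew[of v w'] by simp
  moreover have "br v (c *\<^sub>R w) = c *\<^sub>R br v w" for c v w
    using br_scale_left[of c w v] br_skew[of v "c *\<^sub>R w"] br_skew[of v w] by simp
  ultimately show ?thesis unfolding bilinear_def by (auto intro!: linearI simp: br_add_left br_scale_left)
qed

end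

text \<open>\<open>gm\<close>, \<open>j\<close> and \<open>\<Omega>\<close> are the constant
  coefficients of the structure in the invariant frame. The Lee form is not among them: its
  constancy is a consequence of the equations.\<close>

locale invariant_structure = lie_quotient G A U \<phi> \<Gamma> B \<pi>
  for G :: "'g::{t2_space, second_countable_topology} monoid" (structure)
    and A :: "('g, 'e::euclidean_space) atlas" and U \<phi> \<Gamma>
    and B :: "('m::{t2_space, second_countable_topology}, 'e) atlas" and \<pi> +
  fixes n :: nat and g :: "('m, real) tensor" and J :: "'m vf \<Rightarrow> 'm vf" and \<Psi> :: "('m, complex) tensor"
    and gm :: "'e \<Rightarrow> 'e \<Rightarrow> real" and j :: "'e \<Rightarrow> 'e" and \<Omega> :: "'e list \<Rightarrow> complex"
  assumes su: "su_structure B n g J \<Psi>"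
    and g_frame: "\<And>v w p. g [frame v, frame w] p = gm v w" and J_frame: "\<And>v. J (frame v) = frame (j v)"
    and \<Psi>_frame: "\<And>vs p. length vs = n \<Longrightarrow> \<Psi> (map frame vs) p = \<Omega> vs"
begin

lemma g_tensor: "is_tensor B 2 g" and g_sym: "\<And>X Y p. X \<in> vfields B \<Longrightarrow> Y \<in> vfields B \<Longrightarrow> g [X, Y] p = g [Y, X] p"
  and g_pos: "\<And>X p. X \<in> vfields B \<Longrightarrow> (\<exists>f\<in>smooth_funs B. X f p \<noteq> 0) \<Longrightarrow> g [X, X] p > 0"
  and J_vfields: "\<And>X. X \<in> vfields B \<Longrightarrow> J X \<in> vfields B"
  and J_add: "\<And>X Y. X \<in> vfields B \<Longrightarrow> Y \<in> vfields B \<Longrightarrow> J (vf_add X Y) = vf_add (J X) (J Y)"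
  and J_scale: "\<And>X h. X \<in> vfields B \<Longrightarrow> h \<in> smooth_funs B \<Longrightarrow> J (vf_scale h X) = vf_scale h (J X)"
  and J_J: "\<And>X. X \<in> vfields B \<Longrightarrow> J (J X) = vf_scale (\<lambda>p. - 1) X"
  and g_J: "\<And>X Y p. X \<in> vfields B \<Longrightarrow> Y \<in> vfields B \<Longrightarrow> g [J X, J Y] p = g [X, Y] p"
  and dim: "DIM('e) = 2 * n"
  using su unfolding su_structure_def almost_hermitian_def riemannian_metric_def almost_complex_def by blast+

lemma gm_bilinear: "bilinear gm"
proof -
  have c: "frame (c *\<^sub>R v) = vf_scale (\<lambda>p. c) (frame v)" for c v by (rule frame_scale)
  note t = is_tensor_2[OF g_tensor frame_vfields frame_vfields frame_vfields smooth_funs_const]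
  have "gm (v + v') w = gm v w + gm v' w" "gm w (v + v') = gm w v + gm w v'"
    "gm (c *\<^sub>R v) w = c * gm v w" "gm w (c *\<^sub>R v) = c * gm w v" for v v' w c
    unfolding g_frame[symmetric, of _ _ undefined] frame_add frame_scale by (rule t)+
  then show ?thesis unfolding bilinear_def by (auto intro!: linearI)
qed

sublocale h: hermitian_lie_algebra br gm j
proof (intro hermitian_lie_algebra.intro metric_lie_algebra.intro hermitian_lie_algebra_axioms.intro)
  show "bilinear br" by (rule br_bilinear)
  show "bilinear gm" by (rule gm_bilinear)
  show "br x y = - br y x" for x y by (rule br_skew)
  show "br (br x y) z + br (br y z) x + br (br z x) y = 0" for x y z by (rule br_jacobi)
  show "gm x y = gm y x" for x y
    unfolding g_frame[symmetric, of _ _ undefined] by (rule g_sym[OF frame_vfields frame_vfields])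
  show "x \<noteq> 0 \<Longrightarrow> 0 < gm x x" for x
    unfolding g_frame[symmetric, of _ _ undefined] by (intro g_pos frame_vfields frame_nonzero)
  show "linear j"
  proof (rule linearI)
    show "j (v + w) = j v + j w" for v w
      unfolding frame_inject[symmetric] J_frame[symmetric] frame_add by (rule J_add[OF frame_vfields frame_vfields])
    show "j (c *\<^sub>R v) = c *\<^sub>R j v" for c v
      unfolding frame_inject[symmetric] J_frame[symmetric] frame_scale by (rule J_scale[OF frame_vfields smooth_funs_const])
  qed
  show "gm (j x) (j y) = gm x y" for x y
    unfolding g_frame[symmetric, of _ _ undefined] J_frame[symmetric] by (rule g_J[OF frame_vfields frame_vfields])
  show "j (j x) = - x" for x
  proof -
    have "frame (j (j x)) = frame (- x)"
      using J_J[OF frame_vfields, of x] frame_scale[of "- 1" x] by (simp add: J_frame)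
    then show ?thesis by (simp add: frame_inject)
  qed
qed

abbreviation "\<omega> \<equiv> fundamental_form g J"

lemma \<omega>_frame: "\<omega> [frame v, frame w] p = gm (j v) w"
  by (simp add: fundamental_form_def J_frame g_frame)

lemma \<omega>_form: "is_form B 2 \<omega>"
proof -
  have sm: "\<omega> Xs \<in> smooth_funs B" if Xs: "Xs \<in> vf_tuples B 2" for Xs
  proof -
    have "[J (Xs ! 0), Xs ! 1] \<in> vf_tuples B 2"
      using Xs J_vfields unfolding vf_tuples_def by (auto simp: subset_iff)
    then show ?thesis using g_tensor unfolding is_tensor_def fundamental_form_def by blast
  qed
  have "is_tensor B 2 \<omega>"
    unfolding is_tensor_def
  proof (intro ballI conjI allI impI)
    fix Xs p and i :: nat
    assume Xs: "Xs \<in> vf_tuples B 2" and i: "i < 2"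
    obtain X Y where XY: "Xs = [X, Y]" "X \<in> vfields B" "Y \<in> vfields B"
      using Xs unfolding vf_tuples_def by (auto simp: length_Suc_conv numeral_2_eq_2)
    have i': "i = 0 \<or> i = 1" using i by auto
    show "\<omega> (Xs[i := vf_add (Xs ! i) Z]) p = \<omega> Xs p + \<omega> (Xs[i := Z]) p" if "Z \<in> vfields B" for Z
      using i' XY that is_tensor_2(1)[OF g_tensor J_vfields[OF XY(2)] J_vfields[OF that] XY(3) smooth_funs_const, of p]
        is_tensor_2(2)[OF g_tensor XY(3) that J_vfields[OF XY(2)] smooth_funs_const, of p]
      by (auto simp: fundamental_form_def J_add)
    show "\<omega> (Xs[i := vf_scale h (Xs ! i)]) p = h p * \<omega> Xs p" if "h \<in> smooth_funs B" for h
      using i' XY that is_tensor_2(3)[OF g_tensor J_vfields[OF XY(2)] J_vfields[OF XY(2)] XY(3) that, of p]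
        is_tensor_2(4)[OF g_tensor XY(3) XY(3) J_vfields[OF XY(2)] that, of p]
      by (auto simp: fundamental_form_def J_scale)
  qed (rule sm)
  moreover have "\<omega> Xs p = 0" if Xs: "Xs \<in> vf_tuples B 2" and ik: "i < k" "k < 2" "Xs ! i = Xs ! k" for Xs i k p
  proof -
    obtain X Y where XY: "Xs = [X, Y]" "X \<in> vfields B" "Y \<in> vfields B"
      using Xs unfolding vf_tuples_def by (auto simp: length_Suc_conv numeral_2_eq_2)
    have "X = Y" using ik XY by (cases k) (auto simp: less_2_cases_iff)
    have JX: "J X \<in> vfields B" by (rule J_vfields[OF XY(2)])
    have "g [J X, X] p = g [vf_scale (\<lambda>p. - 1) X, J X] p"
      using g_J[OF JX XY(2), of p] J_J[OF XY(2)] by simp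
    also have "\<dots> = - g [X, J X] p"
      using is_tensor_2(3)[OF g_tensor XY(2) XY(2) JX smooth_funs_const[of "- 1"], of p] by simp
    finally show ?thesis using g_sym[OF XY(2) JX, of p] XY \<open>X = Y\<close> by (simp add: fundamental_form_def)
  qed
  ultimately show ?thesis unfolding is_form_def by blast
qed

lemma \<omega>_skew: "X \<in> range frame \<Longrightarrow> Y \<in> range frame \<Longrightarrow> \<omega> [X, Y] p = - \<omega> [Y, X] p"
  using is_form_2_skew[OF \<omega>_form] frame_vfields by blast

lemma frame_const: "frame v (\<lambda>p. c) p = 0"
  by (rule vf_const[OF frame_vfields])

lemma d\<omega>_frame: "ext_d \<omega> [frame x, frame y, frame z] p = h.dom3 x y z"
  unfolding ext_d_2 bracket_frame \<omega>_frame[abs_def] frame_const h.dom3_def by simp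

lemma ddc_frame: "ext_d (d_c J \<omega>) [frame x, frame y, frame z, frame t] p = h.ddc x y z t"
proof -
  have "d_c J \<omega> [frame a, frame b, frame c] = (\<lambda>p. h.dom3 (j a) (j b) (j c))" for a b c
    by (simp add: d_c_def J_frame d\<omega>_frame fun_eq_iff)
  then show ?thesis unfolding ext_d_3 bracket_frame by (simp add: frame_const h.ddc_def)
qed

text \<open>The coefficients of any field in a frame orthonormal for the metric are the smooth
  functions \<open>g [X, frame (?e i)]\<close>, so every global field is a finite combination of
  frame fields over the functions.\<close>

lemma d\<omega>_closed:
  assumes z: "\<And>x y z. h.dom3 x y z = 0"
  shows "tensor_eq B 3 (ext_d \<omega>) zero_form"
proof -
  obtain u where "h.unitary u n" using h.unitary_exists[of n] dim by auto
  then have e: "h.onb (h.real_basis u) (2 * n)" using h.unitary_onb dim by blast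
  let ?e = "h.real_basis u"
  have decomp: "X = vf_sum_fields (\<lambda>i. vf_scale (g [X, frame (?e i)]) (frame (?e i))) {..<2 * n}"
    if X: "X \<in> vfields B" for X
  proof (intro ext)
    fix f p
    obtain v where v: "\<And>f. f \<in> smooth_funs B \<Longrightarrow> X f p = frame v f p" using frame_span[OF X] by blast
    have gv: "g [X, frame w] p = gm v w" for w
      using is_tensor_pointwise[OF atlas_B g_tensor, of "[X, frame w]" 0 X "frame v" p] X frame_vfields v
      by (simp add: vf_tuples_def g_frame)
    show "X f p = vf_sum_fields (\<lambda>i. vf_scale (g [X, frame (?e i)]) (frame (?e i))) {..<2 * n} f p"
    proof (cases "f \<in> smooth_funs B")
      case True
      have "linear (\<lambda>v. frame v f p)"
        by (rule linearI) (simp_all add: frame_add frame_scale vf_add_def vf_scale_def)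
      from h.onb_linear_expand[OF e this, of v] show ?thesis
        using v[OF True] by (simp add: vf_sum_fields_def vf_scale_def gv)
    next
      case False
      then show ?thesis using vfieldsD(2)[OF X] vfieldsD(2)[OF frame_vfields] by (simp add: vf_sum_fields_def vf_scale_def)
    qed
  qed
  have gs: "g [X, frame w] \<in> smooth_funs B" if "X \<in> vfields B" for X w
    using form_smooth g_tensor that frame_vfields unfolding is_tensor_def vf_tuples_def by auto
  \<comment> \<open>Replaces the first argument by a frame field. Skewness brings the other two
    slots to the front, and the three facts below treat one slot each.\<close>
  have red: "ext_d \<omega> [X, Y, Z] p = 0"
    if X: "X \<in> vfields B" and "Y \<in> vfields B" "Z \<in> vfields B" and F: "\<And>v. ext_d \<omega> [frame v, Y, Z] p = 0" for X Y Z p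
    by (subst decomp[OF X]) (intro ext_d_2_sum[OF \<omega>_form] frame_vfields gs that finite_lessThan F)
  have 1: "ext_d \<omega> [X, frame v, frame w] p = 0" if "X \<in> vfields B" for X v w p
    by (rule red[OF that frame_vfields frame_vfields]) (simp add: d\<omega>_frame z)
  have 2: "ext_d \<omega> [X, Y, frame w] p = 0" if X: "X \<in> vfields B" and Y: "Y \<in> vfields B" for X Y w p
  proof (rule red[OF X Y frame_vfields])
    fix v show "ext_d \<omega> [frame v, Y, frame w] p = 0"
      using ext_d_2_skew(1)[OF \<omega>_form frame_vfields Y frame_vfields, of v w p] 1[OF Y] by simp
  qed
  have 3: "ext_d \<omega> [X, Y, Z] p = 0" if X: "X \<in> vfields B" and Y: "Y \<in> vfields B" and Z: "Z \<in> vfields B" for X Y Z p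
  proof (rule red[OF X Y Z])
    fix v
    have "ext_d \<omega> [frame v, Y, Z] p = - ext_d \<omega> [Y, frame v, Z] p"
      by (rule ext_d_2_skew(1)[OF \<omega>_form frame_vfields Y Z])
    also have "\<dots> = ext_d \<omega> [Y, Z, frame v] p"
      using ext_d_2_skew(2)[OF \<omega>_form Y frame_vfields Z, of v p] by simp
    finally show "ext_d \<omega> [frame v, Y, Z] p = 0" using 2[OF Y Z] by simp
  qed
  show ?thesis unfolding tensor_eq_def zero_form_def vf_tuples_def
    using 3 by (auto simp: length_Suc_conv numeral_3_eq_3)
qed

lemma one_form_frame_zero:
  assumes \<theta>: "is_form B 1 \<theta>" and z: "\<And>v p. \<theta> [frame v] p = 0" and X: "X \<in> vfields B"
  shows "\<theta> [X] p = 0"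
proof -
  have t: "is_tensor B 1 \<theta>" using \<theta> unfolding is_form_def by blast
  obtain v where "\<And>f. f \<in> smooth_funs B \<Longrightarrow> X f p = frame v f p" using frame_span[OF X] by blast
  then show ?thesis
    using is_tensor_pointwise[OF atlas_B t, of "[X]" 0 X "frame v" p] X frame_vfields z by (simp add: vf_tuples_def)
qed

end

context invariant_structure
begin

lemma theta_linear:
  assumes "is_form B 1 \<theta>"
  shows "linear (\<lambda>v. \<theta> [frame v] p)"
proof (rule linearI)
  have t: "is_tensor B 1 \<theta>" using assms unfolding is_form_def by blast
  show "\<theta> [frame (v + w)] p = \<theta> [frame v] p + \<theta> [frame w] p" for v w
    using is_tensorD(1)[OF t, of "[frame v]" 0 "frame v" "frame w" p] frame_vfields
    by (simp add: vf_tuples_def frame_add)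
  show "\<theta> [frame (c *\<^sub>R v)] p = c *\<^sub>R \<theta> [frame v] p" for c v
    using is_tensorD(2)[OF t, of "[frame v]" 0 "frame v" "\<lambda>p. c" p] frame_vfields smooth_funs_const[of c B]
    by (simp add: vf_tuples_def frame_scale)
qed

lemma torsion_vanishes:
  assumes sol: "solvable G" and n: "n \<le> 3" and u: "h.unitary u n" and \<theta>: "is_form B 1 \<theta>"
    and lee1: "\<And>p a. a < n \<Longrightarrow> (\<Sum>b<n. h.dom3 (u b) (j (u b)) (u a)) = \<theta> [frame (u a)] p"
    and lee2: "\<And>p a. a < n \<Longrightarrow> (\<Sum>b<n. h.dom3 (u b) (j (u b)) (j (u a))) = \<theta> [frame (j (u a))] p"
    and nij: "\<And>x y. h.nij x y = 0"
    and psi: "\<And>x p. \<theta> [frame x] p = - (\<Sum>a<n. gm (h.ad01 x (u a)) (u a))"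
    and skt: "tensor_eq B 4 (ext_d (d_c J \<omega>)) zero_form" and closed: "tensor_eq B 2 (ext_d \<theta>) zero_form"
  shows "\<theta> [frame v] p = 0" "h.dom3 x y z = 0"
proof -
  define th where "th = (\<lambda>v. \<theta> [frame v] (\<pi> \<one>))"
  \<comment> \<open>\<theta> is not assumed invariant; the trace formula determines its values on
    the frame by quantities that do not depend on the point.\<close>
  have const: "\<theta> [frame v] = (\<lambda>p. th v)" for v
    using psi by (simp add: th_def fun_eq_iff)
  have lin: "linear th" unfolding th_def by (rule theta_linear[OF \<theta>])
  have cl: "th (br x y) = 0" for x y
  proof -
    have "ext_d \<theta> [frame x, frame y] undefined = 0"
      using closed frame_vfields unfolding tensor_eq_def vf_tuples_def zero_form_def by simp
    then show ?thesis by (simp add: ext_d_1 bracket_frame const frame_const)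
  qed
  have sk: "h.ddc x y z t = 0" for x y z t
  proof -
    have "ext_d (d_c J \<omega>) [frame x, frame y, frame z, frame t] undefined = 0"
      using skt frame_vfields unfolding tensor_eq_def vf_tuples_def zero_form_def by simp
    then show ?thesis by (simp add: ddc_frame)
  qed
  have d: "DIM('e) \<le> 6" using dim n by simp
  have nij': "br x y - br (j x) (j y) + j (br (j x) y) + j (br x (j y)) = 0" for x y
    using nij unfolding h.nij_def .
  have "th x = - (\<Sum>a<n. gm (h.ad01 x (u a)) (u a))" for x unfolding th_def by (rule psi)
  from h.theta_from_trace[OF u nij this]
  have psi': "th x = - (h.tr (h.real_basis u) (2 * n) (br x) + h.tr (h.real_basis u) (2 * n) (\<lambda>y. j (br (j x) y))) / 2" for x .
  have lee': "(\<Sum>i<2 * n. h.dom3 (h.real_basis u i) (j (h.real_basis u i)) x) = 2 * th x" for x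
    by (rule h.lee_from_trace[OF u dim lin]) (simp_all only: th_def lee1 lee2)
  note result = h.solvable_twisted_torsion_free[OF solvable_lie_algebra[OF sol] d lin cl nij'
      h.unitary_onb[OF u dim] psi' lee' sk]
  show "\<theta> [frame v] p = 0" using result(1) by (simp add: const)
  show "h.dom3 x y z = 0" by (rule result(2))
qed

lemma unitaryD:
  assumes "h.unitary u m" "a < m" "b < m"
  shows "gm (u a) (u b) = (if a = b then 1 else 0)" "gm (j (u a)) (u b) = 0" "gm (u a) (j (u b)) = 0"
  using assms h.gm_sym[of "u a" "j (u b)"] unfolding h.unitary_def by simp_all

lemma \<Psi>_forms: "is_form B n (re_form \<Psi>)" "is_form B n (im_form \<Psi>)"
  and \<Psi>_J: "\<And>Xs i p. Xs \<in> vf_tuples B n \<Longrightarrow> i < n \<Longrightarrow> \<Psi> (Xs[i := J (Xs ! i)]) p = \<i> * \<Psi> Xs p"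
  using su unfolding su_structure_def type_n0_def is_cform_def by blast+

lemma complex_form_eqI: "re_form \<Psi> Xs p = Re z \<Longrightarrow> im_form \<Psi> Xs p = Im z \<Longrightarrow> \<Psi> Xs p = z"
  by (simp add: re_form_def im_form_def complex_eq_iff)

lemma \<omega>_power_1: "form_power \<omega> 1 [frame v, frame w] = (\<lambda>p. gm (j v) w)"
  by (rule ext) (simp only: form_power_1[of "range frame" \<omega>, OF \<omega>_skew rangeI rangeI] \<omega>_frame)

lemma \<omega>_power_2: "form_power \<omega> 2 [frame x, frame y, frame z, frame t] = (\<lambda>p. square2 (\<lambda>v w. gm (j v) w) x y z t)"
proof (rule ext)
  fix p
  have S: "set [frame x, frame y, frame z, frame t] \<subseteq> range frame" by auto
  show "form_power \<omega> 2 [frame x, frame y, frame z, frame t] p = square2 (\<lambda>v w. gm (j v) w) x y z t"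
    by (simp only: form_power_2[of "range frame" \<omega>, OF \<omega>_skew S] square2_def \<omega>_frame)
qed

lemma closed_if_lee_form_zero:
  assumes \<theta>: "is_form B 1 \<theta>" and z: "\<And>v p. \<theta> [frame v] p = 0"
    and psi: "tensor_eq B (n + 1) (ext_dc \<Psi>) (wedge 1 n (\<lambda>Xs p. complex_of_real (\<theta> Xs p)) \<Psi>)"
  shows "tensor_eq B (n + 1) (ext_dc \<Psi>) zero_form"
  unfolding tensor_eq_def zero_form_def
proof (intro ballI allI)
  fix Xs p assume Xs: "Xs \<in> vf_tuples B (n + 1)"
  have "\<theta> (map (\<lambda>i. Xs ! \<sigma> i) [0..<1]) p = 0" if "\<sigma> permutes {..<1 + n}" for \<sigma>
  proof -
    have "\<sigma> 0 < n + 1" using permutes_in_image[OF that, of 0] by auto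
    then have "Xs ! \<sigma> 0 \<in> vfields B" using Xs unfolding vf_tuples_def by (auto simp: subset_iff)
    from one_form_frame_zero[OF \<theta> z this] show ?thesis by simp
  qed
  then have "wedge 1 n (\<lambda>Xs p. complex_of_real (\<theta> Xs p)) \<Psi> Xs p = 0"
    unfolding wedge_def by (auto intro!: sum.neutral simp del: One_nat_def)
  then show "ext_dc \<Psi> Xs p = 0" using psi Xs unfolding tensor_eq_def by simp
qed

lemma torsion_free_2:
  assumes n: "n = 2" and sol: "solvable G" and lee: "lee_form B n \<omega> \<theta>" and tw: "twisted_calabi_yau B n J \<omega> \<theta> \<Psi>"
  shows "torsion_free B n \<omega> \<Psi>"
proof -
  obtain u where u: "h.unitary u 2" using h.unitary_exists[of 2] dim n by auto
  have d: "DIM('e) = 2 * 2" using dim n by simp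
  note U = unitaryD[OF u]
  have U': "gm (u 0) (u 0) = 1" "gm (u 1) (u 1) = 1" "gm (u 0) (u 1) = 0" "gm (u 1) (u 0) = 0"
    "gm (j (u 0)) (u 0) = 0" "gm (j (u 1)) (u 1) = 0" "gm (j (u 0)) (u 1) = 0" "gm (j (u 1)) (u 0) = 0"
    "gm (u 0) (j (u 0)) = 0" "gm (u 1) (j (u 1)) = 0" "gm (u 0) (j (u 1)) = 0" "gm (u 1) (j (u 0)) = 0"
    by (simp_all add: U)
  have \<theta>: "is_form B 1 \<theta>" and le: "tensor_eq B 3 (ext_d (form_power \<omega> 1)) (wedge 1 2 \<theta> (form_power \<omega> 1))"
    using lee n by (simp_all add: lee_form_def del: form_power.simps)
  have psi: "tensor_eq B 3 (ext_dc \<Psi>) (wedge 1 2 (\<lambda>Xs p. complex_of_real (\<theta> Xs p)) \<Psi>)"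
    and skt: "tensor_eq B 4 (ext_d (d_c J \<omega>)) zero_form" and closed: "tensor_eq B 2 (ext_d \<theta>) zero_form"
    using tw n by (simp_all add: twisted_calabi_yau_def)
  \<comment> \<open>In complex dimension two the defining equation of the Lee form is d\<omega> =
    \<theta> \<and> \<omega> itself.\<close>
  have l: "h.dom3 x y z = \<theta> [frame x] p * gm (j y) z - \<theta> [frame y] p * gm (j x) z + \<theta> [frame z] p * gm (j x) y" for x y z p
  proof -
    have "ext_d (form_power \<omega> 1) [frame x, frame y, frame z] p = wedge 1 2 \<theta> (form_power \<omega> 1) [frame x, frame y, frame z] p"
      using le frame_vfields unfolding tensor_eq_def vf_tuples_def by (simp del: form_power.simps One_nat_def)
    also have "\<dots> = \<theta> [frame x] p * gm (j y) z - \<theta> [frame y] p * gm (j x) z + \<theta> [frame z] p * gm (j x) y"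
    proof -
      have "form_power \<omega> 1 [X, Y] p = - form_power \<omega> 1 [Y, X] p" if XY: "X \<in> range frame" "Y \<in> range frame" for X Y
      proof -
        obtain v w where "X = frame v" "Y = frame w" using XY by auto
        then show ?thesis using \<omega>_skew[OF XY, of p] by (simp add: \<omega>_power_1 \<omega>_frame del: form_power.simps One_nat_def)
      qed
      from wedge_1_2[of "range frame" "form_power \<omega> 1" p "frame x" "frame y" "frame z" \<theta>, OF this]
      show ?thesis by (simp add: \<omega>_power_1 del: form_power.simps One_nat_def)
    qed
    finally show ?thesis
      unfolding ext_d_2 bracket_frame \<omega>_power_1 frame_const by (simp add: h.dom3_def)
  qed
  have fr: "set [frame x, frame y] \<subseteq> vfields B" for x y using frame_vfields by simp
  have \<Psi>f: "\<Psi> [frame x, frame y] p = \<Omega> [x, y]" for x y p using \<Psi>_frame[of "[x, y]" p] n by simp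
  note f2 = \<Psi>_forms[unfolded n]
  have t2: "is_tensor B 2 (re_form \<Psi>)" "is_tensor B 2 (im_form \<Psi>)" using f2 unfolding is_form_def by auto
  have lin: "linear (\<lambda>x. \<Omega> [x, y])" for y
  proof (rule linearI)
    note t = is_tensor_2[OF t2(1) frame_vfields frame_vfields frame_vfields smooth_funs_const, of _ _ y undefined]
      is_tensor_2[OF t2(2) frame_vfields frame_vfields frame_vfields smooth_funs_const, of _ _ y undefined]
    show "\<Omega> [v + w, y] = \<Omega> [v, y] + \<Omega> [w, y]" for v w
      unfolding \<Psi>f[symmetric, of _ _ undefined] frame_add
      by (rule complex_form_eqI) (simp_all add: t, simp_all add: re_form_def im_form_def)
    show "\<Omega> [c *\<^sub>R v, y] = c *\<^sub>R \<Omega> [v, y]" for c v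
      unfolding \<Psi>f[symmetric, of _ _ undefined] frame_scale
      by (rule complex_form_eqI) (simp_all add: t, simp_all add: re_form_def im_form_def)
  qed
  have sk: "\<Psi> [frame x, frame y] p = - \<Psi> [frame y, frame x] p" for x y p
    using is_form_2_skew[OF f2(1) frame_vfields frame_vfields, of x y p]
      is_form_2_skew[OF f2(2) frame_vfields frame_vfields, of x y p]
    by (intro complex_form_eqI) (simp_all add: re_form_def im_form_def)
  have alt: "\<Omega> [x, y] = - \<Omega> [y, x]" for x y using sk[of x y undefined] by (simp only: \<Psi>f)
  have Jc: "\<Omega> [j x, y] = \<i> * \<Omega> [x, y]" for x y
    using \<Psi>_J[of "[frame x, frame y]" 0 undefined] n frame_vfields by (simp add: vf_tuples_def J_frame \<Psi>f)
  have dPsi: "ext_dc \<Psi> [frame x, frame y, frame z] p = - \<Omega> [br x y, z] + \<Omega> [br x z, y] - \<Omega> [br y z, x]" for x y z p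
  proof -
    have "re_form \<Psi> [frame a, frame b] = (\<lambda>p. Re (\<Omega> [a, b]))" "im_form \<Psi> [frame a, frame b] = (\<lambda>p. Im (\<Omega> [a, b]))" for a b
      by (simp_all add: re_form_def im_form_def \<Psi>f fun_eq_iff)
    then show ?thesis unfolding ext_dc_def ext_d_2 bracket_frame by (simp add: frame_const complex_eq_iff)
  qed
  have wPsi: "wedge 1 2 (\<lambda>Xs p. complex_of_real (\<theta> Xs p)) \<Psi> [frame x, frame y, frame z] p =
      \<theta> [frame x] p * \<Omega> [y, z] - \<theta> [frame y] p * \<Omega> [x, z] + \<theta> [frame z] p * \<Omega> [x, y]" for x y z p
  proof -
    have "\<Psi> [X, Y] p = - \<Psi> [Y, X] p" if XY: "X \<in> range frame" "Y \<in> range frame" for X Y using that sk by blast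
    from wedge_1_2[of "range frame" \<Psi> p "frame x" "frame y" "frame z" "\<lambda>Xs p. complex_of_real (\<theta> Xs p)", OF this]
    show ?thesis by (simp add: \<Psi>f)
  qed
  \<comment> \<open>If \<Omega> vanished on the complex basis it would vanish identically, and so
    would the square of its real part. The normalisation equates that square with \<omega> \<and>
    \<omega>, whose value on the unitary basis is 2.\<close>
  have nz: "\<Omega> [u 0, u 1] \<noteq> 0"
  proof
    assume z: "\<Omega> [u 0, u 1] = 0"
    have ex: "\<Omega> [x, y] = Complex (gm x (u 0)) (gm x (j (u 0))) * \<Omega> [u 0, y] + Complex (gm x (u 1)) (gm x (j (u 1))) * \<Omega> [u 1, y]" for x y
      using h.complex_linear_expand[OF u d lin Jc, of x y] by (simp add: numeral_2_eq_2)
    have s: "\<Omega> [u 0, u 0] = 0" "\<Omega> [u 1, u 1] = 0" "\<Omega> [u 1, u 0] = 0"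
      using alt[of "u 0" "u 0"] alt[of "u 1" "u 1"] alt[of "u 1" "u 0"] z by simp_all
    have "\<Omega> [x, u 0] = 0" "\<Omega> [x, u 1] = 0" for x using ex[of x "u 0"] ex[of x "u 1"] s z by simp_all
    then have "\<Omega> [u 0, y] = 0" "\<Omega> [u 1, y] = 0" for y using alt[of "u 0" y] alt[of "u 1" y] by simp_all
    then have z: "\<Omega> [x, y] = 0" for x y using ex[of x y] by simp
    let ?e = "[u 0, j (u 0), u 1, j (u 1)]"
    have "tensor_eq B 4 (form_power \<omega> 2) (wedge 2 2 (re_form \<Psi>) (re_form \<Psi>))"
      using su n unfolding su_structure_def unit_norm_def by simp
    then have "form_power \<omega> 2 (map frame ?e) undefined = wedge 2 2 (re_form \<Psi>) (re_form \<Psi>) (map frame ?e) undefined"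
      using frame_vfields unfolding tensor_eq_def vf_tuples_def by (simp del: form_power.simps)
    also have "\<dots> = 0"
      unfolding wedge_def
    proof (intro divide_eq_0_iff[THEN iffD2] disjI1 sum.neutral ballI)
      fix \<sigma> assume "\<sigma> \<in> {\<sigma>. \<sigma> permutes {..<2 + 2::nat}}"
      then have s: "\<sigma> i < 4" if "i < 4" for i using permutes_in_image[of \<sigma> "{..<4}" i] that by auto
      have "map (\<lambda>i. map frame ?e ! \<sigma> i) [0..<2] = [frame (?e ! \<sigma> 0), frame (?e ! \<sigma> 1)]"
        using s[of 0] s[of 1] by (simp add: upt_rec numeral_2_eq_2 nth_map[where xs = ?e, simplified])
      then show "of_int (sign \<sigma>) * re_form \<Psi> (map (\<lambda>i. map frame ?e ! \<sigma> i) [0..<2]) undefined *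
          re_form \<Psi> (map (\<lambda>i. map frame ?e ! \<sigma> i) [2..<2 + 2]) undefined = 0"
        by (simp only: re_form_def \<Psi>f z zero_complex.sel mult_zero_right mult_zero_left)
    qed
    finally show False by (simp add: \<omega>_power_2 square2_def h.j_isometry h.gm_lin U'[simplified] del: form_power.simps)
  qed
  have eq: "- \<Omega> [br x y, z] + \<Omega> [br x z, y] - \<Omega> [br y z, x] =
      \<theta> [frame x] p * \<Omega> [y, z] - \<theta> [frame y] p * \<Omega> [x, z] + \<theta> [frame z] p * \<Omega> [x, y]" for x y z p
  proof -
    have "ext_dc \<Psi> [frame x, frame y, frame z] p =
        wedge 1 2 (\<lambda>Xs p. complex_of_real (\<theta> Xs p)) \<Psi> [frame x, frame y, frame z] p"
      using psi frame_vfields unfolding tensor_eq_def vf_tuples_def by simp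
    then show ?thesis unfolding dPsi wPsi .
  qed
  note vol = h.volume_form_2[OF u d, of "\<lambda>x y. \<Omega> [x, y]", OF lin alt Jc nz eq]
  have lee1: "(\<Sum>b<n. h.dom3 (u b) (j (u b)) (u a)) = \<theta> [frame (u a)] p" if "a < n" for a p
    using that n l[of "u 0" "j (u 0)" "u a" p] l[of "u 1" "j (u 1)" "u a" p]
    by (auto simp: numeral_2_eq_2 less_Suc_eq h.j_isometry h.gm_lin U'[simplified])
  have lee2: "(\<Sum>b<n. h.dom3 (u b) (j (u b)) (j (u a))) = \<theta> [frame (j (u a))] p" if "a < n" for a p
    using that n l[of "u 0" "j (u 0)" "j (u a)" p] l[of "u 1" "j (u 1)" "j (u a)" p]
    by (auto simp: numeral_2_eq_2 less_Suc_eq h.j_isometry h.gm_lin U'[simplified])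
  have th: "\<theta> [frame x] p = - (\<Sum>a<n. gm (h.ad01 x (u a)) (u a))" for x p
    using vol(2) n by simp
  have n3: "n \<le> 3" and un: "h.unitary u n" using n u by simp_all
  note res = torsion_vanishes[OF sol n3 un \<theta> lee1 lee2 vol(1) th skt closed]
  note c = closed_if_lee_form_zero[OF \<theta> res(1)]
  have "tensor_eq B 3 (ext_dc \<Psi>) zero_form" using c n psi by simp
  then show ?thesis using d\<omega>_closed[OF res(2)] n unfolding torsion_free_def by simp
qed

end

context invariant_structure
begin

text \<open>Evaluate d(\<omega> \<and> \<omega>) = \<theta> \<and> \<omega> \<and> \<omega> on y,
  Jy, z, Jz, x with the three complex lines orthogonal; both sides then carry the factor 2.\<close>

lemma lee_form_unitary_3:
  assumes lee: "tensor_eq B 5 (ext_d (form_power \<omega> 2)) (wedge 1 4 \<theta> (form_power \<omega> 2))"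
    and norm: "gm y y = 1" "gm z z = 1"
    and orth: "gm y z = 0" "gm (j y) z = 0" "gm x y = 0" "gm (j x) y = 0" "gm x z = 0" "gm (j x) z = 0"
  shows "h.dom3 y (j y) x + h.dom3 z (j z) x = \<theta> [frame x] p"
proof -
  have swap: "gm (j v) w = - gm (j w) v" for v w
    using h.j_isometry[of v "j w"] h.gm_sym[of v "j w"] by (simp add: h.gm_lin)
  have swap': "gm v (j w) = gm (j w) v" for v w by (rule h.gm_sym)
  have W: "gm (j v) v = 0" for v using swap[of v v] by simp
  have orth': "gm z y = 0" "gm y x = 0" "gm z x = 0" "gm (j z) y = 0" "gm (j y) x = 0" "gm (j z) x = 0"
    "gm y (j z) = 0" "gm z (j y) = 0" "gm x (j y) = 0" "gm y (j x) = 0" "gm x (j z) = 0" "gm z (j x) = 0"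
    "gm y (j y) = 0" "gm z (j z) = 0" "gm x (j x) = 0"
    using orth swap[of z y] swap[of y x] swap[of z x] swap'[of y z] swap'[of z y] swap'[of x y] swap'[of y x]
      swap'[of x z] swap'[of z x] swap'[of y y] swap'[of z z] swap'[of x x] W
      h.gm_sym[of z y] h.gm_sym[of y x] h.gm_sym[of z x] by simp_all
  note o = orth orth' W norm
  let ?L = "[frame y, frame (j y), frame z, frame (j z), frame x]"
  have "ext_d (form_power \<omega> 2) ?L p = wedge 1 4 \<theta> (form_power \<omega> 2) ?L p"
    using lee frame_vfields unfolding tensor_eq_def vf_tuples_def by (simp del: form_power.simps One_nat_def)
  also have "\<dots> = 2 * \<theta> [frame x] p"
  proof (rule wedge_1_4_unitary[of "range frame" \<omega>, OF \<omega>_skew])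
    show "set ?L \<subseteq> range frame" by auto
    fix a b :: nat assume "a < 5" "b < 5"
    then have "a = 0 \<or> a = 1 \<or> a = 2 \<or> a = 3 \<or> a = 4" "b = 0 \<or> b = 1 \<or> b = 2 \<or> b = 3 \<or> b = 4" by linarith+
    then show "\<omega> [?L ! a, ?L ! b] p = of_int (if a < 4 \<and> b < 4 then tab a b else 0)"
      by (elim disjE; simp add: \<omega>_frame h.j_isometry h.gm_lin o)
  qed simp_all
  finally have "ext_d (form_power \<omega> 2) ?L p = 2 * \<theta> [frame x] p" .
  then have "2 * (h.dom3 y (j y) x + h.dom3 z (j z) x) = 2 * \<theta> [frame x] p"
    unfolding ext_d_4 bracket_frame \<omega>_power_2 frame_const
    by (simp add: square2_def h.dom3_def h.j_isometry h.gm_lin o)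
  then show ?thesis by simp
qed

lemma torsion_free_3:
  assumes n: "n = 3" and sol: "solvable G" and lee: "lee_form B n \<omega> \<theta>" and tw: "twisted_calabi_yau B n J \<omega> \<theta> \<Psi>"
  shows "torsion_free B n \<omega> \<Psi>"
proof -
  obtain u where u: "h.unitary u 3" using h.unitary_exists[of 3] dim n by auto
  have d: "DIM('e) = 2 * 3" using dim n by simp
  note U = unitaryD[OF u]
  have \<theta>: "is_form B 1 \<theta>" and le: "tensor_eq B 5 (ext_d (form_power \<omega> 2)) (wedge 1 4 \<theta> (form_power \<omega> 2))"
    using lee n by (simp_all add: lee_form_def del: form_power.simps)
  have psi: "tensor_eq B (n + 1) (ext_dc \<Psi>) (wedge 1 n (\<lambda>Xs p. complex_of_real (\<theta> Xs p)) \<Psi>)"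
    and skt: "tensor_eq B 4 (ext_d (d_c J \<omega>)) zero_form" and closed: "tensor_eq B 2 (ext_d \<theta>) zero_form"
    using tw by (simp_all add: twisted_calabi_yau_def)
  have \<Psi>f: "\<Psi> [frame x, frame y, frame z] p = \<Omega> [x, y, z]" for x y z p using \<Psi>_frame[of "[x, y, z]" p] n by simp
  note f3 = \<Psi>_forms[unfolded n]
  have t3: "is_tensor B 3 (re_form \<Psi>)" "is_tensor B 3 (im_form \<Psi>)" using f3 unfolding is_form_def by auto
  have lin: "linear (\<lambda>x. \<Omega> [x, y, z])" for y z
  proof (rule linearI)
    note t = is_tensor_3[OF t3(1) frame_vfields frame_vfields frame_vfields frame_vfields smooth_funs_const, of _ _ y z undefined]
      is_tensor_3[OF t3(2) frame_vfields frame_vfields frame_vfields frame_vfields smooth_funs_const, of _ _ y z undefined]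
    show "\<Omega> [v + w, y, z] = \<Omega> [v, y, z] + \<Omega> [w, y, z]" for v w
      unfolding \<Psi>f[symmetric, of _ _ _ undefined] frame_add
      by (rule complex_form_eqI) (simp_all add: t, simp_all add: re_form_def im_form_def)
    show "\<Omega> [c *\<^sub>R v, y, z] = c *\<^sub>R \<Omega> [v, y, z]" for c v
      unfolding \<Psi>f[symmetric, of _ _ _ undefined] frame_scale
      by (rule complex_form_eqI) (simp_all add: t, simp_all add: re_form_def im_form_def)
  qed
  have sk: "\<Psi> [frame x, frame y, frame z] p = - \<Psi> [frame y, frame x, frame z] p"
    "\<Psi> [frame x, frame y, frame z] p = - \<Psi> [frame x, frame z, frame y] p" for x y z p
    using is_form_3_skew[OF f3(1) frame_vfields frame_vfields frame_vfields, of x y z p]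
      is_form_3_skew[OF f3(2) frame_vfields frame_vfields frame_vfields, of x y z p]
    by (auto intro!: complex_form_eqI simp: re_form_def im_form_def)
  have alt: "\<Omega> [x, y, z] = - \<Omega> [y, x, z]" "\<Omega> [x, y, z] = - \<Omega> [x, z, y]" for x y z
    using sk[of x y z undefined] by (simp_all only: \<Psi>f)
  have Jc: "\<Omega> [j x, y, z] = \<i> * \<Omega> [x, y, z]" for x y z
    using \<Psi>_J[of "[frame x, frame y, frame z]" 0 undefined] n frame_vfields by (simp add: vf_tuples_def J_frame \<Psi>f)
  have dPsi: "ext_dc \<Psi> [frame x, frame y, frame z, frame t] p = - \<Omega> [br x y, z, t] + \<Omega> [br x z, y, t]
      - \<Omega> [br x t, y, z] - \<Omega> [br y z, x, t] + \<Omega> [br y t, x, z] - \<Omega> [br z t, x, y]" for x y z t p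
  proof -
    have "re_form \<Psi> [frame a, frame b, frame c] = (\<lambda>p. Re (\<Omega> [a, b, c]))"
      "im_form \<Psi> [frame a, frame b, frame c] = (\<lambda>p. Im (\<Omega> [a, b, c]))" for a b c
      by (simp_all add: re_form_def im_form_def \<Psi>f fun_eq_iff)
    then show ?thesis unfolding ext_dc_def ext_d_3 bracket_frame by (simp add: frame_const complex_eq_iff)
  qed
  have wPsi: "wedge 1 3 (\<lambda>Xs p. complex_of_real (\<theta> Xs p)) \<Psi> [frame x, frame y, frame z, frame t] p =
      \<theta> [frame x] p * \<Omega> [y, z, t] - \<theta> [frame y] p * \<Omega> [x, z, t] + \<theta> [frame z] p * \<Omega> [x, y, t]
      - \<theta> [frame t] p * \<Omega> [x, y, z]" for x y z t p
  proof -
    have s1: "\<Psi> [X, Y, Z] p = - \<Psi> [Y, X, Z] p" and s2: "\<Psi> [X, Y, Z] p = - \<Psi> [X, Z, Y] p"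
      if "X \<in> range frame" "Y \<in> range frame" "Z \<in> range frame" for X Y Z using that sk by blast+
    have S: "set [frame x, frame y, frame z, frame t] \<subseteq> range frame" by auto
    show ?thesis
      using wedge_1_3[of "range frame" \<Psi> p "frame x" "frame y" "frame z" "frame t" "\<lambda>Xs p. complex_of_real (\<theta> Xs p)",
          OF s1 s2 S] by (simp add: \<Psi>f)
  qed
  \<comment> \<open>As in the lower dimension, a degenerate \<Omega> vanishes identically, while the
    normalisation makes three times the wedge of its real and imaginary parts equal to 2 * 6 on the
    unitary basis.\<close>
  have nz: "\<Omega> [u 0, u 1, u 2] \<noteq> 0"
  proof
    assume z: "\<Omega> [u 0, u 1, u 2] = 0"
    have ex: "\<Omega> [x, y, z] = 0" if "\<And>a. a < 3 \<Longrightarrow> \<Omega> [u a, y, z] = 0" for x y z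
      using h.complex_linear_expand[OF u d lin Jc, of x y z] that by simp
    have self: "\<Omega> [x, x, y] = 0" "\<Omega> [x, y, y] = 0" "\<Omega> [x, y, x] = 0" for x y
      using alt(1)[of x x y] alt(2)[of x y y] alt(1)[of x y x] alt(2)[of y x x] by simp_all
    have p1: "\<Omega> [u 1, u 0, u 2] = 0" "\<Omega> [u 0, u 2, u 1] = 0"
      using alt[of "u 0" "u 1" "u 2"] z by simp_all
    have p2: "\<Omega> [u 1, u 2, u 0] = 0" "\<Omega> [u 2, u 0, u 1] = 0"
      using alt(2)[of "u 1" "u 0" "u 2"] alt(1)[of "u 0" "u 2" "u 1"] p1 by simp_all
    have p3: "\<Omega> [u 2, u 1, u 0] = 0" using alt(2)[of "u 2" "u 0" "u 1"] p2 by simp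
    have all: "\<Omega> [u a, u b, u c] = 0" if "a < 3" "b < 3" "c < 3" for a b c
    proof -
      have "a = 0 \<or> a = 1 \<or> a = 2" "b = 0 \<or> b = 1 \<or> b = 2" "c = 0 \<or> c = 1 \<or> c = 2" using that by linarith+
      then show ?thesis by (elim disjE; simp only: z p1 p2 p3 self)
    qed
    \<comment> \<open>Complex linearity was expanded in the first slot only; skewness rotates the
      remaining slots into that position one after the other.\<close>
    have 1: "\<Omega> [u b, x, u c] = 0" if "b < 3" "c < 3" for x b c
      using alt(1)[of "u b" x "u c"] ex[of "u b" "u c" x] all that by simp
    have 2: "\<Omega> [u c, x, y] = 0" if "c < 3" for x y c
      using alt(1)[of "u c" x y] alt(2)[of x "u c" y] ex[of y "u c" x] 1 that by simp
    have 3: "\<Omega> [x, y, z] = 0" for x y z by (rule ex) (rule 2)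
    let ?e = "[u 0, j (u 0), u 1, j (u 1), u 2, j (u 2)]"
    let ?L = "[frame (u 0), frame (j (u 0)), frame (u 1), frame (j (u 1)), frame (u 2), frame (j (u 2))]"
    have "tensor_eq B 6 (\<lambda>Xs p. 3 * wedge 3 3 (re_form \<Psi>) (im_form \<Psi>) Xs p) (\<lambda>Xs p. 2 * form_power \<omega> 3 Xs p)"
      using su n unfolding su_structure_def unit_norm_def by simp
    then have "3 * wedge 3 3 (re_form \<Psi>) (im_form \<Psi>) ?L undefined = 2 * form_power \<omega> 3 ?L undefined"
      using frame_vfields unfolding tensor_eq_def vf_tuples_def by (simp del: form_power.simps)
    also have "form_power \<omega> 3 ?L undefined = 6"
    proof (rule form_power_3_unitary[of "range frame" \<omega>, OF \<omega>_skew])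
      show "set ?L \<subseteq> range frame" by auto
      fix a b :: nat assume "a < 6" "b < 6"
      then have "a = 0 \<or> a = 1 \<or> a = 2 \<or> a = 3 \<or> a = 4 \<or> a = 5" "b = 0 \<or> b = 1 \<or> b = 2 \<or> b = 3 \<or> b = 4 \<or> b = 5"
        by linarith+
      then show "\<omega> [?L ! a, ?L ! b] undefined = of_int (tab a b)"
        by (elim disjE; simp add: \<omega>_frame h.j_isometry h.gm_lin U)
    qed simp_all
    also have "wedge 3 3 (re_form \<Psi>) (im_form \<Psi>) ?L undefined = 0"
      unfolding wedge_def
    proof (intro divide_eq_0_iff[THEN iffD2] disjI1 sum.neutral ballI)
      fix \<sigma> assume "\<sigma> \<in> {\<sigma>. \<sigma> permutes {..<3 + 3::nat}}"
      then have s: "\<sigma> i < length ?e" if "i < 6" for i using permutes_in_image[of \<sigma> "{..<6}" i] that by auto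
      have L: "?L ! \<sigma> i = frame (?e ! \<sigma> i)" if "i < 6" for i
        using nth_map[OF s[OF that], of frame] by (simp only: list.map)
      have L3: "?L ! \<sigma> 0 = frame (?e ! \<sigma> 0)" "?L ! \<sigma> 1 = frame (?e ! \<sigma> 1)" "?L ! \<sigma> 2 = frame (?e ! \<sigma> 2)"
        by (rule L; simp)+
      have "[0..<3] = [0, 1, 2::nat]" by (simp add: upt_rec)
      then have "re_form \<Psi> (map (\<lambda>i. ?L ! \<sigma> i) [0..<3]) undefined = 0"
        by (simp only: list.map L3 re_form_def \<Psi>f 3 zero_complex.sel)
      then show "of_int (sign \<sigma>) * re_form \<Psi> (map (\<lambda>i. ?L ! \<sigma> i) [0..<3]) undefined *
          im_form \<Psi> (map (\<lambda>i. ?L ! \<sigma> i) [3..<3 + 3]) undefined = 0"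
        by (simp only: mult_zero_right mult_zero_left)
    qed
    finally show False by simp
  qed
  have eq: "- \<Omega> [br x y, z, t] + \<Omega> [br x z, y, t] - \<Omega> [br x t, y, z] - \<Omega> [br y z, x, t] + \<Omega> [br y t, x, z] - \<Omega> [br z t, x, y] =
      \<theta> [frame x] p * \<Omega> [y, z, t] - \<theta> [frame y] p * \<Omega> [x, z, t] + \<theta> [frame z] p * \<Omega> [x, y, t]
      - \<theta> [frame t] p * \<Omega> [x, y, z]" for x y z t p
  proof -
    have "ext_dc \<Psi> [frame x, frame y, frame z, frame t] p =
        wedge 1 3 (\<lambda>Xs p. complex_of_real (\<theta> Xs p)) \<Psi> [frame x, frame y, frame z, frame t] p"
      using psi n frame_vfields unfolding tensor_eq_def vf_tuples_def by (simp del: One_nat_def)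
    then show ?thesis unfolding dPsi wPsi .
  qed
  note vol = h.volume_form_3[OF u d, of "\<lambda>x y z. \<Omega> [x, y, z]", OF lin alt Jc nz eq]
  \<comment> \<open>In the sums over \<open>b\<close> the diagonal term \<open>b = a\<close>
    vanishes by skewness, so the two terms supplied by \<open>lee_form_unitary_3\<close> are the
    whole contraction.\<close>
  have z: "h.dom3 x (j x) x = 0" "h.dom3 x (j x) (j x) = 0" for x
    using h.dom3_skew(1)[of x x "j x"] h.dom3_skew(2)[of x "j x" x] h.dom3_skew(2)[of x "j x" "j x"] by simp_all
  have l: "h.dom3 (u b) (j (u b)) (u a) + h.dom3 (u c) (j (u c)) (u a) = \<theta> [frame (u a)] p"
    "h.dom3 (u b) (j (u b)) (j (u a)) + h.dom3 (u c) (j (u c)) (j (u a)) = \<theta> [frame (j (u a))] p"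
    if "a < 3" "b < 3" "c < 3" "a \<noteq> b" "a \<noteq> c" "b \<noteq> c" for a b c p
    by (rule lee_form_unitary_3[OF le]; simp add: that U h.j_isometry h.gm_lin)+
  have sum3: "(\<Sum>b<n. f b) = f 0 + f 1 + f 2" for f :: "nat \<Rightarrow> real" unfolding n by (simp add: eval_nat_numeral)
  have c3: "a = 0 \<or> a = 1 \<or> a = 2" if "a < n" for a using that n by linarith
  have lee1: "(\<Sum>b<n. h.dom3 (u b) (j (u b)) (u a)) = \<theta> [frame (u a)] p" if "a < n" for a p
    using c3[OF that] l(1)[of 0 1 2 p] l(1)[of 1 0 2 p] l(1)[of 2 0 1 p] z unfolding sum3 by auto
  have lee2: "(\<Sum>b<n. h.dom3 (u b) (j (u b)) (j (u a))) = \<theta> [frame (j (u a))] p" if "a < n" for a p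
    using c3[OF that] l(2)[of 0 1 2 p] l(2)[of 1 0 2 p] l(2)[of 2 0 1 p] z unfolding sum3 by auto
  have th: "\<theta> [frame x] p = - (\<Sum>a<n. gm (h.ad01 x (u a)) (u a))" for x p
    using vol(2) unfolding n .
  have n3: "n \<le> 3" and un: "h.unitary u n" using n u by simp_all
  note res = torsion_vanishes[OF sol n3 un \<theta> lee1 lee2 vol(1) th skt closed]
  show ?thesis
    using d\<omega>_closed[OF res(2)] closed_if_lee_form_zero[OF \<theta> res(1) psi] unfolding torsion_free_def by simp
qed

end

theorem proposition3p6:
  fixes G :: "'g::{t2_space, second_countable_topology} monoid"
    and A :: "('g, 'e::euclidean_space) atlas"
    and \<Gamma> :: "'g set"
    and B :: "('m::{t2_space, second_countable_topology}, 'e) atlas"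
    and \<pi> :: "'g \<Rightarrow> 'm"
    and n :: nat
    and g :: "('m, real) tensor"
    and J :: "'m vf \<Rightarrow> 'm vf"
    and \<omega> \<theta> :: "('m, real) tensor"
    and \<Psi> :: "('m, complex) tensor"
  assumes "n = 2 \<or> n = 3"
    and "DIM('e) = 2 * n"
    and "compact_solvmanifold G A \<Gamma> B \<pi>"
    and "invariant_su_structure G A B \<pi> n g J \<Psi>"
    and "\<omega> = fundamental_form g J"
    and "lee_form B n \<omega> \<theta>"
    and "twisted_calabi_yau B n J \<omega> \<theta> \<Psi>"
  shows "torsion_free B n \<omega> \<Psi>"
proof -
  have lie: "lie_group G A" and sol: "solvable G" and B: "smooth_atlas B" "local_diffeo A B \<pi>" "surj \<pi>"
    and fib: "\<And>x y. \<pi> x = \<pi> y \<longleftrightarrow> (\<exists>\<gamma>\<in>\<Gamma>. y = \<gamma> \<otimes>\<^bsub>G\<^esub> x)"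
    using assms(3) unfolding compact_solvmanifold_def by blast+
  have A: "smooth_atlas A" and G: "carrier G = UNIV" using lie unfolding lie_group_def by blast+
  obtain U \<phi> where U: "(U, \<phi>) \<in> A" "\<one>\<^bsub>G\<^esub> \<in> U" using smooth_atlas_cover[OF A] .
  interpret q: lie_quotient G A U \<phi> \<Gamma> B \<pi>
    by (intro lie_quotient.intro charted_lie_group.intro lie_quotient_axioms.intro lie U B fib)
  obtain g' J' \<Psi>' where su': "su_structure A n g' J' \<Psi>'" and inv: "left_invariant G A n g' J' \<Psi>'"
    and pb: "is_pullback A B \<pi> 2 g' g" "is_endo_pullback A B \<pi> J' J" "is_pullback A B \<pi> n \<Psi>' \<Psi>"
    and su: "su_structure B n g J \<Psi>"
    using assms(4) unfolding invariant_su_structure_def by blast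
  have inv_g: "is_pullback A A (\<lambda>x. a \<otimes>\<^bsub>G\<^esub> x) 2 g' g'" and inv_J: "is_endo_pullback A A (\<lambda>x. a \<otimes>\<^bsub>G\<^esub> x) J' J'"
    and inv_\<Psi>: "is_pullback A A (\<lambda>x. a \<otimes>\<^bsub>G\<^esub> x) n \<Psi>' \<Psi>'" for a
    using inv G unfolding left_invariant_def by blast+
  have J': "J' X \<in> vfields A" if "X \<in> vfields A" for X
    using su' that unfolding su_structure_def almost_hermitian_def almost_complex_def by blast
  \<comment> \<open>Any base point would serve, since the coefficients in the frame are constant by
    \<open>pullback_constant\<close>.\<close>
  define gm where "gm = (\<lambda>v w. g [q.frame v, q.frame w] (\<pi> \<one>\<^bsub>G\<^esub>))"
  have "\<forall>v. \<exists>u. J (q.frame v) = q.frame u" using q.endo_pullback_frame[OF J' inv_J pb(2)] by blast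
  then obtain j where j: "\<And>v. J (q.frame v) = q.frame (j v)" by metis
  interpret s: invariant_structure G A U \<phi> \<Gamma> B \<pi> n g J \<Psi> gm j "\<lambda>vs. \<Psi> (map q.frame vs) (\<pi> \<one>\<^bsub>G\<^esub>)"
  proof (intro invariant_structure.intro q.lie_quotient_axioms invariant_structure_axioms.intro su j)
    show "g [q.frame v, q.frame w] p = gm v w" for v w p
      using q.pullback_constant[OF inv_g pb(1), of "[v, w]" p] unfolding gm_def by simp
    show "\<Psi> (map q.frame vs) p = \<Psi> (map q.frame vs) (\<pi> \<one>\<^bsub>G\<^esub>)" if "length vs = n" for vs p
      by (rule q.pullback_constant[OF inv_\<Psi> pb(3) that])
  qed
  show ?thesis
    using assms(1) s.torsion_free_2[OF _ sol assms(6,7)[unfolded assms(5)]]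
      s.torsion_free_3[OF _ sol assms(6,7)[unfolded assms(5)]]
    unfolding assms(5) by blast
qed

end
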